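(* Let $D\subset\mathbb C^2$ be a $C^2$-smooth, strongly convex Reinhardt domain and let $\mu$ be any rotation-invariant continuous positive multiple of surface measure on $bD$. Then the Leray transform $\mathbb L$ is bounded on $L^2(bD,\mu)$. Moreover, with $\mathbb L_\mu^*$ the adjoint of $\mathbb L$ in $L^2(bD,\mu)$, the operator $\mathbb L_\mu^*\mathbb L$ admits an orthogonal basis of eigenfunctions, and the essential spectrum of $\mathbb L_\mu^*\mathbb L$ is equal to $$\{0\}\cup\left\{\frac{\sqrt{p(\zeta)p^*(\zeta)}}{2}:\zeta\in bD\right\},$$ or, equivalently, $$\{0\}\cup\left\{\frac{p(\zeta)}{2\sqrt{p(\zeta)-1}}:\zeta\in bD\right\},$$ where $p^*(\zeta)$ is the conjugate exponent of $p(\zeta)$. The essential norm of $\mathbb L$ is $$\max\left\{\sqrt[4]{\frac{p(\zeta)p^*(\zeta)}{4}}:\zeta\in bD\right\}.$$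
   Context: $D\subset\mathbb C^2$ is Reinhardt if it is invariant under all rotations $(z_1,z_2)\mapsto(e^{i\theta_1}z_1,e^{i\theta_2}z_2)$. $bD$ is the boundary. A domain $D$ as in the claim has the form $D=\{|z_1|<b_1,\ |z_2|<\phi(|z_1|)\}$ with $b_1>0$ and $\phi$ continuous on $[0,b_1]$, $\phi(b_1)=0$, $\phi$ of class $C^2$ on $(0,b_1)$ with $\phi'<0$, $\phi''<0$ there. On $bD$ write $\zeta_j=r_je^{i\theta_j}$, $r_j=|\zeta_j|$. Where $\zeta_1\zeta_2\neq0$ set $$s=\frac{-r_1\phi'(r_1)}{\phi(r_1)-r_1\phi'(r_1)},\qquad p(\zeta)=1+\frac{r_1\phi(r_1)\phi''(r_1)}{\phi'(r_1)(\phi(r_1)-r_1\phi'(r_1))}.$$ ($p(\zeta)$ is the exponent of the unique domain $\{a_1|z_1|^p+a_2|z_2|^p<1\}$, $a_j>0$, $p>1$, osculating $bD$ to second order at $\zeta$.) Set $p(\zeta)=2$ where $\zeta_1\zeta_2=0$; this makes $p$ continuous on $bD$. The function $s$ is a strictly increasing function of $r_1$ with range $(0,1)$; $(s,\theta_1,\theta_2)\in(0,1)\times[0,2\pi)^2$ are coordinates on $bD\setminus\{\zeta_1\zeta_2=0\}$ and $r_1,r_2$ are functions of $s$. Leray transform: for $w\in D$, $\mathbb Lf(w)=\int_{\zeta\in bD}f(\zeta)L(\zeta,w)$, where $$L(\zeta,w)=\frac1{(2\pi i)^2}\frac{j^*(\partial\rho\wedge\bar\partial\partial\rho)(\zeta)}{\left[\frac{\partial\rho}{\partial\zeta_1}(\zeta)(\zeta_1-w_1)+\frac{\partial\rho}{\partial\zeta_2}(\zeta)(\zeta_2-w_2)\right]^2},$$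 $\rho$ is any defining function of $bD$ (the kernel does not depend on the choice) and $j:bD\to\mathbb C^2$ is the inclusion. In coordinates, $$L(\zeta,w)=\frac{ds\wedge d\theta_1\wedge d\theta_2}{4\pi^2\left(1-e^{-i\theta_1}\frac s{r_1}w_1-e^{-i\theta_2}\frac{1-s}{r_2}w_2\right)^2},$$ with $bD$ oriented so that $ds\wedge d\theta_1\wedge d\theta_2>0$. Operator on $L^2$: an $(n,m)$-monomial ($n,m\in\mathbb Z$) is a function on $bD$ of the form $g(s)e^{i(n\theta_1+m\theta_2)}$. For $\mu$ as in the claim and an $(n,m)$-monomial $f\in L^2(bD,\mu)$, $\mathbb Lf$ is a constant multiple of $w_1^nw_2^m$ (and is $0$ if $\min\{n,m\}<0$), hence extends continuously to $\overline D$; its boundary values are denoted $\mathbb L_{n,m}f$. Writing $f\in L^2(bD,\mu)$ as the orthogonal sum $\sum_{n,m\in\mathbb Z} f_{n,m}$ of $(n,m)$-monomials, $\mathbb Lf=\sum_{n,m\ge0}\mathbb L_{n,m}f_{n,m}$; $\mathbb L$ is bounded on $L^2(bD,\mu)$ if this defines a bounded operator. "$\mu$ is a rotation-invariant continuous positive multiple of surface measure" means $d\mu=h\,d\sigma$ with $d\sigma$ surface measure and $h$ a continuous positive rotation-invariant function on $bD$. The essential spectrum of a bounded operator is the spectrum of its image in the Calkin algebra; the essential norm is the operator-norm distance to the compact operators. *)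

theory Defs
  imports "HOL-Analysis.Analysis"
begin

type_synonym C2 = "complex \<times> complex"

section \<open>Strongly convex Reinhardt domains\<close>

definition torus_rot :: "real \<Rightarrow> real \<Rightarrow> C2 \<Rightarrow> C2" where
  "torus_rot a b z = (cis a * fst z, cis b * snd z)"

definition reinhardt :: "C2 set \<Rightarrow> bool" where
  "reinhardt D \<longleftrightarrow> (\<forall>z\<in>D. \<forall>a b. torus_rot a b z \<in> D)"

text \<open>Twice continuously differentiable, with gradient \<open>G\<close> and Hessian \<open>H\<close>.\<close>

definition C2_on :: "C2 set \<Rightarrow> (C2 \<Rightarrow> real) \<Rightarrow> bool" where
  "C2_on U \<rho> \<longleftrightarrow>
     (\<exists>G H. (\<forall>x\<in>U. (\<rho> has_derivative (\<lambda>v. G x \<bullet> v)) (at x)) \<and>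
            (\<forall>x\<in>U. (G has_derivative H x) (at x)) \<and>
            (\<forall>v. continuous_on U (\<lambda>x. H x v)))"

definition C2_defining_function :: "C2 set \<Rightarrow> (C2 \<Rightarrow> real) \<Rightarrow> bool" where
  "C2_defining_function D \<rho> \<longleftrightarrow>
     (\<exists>U. open U \<and> frontier D \<subseteq> U \<and> C2_on U \<rho> \<and> D \<inter> U = {x \<in> U. \<rho> x < 0}) \<and>
     (\<forall>\<zeta>\<in>frontier D. \<exists>v. frechet_derivative \<rho> (at \<zeta>) v \<noteq> 0)"

definition second_derivative :: "(C2 \<Rightarrow> real) \<Rightarrow> C2 \<Rightarrow> C2 \<Rightarrow> C2 \<Rightarrow> real" where
  "second_derivative \<rho> \<zeta> u v =
     frechet_derivative (\<lambda>x. frechet_derivative \<rho> (at x) u) (at \<zeta>) v"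

text \<open>The condition on the Hessian (positive definite second fundamental form) does not
  depend on the choice of the defining function.\<close>

definition strongly_convex :: "C2 set \<Rightarrow> (C2 \<Rightarrow> real) \<Rightarrow> bool" where
  "strongly_convex D \<rho> \<longleftrightarrow> convex D \<and>
     (\<forall>\<zeta>\<in>frontier D. \<forall>v. v \<noteq> 0 \<and> frechet_derivative \<rho> (at \<zeta>) v = 0
        \<longrightarrow> second_derivative \<rho> \<zeta> v v > 0)"

text \<open>The function \<open>\<phi>\<close> with \<open>D = {|z\<^sub>1| < b\<^sub>1, |z\<^sub>2| < \<phi>(|z\<^sub>1|)}\<close>, read off from \<open>D\<close>;
  only its values on the open interval from \<open>0\<close> to \<open>b\<^sub>1\<close> matter.\<close>

definition profile :: "C2 set \<Rightarrow> real \<Rightarrow> real" where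
  "profile D r = Sup {t. 0 \<le> t \<and> (complex_of_real r, complex_of_real t) \<in> D}"

definition s_coord :: "C2 set \<Rightarrow> C2 \<Rightarrow> real" where
  "s_coord D \<zeta> =
     (let r = norm (fst \<zeta>); \<phi> = profile D in - r * deriv \<phi> r / (\<phi> r - r * deriv \<phi> r))"

definition osc_exponent :: "C2 set \<Rightarrow> C2 \<Rightarrow> real" where
  "osc_exponent D \<zeta> =
     (if fst \<zeta> * snd \<zeta> = 0 then 2
      else let r = norm (fst \<zeta>); \<phi> = profile D in
        1 + r * \<phi> r * deriv (deriv \<phi>) r / (deriv \<phi> r * (\<phi> r - r * deriv \<phi> r)))"

definition conj_exponent :: "real \<Rightarrow> real" where
  "conj_exponent p = p / (p - 1)"

section \<open>Surface measure\<close>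

definition gram_det :: "C2 \<Rightarrow> C2 \<Rightarrow> C2 \<Rightarrow> real" where
  "gram_det u v w =
     det (vector [vector [u \<bullet> u, u \<bullet> v, u \<bullet> w],
                  vector [v \<bullet> u, v \<bullet> v, v \<bullet> w],
                  vector [w \<bullet> u, w \<bullet> v, w \<bullet> w]] :: real^3^3)"

text \<open>\<open>\<sigma>\<close> is the surface measure of the hypersurface \<open>S\<close>: a Borel measure on \<open>S\<close> which in every
  injective, immersed \<open>C\<^sup>1\<close> parametrization has density \<open>sqrt (det (D\<psi>\<^sup>T D\<psi>))\<close>. If \<open>S\<close> is a \<open>C\<^sup>1\<close>
  hypersurface, this determines \<open>\<sigma>\<close> uniquely.\<close>

definition surface_measure :: "C2 set \<Rightarrow> C2 measure \<Rightarrow> bool" where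
  "surface_measure S \<sigma> \<longleftrightarrow>
     space \<sigma> = S \<and> sets \<sigma> = sets (restrict_space borel S) \<and>
     (\<forall>(U :: (real \<times> real \<times> real) set) \<psi> \<psi>'.
        open U \<and> \<psi> ` U \<subseteq> S \<and> inj_on \<psi> U \<and>
        (\<forall>x\<in>U. (\<psi> has_derivative \<psi>' x) (at x) \<and> inj (\<psi>' x)) \<and>
        (\<forall>v. continuous_on U (\<lambda>x. \<psi>' x v)) \<longrightarrow>
        (\<forall>A\<in>sets \<sigma>. A \<subseteq> \<psi> ` U \<longrightarrow>
           emeasure \<sigma> A =
             (\<integral>\<^sup>+ x\<in>{x\<in>U. \<psi> x \<in> A}.
                ennreal (sqrt (gram_det (\<psi>' x (1, 0, 0)) (\<psi>' x (0, 1, 0)) (\<psi>' x (0, 0, 1))))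
              \<partial>lborel)))"

section \<open>The Leray integral\<close>

definition coord :: "nat \<Rightarrow> C2 \<Rightarrow> complex" where
  "coord j z = (if j = 1 then fst z else snd z)"

definition coord_vec :: "nat \<Rightarrow> complex \<Rightarrow> C2" where
  "coord_vec j c = (if j = 1 then (c, 0) else (0, c))"

text \<open>Wirtinger derivatives \<open>\<partial>/\<partial>\<zeta>\<^sub>j\<close> and \<open>\<partial>/\<partial>\<zeta>\<^sub>j\<close>-bar for \<open>j \<in> {1, 2}\<close>.\<close>

definition dz :: "nat \<Rightarrow> (C2 \<Rightarrow> complex) \<Rightarrow> C2 \<Rightarrow> complex" where
  "dz j F \<zeta> = (frechet_derivative F (at \<zeta>) (coord_vec j 1)
              - \<i> * frechet_derivative F (at \<zeta>) (coord_vec j \<i>)) / 2"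

definition dzbar :: "nat \<Rightarrow> (C2 \<Rightarrow> complex) \<Rightarrow> C2 \<Rightarrow> complex" where
  "dzbar j F \<zeta> = (frechet_derivative F (at \<zeta>) (coord_vec j 1)
                 + \<i> * frechet_derivative F (at \<zeta>) (coord_vec j \<i>)) / 2"

abbreviation cfun :: "(C2 \<Rightarrow> real) \<Rightarrow> C2 \<Rightarrow> complex" where
  "cfun \<rho> \<equiv> \<lambda>\<zeta>. complex_of_real (\<rho> \<zeta>)"

text \<open>The 1-form \<open>\<partial>\<rho>\<close>, the 2-form \<open>\<partial>bar \<partial>\<rho> = \<Sum> (\<partial>\<^sup>2\<rho>/\<partial>\<zeta>bar\<^sub>k\<partial>\<zeta>\<^sub>j) d\<zeta>bar\<^sub>k \<and> d\<zeta>\<^sub>j\<close> and their wedge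
  product, evaluated on tangent vectors.\<close>

definition del_form :: "(C2 \<Rightarrow> real) \<Rightarrow> C2 \<Rightarrow> C2 \<Rightarrow> complex" where
  "del_form \<rho> \<zeta> u = (\<Sum>j\<in>{1,2}. dz j (cfun \<rho>) \<zeta> * coord j u)"

definition delbar_del_form :: "(C2 \<Rightarrow> real) \<Rightarrow> C2 \<Rightarrow> C2 \<Rightarrow> C2 \<Rightarrow> complex" where
  "delbar_del_form \<rho> \<zeta> u v =
     (\<Sum>k\<in>{1,2}. \<Sum>j\<in>{1,2}. dzbar k (dz j (cfun \<rho>)) \<zeta> *
        (cnj (coord k u) * coord j v - cnj (coord k v) * coord j u))"

definition leray_form :: "(C2 \<Rightarrow> real) \<Rightarrow> C2 \<Rightarrow> C2 \<Rightarrow> C2 \<Rightarrow> C2 \<Rightarrow> complex" where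
  "leray_form \<rho> \<zeta> u v w =
     del_form \<rho> \<zeta> u * delbar_del_form \<rho> \<zeta> v w +
     del_form \<rho> \<zeta> v * delbar_del_form \<rho> \<zeta> w u +
     del_form \<rho> \<zeta> w * delbar_del_form \<rho> \<zeta> u v"

definition outer_normal :: "(C2 \<Rightarrow> real) \<Rightarrow> C2 \<Rightarrow> C2" where
  "outer_normal \<rho> \<zeta> = sgn (\<Sum>b\<in>Basis. frechet_derivative \<rho> (at \<zeta>) b *\<^sub>R b)"

text \<open>Let \<open>\<nu> = (n\<^sub>1, n\<^sub>2)\<close> be the outer unit normal, and put \<open>t\<^sub>1 = i\<nu>\<close>,
  \<open>t\<^sub>2 = (-cnj n\<^sub>2, cnj n\<^sub>1)\<close>, \<open>t\<^sub>3 = i t\<^sub>2\<close>. Then \<open>\<nu>, t\<^sub>1, t\<^sub>2, t\<^sub>3\<close> is an orthonormal basis that is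
  positive for the complex orientation, so \<open>t\<^sub>1, t\<^sub>2, t\<^sub>3\<close> is a positive orthonormal basis of the
  tangent space for the boundary orientation (for which \<open>ds \<and> d\<theta>\<^sub>1 \<and> d\<theta>\<^sub>2 > 0\<close>). Hence the
  integral of \<open>f\<close> times a 3-form over the boundary is the integral of \<open>f\<close> times the value of
  the form on \<open>t\<^sub>1, t\<^sub>2, t\<^sub>3\<close> with respect to surface measure.\<close>

definition leray_density :: "(C2 \<Rightarrow> real) \<Rightarrow> C2 \<Rightarrow> C2 \<Rightarrow> complex" where
  "leray_density \<rho> \<zeta> w =
     (let n1 = fst (outer_normal \<rho> \<zeta>); n2 = snd (outer_normal \<rho> \<zeta>) in
      1 / (2 * complex_of_real pi * \<i>)\<^sup>2 *
      (leray_form \<rho> \<zeta> (\<i> * n1, \<i> * n2) (- cnj n2, cnj n1) (- \<i> * cnj n2, \<i> * cnj n1) /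
       (\<Sum>j\<in>{1,2}. dz j (cfun \<rho>) \<zeta> * (coord j \<zeta> - coord j w))\<^sup>2))"

definition leray_integral ::
    "(C2 \<Rightarrow> real) \<Rightarrow> C2 measure \<Rightarrow> (C2 \<Rightarrow> complex) \<Rightarrow> C2 \<Rightarrow> complex" where
  "leray_integral \<rho> \<sigma> f w = (LINT \<zeta>|\<sigma>. f \<zeta> * leray_density \<rho> \<zeta> w)"

section \<open>Operators on \<open>L\<^sup>2\<close>\<close>

text \<open>Elements of \<open>L\<^sup>2(M)\<close> are represented by functions, identified when they agree almost
  everywhere; operators are maps on representatives.\<close>

definition L2 :: "'a measure \<Rightarrow> ('a \<Rightarrow> complex) set" where
  "L2 M = {f \<in> borel_measurable M. integrable M (\<lambda>x. (norm (f x))\<^sup>2)}"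

definition l2_norm :: "'a measure \<Rightarrow> ('a \<Rightarrow> complex) \<Rightarrow> real" where
  "l2_norm M f = sqrt (LINT x|M. (norm (f x))\<^sup>2)"

definition l2_inner :: "'a measure \<Rightarrow> ('a \<Rightarrow> complex) \<Rightarrow> ('a \<Rightarrow> complex) \<Rightarrow> complex" where
  "l2_inner M f g = (LINT x|M. f x * cnj (g x))"

definition l2_has_sum ::
    "'a measure \<Rightarrow> ('i \<Rightarrow> 'a \<Rightarrow> complex) \<Rightarrow> ('a \<Rightarrow> complex) \<Rightarrow> 'i set \<Rightarrow> bool" where
  "l2_has_sum M F g I \<longleftrightarrow> g \<in> L2 M \<and> (\<forall>i\<in>I. F i \<in> L2 M) \<and>
     ((\<lambda>X. l2_norm M (\<lambda>x. (\<Sum>i\<in>X. F i x) - g x)) \<longlongrightarrow> 0) (finite_subsets_at_top I)"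

type_synonym 'a op = "('a \<Rightarrow> complex) \<Rightarrow> 'a \<Rightarrow> complex"

text \<open>Compatibility with almost everywhere equality follows from linearity and boundedness.\<close>

definition l2_bounded_op :: "'a measure \<Rightarrow> 'a op \<Rightarrow> bool" where
  "l2_bounded_op M T \<longleftrightarrow>
     (\<forall>f\<in>L2 M. T f \<in> L2 M) \<and>
     (\<forall>f\<in>L2 M. \<forall>g\<in>L2 M. AE x in M. T (\<lambda>y. f y + g y) x = T f x + T g x) \<and>
     (\<forall>c. \<forall>f\<in>L2 M. AE x in M. T (\<lambda>y. c * f y) x = c * T f x) \<and>
     (\<exists>C. \<forall>f\<in>L2 M. l2_norm M (T f) \<le> C * l2_norm M f)"

definition l2_adjoint :: "'a measure \<Rightarrow> 'a op \<Rightarrow> 'a op \<Rightarrow> bool" where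
  "l2_adjoint M T S \<longleftrightarrow> l2_bounded_op M S \<and>
     (\<forall>f\<in>L2 M. \<forall>g\<in>L2 M. l2_inner M (T f) g = l2_inner M f (S g))"

definition l2_compact_op :: "'a measure \<Rightarrow> 'a op \<Rightarrow> bool" where
  "l2_compact_op M K \<longleftrightarrow> l2_bounded_op M K \<and>
     (\<forall>f :: nat \<Rightarrow> 'a \<Rightarrow> complex. (\<forall>n. f n \<in> L2 M \<and> l2_norm M (f n) \<le> 1) \<longrightarrow>
        (\<exists>r g. strict_mono r \<and> g \<in> L2 M \<and>
           (\<lambda>n. l2_norm M (\<lambda>x. K (f (r n)) x - g x)) \<longlonglongrightarrow> 0))"

definition l2_op_norm :: "'a measure \<Rightarrow> 'a op \<Rightarrow> real" where
  "l2_op_norm M T = Inf {C. 0 \<le> C \<and> (\<forall>f\<in>L2 M. l2_norm M (T f) \<le> C * l2_norm M f)}"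

definition l2_essential_norm :: "'a measure \<Rightarrow> 'a op \<Rightarrow> real" where
  "l2_essential_norm M T =
     Inf {l2_op_norm M (\<lambda>f x. T f x - K f x) | K. l2_compact_op M K}"

text \<open>The class of \<open>T\<close> is invertible in the Calkin algebra: there is a bounded operator \<open>S\<close> such
  that \<open>S T\<close> and \<open>T S\<close> agree with the identity modulo compact operators.\<close>

definition calkin_invertible :: "'a measure \<Rightarrow> 'a op \<Rightarrow> bool" where
  "calkin_invertible M T \<longleftrightarrow>
     (\<exists>S. l2_bounded_op M S \<and>
          l2_compact_op M (\<lambda>f x. S (T f) x - f x) \<and>
          l2_compact_op M (\<lambda>f x. T (S f) x - f x))"

definition l2_essential_spectrum :: "'a measure \<Rightarrow> 'a op \<Rightarrow> complex set" where
  "l2_essential_spectrum M T =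
     {c. \<not> calkin_invertible M (\<lambda>f x. T f x - c * f x)}"

definition l2_orthogonal_basis :: "'a measure \<Rightarrow> ('a \<Rightarrow> complex) set \<Rightarrow> bool" where
  "l2_orthogonal_basis M E \<longleftrightarrow>
     E \<subseteq> L2 M \<and> (\<forall>e\<in>E. l2_norm M e \<noteq> 0) \<and>
     (\<forall>e\<in>E. \<forall>e'\<in>E. e \<noteq> e' \<longrightarrow> l2_inner M e e' = 0) \<and>
     (\<forall>f\<in>L2 M. \<exists>c. l2_has_sum M (\<lambda>e x. c e * e x) f E)"

definition l2_eigenfunction :: "'a measure \<Rightarrow> 'a op \<Rightarrow> ('a \<Rightarrow> complex) \<Rightarrow> bool" where
  "l2_eigenfunction M T e \<longleftrightarrow>
     e \<in> L2 M \<and> l2_norm M e \<noteq> 0 \<and> (\<exists>c. AE x in M. T e x = c * e x)"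

section \<open>The Leray transform on \<open>L\<^sup>2\<close>\<close>

definition monomial :: "C2 set \<Rightarrow> int \<Rightarrow> int \<Rightarrow> (C2 \<Rightarrow> complex) \<Rightarrow> bool" where
  "monomial D n m f \<longleftrightarrow>
     (\<exists>g :: real \<Rightarrow> complex. \<forall>\<zeta>\<in>frontier D. fst \<zeta> * snd \<zeta> \<noteq> 0 \<longrightarrow>
        f \<zeta> = g (s_coord D \<zeta>) * cis (of_int n * Arg (fst \<zeta>) + of_int m * Arg (snd \<zeta>)))"

text \<open>Boundary values of the continuous extension to the closure of \<open>D\<close>.\<close>

definition leray_boundary ::
    "C2 set \<Rightarrow> (C2 \<Rightarrow> real) \<Rightarrow> C2 measure \<Rightarrow> (C2 \<Rightarrow> complex) \<Rightarrow> C2 \<Rightarrow> complex" where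
  "leray_boundary D \<rho> \<sigma> f \<zeta> = Lim (at \<zeta> within D) (leray_integral \<rho> \<sigma> f)"

text \<open>\<open>T\<close> sends every \<open>f = \<Sum> f\<^sub>n\<^sub>,\<^sub>m\<close>, with \<open>f\<^sub>n\<^sub>,\<^sub>m\<close> an \<open>(n,m)\<close>-monomial, to the sum over
  \<open>n, m \<ge> 0\<close> of the boundary values of the Leray integrals of the \<open>f\<^sub>n\<^sub>,\<^sub>m\<close>. The decomposition is
  orthogonal and unique up to null sets when \<open>\<mu>\<close> is rotation-invariant.\<close>

definition leray_transform ::
    "C2 set \<Rightarrow> (C2 \<Rightarrow> real) \<Rightarrow> C2 measure \<Rightarrow> C2 measure \<Rightarrow> C2 op \<Rightarrow> bool" where
  "leray_transform D \<rho> \<sigma> \<mu> T \<longleftrightarrow>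
     (\<forall>f\<in>L2 \<mu>. \<exists>F :: int \<times> int \<Rightarrow> C2 \<Rightarrow> complex.
        (\<forall>n m. monomial D n m (F (n, m))) \<and>
        l2_has_sum \<mu> F f UNIV \<and>
        l2_has_sum \<mu> (\<lambda>(n, m). leray_boundary D \<rho> \<sigma> (F (n, m))) (T f) {(n, m). 0 \<le> n \<and> 0 \<le> m})"

end

(* In the coordinates (s, theta1, theta2) the measure mu becomes W(s) ds dtheta1 dtheta2 with W
   continuous and positive on [0,1], and the Leray integral of an (n,m)-monomial f is
   t(n,m) <f, e(n,m)> v(n,m) for unit monomials e(n,m), v(n,m). Hence L is diagonal with respect to
   two orthonormal families, L* L has the eigenvalues t(n,m)^2 (and 0 on the sectors with
   min(n,m) < 0), and everything is reduced to the accumulation points of the numbers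
     t(n,m)^2 = ((n+m+1)!/(n! m!))^2 * integral of (s/r1)^2n ((1-s)/r2)^2m / W
                                     * integral of r1^2n r2^2m W.
   Both integrals are Laplace integrals in N = n + m whose phase is comparable to the
   Kullback-Leibler divergence of sigma = n/N and s; as N tends to infinity and sigma to s0 the
   product tends to p/(2 sqrt(p - 1)) at s0, also at the endpoints s0 = 0, 1. *)
theory Submission
  imports Defs "HOL-Probability.Probability"
begin

text \<open>The logarithmic derivatives of r1 and r2 in s are 1/(p s) and -1/(p (1 - s)). With N = n
  + m and sigma = n/N the phase of the second integral therefore has 2/p times the derivative of N
  KL, and the phase of the first one has 2 - 2/p = 2/q times it, q the conjugate exponent. The
  factorials are reciprocal Beta integrals, hence the same Laplace integral with the constant 1 in
  place of 2/p; forming quotients avoids Stirling's formula. A constant kappa in the exponent costs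
  the factor 1/sqrt(kappa), the amplitudes W and 1/W cancel, and sqrt(p q)/2 is left, whatever mu
  is. Since p is merely continuous, phases are compared through their derivatives. The obstacle is
  uniformity: when sigma tends to 0 or 1 the Gaussian approximation fails. But there p = 2, both
  constants are 1, and only the stability of the reference integral under small changes of the
  exponent is needed, which follows from the convexity of KL.\<close>

abbreviation (input) seq_limit ("(_ ---> _)" [60, 60] 60) where "X ---> L == (X \<longlonglongrightarrow> L)"
abbreviation (input) cr where "cr == complex_of_real"
abbreviation (input) inn where "inn == l2_inner"
abbreviation (input) nr where "nr == l2_norm"
abbreviation (input) bm where "bm == borel_measurable"
abbreviation (input) ang :: "int => int => C2 => real" where
 "ang n m z == of_int n * Arg (fst z) + of_int m * Arg (snd z)"

section \<open>The space of square integrable functions\<close>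

lemma L2_measurable [measurable_dest]: "f : L2 M ==> f : bm M"
 by (simp add: L2_def)

lemma L2_integrable: "f : L2 M ==> integrable M (%x. (norm (f x))\<^sup>2)"
 by (simp add: L2_def)

lemma L2_bound:
 assumes "f : bm M" "integrable M g" "!!x. x : space M ==> (norm (f x))\<^sup>2 <= g x"
 shows "f : L2 M"
 unfolding L2_def
proof (safe intro!: assms(1))
 show "integrable M (%x. (norm (f x))\<^sup>2)"
  by (rule Bochner_Integration.integrable_bound[OF assms(2)])
    (use assms in \<open>auto intro!: AE_I2 intro: order_trans[OF _ abs_ge_self]\<close>)
qed

lemma L2_zero [simp]: "(%x. 0) : L2 M"
 by (simp add: L2_def)

lemma norm_add_square_le: "(norm (a + b :: complex))\<^sup>2 <= 2 * (norm a)\<^sup>2 + 2 * (norm b)\<^sup>2"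
proof -
 have "(norm (a + b))\<^sup>2 <= (norm a + norm b)\<^sup>2"
  by (intro power_mono norm_triangle_ineq) auto
 also have "... <= 2 * (norm a)\<^sup>2 + 2 * (norm b)\<^sup>2"
  using sum_squares_bound[of "norm a" "norm b"] by (simp add: power2_sum)
 finally show ?thesis .
qed

lemma L2_add:
 assumes "f : L2 M" "g : L2 M"
 shows "(%x. f x + g x) : L2 M"
 by (rule L2_bound[where g = "%x. 2 * (norm (f x))\<^sup>2 + 2 * (norm (g x))\<^sup>2"])
   (use assms in \<open>auto intro!: norm_add_square_le L2_measurable
    Bochner_Integration.integrable_add integrable_mult_right L2_integrable\<close>)

lemma L2_scale:
 assumes "f : L2 M"
 shows "(%x. c * f x) : L2 M"
 by (rule L2_bound[where g = "%x. (norm c)\<^sup>2 * (norm (f x))\<^sup>2"])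
   (use assms in \<open>auto intro: L2_integrable L2_measurable simp: norm_mult power_mult_distrib\<close>)

lemma L2_uminus: "f : L2 M ==> (%x. - f x) : L2 M"
 using L2_scale[of f M "-1"] by simp

lemma L2_diff: "f : L2 M ==> g : L2 M ==> (%x. f x - g x) : L2 M"
 using L2_add[OF _ L2_uminus[of g M], of f] by simp

lemma L2_sum:
 assumes "!!i. i : X ==> F i : L2 M"
 shows "(%x. \<Sum>i\<in>X. F i x) : L2 M"
 using assms by (induction X rule: infinite_finite_induct) (auto intro: L2_add)

lemma L2_norm: "f : L2 M ==> (%x. cr (norm (f x))) : L2 M"
 by (auto simp: L2_def)


lemma borel_measurable_cnj [measurable (raw)]:
 "f : bm M ==> (%x. cnj (f x)) : bm M"
 by (rule borel_measurable_continuous_on[where f = cnj]) (auto intro: continuous_intros)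

lemma L2_mult_integrable:
 assumes "f : L2 M" "g : L2 M"
 shows "integrable M (%x. f x * cnj (g x))"
proof (rule Bochner_Integration.integrable_bound)
 show "integrable M (%x. (norm (f x))\<^sup>2 + (norm (g x))\<^sup>2)"
  using assms by (auto intro: L2_integrable)
 show "(%x. f x * cnj (g x)) : bm M"
  using assms by (intro borel_measurable_times borel_measurable_cnj L2_measurable)
 have "norm (a * cnj b) <= norm ((norm a)\<^sup>2 + (norm b)\<^sup>2)" for a b :: complex
 proof -
  have "2 * (norm a * norm b) <= (norm a)\<^sup>2 + (norm b)\<^sup>2"
   using sum_squares_bound[of "norm a" "norm b"] by (simp add: mult_ac)
  moreover have "0 <= norm a * norm b" by simp
  ultimately have "norm a * norm b <= (norm a)\<^sup>2 + (norm b)\<^sup>2"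
   by linarith
  then show ?thesis
   by (simp add: norm_mult)
 qed
 then show "AE x in M. norm (f x * cnj (g x)) <= norm ((norm (f x))\<^sup>2 + (norm (g x))\<^sup>2)"
  by (intro AE_I2)
qed

lemma l2_inner_add_left:
 "f : L2 M ==> g : L2 M ==> k : L2 M ==>
  inn M (%x. f x + g x) k = inn M f k + inn M g k"
 by (simp add: l2_inner_def distrib_right L2_mult_integrable)

lemma l2_inner_scale_left [simp]: "inn M (%x. c * f x) k = c * inn M f k"
 by (simp add: l2_inner_def mult.assoc)

lemma l2_inner_scale_right [simp]: "inn M f (%x. c * k x) = cnj c * inn M f k"
proof -
 have "f x * cnj (c * k x) = cnj c * (f x * cnj (k x))" for x
  by (simp add: mult_ac)
 then show ?thesis
  unfolding l2_inner_def by (simp only: integral_mult_right_zero)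
qed

lemma l2_inner_diff_left:
 "f : L2 M ==> g : L2 M ==> k : L2 M ==>
  inn M (%x. f x - g x) k = inn M f k - inn M g k"
 by (simp add: l2_inner_def left_diff_distrib L2_mult_integrable)

lemma l2_inner_commute: "inn M f g = cnj (inn M g f)"
 unfolding l2_inner_def Bochner_Integration.integral_cnj[symmetric] by (simp add: mult.commute)

lemma l2_inner_add_right:
 "f : L2 M ==> g : L2 M ==> k : L2 M ==>
  inn M k (%x. f x + g x) = inn M k f + inn M k g"
 by (subst (1 2 3) l2_inner_commute) (simp add: l2_inner_add_left)

lemma l2_inner_diff_right:
 "f : L2 M ==> g : L2 M ==> k : L2 M ==>
  inn M k (%x. f x - g x) = inn M k f - inn M k g"
 by (subst (1 2 3) l2_inner_commute) (simp add: l2_inner_diff_left)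

lemma l2_inner_zero_left [simp]: "inn M (%x. 0) k = 0"
 by (simp add: l2_inner_def)

lemma l2_inner_sum_left:
 assumes "!!i. i : X ==> F i : L2 M" "k : L2 M"
 shows "inn M (%x. \<Sum>i\<in>X. F i x) k = (\<Sum>i\<in>X. inn M (F i) k)"
 using assms
proof (induction X rule: infinite_finite_induct)
 case (insert i X)
 then show ?case
  by (simp add: l2_inner_add_left L2_sum)
qed auto

lemma l2_inner_sum_right:
 assumes "!!i. i : X ==> F i : L2 M" "k : L2 M"
 shows "inn M k (%x. \<Sum>i\<in>X. F i x) = (\<Sum>i\<in>X. inn M k (F i))"
 using l2_inner_sum_left[of X F M k, OF assms]
 by (subst (1 2) l2_inner_commute) (simp flip: cnj_sum)

lemma l2_inner_cong_AE:
 assumes "f : L2 M" "f' : L2 M" "k : L2 M" "AE x in M. f x = f' x"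
 shows "inn M f k = inn M f' k" "inn M k f = inn M k f'"
proof -
 show *: "inn M f k = inn M f' k"
  unfolding l2_inner_def
  by (rule integral_cong_AE)
    (use assms in \<open>auto intro!: borel_measurable_times borel_measurable_cnj L2_measurable\<close>)
 show "inn M k f = inn M k f'"
  by (subst (1 2) l2_inner_commute) (simp add: *)
qed

lemma l2_norm_cong_AE:
 assumes "f : bm M" "g : bm M" "AE x in M. f x = g x"
 shows "nr M f = nr M g"
 unfolding l2_norm_def
 by (subst integral_cong_AE[where g = "%x. (norm (g x))\<^sup>2"]) (use assms in auto)

lemma l2_norm_nonneg [simp]: "nr M f >= 0"
 by (simp add: l2_norm_def)

lemma l2_norm_power2: "(nr M f)\<^sup>2 = (LINT x|M. (norm (f x))\<^sup>2)"
 by (simp add: l2_norm_def)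

lemma l2_inner_self: "inn M f f = of_real ((nr M f)\<^sup>2)"
proof -
 have "inn M f f = (LINT x|M. cr ((norm (f x))\<^sup>2))"
  unfolding l2_inner_def by (simp only: complex_norm_square)
 then show ?thesis
  by (simp only: integral_complex_of_real l2_norm_power2)
qed

lemma l2_norm_scale [simp]: "nr M (%x. c * f x) = norm c * nr M f"
 by (simp add: l2_norm_def norm_mult power_mult_distrib real_sqrt_mult)

lemma l2_norm_uminus [simp]: "nr M (%x. - f x) = nr M f"
 by (simp add: l2_norm_def)

lemma l2_norm_zero [simp]: "nr M (%x. 0) = 0"
 by (simp add: l2_norm_def)

lemma l2_norm_minus_commute: "nr M (%x. f x - g x) = nr M (%x. g x - f x)"
 by (simp add: l2_norm_def norm_minus_commute)

lemma l2_norm_eq_0_iff: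
 assumes "f : L2 M"
 shows "nr M f = 0 \<longleftrightarrow> (AE x in M. f x = 0)"
proof -
 have "nr M f = 0 \<longleftrightarrow> (LINT x|M. (norm (f x))\<^sup>2) = 0"
  by (simp add: l2_norm_def)
 also have "... \<longleftrightarrow> (AE x in M. (norm (f x))\<^sup>2 = 0)"
  by (rule integral_nonneg_eq_0_iff_AE) (use assms in \<open>auto intro: L2_integrable\<close>)
 finally show ?thesis
  by simp
qed

lemma l2_norm_diff_expand:
 assumes "f : L2 M" "g : L2 M"
 shows "(nr M (%x. f x - g x))\<^sup>2 = (nr M f)\<^sup>2 + (nr M g)\<^sup>2 - 2 * Re (inn M f g)"
proof -
 have "cr ((nr M (%x. f x - g x))\<^sup>2) =
   inn M f f + inn M g g - (inn M f g + inn M g f)"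
  unfolding l2_inner_self[symmetric] using assms
  by (simp add: l2_inner_diff_left l2_inner_diff_right L2_diff)
 also have "inn M f g + inn M g f = of_real (2 * Re (inn M f g))"
  by (subst (2) l2_inner_commute) (simp add: complex_add_cnj)
 finally have "cr ((nr M (%x. f x - g x))\<^sup>2) =
  of_real ((nr M f)\<^sup>2 + (nr M g)\<^sup>2 - 2 * Re (inn M f g))"
  by (simp add: l2_inner_self)
 then show ?thesis
  by (simp only: of_real_eq_iff)
qed

lemma l2_norm_add_expand:
 assumes "f : L2 M" "g : L2 M"
 shows "(nr M (%x. f x + g x))\<^sup>2 = (nr M f)\<^sup>2 + (nr M g)\<^sup>2 + 2 * Re (inn M f g)"
 using l2_norm_diff_expand[OF assms(1) L2_uminus[OF assms(2)]] l2_inner_scale_right[of M f "-1" g]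
 by simp

lemma l2_Cauchy_Schwarz:
 assumes "f : L2 M" "g : L2 M"
 shows "norm (inn M f g) <= nr M f * nr M g"
proof (cases "nr M g = 0")
 case True
 then have "AE x in M. g x = 0"
  using assms l2_norm_eq_0_iff by blast
 then have "inn M f g = inn M f (%x. 0)"
  using assms by (intro l2_inner_cong_AE) auto
 then show ?thesis
  by (simp add: True l2_inner_def)
next
 case False
 define N where "N = (nr M g)\<^sup>2"
 \<comment> \<open>The coefficient of the projection of \<open>f\<close> onto \<open>g\<close>; the
   squared norm of the remainder is nonnegative.\<close>
 define c where "c = inn M f g / of_real N"
 have N: "N > 0" using False by (simp add: N_def)
 have "0 <= (nr M (%x. f x - c * g x))\<^sup>2" by simp
 also have "... = (nr M f)\<^sup>2 + (norm c)\<^sup>2 * N - 2 * Re (cnj c * inn M f g)"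
  using assms by (simp add: l2_norm_diff_expand L2_scale power_mult_distrib N_def)
 also have "cnj c * inn M f g = of_real ((norm (inn M f g))\<^sup>2 / N)"
  using complex_norm_square[of "inn M f g"] by (simp add: c_def mult.commute)
 also have "(norm c)\<^sup>2 * N = (norm (inn M f g))\<^sup>2 / N"
  using N by (simp add: c_def norm_divide power_divide power2_eq_square)
 finally have "(norm (inn M f g))\<^sup>2 / N <= (nr M f)\<^sup>2"
  by simp
 then have "(norm (inn M f g))\<^sup>2 <= (nr M f * nr M g)\<^sup>2"
  using N by (simp add: divide_le_eq N_def power_mult_distrib)
 then show ?thesis
  by (rule power2_le_imp_le) simp
qed

lemma l2_norm_triangle:
 assumes "f : L2 M" "g : L2 M"
 shows "nr M (%x. f x + g x) <= nr M f + nr M g"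
proof (rule power2_le_imp_le)
 have "Re (inn M f g) <= nr M f * nr M g"
  using l2_Cauchy_Schwarz[OF assms] complex_Re_le_cmod order_trans by blast
 then show "(nr M (%x. f x + g x))\<^sup>2 <= (nr M f + nr M g)\<^sup>2"
  by (simp add: l2_norm_add_expand[OF assms] power2_sum)
qed simp

lemma l2_norm_triangle_diff:
 assumes "f : L2 M" "g : L2 M"
 shows "nr M (%x. f x - g x) <= nr M f + nr M g"
 using l2_norm_triangle[OF assms(1) L2_uminus[OF assms(2)]] by simp

lemma l2_norm_diff_triangle:
 assumes "f : L2 M" "g : L2 M" "k : L2 M"
 shows "nr M (%x. f x - k x) <= nr M (%x. f x - g x) + nr M (%x. g x - k x)"
 using l2_norm_triangle[of "%x. f x - g x" M "%x. g x - k x"] assms by (simp add: L2_diff)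

lemma l2_norm_diff_ge:
 assumes "f : L2 M" "g : L2 M"
 shows "\<bar>nr M f - nr M g\<bar> <= nr M (%x. f x - g x)"
 using l2_norm_triangle[of "%x. f x - g x" M g] l2_norm_triangle[of "%x. g x - f x" M f] assms
 by (simp add: L2_diff l2_norm_minus_commute[of M g f])

lemma l2_norm_sum_le:
 assumes "!!i. i : X ==> F i : L2 M"
 shows "nr M (%x. \<Sum>i\<in>X. F i x) <= (\<Sum>i\<in>X. nr M (F i))"
 using assms
proof (induction X rule: infinite_finite_induct)
 case (insert i X)
 have "nr M (%x. F i x + (\<Sum>i\<in>X. F i x)) <= nr M (F i) + nr M (%x. \<Sum>i\<in>X. F i x)"
  using insert by (intro l2_norm_triangle L2_sum) auto
 then show ?case
  using insert by force
qed auto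

lemma nn_integral_L2: "f : L2 M ==> (\<integral>\<^sup>+x. ennreal ((norm (f x))\<^sup>2) \<partial>M) = ennreal ((nr M f)\<^sup>2)"
 unfolding l2_norm_power2 by (rule nn_integral_eq_integral) (auto intro: L2_integrable)

lemma L2_I_nn_integral:
 assumes "f : bm M" "(\<integral>\<^sup>+x. ennreal ((norm (f x))\<^sup>2) \<partial>M) <= ennreal (B\<^sup>2)" "B >= 0"
 shows "f : L2 M" "nr M f <= B"
proof -
 show f: "f : L2 M"
  unfolding L2_def using assms(1)
  by (auto simp: integrable_iff_bounded intro: le_less_trans[OF assms(2)])
 from assms(2) have "(nr M f)\<^sup>2 <= B\<^sup>2"
  by (simp add: nn_integral_L2[OF f])
 then show "nr M f <= B"
  using assms(3) by (rule power2_le_imp_le)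
qed

text \<open>The limit is taken pointwise, so that it stays in every class of functions that is closed under
 the operation \<open>plim\<close>.\<close>

definition plim :: "(nat => 'a => complex) => 'a => complex" where
 "plim u x = (if convergent (%k. u k x) then lim (%k. u k x) else 0)"

lemma plim_measurable [measurable]:
 assumes [measurable]: "!!k. u k : bm M"
 shows "plim u : bm M"
proof -
 have "Measurable.pred M (%x. Cauchy (%k. u k x))"
  unfolding metric_Cauchy_iff2 by measurable
 then show ?thesis
  unfolding plim_def[abs_def] Cauchy_convergent_iff[symmetric]
  by (intro measurable_If borel_measurable_lim_metric) auto
qed

text \<open>The sums \<open>H n\<close> of the jumps between consecutive \<open>u k\<close> are
  bounded in \<open>L2\<close> by a geometric series, so monotone convergence makes the series of
  jumps finite almost everywhere. This gives pointwise convergence, and Fatou's lemma turns it into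
  convergence in norm.\<close>

lemma Riesz_Fischer:
 assumes u: "!!k. u k : L2 M"
  and fast: "!!k. nr M (%x. u (Suc k) x - u k x) <= (1/2)^k"
 shows "plim u : L2 M" "(%k. nr M (%x. u k x - plim u x)) ---> 0"
proof -
 define g where "g = plim u"
 have um [measurable]: "u k : bm M" for k
  using u by (rule L2_measurable)
 have geo: "(\<Sum>i<j. (1/2::real)^i) <= 2" for j
  by (subst sum_gp_strict) (simp add: field_simps)
 define d where "d k x = norm (u (Suc k) x - u k x)" for k x
 have [measurable]: "d k : bm M" for k
  unfolding d_def by measurable
 have dL: "(%x. cr (d k x)) : L2 M" for k
  unfolding d_def by (intro L2_norm L2_diff u)
 have dn: "nr M (%x. cr (d k x)) <= (1/2)^k" for k
  using fast[of k] unfolding d_def l2_norm_def by simp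
 define H where "H n x = (\<Sum>k<n. d k x)" for n x
 have [measurable]: "H n : bm M" for n
  unfolding H_def by measurable
 have HL: "(%x. cr (H n x)) : L2 M" for n
  unfolding H_def of_real_sum by (intro L2_sum dL)
 have Hn: "nr M (%x. cr (H n x)) <= 2" for n
 proof -
  have "nr M (%x. cr (H n x)) <= (\<Sum>k<n. (1/2)^k)"
   unfolding H_def of_real_sum
   by (intro order_trans[OF l2_norm_sum_le] sum_mono dn dL)
  also have "... <= 2"
   by (rule geo)
  finally show ?thesis .
 qed
 have Hnn: "0 <= H n x" for n x
  unfolding H_def d_def by (intro sum_nonneg) auto
 have Hmono: "H n x <= H m x" if "n <= m" for n m x
  unfolding H_def d_def using that by (intro sum_mono2) auto
 have "(\<integral>\<^sup>+x. (SUP n. ennreal ((H n x)\<^sup>2)) \<partial>M) = (SUP n. \<integral>\<^sup>+x. ennreal ((H n x)\<^sup>2) \<partial>M)"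
  by (rule nn_integral_monotone_convergence_SUP)
    (auto simp: incseq_def le_fun_def intro!: ennreal_leI power_mono Hmono Hnn)
 also have "... <= 4"
 proof (rule SUP_least)
  fix n
  have "(\<integral>\<^sup>+x. ennreal ((H n x)\<^sup>2) \<partial>M) = ennreal ((nr M (%x. cr (H n x)))\<^sup>2)"
   using nn_integral_L2[OF HL[of n]] by simp
  also have "... <= ennreal (2\<^sup>2)"
   by (intro ennreal_leI power_mono Hn) auto
  finally show "(\<integral>\<^sup>+x. ennreal ((H n x)\<^sup>2) \<partial>M) <= 4"
   by simp
 qed
 finally have "(\<integral>\<^sup>+x. (SUP n. ennreal ((H n x)\<^sup>2)) \<partial>M) ~= \<infinity>"
  by (auto simp: top_unique)
 then have "AE x in M. (SUP n. ennreal ((H n x)\<^sup>2)) ~= \<infinity>"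
  by (intro nn_integral_noteq_infinite) auto
 then have conv: "AE x in M. (%k. u k x) ---> g x"
 proof eventually_elim
  case (elim x)
  define B where "B = enn2real (SUP n. ennreal ((H n x)\<^sup>2))"
  have "(SUP n. ennreal ((H n x)\<^sup>2)) < top"
   using elim by (metis infinity_ennreal_def less_top)
  then have "ennreal ((H n x)\<^sup>2) <= ennreal B" for n
   unfolding B_def by (subst ennreal_enn2real) (assumption, rule SUP_upper, simp)
  moreover have "0 <= B"
   by (simp add: B_def)
  ultimately have "(H n x)\<^sup>2 <= B" for n
   by (simp add: ennreal_le_iff)
  then have "H n x <= sqrt B" for n
   by (rule real_le_rsqrt)
  then have "summable (%k. norm (u (Suc k) x - u k x))"
   unfolding H_def d_def by (intro bounded_imp_summable[where B = "sqrt B"])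
    (auto simp: lessThan_Suc_atMost[symmetric] simp del: sum.lessThan_Suc)
  then have "summable (%k. u (Suc k) x - u k x)"
   by (rule summable_norm_cancel)
  then have "convergent (%n. \<Sum>k<n. u (Suc k) x - u k x)"
   by (simp add: summable_iff_convergent)
  then have "convergent (%n. u n x - u 0 x)"
   by (simp only: sum_lessThan_telescope[of "%k. u k x"])
  then have "convergent (%n. (u n x - u 0 x) + u 0 x)"
   by (intro convergent_add convergent_const)
  then have "convergent (%n. u n x)"
   by simp
  then show ?case
   by (simp add: g_def plim_def convergent_LIMSEQ_iff)
 qed
 have [measurable]: "g : bm M"
  unfolding g_def by measurable
 have dist: "nr M (%x. u (k + j) x - u k x) <= 2 * (1/2)^k" for k j
 proof -
  have "nr M (%x. u (k + j) x - u k x) <= (\<Sum>i<j. (1/2)^(k+i))"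
  proof (induction j)
   case (Suc j)
   have "nr M (%x. u (k + Suc j) x - u k x) \<le>
     nr M (%x. u (Suc (k + j)) x - u (k + j) x) + nr M (%x. u (k + j) x - u k x)"
    using l2_norm_diff_triangle[OF u[of "Suc (k+j)"] u[of "k + j"] u[of k]] by simp
   then show ?case
    using Suc fast[of "k + j"] by simp
  qed auto
  also have "... = (1/2)^k * (\<Sum>i<j. (1/2)^i)"
   by (simp add: sum_distrib_left power_add)
  also have "... <= (1/2)^k * 2"
   by (rule mult_left_mono[OF geo]) simp
  finally show ?thesis
   by (simp add: mult.commute)
 qed
 \<comment> \<open>Fatou's lemma for the squared differences of \<open>u (k + j)\<close> and
   \<open>u k\<close>, whose limit in \<open>j\<close> is the squared distance from
   \<open>u k\<close> to the limit function.\<close>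
 have key: "(\<integral>\<^sup>+x. ennreal ((norm (u k x - g x))\<^sup>2) \<partial>M) <= ennreal ((2 * (1/2)^k)\<^sup>2)" for k
 proof -
  have "(\<integral>\<^sup>+x. ennreal ((norm (u k x - g x))\<^sup>2) \<partial>M) =
    (\<integral>\<^sup>+x. liminf (%j. ennreal ((norm (u (k + j) x - u k x))\<^sup>2)) \<partial>M)"
  proof (rule nn_integral_cong_AE)
   from conv show "AE x in M. ennreal ((norm (u k x - g x))\<^sup>2) =
     liminf (%j. ennreal ((norm (u (k + j) x - u k x))\<^sup>2))"
   proof eventually_elim
    case (elim x)
    have "(%j. u (k + j) x) ---> g x"
     using LIMSEQ_ignore_initial_segment[OF elim, of k] by (simp add: add.commute)
    then have "(%j. ennreal ((norm (u (k + j) x - u k x))\<^sup>2)) ---> ennreal ((norm (g x - u k x))\<^sup>2)"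
     by (intro tendsto_intros tendsto_ennrealI)
    from lim_imp_Liminf[OF _ this] show ?case
     by (simp add: norm_minus_commute)
   qed
  qed
  also have "... <= liminf (%j. \<integral>\<^sup>+x. ennreal ((norm (u (k + j) x - u k x))\<^sup>2) \<partial>M)"
   by (rule nn_integral_liminf) measurable
  also have "... <= liminf (%j::nat. ennreal ((2 * (1/2)^k)\<^sup>2))"
  proof (intro Liminf_mono eventuallyI)
   fix j
   have "(\<integral>\<^sup>+x. ennreal ((norm (u (k + j) x - u k x))\<^sup>2) \<partial>M) =
     ennreal ((nr M (%x. u (k + j) x - u k x))\<^sup>2)"
    by (intro nn_integral_L2 L2_diff u)
   also have "... <= ennreal ((2 * (1/2)^k)\<^sup>2)"
    by (intro ennreal_leI power_mono dist) simp
   finally show "(\<integral>\<^sup>+x. ennreal ((norm (u (k + j) x - u k x))\<^sup>2) \<partial>M) <= ennreal ((2 * (1/2)^k)\<^sup>2)" .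
  qed
  finally show ?thesis
   by (simp add: Liminf_const)
 qed
 have L: "(%x. u k x - g x) : L2 M" "nr M (%x. u k x - g x) <= 2 * (1/2)^k" for k
  by (rule L2_I_nn_integral[OF _ key], measurable)+
 have "(%x. u 0 x - (u 0 x - g x)) : L2 M"
  by (intro L2_diff u L)
 then show "plim u : L2 M"
  by (simp add: g_def)
 have "(%k. 2 * (1/2::real)^k) ---> 2 * 0"
  by (intro tendsto_intros LIMSEQ_power_zero) auto
 then show "(%k. nr M (%x. u k x - plim u x)) ---> 0"
  unfolding g_def[symmetric] mult_zero_right
  by (rule tendsto_sandwich[OF _ _ tendsto_const, rotated 2]) (simp_all add: L)
qed

section \<open>Orthonormal families\<close>

definition orthonormal :: "'a measure => 'i set => ('i => 'a => complex) => bool" where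
 "orthonormal M I e \<longleftrightarrow> (\<forall>i\<in>I. e i : L2 M) \<and>
   (\<forall>i\<in>I. \<forall>j\<in>I. inn M (e i) (e j) = (if i = j then 1 else 0))"

lemma orthonormal_L2: "orthonormal M I e ==> i : I ==> e i : L2 M"
 by (simp add: orthonormal_def)

lemma orthonormal_inner:
 "orthonormal M I e ==> i : I ==> j : I ==> inn M (e i) (e j) = (if i = j then 1 else 0)"
 by (simp add: orthonormal_def)

lemma orthonormal_norm:
 assumes "orthonormal M I e" "i : I"
 shows "nr M (e i) = 1"
proof -
 have "cr ((nr M (e i))\<^sup>2) = 1"
  unfolding l2_inner_self[symmetric] using orthonormal_inner[OF assms assms(2)] by simp
 then have "(nr M (e i))\<^sup>2 = 1"
  by (simp only: of_real_eq_1_iff)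
 then show ?thesis
  using l2_norm_nonneg[of M "e i"] by (simp add: power2_eq_1_iff)
qed


lemma orthonormal_reindex:
 assumes "orthonormal M I e" "inj_on h J" "h ` J \<subseteq> I"
 shows "orthonormal M J (%j. e (h j))"
 using assms unfolding orthonormal_def by (auto simp: inj_on_eq_iff image_subset_iff)

lemma orthonormal_sum_L2:
 "orthonormal M I e ==> X \<subseteq> I ==> (%x. \<Sum>i\<in>X. c i * e i x) : L2 M"
 by (intro L2_sum L2_scale) (auto intro: orthonormal_L2)

lemma orthonormal_sum_inner:
 assumes "orthonormal M I e" "X \<subseteq> I" "finite X" "j : I"
 shows "inn M (%x. \<Sum>i\<in>X. c i * e i x) (e j) = (if j : X then c j else 0)"
proof -
 have "inn M (%x. \<Sum>i\<in>X. c i * e i x) (e j) = (\<Sum>i\<in>X. c i * inn M (e i) (e j))"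
  using assms by (subst l2_inner_sum_left) (auto intro!: L2_scale orthonormal_L2)
 also have "... = (\<Sum>i\<in>X. if i = j then c i else 0)"
  using assms by (intro sum.cong) (auto simp: orthonormal_inner subset_iff)
 finally show ?thesis
  using assms by simp
qed

lemma orthonormal_sum_norm:
 assumes "orthonormal M I e" "X \<subseteq> I" "finite X"
 shows "(nr M (%x. \<Sum>i\<in>X. c i * e i x))\<^sup>2 = (\<Sum>i\<in>X. (norm (c i))\<^sup>2)"
proof -
 let ?s = "%x. \<Sum>i\<in>X. c i * e i x"
 have "cr ((nr M ?s)\<^sup>2) = (\<Sum>i\<in>X. inn M ?s (%x. c i * e i x))"
  unfolding l2_inner_self[symmetric] using assms
  by (subst l2_inner_sum_right) (auto intro!: L2_scale orthonormal_sum_L2[OF assms(1,2)]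
    intro: orthonormal_L2[OF assms(1)])
 also have "... = (\<Sum>i\<in>X. cr ((norm (c i))\<^sup>2))"
  using assms orthonormal_sum_inner[OF assms]
  by (intro sum.cong) (auto simp del: of_real_power simp: complex_norm_square mult.commute subset_iff)
 finally show ?thesis
  by (simp only: of_real_sum[symmetric] of_real_eq_iff)
qed

lemma Bessel_finite:
 assumes "orthonormal M I e" "X \<subseteq> I" "finite X" "f : L2 M"
 shows "(\<Sum>i\<in>X. (norm (inn M f (e i)))\<^sup>2) <= (nr M f)\<^sup>2"
proof -
 let ?c = "%i. inn M f (e i)"
 let ?s = "%x. \<Sum>i\<in>X. ?c i * e i x"
 have s: "?s : L2 M"
  using assms by (intro orthonormal_sum_L2)
 have "inn M f ?s = (\<Sum>i\<in>X. cnj (?c i) * ?c i)"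
  using assms by (subst l2_inner_sum_right) (auto intro!: L2_scale orthonormal_L2)
 also have "... = of_real (\<Sum>i\<in>X. (norm (?c i))\<^sup>2)"
  by (simp only: of_real_sum complex_norm_square mult.commute)
 finally have "Re (inn M f ?s) = (\<Sum>i\<in>X. (norm (?c i))\<^sup>2)"
  by (simp only: Re_complex_of_real)
 moreover have "0 <= (nr M (%x. f x - ?s x))\<^sup>2"
  by simp
 ultimately show ?thesis
  using l2_norm_diff_expand[OF assms(4) s] orthonormal_sum_norm[OF assms(1-3), of ?c] by simp
qed

lemma Bessel_summable:
 assumes "orthonormal M I e" "f : L2 M"
 shows "(%i. (norm (inn M f (e i)))\<^sup>2) summable_on I"
 by (rule nonneg_bdd_above_summable_on)
   (auto simp: bdd_above_def intro!: exI[of _ "(nr M f)\<^sup>2"] Bessel_finite assms)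


lemma l2_has_sum_L2: "l2_has_sum M F g I ==> g : L2 M"
 by (simp add: l2_has_sum_def)

lemma l2_has_sum_AE:
 assumes "l2_has_sum M F g I" "g' : L2 M" "AE x in M. g x = g' x"
 shows "l2_has_sum M F g' I"
proof -
 have "((%X. nr M (%x. (\<Sum>i\<in>X. F i x) - g x)) \<longlongrightarrow> 0) (finite_subsets_at_top I) \<longleftrightarrow>
  ((%X. nr M (%x. (\<Sum>i\<in>X. F i x) - g' x)) \<longlongrightarrow> 0) (finite_subsets_at_top I)"
 proof (rule tendsto_cong, rule eventually_finite_subsets_at_top_weakI)
  fix X assume "finite X" "X \<subseteq> I"
  then have "(%x. \<Sum>i\<in>X. F i x) : L2 M"
   using assms(1) by (intro L2_sum) (auto simp: l2_has_sum_def)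
  then show "nr M (%x. (\<Sum>i\<in>X. F i x) - g x) = nr M (%x. (\<Sum>i\<in>X. F i x) - g' x)"
   using assms by (intro l2_norm_cong_AE L2_measurable L2_diff) (auto simp: l2_has_sum_def)
 qed
 then show ?thesis
  using assms by (simp add: l2_has_sum_def)
qed

lemma l2_has_sum_inner:
 assumes "l2_has_sum M F g I" "h : L2 M"
 shows "((%i. inn M (F i) h) has_sum inn M g h) I"
proof -
 have g: "g : L2 M" and F: "!!i. i : I ==> F i : L2 M"
  using assms by (auto simp: l2_has_sum_def)
 have lim: "((%X. nr M (%x. (\<Sum>i\<in>X. F i x) - g x) * nr M h) \<longlongrightarrow> 0)
   (finite_subsets_at_top I)"
  using assms by (intro tendsto_mult_left_zero) (auto simp: l2_has_sum_def)
 have "((%X. (\<Sum>i\<in>X. inn M (F i) h) - inn M g h) \<longlongrightarrow> 0) (finite_subsets_at_top I)"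
 proof (rule Lim_null_comparison[OF _ lim], intro eventually_finite_subsets_at_top_weakI)
  fix X assume X: "finite X" "X \<subseteq> I"
  have s: "(%x. \<Sum>i\<in>X. F i x) : L2 M"
   using X F by (intro L2_sum) auto
  have "(\<Sum>i\<in>X. inn M (F i) h) - inn M g h = inn M (%x. (\<Sum>i\<in>X. F i x) - g x) h"
   using X F g assms(2) s by (subst l2_inner_diff_left) (auto intro!: l2_inner_sum_left[symmetric])
  then show "norm ((\<Sum>i\<in>X. inn M (F i) h) - inn M g h) \<le>
    nr M (%x. (\<Sum>i\<in>X. F i x) - g x) * nr M h"
   using l2_Cauchy_Schwarz[OF L2_diff[OF s g] assms(2)] by simp
 qed
 then show ?thesis
  by (simp add: has_sum_def LIM_zero_iff)
qed

lemma l2_eq_AE: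
 assumes "f : L2 M" "g : L2 M" "!!h. h : L2 M ==> inn M f h = inn M g h"
 shows "AE x in M. f x = g x"
proof -
 have d: "(%x. f x - g x) : L2 M"
  using assms by (intro L2_diff)
 have "cr ((nr M (%x. f x - g x))\<^sup>2) = 0"
  unfolding l2_inner_self[symmetric] using assms d by (subst l2_inner_diff_left) auto
 then have "nr M (%x. f x - g x) = 0"
  by simp
 then show ?thesis
  by (simp add: l2_norm_eq_0_iff[OF d])
qed


lemma l2_has_sum_norm:
 assumes "l2_has_sum M (%i x. c i * e i x) g I" "orthonormal M I e"
 shows "((%i. (norm (c i))\<^sup>2) has_sum (nr M g)\<^sup>2) I"
proof -
 let ?s = "%X x. \<Sum>i\<in>X. c i * e i x"
 have g: "g : L2 M" and lim: "((%X. nr M (%x. ?s X x - g x)) \<longlongrightarrow> 0) (finite_subsets_at_top I)"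
  using assms by (auto simp: l2_has_sum_def)
 have "((%X. nr M (?s X) - nr M g) \<longlongrightarrow> 0) (finite_subsets_at_top I)"
 proof (rule Lim_null_comparison[OF _ lim], intro eventually_finite_subsets_at_top_weakI)
  fix X assume "finite X" "X \<subseteq> I"
  then show "norm (nr M (?s X) - nr M g) <= nr M (%x. ?s X x - g x)"
   using l2_norm_diff_ge[OF orthonormal_sum_L2[OF assms(2)] g] by simp
 qed
 then have "((%X. (nr M (?s X))\<^sup>2) \<longlongrightarrow> (nr M g)\<^sup>2) (finite_subsets_at_top I)"
  by (intro tendsto_power) (simp add: LIM_zero_iff)
 moreover have "((%X. (nr M (?s X))\<^sup>2) \<longlongrightarrow> (nr M g)\<^sup>2) (finite_subsets_at_top I) \<longleftrightarrow>
   ((%X. \<Sum>i\<in>X. (norm (c i))\<^sup>2) \<longlongrightarrow> (nr M g)\<^sup>2) (finite_subsets_at_top I)"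
  by (rule tendsto_cong, intro eventually_finite_subsets_at_top_weakI orthonormal_sum_norm[OF assms(2)])
 ultimately show ?thesis
  by (simp add: has_sum_def)
qed

text \<open>The sum is exhibited as \<open>plim\<close> of finite linear combinations, so that it
  belongs to every class of functions closed under linear combinations and \<open>plim\<close>;
  \<open>orthogonal_projection\<close> relies on this.\<close>

lemma Riesz_Fischer_orthonormal:
 assumes e: "orthonormal M I e" and c: "(%i. (norm (c i))\<^sup>2) summable_on I"
 shows "\<exists>X. (\<forall>k. finite (X k) & X k \<subseteq> I) \<and>
  l2_has_sum M (%i x. c i * e i x) (plim (%k x. \<Sum>i\<in>X k. c i * e i x)) I"
proof -
 let ?w = "%i. (norm (c i))\<^sup>2"
 define S where "S = infsum ?w I"
 have lim: "(sum ?w \<longlongrightarrow> S) (finite_subsets_at_top I)"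
  using c unfolding S_def by (simp add: has_sum_def[symmetric] has_sum_infsum)
 \<comment> \<open>Two sums within half of \<open>(1/4)^k\<close> of \<open>S\<close> differ by at
   most \<open>(1/4)^k\<close>, so the norms of the differences obey the rate \<open>(1/2)^k\<close>
   that \<open>Riesz_Fischer\<close> demands.\<close>
 have "\<exists>Y. finite Y & Y \<subseteq> I & (\<forall>Z. finite Z & Y \<subseteq> Z & Z \<subseteq> I --> \<bar>sum ?w Z - S\<bar> < (1/4)^k / 2)" for k :: nat
  using tendstoD[OF lim, of "(1/4)^k / 2"] unfolding eventually_finite_subsets_at_top dist_real_def by auto
 then obtain Y where Y: "!!k. finite (Y k)" "!!k. Y k \<subseteq> I"
  "!!k Z. finite Z ==> Y k \<subseteq> Z ==> Z \<subseteq> I ==> \<bar>sum ?w Z - S\<bar> < (1/4)^k / 2"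
  by metis
 \<comment> \<open>Unions make the finite sets increasing, so that the difference of consecutive
   partial sums is again a sum over a set difference.\<close>
 define X where "X k = (\<Union>j\<le>k. Y j)" for k :: nat
 have X: "finite (X k)" "X k \<subseteq> I" "X k \<subseteq> X (Suc k)" "Y k \<subseteq> X k" for k
  unfolding X_def using Y by (fastforce simp: le_Suc_eq)+
 define u where "u k x = (\<Sum>i\<in>X k. c i * e i x)" for k x
 have uL: "u k : L2 M" for k
  unfolding u_def using orthonormal_sum_L2[OF e X(2)] .
 have close: "nr M (%x. (\<Sum>i\<in>Z. c i * e i x) - u k x) <= (1/2)^k"
  if Z: "finite Z" "X k \<subseteq> Z" "Z \<subseteq> I" for Z k
 proof (rule power2_le_imp_le)
  have "(\<Sum>i\<in>Z. c i * e i x) - u k x = (\<Sum>i\<in>Z - X k. c i * e i x)" for x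
   unfolding u_def using Z by (simp add: sum_diff)
  then have "(nr M (%x. (\<Sum>i\<in>Z. c i * e i x) - u k x))\<^sup>2 = sum ?w (Z - X k)"
   using orthonormal_sum_norm[OF e, of "Z - X k" c] Z by auto
  also have "... = sum ?w Z - sum ?w (X k)"
   using Z X by (simp add: sum_diff)
  also have "... <= (1/4)^k"
  proof -
   have "\<bar>sum ?w Z - S\<bar> < (1/4)^k / 2"
    using Z X(4)[of k] by (intro Y(3)) auto
   moreover have "\<bar>sum ?w (X k) - S\<bar> < (1/4)^k / 2"
    using X(1,2,4)[of k] by (intro Y(3)) auto
   ultimately show ?thesis
    by linarith
  qed
  finally show "(nr M (%x. (\<Sum>i\<in>Z. c i * e i x) - u k x))\<^sup>2 <= ((1/2)^k)\<^sup>2"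
   by (simp add: power2_eq_square flip: power_mult_distrib)
 qed simp
 have "nr M (%x. u (Suc k) x - u k x) <= (1/2)^k" for k
  using close[OF X(1) X(3) X(2)] unfolding u_def[of "Suc k"] .
 note RF = Riesz_Fischer[OF uL this]
 have "((%Z. nr M (%x. (\<Sum>i\<in>Z. c i * e i x) - plim u x)) \<longlongrightarrow> 0) (finite_subsets_at_top I)"
 proof (rule tendstoI)
  fix r :: real assume r: "r > 0"
  have "(%k. (1/2)^k + nr M (%x. u k x - plim u x)) ---> 0 + 0"
   by (intro tendsto_add RF LIMSEQ_power_zero) auto
  then have "eventually (%k. (1/2)^k + nr M (%x. u k x - plim u x) < r) sequentially"
   using r by (intro order_tendstoD(2)) auto
  then obtain k where k: "(1/2)^k + nr M (%x. u k x - plim u x) < r"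
   by (auto simp: eventually_sequentially)
  show "\<forall>\<^sub>F Z in finite_subsets_at_top I.
    dist (nr M (%x. (\<Sum>i\<in>Z. c i * e i x) - plim u x)) 0 < r"
   unfolding eventually_finite_subsets_at_top
  proof (intro exI[of _ "X k"] conjI allI impI X)
   fix Z assume Z: "finite Z & X k \<subseteq> Z & Z \<subseteq> I"
   have "nr M (%x. (\<Sum>i\<in>Z. c i * e i x) - plim u x) \<le>
     (1/2)^k + nr M (%x. u k x - plim u x)"
    using close[of Z k] Z
    by (intro order_trans[OF l2_norm_diff_triangle[OF _ uL[of k] RF(1)]] add_right_mono orthonormal_sum_L2[OF e]) auto
   then show "dist (nr M (%x. (\<Sum>i\<in>Z. c i * e i x) - plim u x)) 0 < r"
    using k by simp
  qed
 qed
 then have "l2_has_sum M (%i x. c i * e i x) (plim u) I"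
  unfolding l2_has_sum_def using RF(1) e by (auto intro: L2_scale orthonormal_L2)
 then show ?thesis
  using X unfolding u_def[abs_def] by blast
qed

lemma l2_has_sum_exists:
 assumes "orthonormal M I e" "(%i. (norm (c i))\<^sup>2) summable_on I"
 shows "\<exists>g. l2_has_sum M (%i x. c i * e i x) g I"
 using Riesz_Fischer_orthonormal[OF assms] by blast

section \<open>Operators that are diagonal with respect to two orthonormal families\<close>

text \<open>The sum is determined only up to a null set; \<open>SOME\<close> picks a representative,
  and statements about the operator are therefore statements almost everywhere.\<close>

definition diagonal_op ::
  "'a measure => 'i set => ('i => 'a => complex) => ('i => 'a => complex) => ('i => complex) => 'a op" where
 "diagonal_op M I e v a f = (SOME g. l2_has_sum M (%i x. (a i * inn M f (e i)) * v i x) g I)"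

text \<open>Two families are needed because the Leray transform is in general not self-adjoint: the
  vector that extracts the coefficient of a sector and the monomial that carries the result need not
  be proportional.\<close>

locale diagonal =
 fixes M :: "'a measure" and I :: "'i set" and e v :: "'i => 'a => complex"
  and a :: "'i => complex" and C :: real
 assumes e: "orthonormal M I e" and v: "orthonormal M I v"
  and bound: "i : I ==> norm (a i) <= C" and C: "C >= 0"
begin

abbreviation T :: "'a op" where "T == diagonal_op M I e v a"

lemma norm_coeff_le:
 assumes "i : I"
 shows "(norm (a i * inn M f (e i)))\<^sup>2 <= C\<^sup>2 * (norm (inn M f (e i)))\<^sup>2"
 using bound[OF assms] by (simp add: norm_mult power_mult_distrib mult_right_mono power_mono)

lemma has_sum_T:
 assumes "f : L2 M"
 shows "l2_has_sum M (%i x. (a i * inn M f (e i)) * v i x) (T f) I"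
proof -
 have "(%i. (norm (a i * inn M f (e i)))\<^sup>2) summable_on I"
  by (rule summable_on_comparison_test[where f = "%i. C\<^sup>2 * (norm (inn M f (e i)))\<^sup>2"])
    (auto intro!: norm_coeff_le summable_on_cmult_right Bessel_summable[OF e assms])
 from someI_ex[OF l2_has_sum_exists[OF v this]] show ?thesis
  unfolding diagonal_op_def .
qed

lemma T_L2: "f : L2 M ==> T f : L2 M"
 using has_sum_T l2_has_sum_L2 by blast

lemma T_inner:
 assumes "f : L2 M" "h : L2 M"
 shows "((%i. a i * inn M f (e i) * inn M (v i) h) has_sum inn M (T f) h) I"
 using l2_has_sum_inner[OF has_sum_T[OF assms(1)] assms(2)] by simp

text \<open>Operators are compared through their matrix elements. Linearity and products of diagonal
  operators then become identities between scalar sums.\<close>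

lemma T_eqI:
 assumes "f : L2 M" "g : L2 M"
  and "!!h. h : L2 M ==> ((%i. a i * inn M f (e i) * inn M (v i) h) has_sum inn M g h) I"
 shows "AE x in M. T f x = g x"
 by (rule l2_eq_AE[OF T_L2[OF assms(1)] assms(2)]) (auto intro: has_sum_unique T_inner assms)

lemma T_inner_v:
 assumes "f : L2 M" "j : I"
 shows "inn M (T f) (v j) = a j * inn M f (e j)"
proof -
 have "((%i. a i * inn M f (e i) * inn M (v i) (v j)) has_sum inn M (T f) (v j)) I"
  using assms v by (intro T_inner) (auto intro: orthonormal_L2)
 moreover have "((%i. a i * inn M f (e i) * inn M (v i) (v j)) has_sum
   (\<Sum>i\<in>{j}. a i * inn M f (e i) * inn M (v i) (v j))) I"
  using assms v by (intro has_sum_finite_neutralI[of "{j}"]) (auto simp: orthonormal_inner)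
 ultimately show ?thesis
  using assms orthonormal_inner[OF v, of j j] by (auto dest: has_sum_unique)
qed

lemma T_norm:
 assumes "f : L2 M"
 shows "((%i. (norm (a i * inn M f (e i)))\<^sup>2) has_sum (nr M (T f))\<^sup>2) I"
 by (rule l2_has_sum_norm[OF has_sum_T[OF assms] v])

lemma T_bound:
 assumes "f : L2 M"
 shows "nr M (T f) <= C * nr M f"
proof (rule power2_le_imp_le)
 have "(nr M (T f))\<^sup>2 <= (C * nr M f)\<^sup>2"
 proof (rule has_sum_le_finite_sums[OF T_norm[OF assms]])
  fix X assume X: "finite X" "X \<subseteq> I"
  have "(\<Sum>i\<in>X. (norm (a i * inn M f (e i)))\<^sup>2) <= (\<Sum>i\<in>X. C\<^sup>2 * (norm (inn M f (e i)))\<^sup>2)"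
   using X by (intro sum_mono norm_coeff_le) auto
  also have "... <= C\<^sup>2 * (nr M f)\<^sup>2"
   unfolding sum_distrib_left[symmetric] by (intro mult_left_mono Bessel_finite[OF e X(2,1) assms]) auto
  finally show "(\<Sum>i\<in>X. (norm (a i * inn M f (e i)))\<^sup>2) <= (C * nr M f)\<^sup>2"
   by (simp add: power_mult_distrib)
 qed
 then show "(nr M (T f))\<^sup>2 <= (C * nr M f)\<^sup>2" .
qed (use C in simp)

lemma T_add:
 assumes "f : L2 M" "g : L2 M"
 shows "AE x in M. T (%y. f y + g y) x = T f x + T g x"
proof (rule T_eqI)
 fix h assume h: "h : L2 M"
 have "((%i. a i * inn M f (e i) * inn M (v i) h + a i * inn M g (e i) * inn M (v i) h)
   has_sum inn M (T f) h + inn M (T g) h) I"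
  by (intro has_sum_add T_inner assms h)
 also have "((%i. a i * inn M f (e i) * inn M (v i) h + a i * inn M g (e i) * inn M (v i) h)
   has_sum inn M (T f) h + inn M (T g) h) I \<longleftrightarrow>
  ((%i. a i * inn M (%y. f y + g y) (e i) * inn M (v i) h)
   has_sum inn M (T f) h + inn M (T g) h) I"
  by (intro has_sum_cong) (use assms e in \<open>auto simp: l2_inner_add_left orthonormal_L2 algebra_simps\<close>)
 also have "inn M (T f) h + inn M (T g) h = inn M (%x. T f x + T g x) h"
  using assms h by (simp add: l2_inner_add_left T_L2)
 finally show "((%i. a i * inn M (%y. f y + g y) (e i) * inn M (v i) h)
   has_sum inn M (%x. T f x + T g x) h) I" .
qed (auto intro: L2_add T_L2 assms)

lemma T_scale:
 assumes "f : L2 M"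
 shows "AE x in M. T (%y. c * f y) x = c * T f x"
proof (rule T_eqI)
 fix h assume h: "h : L2 M"
 show "((%i. a i * inn M (%y. c * f y) (e i) * inn M (v i) h)
   has_sum inn M (%x. c * T f x) h) I"
  using has_sum_cmult_right[OF T_inner[OF assms h], of c] by (simp add: mult_ac)
qed (auto intro: L2_scale T_L2 assms)

lemma bounded_T: "l2_bounded_op M T"
 unfolding l2_bounded_op_def using T_L2 T_add T_scale T_bound by blast

text \<open>Serves the lower bound of the essential norm, where a compact operator is tested on
  differences of basis vectors.\<close>

lemma norm_T_diff_e:
 assumes "i : I" "j : I" "i ~= j"
 shows "(nr M (T (%x. e i x - e j x)))\<^sup>2 = (norm (a i))\<^sup>2 + (norm (a j))\<^sup>2"
proof -
 let ?f = "%x. e i x - e j x"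
 have f: "?f : L2 M"
  using assms e by (intro L2_diff orthonormal_L2)
 have ip: "inn M ?f (e k) = (if k = i then 1 else 0) - (if k = j then 1 else 0)" if "k : I" for k
  using assms e that by (auto simp: l2_inner_diff_left orthonormal_L2 orthonormal_inner)
 have "((%k. (norm (a k * inn M ?f (e k)))\<^sup>2) has_sum
   (\<Sum>k\<in>{i, j}. (norm (a k * inn M ?f (e k)))\<^sup>2)) I"
  using assms by (intro has_sum_finite_neutralI[of "{i, j}"]) (auto simp: ip)
 then show ?thesis
  using has_sum_unique[OF T_norm[OF f]] assms by (simp add: ip)
qed

end

lemma l2_bounded_op_cong:
 assumes "l2_bounded_op M T" and "!!f. f : L2 M ==> T' f : L2 M"
  and eq: "!!f. f : L2 M ==> AE x in M. T' f x = T f x"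
 shows "l2_bounded_op M T'"
proof -
 have n: "nr M (T' f) = nr M (T f)" if "f : L2 M" for f
  using assms that by (intro l2_norm_cong_AE L2_measurable) (auto simp: l2_bounded_op_def)
 have add: "AE x in M. T' (%y. f y + g y) x = T' f x + T' g x" if "f : L2 M" "g : L2 M" for f g
 proof -
  have "AE x in M. T (%y. f y + g y) x = T f x + T g x"
   using assms that by (auto simp: l2_bounded_op_def)
  then show ?thesis
   using eq[OF L2_add[OF that]] eq[OF that(1)] eq[OF that(2)] by eventually_elim simp
 qed
 have scale: "AE x in M. T' (%y. c * f y) x = c * T' f x" if "f : L2 M" for c f
 proof -
  have "AE x in M. T (%y. c * f y) x = c * T f x"
   using assms that by (auto simp: l2_bounded_op_def)
  then show ?thesis
   using eq[OF L2_scale[OF that, of c]] eq[OF that] by eventually_elim simp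
 qed
 from assms(1) obtain B where "\<forall>f\<in>L2 M. nr M (T f) <= B * nr M f"
  by (auto simp: l2_bounded_op_def)
 then show ?thesis
  unfolding l2_bounded_op_def using assms(2) n add scale by auto
qed

lemma l2_compact_op_cong:
 assumes "l2_compact_op M T" and L: "!!f. f : L2 M ==> T' f : L2 M"
  and eq: "!!f. f : L2 M ==> AE x in M. T' f x = T f x"
 shows "l2_compact_op M T'"
 unfolding l2_compact_op_def
proof (intro conjI allI impI)
 have bT: "l2_bounded_op M T"
  using assms(1) by (simp add: l2_compact_op_def)
 then have TL: "T f : L2 M" if "f : L2 M" for f
  using that by (simp add: l2_bounded_op_def)
 show "l2_bounded_op M T'"
  by (rule l2_bounded_op_cong[OF bT L eq])
 fix f :: "nat => 'a => complex" assume f: "\<forall>n. f n : L2 M & nr M (f n) <= 1"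
 with assms(1) obtain r g where rg: "strict_mono r" "g : L2 M"
   "(%n. nr M (%x. T (f (r n)) x - g x)) ---> 0"
  unfolding l2_compact_op_def by blast
 have "nr M (%x. T (f (r n)) x - g x) = nr M (%x. T' (f (r n)) x - g x)" for n
 proof (intro l2_norm_cong_AE L2_measurable L2_diff TL L rg)
  show "f (r n) : L2 M" "f (r n) : L2 M" using f by auto
  then show "AE x in M. T (f (r n)) x - g x = T' (f (r n)) x - g x"
   using eq by fastforce
 qed
 then show "\<exists>r g. strict_mono r & g : L2 M & (%n. nr M (%x. T' (f (r n)) x - g x)) ---> 0"
  using rg by (intro exI[of _ r] exI[of _ g]) simp
qed

lemma bounded_finite_family_convergent_subsequence:
 fixes c :: "nat => 'i => complex"
 assumes "finite X" "!!n i. i : X ==> norm (c n i) <= B"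
 shows "\<exists>r l. strict_mono r & (\<forall>i\<in>X. (%n. c (r n) i) ---> l i)"
 using assms
proof (induction X)
 case empty
 then show ?case
  by (auto intro: strict_mono_id)
next
 case (insert j X)
 then obtain r l where r: "strict_mono r" "\<forall>i\<in>X. (%n. c (r n) i) ---> l i"
  by auto
 have "bounded (range (%n. c (r n) j))"
  using insert.prems by (auto simp: bounded_iff)
 then obtain s m where s: "strict_mono s" "((%n. c (r n) j) \<circ> s) ---> m"
  using bounded_imp_convergent_subsequence by blast
 have "\<forall>i\<in>insert j X. (%n. c ((r \<circ> s) n) i) ---> (l(j := m)) i"
 proof
  fix i assume i: "i : insert j X"
  show "(%n. c ((r \<circ> s) n) i) ---> (l(j := m)) i"
  proof (cases "i = j")
   case True
   then show ?thesis using s by (simp add: o_def)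
  next
   case False
   then show ?thesis
    using r(2) i LIMSEQ_subseq_LIMSEQ[OF _ s(1), of "%n. c (r n) i" "l i"] by (simp add: o_def)
  qed
 qed
 then show ?case
  using strict_mono_o[OF r(1) s(1)] by blast
qed

text \<open>The operator has finite rank: the image depends on finitely many bounded coefficients,
  and these converge along a subsequence by Bolzano-Weierstrass.\<close>

lemma (in diagonal) compact_T:
 assumes fin: "finite {i\<in>I. a i ~= 0}"
 shows "l2_compact_op M T"
 unfolding l2_compact_op_def
proof (intro conjI allI impI bounded_T)
 define X where "X = {i\<in>I. a i ~= 0}"
 have X: "finite X" "X \<subseteq> I"
  using fin by (auto simp: X_def)
 fix f :: "nat => 'a => complex" assume f: "\<forall>n. f n : L2 M & nr M (f n) <= 1"
 have "norm (inn M (f n) (e i)) <= 1" if "i : X" for n i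
  using l2_Cauchy_Schwarz[of "f n" M "e i"] f that X orthonormal_norm[OF e] orthonormal_L2[OF e]
  by (metis mult.right_neutral order_trans subsetD)
 from bounded_finite_family_convergent_subsequence[of X "%n i. inn M (f n) (e i)" 1, OF X(1) this]
 obtain r l where r: "strict_mono r" and l: "\<forall>i\<in>X. (%n. inn M (f (r n)) (e i)) ---> l i"
  by blast
 define g where "g x = (\<Sum>i\<in>X. (a i * l i) * v i x)" for x
 have g: "g : L2 M"
  unfolding g_def using X v by (intro orthonormal_sum_L2)
 have eq: "nr M (%x. T (f (r n)) x - g x) = sqrt (\<Sum>i\<in>X. (norm (a i * (inn M (f (r n)) (e i) - l i)))\<^sup>2)" for n
 proof -
  let ?f = "f (r n)"
  let ?S = "%x. \<Sum>i\<in>X. (a i * inn M ?f (e i)) * v i x"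
  have "AE x in M. T ?f x = ?S x"
  proof (rule T_eqI)
   fix h assume h: "h : L2 M"
   have "inn M ?S h = (\<Sum>i\<in>X. a i * inn M ?f (e i) * inn M (v i) h)"
    using X h v by (subst l2_inner_sum_left) (auto intro!: L2_scale orthonormal_L2)
   then show "((%i. a i * inn M ?f (e i) * inn M (v i) h) has_sum inn M ?S h) I"
    using X by (intro has_sum_finite_neutralI[of X]) (auto simp: X_def)
  qed (use f X v in \<open>auto intro!: orthonormal_sum_L2\<close>)
  then have "nr M (%x. T ?f x - g x) = nr M (%x. ?S x - g x)"
   using f X v g by (intro l2_norm_cong_AE L2_measurable L2_diff T_L2 orthonormal_sum_L2) auto
  also have "(%x. ?S x - g x) = (%x. \<Sum>i\<in>X. (a i * (inn M ?f (e i) - l i)) * v i x)"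
   by (simp add: g_def sum_subtractf[symmetric] algebra_simps)
  also have "nr M ... = sqrt ((nr M ...)\<^sup>2)"
   by simp
  also have "... = sqrt (\<Sum>i\<in>X. (norm (a i * (inn M ?f (e i) - l i)))\<^sup>2)"
   by (subst orthonormal_sum_norm[OF v X(2,1)]) simp
  finally show ?thesis .
 qed
 have "(%n. sqrt (\<Sum>i\<in>X. (norm (a i * (inn M (f (r n)) (e i) - l i)))\<^sup>2)) --->
   sqrt (\<Sum>i\<in>X. (norm (a i * (l i - l i)))\<^sup>2)"
  using l by (intro tendsto_intros) auto
 then have "(%n. nr M (%x. T (f (r n)) x - g x)) ---> 0"
  by (simp add: eq)
 then show "\<exists>r g. strict_mono r & g : L2 M & (%n. nr M (%x. T (f (r n)) x - g x)) ---> 0"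
  by (intro exI[of _ r] exI[of _ g] conjI r g)
qed

section \<open>Essential spectrum and essential norm of diagonal operators\<close>

lemma l2_bounded_op_L2: "l2_bounded_op M T ==> f : L2 M ==> T f : L2 M"
 by (simp add: l2_bounded_op_def)

lemma l2_bounded_op_bound:
 assumes "l2_bounded_op M T"
 shows "\<exists>C\<ge>0. \<forall>f\<in>L2 M. nr M (T f) <= C * nr M f"
proof -
 from assms obtain C where C: "\<forall>f\<in>L2 M. nr M (T f) <= C * nr M f"
  by (auto simp: l2_bounded_op_def)
 have "nr M (T f) <= max C 0 * nr M f" if "f : L2 M" for f
 proof -
  have "nr M (T f) <= C * nr M f" using C that by blast
  also have "... <= max C 0 * nr M f" by (intro mult_right_mono) auto
  finally show ?thesis .
 qed
 then show ?thesis by (intro exI[of _ "max C 0"]) auto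
qed

lemma l2_bounded_op_add:
 "l2_bounded_op M T ==> f : L2 M ==> g : L2 M ==> AE x in M. T (%y. f y + g y) x = T f x + T g x"
 by (simp add: l2_bounded_op_def)

lemma l2_bounded_op_scale:
 "l2_bounded_op M T ==> f : L2 M ==> AE x in M. T (%y. c * f y) x = c * T f x"
 by (simp add: l2_bounded_op_def)

lemma has_sum_minus:
 fixes f g :: "'i => complex"
 assumes "(f has_sum a) I" "(g has_sum b) I"
 shows "((%i. f i - g i) has_sum (a - b)) I"
 using has_sum_add[OF assms(1) has_sum_cmult_right[OF assms(2), of "-1"]] by simp

lemma l2_bounded_op_diff:
 assumes T: "l2_bounded_op M T" and f: "f : L2 M" and g: "g : L2 M"
 shows "AE x in M. T (%y. f y - g y) x = T f x - T g x"
proof -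
 have g': "(%y. (-1) * g y) : L2 M" by (rule L2_scale[OF g])
 have "AE x in M. T (%y. (-1) * g y) x = (-1) * T g x"
  by (rule l2_bounded_op_scale[OF T g])
 moreover have "AE x in M. T (%y. f y + (-1) * g y) x = T f x + T (%y. (-1) * g y) x"
  by (rule l2_bounded_op_add[OF T f g'])
 ultimately have "AE x in M. T (%y. f y + (-1) * g y) x = T f x - T g x"
  by eventually_elim simp
 then show ?thesis by simp
qed

lemma l2_bounded_op_combine:
 assumes T: "l2_bounded_op M T" and S: "l2_bounded_op M S"
 shows "l2_bounded_op M (%f x. T f x + c * S f x)"
 unfolding l2_bounded_op_def
proof (intro conjI ballI allI)
 note L = l2_bounded_op_L2[OF T] l2_bounded_op_L2[OF S]
 show "(%x. T f x + c * S f x) : L2 M" if "f : L2 M" for f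
  using that by (intro L2_add L2_scale L)
 show "AE x in M. T (%y. f y + g y) x + c * S (%y. f y + g y) x = T f x + c * S f x + (T g x + c * S g x)"
  if "f : L2 M" "g : L2 M" for f g
 proof -
  have "AE x in M. T (%y. f y + g y) x = T f x + T g x" "AE x in M. S (%y. f y + g y) x = S f x + S g x"
   by (intro l2_bounded_op_add T S that)+
  then show ?thesis by eventually_elim (simp add: algebra_simps)
 qed
 show "AE x in M. T (%y. d * f y) x + c * S (%y. d * f y) x = d * (T f x + c * S f x)"
  if "f : L2 M" for d f
 proof -
  have "AE x in M. T (%y. d * f y) x = d * T f x" "AE x in M. S (%y. d * f y) x = d * S f x"
   by (intro l2_bounded_op_scale T S that)+
  then show ?thesis by eventually_elim (simp add: algebra_simps)
 qed
 obtain C1 where C1: "C1 >= 0" "!!f. f : L2 M ==> nr M (T f) <= C1 * nr M f"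
  using l2_bounded_op_bound[OF T] by blast
 obtain C2 where C2: "C2 >= 0" "!!f. f : L2 M ==> nr M (S f) <= C2 * nr M f"
  using l2_bounded_op_bound[OF S] by blast
 have "nr M (%x. T f x + c * S f x) <= (C1 + norm c * C2) * nr M f" if f: "f : L2 M" for f
 proof -
  have "nr M (%x. T f x + c * S f x) <= nr M (T f) + norm c * nr M (S f)"
   using l2_norm_triangle[OF L(1)[OF f] L2_scale[OF L(2)[OF f], of c]] by simp
  also have "... <= C1 * nr M f + norm c * (C2 * nr M f)"
   by (intro add_mono mult_left_mono C1 C2 f) auto
  finally show ?thesis by (simp add: algebra_simps)
 qed
 then show "\<exists>C. \<forall>f\<in>L2 M. nr M (%x. T f x + c * S f x) <= C * nr M f" by blast
qed


lemma orthonormal_dist: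
 assumes "orthonormal M I e" "i : I" "j : I" "i ~= j"
 shows "(nr M (%x. e i x - e j x))\<^sup>2 = 2"
 using assms l2_norm_diff_expand[OF orthonormal_L2 orthonormal_L2, OF assms(1,2,1,3)]
 by (simp add: orthonormal_norm orthonormal_inner)

text \<open>A Weyl sequence. If \<open>S T - 1\<close> were compact, \<open>S (T (u k))\<close>
  tending to 0 would force a subsequence of \<open>u\<close> to converge, whereas distinct
  orthonormal vectors have distance \<open>sqrt 2\<close>.\<close>

lemma not_calkin_invertible:
 assumes T: "l2_bounded_op M T" and u: "orthonormal M (UNIV :: nat set) u"
  and lim: "(%k. nr M (T (u k))) ---> 0"
 shows "\<not> calkin_invertible M T"
proof
 assume "calkin_invertible M T"
 then obtain S where S: "l2_bounded_op M S" and K: "l2_compact_op M (%f x. S (T f) x - f x)"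
  unfolding calkin_invertible_def by blast
 have uL: "u k : L2 M" for k using orthonormal_L2[OF u] by simp
 have STL: "S (T (u k)) : L2 M" for k by (intro l2_bounded_op_L2[OF S] l2_bounded_op_L2[OF T] uL)
 have un: "nr M (u k) = 1" for k using orthonormal_norm[OF u] by simp
 obtain r g where r: "strict_mono r" and g: "g : L2 M"
  and rg: "(%n. nr M (%x. S (T (u (r n))) x - u (r n) x - g x)) ---> 0"
  using K uL un unfolding l2_compact_op_def by force
 obtain C where C: "C >= 0" "!!f. f : L2 M ==> nr M (S f) <= C * nr M f"
  using l2_bounded_op_bound[OF S] by blast
 have "(%n. nr M (T (u (r n)))) ---> 0"
  using LIMSEQ_subseq_LIMSEQ[OF lim r] by (simp add: o_def)
 then have "(%n. C * nr M (T (u (r n)))) ---> 0"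
  by (rule tendsto_mult_right_zero)
 then have ST0: "(%n. nr M (S (T (u (r n))))) ---> 0"
  by (rule tendsto_sandwich[OF _ _ tendsto_const, rotated 2])
    (simp_all add: C l2_bounded_op_L2[OF T] uL)
 \<comment> \<open>Since \<open>S (T u)\<close> tends to 0, convergence of
   \<open>S (T u) - u\<close> to \<open>g\<close> means convergence of \<open>u\<close> to
   \<open>- g\<close>.\<close>
 define d where "d n = nr M (%x. u (r n) x - (- g x))" for n
 have gL: "(%x. - g x) : L2 M" by (rule L2_uminus[OF g])
 have dle: "d n <= nr M (S (T (u (r n)))) + nr M (%x. S (T (u (r n))) x - u (r n) x - g x)" for n
 proof -
  have "nr M (%x. S (T (u (r n))) x - (S (T (u (r n))) x - u (r n) x - g x)) \<le>
    nr M (S (T (u (r n)))) + nr M (%x. S (T (u (r n))) x - u (r n) x - g x)"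
   by (intro l2_norm_triangle_diff STL L2_diff uL g)
  then show ?thesis by (simp add: d_def)
 qed
 have d0: "d ---> 0"
 proof (rule tendsto_sandwich[OF _ _ tendsto_const tendsto_add_zero[OF ST0 rg]])
  show "\<forall>\<^sub>F n in sequentially. 0 <= d n"
   by (simp add: d_def)
 qed (intro always_eventually allI dle)
 have "(%n. d n + d (Suc n)) ---> 0"
  using tendsto_add[OF d0 LIMSEQ_Suc[OF d0]] by simp
 then have "\<forall>\<^sub>F n in sequentially. d n + d (Suc n) < 1"
  by (rule order_tendstoD(2)) simp
 then obtain n where n: "d n + d (Suc n) < 1"
  by (auto simp: eventually_sequentially)
 have "r n ~= r (Suc n)"
  using strict_monoD[OF r, of n "Suc n"] by simp
 then have "(nr M (%x. u (r n) x - u (r (Suc n)) x))\<^sup>2 = 2"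
  by (intro orthonormal_dist[OF u]) auto
 moreover have "nr M (%x. u (r n) x - u (r (Suc n)) x) <= d n + d (Suc n)"
  using l2_norm_diff_triangle[OF uL[of "r n"] gL uL[of "r (Suc n)"]]
  unfolding d_def by (simp add: l2_norm_minus_commute[of M "%x. - g x"])
 then have "(nr M (%x. u (r n) x - u (r (Suc n)) x))\<^sup>2 <= (d n + d (Suc n))\<^sup>2"
  by (intro power_mono) auto
 moreover have "(d n + d (Suc n))\<^sup>2 <= 1"
  using n by (intro power_le_one) (auto simp: d_def)
 ultimately show False by simp
qed

text \<open>\<open>P\<close> stands for the product of the adjoint with the operator. As a map on
  representatives it agrees with the diagonal operator only almost everywhere, which is why it is a
  separate parameter.\<close>

locale self_diagonal = diagonal M I e e b C
 for M :: "'a measure" and I :: "'i set" and e b C +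
 fixes P :: "'a op"
 assumes P: "l2_bounded_op M P" and P_eq: "!!f. f : L2 M ==> AE x in M. P f x = T f x"
begin

lemma P_L2: "f : L2 M ==> P f : L2 M"
 by (rule l2_bounded_op_L2[OF P])

lemma P_inner:
 assumes "f : L2 M" "h : L2 M"
 shows "((%i. b i * inn M f (e i) * inn M (e i) h) has_sum inn M (P f) h) I"
 using T_inner[OF assms] l2_inner_cong_AE(1)[OF P_L2[OF assms(1)] T_L2[OF assms(1)] assms(2) P_eq[OF assms(1)]]
 by simp

lemma P_inner_e:
 assumes "f : L2 M" "j : I"
 shows "inn M (P f) (e j) = b j * inn M f (e j)"
 using T_inner_v[OF assms] l2_inner_cong_AE(1)[OF P_L2[OF assms(1)] T_L2[OF assms(1)] orthonormal_L2[OF e assms(2)] P_eq[OF assms(1)]]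
 by simp

lemma P_shift_bounded: "l2_bounded_op M (%f x. P f x - c * f x)"
proof -
 have id: "l2_bounded_op M (%f. f)"
  unfolding l2_bounded_op_def by (auto intro: exI[of _ 1])
 show ?thesis
  using l2_bounded_op_combine[OF P id, of "- c"] by simp
qed

text \<open>The parametrix inverts \<open>P - c\<close> off the finitely many eigenvectors with \<open>b i\<close> near \<open>c\<close>.\<close>

lemma calkin_invertible_shift:
 assumes c: "c ~= 0" and de: "de > 0" and fin: "finite {i\<in>I. norm (b i - c) < de}"
 shows "calkin_invertible M (%f x. P f x - c * f x)"
proof -
 define J where "J = {i\<in>I. norm (b i - c) < de}"
 \<comment> \<open>The family \<open>e\<close> need not be complete, and on its orthogonal
   complement \<open>P - c\<close> is multiplication by \<open>- c\<close>. The parametrix is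
   therefore \<open>- 1 / c\<close> everywhere, plus a diagonal correction \<open>a\<close> that
   produces \<open>1 / (b i - c)\<close> off \<open>J\<close>.\<close>
 define a where "a i = (if i : J then 0 else 1 / (b i - c) + 1 / c)" for i
 \<comment> \<open>On \<open>J\<close> the parametrix is \<open>- 1 / c\<close>, which leaves the
   error \<open>- (b i - c) / c - 1 = - b i / c\<close>.\<close>
 define k where "k i = (if i : J then - b i / c else 0)" for i
 have k: "a i * (b i - c) - b i / c = k i" if "i : I" for i
 proof (cases "i : J")
  case False
  then have "norm (b i - c) >= de" using that by (simp add: J_def)
  then have "b i - c ~= 0" using de by auto
  then have "(1 / (b i - c) + 1 / c) * (b i - c) = 1 + (b i - c) / c"
   by (simp add: distrib_right)
  also have "... = b i / c" using c by (simp add: diff_divide_distrib)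
  finally show ?thesis using False by (simp add: a_def k_def)
 qed (simp add: a_def k_def)
 interpret a: diagonal M I e e a "1 / de + 1 / norm c"
 proof
  fix i assume i: "i : I"
  show "norm (a i) <= 1 / de + 1 / norm c"
  proof (cases "i : J")
   case True then show ?thesis using de by (simp add: a_def)
  next
   case False
   then have "de <= norm (b i - c)" using i by (simp add: J_def)
   then have "1 / norm (b i - c) <= 1 / de" using de by (simp add: frac_le)
   have "norm (a i) <= norm (1 / (b i - c)) + norm (1 / c)"
    using False norm_triangle_ineq by (simp add: a_def)
   also have "... <= 1 / de + 1 / norm c"
    using \<open>1 / norm (b i - c) <= 1 / de\<close> by (simp add: norm_divide)
   finally show ?thesis .
  qed
 qed (use e de in auto)
 interpret k: diagonal M I e e k "\<Sum>i\<in>J. norm (k i)"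
 proof
  fix i assume i: "i : I"
  show "norm (k i) <= (\<Sum>i\<in>J. norm (k i))"
  proof (cases "i : J")
   case True then show ?thesis using fin by (intro member_le_sum) (auto simp: J_def)
  qed (auto simp: k_def intro: sum_nonneg)
 qed (auto intro: e sum_nonneg)
 have "{i\<in>I. k i ~= 0} \<subseteq> J" by (auto simp: k_def split: if_splits)
 then have kfin: "finite {i\<in>I. k i ~= 0}" using fin finite_subset unfolding J_def by blast
 define S where "S f x = a.T f x + (- 1 / c) * f x" for f x
 have id: "l2_bounded_op M (%f. f)"
  unfolding l2_bounded_op_def by (auto intro: exI[of _ 1])
 have S: "l2_bounded_op M S"
  using l2_bounded_op_combine[OF a.bounded_T id, of "- 1 / c"] by (simp add: S_def[abs_def])
 let ?Q = "%f x. P f x - c * f x"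
 note Q = P_shift_bounded[of c]
 have QL: "?Q f : L2 M" if "f : L2 M" for f using l2_bounded_op_L2[OF Q that] .
 have SL: "S f : L2 M" if "f : L2 M" for f using l2_bounded_op_L2[OF S that] .
 have S_inner: "((%i. a i * inn M f (e i) * inn M (e i) h) has_sum (inn M (S f) h + inn M f h / c)) I"
  if "f : L2 M" "h : L2 M" for f h
 proof -
  have "inn M (S f) h = inn M (a.T f) h + (- 1 / c) * inn M f h"
   using l2_inner_add_left[OF a.T_L2[OF that(1)] L2_scale[OF that(1), of "- 1 / c"] that(2)]
   by (simp only: S_def[abs_def] l2_inner_scale_left)
  then have "inn M (S f) h + inn M f h / c = inn M (a.T f) h" by simp
  then show ?thesis using a.T_inner[OF that] by simp
 qed
 have Q_inner: "inn M (?Q f) h = inn M (P f) h - c * inn M f h" if "f : L2 M" "h : L2 M" for f h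
  using that by (subst l2_inner_diff_left) (auto intro: P_L2 L2_scale)
 have 1: "l2_compact_op M (%f x. S (?Q f) x - f x)"
 proof (rule l2_compact_op_cong[OF k.compact_T[OF kfin]])
  fix f assume f: "f : L2 M"
  show fL: "(%x. S (?Q f) x - f x) : L2 M" by (intro L2_diff SL QL f)
  have "AE x in M. k.T f x = S (?Q f) x - f x"
  proof (rule k.T_eqI[OF f fL])
   fix h assume h: "h : L2 M"
   have "((%i. a i * inn M (?Q f) (e i) * inn M (e i) h - (1 / c) * (b i * inn M f (e i) * inn M (e i) h))
     has_sum ((inn M (S (?Q f)) h + inn M (?Q f) h / c) - (1 / c) * inn M (P f) h)) I"
    by (intro has_sum_minus S_inner QL f h has_sum_cmult_right P_inner)
   also have "(inn M (S (?Q f)) h + inn M (?Q f) h / c) - (1 / c) * inn M (P f) h =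
     inn M (%x. S (?Q f) x - f x) h"
    using f h c by (simp add: l2_inner_diff_left SL QL Q_inner diff_divide_distrib)
   also have "((%i. a i * inn M (?Q f) (e i) * inn M (e i) h - (1 / c) * (b i * inn M f (e i) * inn M (e i) h))
     has_sum inn M (%x. S (?Q f) x - f x) h) I \<longleftrightarrow>
    ((%i. k i * inn M f (e i) * inn M (e i) h) has_sum inn M (%x. S (?Q f) x - f x) h) I"
   proof (rule has_sum_cong)
    fix i assume i: "i : I"
    have "inn M (?Q f) (e i) = (b i - c) * inn M f (e i)"
     using f i by (simp add: Q_inner orthonormal_L2[OF e] P_inner_e left_diff_distrib)
    then have "a i * inn M (?Q f) (e i) * inn M (e i) h - (1 / c) * (b i * inn M f (e i) * inn M (e i) h)
     = (a i * (b i - c) - b i / c) * inn M f (e i) * inn M (e i) h"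
     unfolding \<open>inn M (?Q f) (e i) = _\<close> by (simp add: algebra_simps)
    then show "a i * inn M (?Q f) (e i) * inn M (e i) h - (1 / c) * (b i * inn M f (e i) * inn M (e i) h)
     = k i * inn M f (e i) * inn M (e i) h"
     by (simp only: k[OF i])
   qed
   finally show "((%i. k i * inn M f (e i) * inn M (e i) h) has_sum inn M (%x. S (?Q f) x - f x) h) I" .
  qed
  then show "AE x in M. S (?Q f) x - f x = k.T f x" by eventually_elim simp
 qed
 have 2: "l2_compact_op M (%f x. ?Q (S f) x - f x)"
 proof (rule l2_compact_op_cong[OF k.compact_T[OF kfin]])
  fix f assume f: "f : L2 M"
  show fL: "(%x. ?Q (S f) x - f x) : L2 M" by (intro L2_diff[OF QL] SL f)
  have S_e: "inn M (S f) (e i) = (a i - 1 / c) * inn M f (e i)" if "i : I" for i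
  proof -
   have "inn M (S f) (e i) = inn M (a.T f) (e i) + (- 1 / c) * inn M f (e i)"
    using l2_inner_add_left[OF a.T_L2[OF f] L2_scale[OF f, of "- 1 / c"] orthonormal_L2[OF e that]]
    by (simp only: S_def[abs_def] l2_inner_scale_left)
   then show ?thesis using f that by (simp add: a.T_inner_v left_diff_distrib)
  qed
  have "AE x in M. k.T f x = ?Q (S f) x - f x"
  proof (rule k.T_eqI[OF f fL])
   fix h assume h: "h : L2 M"
   have "((%i. b i * inn M (S f) (e i) * inn M (e i) h - c * (a i * inn M f (e i) * inn M (e i) h))
     has_sum (inn M (P (S f)) h - c * (inn M (S f) h + inn M f h / c))) I"
    by (intro has_sum_minus S_inner SL f h has_sum_cmult_right P_inner)
   also have "inn M (P (S f)) h - c * (inn M (S f) h + inn M f h / c) =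
     inn M (%x. ?Q (S f) x - f x) h"
    using f h c by (simp add: l2_inner_diff_left[OF QL] SL Q_inner distrib_left)
   also have "((%i. b i * inn M (S f) (e i) * inn M (e i) h - c * (a i * inn M f (e i) * inn M (e i) h))
     has_sum inn M (%x. ?Q (S f) x - f x) h) I \<longleftrightarrow>
    ((%i. k i * inn M f (e i) * inn M (e i) h) has_sum inn M (%x. ?Q (S f) x - f x) h) I"
   proof (rule has_sum_cong)
    fix i assume i: "i : I"
    have "b i * inn M (S f) (e i) * inn M (e i) h - c * (a i * inn M f (e i) * inn M (e i) h)
     = (a i * (b i - c) - b i / c) * inn M f (e i) * inn M (e i) h"
     unfolding S_e[OF i] by (simp add: algebra_simps)
    then show "b i * inn M (S f) (e i) * inn M (e i) h - c * (a i * inn M f (e i) * inn M (e i) h)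
     = k i * inn M f (e i) * inn M (e i) h"
     by (simp only: k[OF i])
   qed
   finally show "((%i. k i * inn M f (e i) * inn M (e i) h) has_sum inn M (%x. ?Q (S f) x - f x) h) I" .
  qed
  then show "AE x in M. ?Q (S f) x - f x = k.T f x" by eventually_elim simp
 qed
 show ?thesis
  unfolding calkin_invertible_def using S 1 2 by blast
qed

lemma T_e:
 assumes "j : I"
 shows "AE x in M. T (e j) x = b j * e j x"
proof (rule T_eqI)
 fix h assume h: "h : L2 M"
 show "((%i. b i * inn M (e j) (e i) * inn M (e i) h) has_sum inn M (%x. b j * e j x) h) I"
  by (rule has_sum_finite_neutralI[of "{j}"])
    (use assms h in \<open>auto simp: orthonormal_inner[OF e]\<close>)
qed (use assms in \<open>auto intro: L2_scale orthonormal_L2[OF e]\<close>)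

lemma T_orthogonal:
 assumes "f : L2 M" "!!i. i : I ==> inn M f (e i) = 0"
 shows "AE x in M. T f x = 0"
proof (rule T_eqI)
 fix h assume "h : L2 M"
 have "((%i. b i * inn M f (e i) * inn M (e i) h) has_sum 0) I \<longleftrightarrow> ((%i. 0 :: complex) has_sum 0) I"
  by (rule has_sum_cong) (simp add: assms(2))
 then show "((%i. b i * inn M f (e i) * inn M (e i) h) has_sum inn M (%x. 0) h) I"
  by simp
qed (use assms in auto)

text \<open>The vectors \<open>w\<close> lie in the kernel and form a Weyl sequence for 0; the
  vectors \<open>e (q k)\<close> form one for a point of \<open>La\<close>. At every other point
  only finitely many eigenvalues are near, and the parametrix applies.\<close>

lemma essential_spectrum_eq:
 assumes w: "orthonormal M (UNIV :: nat set) w" "!!k i. i : I ==> inn M (w k) (e i) = 0"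
  and La1: "!!c. c : La ==> \<exists>q::nat => 'i. inj q & range q \<subseteq> I & (%k. b (q k)) ---> c"
  and La2: "!!c. c \<notin> La ==> \<exists>de>0. finite {i\<in>I. norm (b i - c) < de}"
 shows "l2_essential_spectrum M P = {0} \<union> La"
proof (intro equalityI subsetI)
 fix c assume "c : l2_essential_spectrum M P"
 then have "\<not> calkin_invertible M (%f x. P f x - c * f x)"
  by (simp add: l2_essential_spectrum_def)
 then show "c : {0} \<union> La"
  using calkin_invertible_shift La2 by blast
next
 fix c assume "c : {0} \<union> La"
 then have "\<not> calkin_invertible M (%f x. P f x - c * f x)"
 proof
  assume "c : {0}"
  then have c: "c = 0" by simp
  have "nr M (%x. P (w k) x - c * w k x) = 0" for k
  proof -
   have wL: "w k : L2 M" using orthonormal_L2[OF w(1)] by simp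
   have "AE x in M. T (w k) x = 0"
    by (rule T_orthogonal[OF wL]) (rule w(2))
   then have "AE x in M. P (w k) x = 0"
    using P_eq[OF wL] by eventually_elim simp
   then show ?thesis
    by (simp add: c l2_norm_eq_0_iff[OF P_L2[OF wL]])
  qed
  then show ?thesis
   by (intro not_calkin_invertible[OF P_shift_bounded w(1)]) simp
 next
  assume "c : La"
  then obtain q :: "nat => 'i" where q: "inj q" "range q \<subseteq> I" "(%k. b (q k)) ---> c"
   using La1 by blast
  have "nr M (%x. P (e (q k)) x - c * e (q k) x) = norm (b (q k) - c)" for k
  proof -
   have qI: "q k : I" using q by auto
   have eL: "e (q k) : L2 M" using orthonormal_L2[OF e qI] .
   have "AE x in M. P (e (q k)) x - c * e (q k) x = (b (q k) - c) * e (q k) x"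
    using P_eq[OF eL] T_e[OF qI] by eventually_elim (simp add: left_diff_distrib)
   then have "nr M (%x. P (e (q k)) x - c * e (q k) x) = nr M (%x. (b (q k) - c) * e (q k) x)"
    by (intro l2_norm_cong_AE L2_measurable L2_diff L2_scale P_L2 eL)
   then show ?thesis using orthonormal_norm[OF e qI] by simp
  qed
  moreover have "(%k. norm (b (q k) - c)) ---> 0"
   using q(3) by (simp add: tendsto_norm_zero LIM_zero)
  ultimately show ?thesis
   using q by (intro not_calkin_invertible[OF P_shift_bounded, of "%k. e (q k)"] orthonormal_reindex[OF e]) auto
 qed
 then show "c : l2_essential_spectrum M P"
  by (simp add: l2_essential_spectrum_def)
qed

text \<open>Zorn's lemma extends \<open>e\<close> to a maximal orthonormal set. The added vectors
  are orthogonal to \<open>e\<close>, hence eigenvectors with eigenvalue 0.\<close>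

lemma eigenbasis: "\<exists>E. l2_orthogonal_basis M E & (\<forall>x\<in>E. l2_eigenfunction M P x)"
proof -
 let ?O = "{E. orthonormal M E (%x. x) & e ` I \<subseteq> E}"
 have "e ` I : ?O"
 proof -
  have "i = j" if "i : I" "j : I" "e i = e j" for i j
   using orthonormal_inner[OF e that(1,1)] orthonormal_inner[OF e that(1,2)] that(3)
   by (simp split: if_splits)
  then show ?thesis
   using e by (auto simp: orthonormal_def)
 qed
 then have ne: "?O ~= {}"
  by (rule ex_in_conv[THEN iffD1, OF exI])
 have chain: "\<Union>\<C> : ?O" if C: "\<C> ~= {}" "subset.chain ?O \<C>" for \<C>
 proof -
  have sub: "\<C> \<subseteq> ?O" using C(2) by (auto simp: subset.chain_def)
  have "orthonormal M (\<Union>\<C>) (%x. x)"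
   unfolding orthonormal_def
  proof (intro conjI ballI)
   fix x assume "x : \<Union>\<C>"
   then show "x : L2 M" using sub by (auto simp: orthonormal_def)
  next
   fix x y assume "x : \<Union>\<C>" "y : \<Union>\<C>"
   then obtain X Y where XY: "x : X" "X : \<C>" "y : Y" "Y : \<C>" by auto
   then have "X \<subseteq> Y \<or> Y \<subseteq> X" using C(2) unfolding subset.chain_def by blast
   then obtain Z where "Z : \<C>" "x : Z" "y : Z" using XY by blast
   then show "inn M x y = (if x = y then 1 else 0)"
    using sub by (auto simp: orthonormal_def)
  qed
  then show ?thesis using sub C(1) by blast
 qed
 have "\<exists>E\<in>?O. \<forall>X\<in>?O. E \<subseteq> X --> X = E"
  by (rule subset_Zorn_nonempty[OF ne chain])
 then obtain E where E: "E : ?O" and max': "\<forall>X\<in>?O. E \<subseteq> X --> X = E"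
  by (rule bexE)
 have max: "X = E" if "X : ?O" "E \<subseteq> X" for X
  using bspec[OF max' that(1)] that(2) by (rule mp)
 have ON: "orthonormal M E (%x. x)" and eE: "e ` I \<subseteq> E" using E by auto
 have EL: "x : L2 M" if "x : E" for x using orthonormal_L2[OF ON that] .
 have complete: "\<exists>c. l2_has_sum M (%x y. c x * x y) f E" if f: "f : L2 M" for f
 proof -
  let ?c = "%x. inn M f x"
  from l2_has_sum_exists[OF ON Bessel_summable[OF ON f]]
  obtain g where g: "l2_has_sum M (%x y. ?c x * x y) g E" by blast
  have gL: "g : L2 M" using g by (rule l2_has_sum_L2)
  have gx: "inn M g x = ?c x" if x: "x : E" for x
  proof -
   have "((%z. inn M (%y. ?c z * z y) x) has_sum inn M g x) E"
    by (rule l2_has_sum_inner[OF g EL[OF x]])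
   moreover have "((%z. inn M (%y. ?c z * z y) x) has_sum ?c x) E"
    by (rule has_sum_finite_neutralI[of "{x}"]) (use x in \<open>auto simp: orthonormal_inner[OF ON]\<close>)
   ultimately show ?thesis by (rule has_sum_unique)
  qed
  define d where "d = (%x. f x - g x)"
  have dL: "d : L2 M" unfolding d_def by (intro L2_diff f gL)
  have dx: "inn M d x = 0" if "x : E" for x
   unfolding d_def using that gx f gL EL by (subst l2_inner_diff_left) auto
  have "nr M d = 0"
  proof (rule ccontr)
   assume nz: "nr M d ~= 0"
   define z where "z = (%x. cr (1 / nr M d) * d x)"
   have zL: "z : L2 M" unfolding z_def by (rule L2_scale[OF dL])
   have zz: "inn M z z = 1"
   proof -
    have "nr M z = norm (cr (1 / nr M d)) * nr M d"
     unfolding z_def by (rule l2_norm_scale)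
    then have "nr M z = 1" using nz by (simp add: norm_divide)
    then show ?thesis by (simp add: l2_inner_self)
   qed
   have zx: "inn M z x = 0" "inn M x z = 0" if "x : E" for x
   proof -
    have "inn M z x = cr (1 / nr M d) * inn M d x"
     unfolding z_def by (rule l2_inner_scale_left)
    then show "inn M z x = 0" using dx[OF that] by simp
    then show "inn M x z = 0" by (subst l2_inner_commute) simp
   qed
   have "z \<notin> E" using zz zx(1)[of z] by auto
   have "orthonormal M (insert z E) (%x. x)"
    using ON zL zz zx \<open>z \<notin> E\<close> by (auto simp: orthonormal_def)
   then have "insert z E = E" using eE by (intro max) auto
   then show False using \<open>z \<notin> E\<close> by blast
  qed
  then have "AE x in M. d x = 0"
   by (simp add: l2_norm_eq_0_iff[OF dL])
  then have "AE x in M. g x = f x"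
   unfolding d_def by eventually_elim simp
  from l2_has_sum_AE[OF g f this] show ?thesis by (intro exI[of _ ?c])
 qed
 have "l2_orthogonal_basis M E"
  unfolding l2_orthogonal_basis_def
  using EL orthonormal_norm[OF ON] orthonormal_inner[OF ON] complete by auto
 moreover have "l2_eigenfunction M P x" if x: "x : E" for x
 proof -
  have "\<exists>c. AE y in M. P x y = c * x y"
  proof (cases "x : e ` I")
   case True
   then obtain i where i: "i : I" "x = e i" by blast
   have "AE y in M. P x y = b i * x y"
    using P_eq[OF EL[OF x]] T_e[OF i(1)] unfolding i(2) by eventually_elim simp
   then show ?thesis by blast
  next
   case False
   have "inn M x (e i) = 0" if "i : I" for i
   proof -
    have "e i : E" "x ~= e i" using that eE False by auto
    then show ?thesis using orthonormal_inner[OF ON x, of "e i"] by simp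
   qed
   then have "AE y in M. T x y = 0"
    by (intro T_orthogonal EL x)
   then have "AE y in M. P x y = 0 * x y"
    using P_eq[OF EL[OF x]] by eventually_elim simp
   then show ?thesis by blast
  qed
  then show ?thesis
   unfolding l2_eigenfunction_def using EL[OF x] orthonormal_norm[OF ON x] by auto
 qed
 ultimately show ?thesis by blast
qed

end

section \<open>Adjoint and essential norm of an operator given by two orthonormal families\<close>

context diagonal
begin

lemma adjoint_bound: "diagonal M I v e (%i. cnj (a i)) C"
 by standard (auto intro: e v bound C)

lemma adjoint: "l2_adjoint M T (diagonal_op M I v e (%i. cnj (a i)))"
proof -
 interpret adj: diagonal M I v e "%i. cnj (a i)" C by (rule adjoint_bound)
 have "inn M (T f) g = inn M f (adj.T g)" if "f : L2 M" "g : L2 M" for f g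
 proof -
  have "((%i. cnj (cnj (a i) * inn M g (v i) * inn M (e i) f)) has_sum cnj (inn M (adj.T g) f)) I"
   using adj.T_inner[OF that(2,1)] by (rule has_sum_cnj_iff[THEN iffD2])
  moreover have "(%i. cnj (cnj (a i) * inn M g (v i) * inn M (e i) f)) =
    (%i. a i * inn M f (e i) * inn M (v i) g)"
  proof
   fix i
   show "cnj (cnj (a i) * inn M g (v i) * inn M (e i) f) = a i * inn M f (e i) * inn M (v i) g"
    using l2_inner_commute[of M "v i" g] l2_inner_commute[of M f "e i"] by (simp add: mult_ac)
  qed
  ultimately have "((%i. a i * inn M f (e i) * inn M (v i) g) has_sum inn M f (adj.T g)) I"
   using l2_inner_commute[of M f "adj.T g"] by simp
  then show ?thesis
   using T_inner[OF that] has_sum_unique by blast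
 qed
 then show ?thesis
  unfolding l2_adjoint_def using adj.bounded_T by blast
qed

text \<open>The family \<open>v\<close> cancels, since the adjoint carries \<open>v i\<close> back
  to \<open>e i\<close>; only the moduli of the coefficients survive.\<close>

lemma self_diagonal_adjoint:
 "self_diagonal M I e (%i. cr ((norm (a i))\<^sup>2)) (C\<^sup>2)
   (%f. diagonal_op M I v e (%i. cnj (a i)) (T f))"
proof -
 interpret adj: diagonal M I v e "%i. cnj (a i)" C by (rule adjoint_bound)
 interpret sq: diagonal M I e e "%i. cr ((norm (a i))\<^sup>2)" "C\<^sup>2"
  by standard (use e bound C in \<open>auto simp: power_mono norm_power\<close>)
 have eq: "AE x in M. sq.T f x = adj.T (T f) x" if f: "f : L2 M" for f
 proof (rule sq.T_eqI[OF f adj.T_L2[OF T_L2[OF f]]])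
  fix h assume h: "h : L2 M"
  have "((%i. cnj (a i) * inn M (T f) (v i) * inn M (e i) h) has_sum inn M (adj.T (T f)) h) I \<longleftrightarrow>
   ((%i. cr ((norm (a i))\<^sup>2) * inn M f (e i) * inn M (e i) h) has_sum inn M (adj.T (T f)) h) I"
   by (rule has_sum_cong) (simp only: T_inner_v[OF f] complex_norm_square mult_ac)
  then show "((%i. cr ((norm (a i))\<^sup>2) * inn M f (e i) * inn M (e i) h) has_sum inn M (adj.T (T f)) h) I"
   using adj.T_inner[OF T_L2[OF f] h] by simp
 qed
 have eq': "AE x in M. adj.T (T f) x = sq.T f x" if f: "f : L2 M" for f
  using eq[OF f] by eventually_elim simp
 show ?thesis
  by (intro self_diagonal.intro self_diagonal_axioms.intro sq.diagonal_axioms eq'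
    l2_bounded_op_cong[OF sq.bounded_T]) (auto intro: adj.T_L2 T_L2)
qed

text \<open>Removing the finitely many coefficients above \<open>La + ep\<close> is a perturbation
  of finite rank, which gives the upper bound. Conversely a compact \<open>K\<close> is negligible
  on suitable differences of the vectors \<open>e (q k)\<close>, while the operator stretches these
  by a factor tending to \<open>La\<close>.\<close>

lemma essential_norm_eq:
 fixes q :: "nat => 'i"
 assumes La: "La >= 0" and up: "!!ep. ep > 0 ==> finite {i\<in>I. norm (a i) > La + ep}"
  and q: "inj q" "range q \<subseteq> I" "(%k. norm (a (q k))) ---> La"
 shows "l2_essential_norm M T = La"
proof (rule antisym)
 let ?S = "{l2_op_norm M (%f x. T f x - K f x) | K. l2_compact_op M K}"
 have nonneg: "0 <= l2_op_norm M (%f x. T f x - K f x)" if K: "l2_compact_op M K" for K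
 proof -
  have "l2_bounded_op M (%f x. T f x + (-1) * K f x)"
   using K by (intro l2_bounded_op_combine bounded_T) (auto simp: l2_compact_op_def)
  then have "l2_bounded_op M (%f x. T f x - K f x)" by simp
  from l2_bounded_op_bound[OF this]
  obtain B where "B >= 0" "!!f. f : L2 M ==> nr M (%x. T f x - K f x) <= B * nr M f" by blast
  then show ?thesis
   unfolding l2_op_norm_def by (intro cInf_greatest) auto
 qed
 have bdd: "bdd_below ?S"
  by (rule bdd_belowI[of _ 0]) (use nonneg in auto)
 show "l2_essential_norm M T <= La"
 proof (rule field_le_epsilon)
  fix ep :: real assume ep: "ep > 0"
  define J where "J = {i\<in>I. norm (a i) > La + ep}"
  have J: "finite J" using up[OF ep] by (simp add: J_def)
  define a1 a2 where "a1 i = (if i : J then a i else 0)" and "a2 i = (if i : J then 0 else a i)" for i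
  interpret A1: diagonal M I e v a1 C
   by standard (use e v bound C in \<open>auto simp: a1_def\<close>)
  interpret A2: diagonal M I e v a2 "La + ep"
   by standard (use e v La ep in \<open>auto simp: a2_def J_def\<close>)
  have K: "l2_compact_op M A1.T"
   by (rule A1.compact_T) (rule finite_subset[OF _ J], auto simp: a1_def split: if_splits)
  have "nr M (%x. T f x - A1.T f x) <= (La + ep) * nr M f" if f: "f : L2 M" for f
  proof -
   have L: "(%x. T f x - A1.T f x) : L2 M" by (intro L2_diff T_L2 A1.T_L2 f)
   have "AE x in M. A2.T f x = T f x - A1.T f x"
   proof (rule A2.T_eqI[OF f L])
    fix h assume h: "h : L2 M"
    have "((%i. a i * inn M f (e i) * inn M (v i) h - a1 i * inn M f (e i) * inn M (v i) h)
     has_sum inn M (T f) h - inn M (A1.T f) h) I"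
     by (intro has_sum_minus T_inner A1.T_inner f h)
    moreover have "a i * inn M f (e i) * inn M (v i) h - a1 i * inn M f (e i) * inn M (v i) h
     = a2 i * inn M f (e i) * inn M (v i) h" for i
     by (simp add: a1_def a2_def)
    ultimately show "((%i. a2 i * inn M f (e i) * inn M (v i) h) has_sum inn M (%x. T f x - A1.T f x) h) I"
     using f h by (simp add: l2_inner_diff_left T_L2 A1.T_L2)
   qed
   then have "nr M (%x. T f x - A1.T f x) = nr M (A2.T f)"
    by (intro l2_norm_cong_AE[symmetric] L2_measurable L A2.T_L2 f)
   then show ?thesis using A2.T_bound[OF f] by simp
  qed
  then have "l2_op_norm M (%f x. T f x - A1.T f x) <= La + ep"
   unfolding l2_op_norm_def using La ep by (intro cInf_lower bdd_belowI[of _ 0]) auto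
  moreover have "l2_essential_norm M T <= l2_op_norm M (%f x. T f x - A1.T f x)"
   unfolding l2_essential_norm_def using K by (intro cInf_lower bdd) auto
  ultimately show "l2_essential_norm M T <= La + ep" by simp
 qed
 have lower: "La <= B" if K: "l2_compact_op M K" and B: "B >= 0"
  "!!f. f : L2 M ==> nr M (%x. T f x - K f x) <= B * nr M f" for K B
 proof -
  define u where "u k = e (q k)" for k
  have u: "orthonormal M UNIV u"
   unfolding u_def using q by (intro orthonormal_reindex[OF e]) auto
  have uL: "u k : L2 M" for k using orthonormal_L2[OF u] by simp
  have un: "nr M (u k) = 1" for k using orthonormal_norm[OF u] by simp
  have Kb: "l2_bounded_op M K" using K by (simp add: l2_compact_op_def)
  obtain r g where r: "strict_mono r" and g: "g : L2 M"
   and rg: "(%n. nr M (%x. K (u (r n)) x - g x)) ---> 0"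
   using K uL un unfolding l2_compact_op_def by force
  \<comment> \<open>Compactness makes \<open>K (u (r n))\<close> converge, but not to 0; on
    consecutive differences \<open>K\<close> does tend to 0.\<close>
  define w where "w n = (%x. u (r n) x - u (r (Suc n)) x)" for n
  have wL: "w n : L2 M" for n unfolding w_def by (intro L2_diff uL)
  have rn: "r n ~= r (Suc n)" for n using strict_monoD[OF r, of n "Suc n"] by simp
  have wn: "(nr M (w n))\<^sup>2 = 2" for n
   unfolding w_def using rn by (intro orthonormal_dist[OF u]) auto
  have Tw: "(nr M (T (w n)))\<^sup>2 = (norm (a (q (r n))))\<^sup>2 + (norm (a (q (r (Suc n)))))\<^sup>2" for n
   unfolding w_def u_def using q rn[of n] by (intro norm_T_diff_e) (auto dest: injD)
  have Kw: "(%n. nr M (K (w n))) ---> 0"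
  proof (rule tendsto_sandwich[OF _ _ tendsto_const tendsto_add_zero[OF rg LIMSEQ_Suc[OF rg]]])
   show "\<forall>\<^sub>F n in sequentially. nr M (K (w n)) \<le>
     nr M (%x. K (u (r n)) x - g x) + nr M (%x. K (u (r (Suc n))) x - g x)"
   proof (intro always_eventually allI)
    fix n
    have KL: "K (u k) : L2 M" for k by (intro l2_bounded_op_L2[OF Kb] uL)
    have "nr M (K (w n)) = nr M (%x. K (u (r n)) x - K (u (r (Suc n))) x)"
     using l2_bounded_op_diff[OF Kb uL[of "r n"] uL[of "r (Suc n)"]] unfolding w_def[symmetric]
     by (intro l2_norm_cong_AE L2_measurable L2_diff KL l2_bounded_op_L2[OF Kb wL])
    also have "... <= nr M (%x. K (u (r n)) x - g x) + nr M (%x. g x - K (u (r (Suc n))) x)"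
     by (intro l2_norm_diff_triangle KL g)
    finally show "nr M (K (w n)) \<le>
     nr M (%x. K (u (r n)) x - g x) + nr M (%x. K (u (r (Suc n))) x - g x)"
     by (simp only: l2_norm_minus_commute[of M g])
   qed
  qed simp
  have "nr M (T (w n)) <= B * sqrt 2 + nr M (K (w n))" for n
  proof -
   have "nr M (T (w n)) <= nr M (%x. T (w n) x - K (w n) x) + nr M (K (w n))"
    using l2_norm_triangle[OF L2_diff[OF T_L2[OF wL] l2_bounded_op_L2[OF Kb wL]] l2_bounded_op_L2[OF Kb wL], of n n n] by simp
   also have "nr M (%x. T (w n) x - K (w n) x) <= B * nr M (w n)"
    by (rule B(2)[OF wL])
   also have "nr M (w n) = sqrt 2"
    using wn[of n] by (metis abs_of_nonneg l2_norm_nonneg real_sqrt_abs)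
   finally show ?thesis by simp
  qed
  moreover have "(%n. nr M (T (w n))) ---> sqrt (La\<^sup>2 + La\<^sup>2)"
  proof -
   have lim: "(%n. norm (a (q (r n)))) ---> La"
    using LIMSEQ_subseq_LIMSEQ[OF q(3) r] by (simp add: o_def)
   have "(%n. sqrt ((norm (a (q (r n))))\<^sup>2 + (norm (a (q (r (Suc n)))))\<^sup>2)) ---> sqrt (La\<^sup>2 + La\<^sup>2)"
    by (intro tendsto_intros lim LIMSEQ_Suc[OF lim])
   moreover have "sqrt ((norm (a (q (r n))))\<^sup>2 + (norm (a (q (r (Suc n)))))\<^sup>2) = nr M (T (w n))" for n
    unfolding Tw[symmetric] by simp
   ultimately show ?thesis by simp
  qed
  moreover have "(%n. B * sqrt 2 + nr M (K (w n))) ---> B * sqrt 2 + 0"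
   by (intro tendsto_intros Kw)
  ultimately have "sqrt (La\<^sup>2 + La\<^sup>2) <= B * sqrt 2 + 0"
   by (intro LIMSEQ_le) auto
  moreover have "sqrt (La\<^sup>2 + La\<^sup>2) = La * sqrt 2"
   using La by (simp add: real_sqrt_mult flip: mult_2)
  ultimately show "La <= B" by simp
 qed
 show "La <= l2_essential_norm M T"
  unfolding l2_essential_norm_def
 proof (rule cInf_greatest)
  interpret Z: diagonal M I e v "%_. 0" 0 by standard (use e v in auto)
  have "l2_compact_op M Z.T" by (rule Z.compact_T) simp
  then show "?S ~= {}" by blast
  fix y assume "y : ?S"
  then obtain K where K: "l2_compact_op M K" and y: "y = l2_op_norm M (%f x. T f x - K f x)" by blast
  have "l2_bounded_op M (%f x. T f x + (-1) * K f x)"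
   using K by (intro l2_bounded_op_combine bounded_T) (auto simp: l2_compact_op_def)
  then have "l2_bounded_op M (%f x. T f x - K f x)" by simp
  from l2_bounded_op_bound[OF this]
  obtain B where "B >= 0" "!!f. f : L2 M ==> nr M (%x. T f x - K f x) <= B * nr M f" by blast
  then show "La <= y"
   unfolding y l2_op_norm_def by (intro cInf_greatest lower[OF K]) auto
 qed
qed

end

section \<open>Laplace integrals with the binary relative entropy\<close>

text \<open>The logarithms are kept apart so that at \<open>sg = 0\<close> and \<open>sg = 1\<close>
  the singular ones are multiplied by 0 and the formula gives the correct limit.\<close>

definition kl :: "real => real => real" where
 "kl sg s = sg * ln sg - sg * ln s + (1 - sg) * ln (1 - sg) - (1 - sg) * ln (1 - s)"

lemma kl_self [simp]: "kl sg sg = 0"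
 by (simp add: kl_def)

lemma DERIV_kl:
 assumes "0 < s" "s < 1"
 shows "(kl sg has_real_derivative (s - sg) / (s * (1 - s))) (at s)"
proof -
 have "((%s. sg * ln sg - sg * ln s + (1 - sg) * ln (1 - sg) - (1 - sg) * ln (1 - s)) has_real_derivative
   (- sg * (1 / s) - (1 - sg) * (- 1 / (1 - s)))) (at s)"
  by (rule derivative_eq_intros refl | use assms in simp)+
 moreover have "- sg * (1 / s) - (1 - sg) * (- 1 / (1 - s)) = (s - sg) / (s * (1 - s))"
  using assms by (simp add: field_simps)
 ultimately show ?thesis
  unfolding kl_def[abs_def] by simp
qed

text \<open>The minimum point \<open>sg\<close> may be an end point of the interval; an end point
  different from \<open>sg\<close> is a singularity and has to be left out.\<close>

lemma continuous_on_kl: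
 assumes "0 <= sg" "sg <= 1"
 shows "continuous_on ({0<..<1} \<union> {sg}) (kl sg)"
proof -
 consider "sg = 0" | "sg = 1" | "0 < sg" "sg < 1"
  using assms by linarith
 then show ?thesis
 proof cases
  case 1
  then show ?thesis
   unfolding kl_def[abs_def] by (auto intro!: continuous_intros)
 next
  case 2
  then show ?thesis
   unfolding kl_def[abs_def] by (auto intro!: continuous_intros)
 next
  case 3
  then show ?thesis
   unfolding kl_def[abs_def] by (auto intro!: continuous_intros)
 qed
qed

text \<open>The sign condition makes \<open>f\<close> decrease to the left of \<open>sg\<close> and
  increase to the right. It is demanded only at points no farther from \<open>sg\<close> than
  \<open>s\<close>, so that bounds valid near \<open>sg\<close> can be used. All comparisons of
  phases are brought into this form.\<close>

lemma le_by_deriv_sign: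
 fixes f f' :: "real => real"
 assumes sg: "0 <= sg" "sg <= 1" and s: "0 < s" "s < 1"
  and cont: "continuous_on ({0<..<1} \<union> {sg}) f"
  and deriv: "!!u. 0 < u ==> u < 1 ==> (f has_real_derivative f' u) (at u)"
  and sign: "!!u. 0 < u ==> u < 1 ==> \<bar>u - sg\<bar> <= \<bar>s - sg\<bar> ==> 0 <= f' u * (u - sg)"
 shows "f sg <= f s"
proof (cases "sg <= s")
 case True
 show ?thesis
 proof (rule DERIV_nonneg_imp_increasing_open[OF True])
  fix x assume x: "sg < x" "x < s"
  then have "0 <= f' x * (x - sg)"
   using sg s by (intro sign) auto
  then show "\<exists>y. DERIV f x :> y & y >= 0"
   using deriv[of x] x s sg by (intro exI[of _ "f' x"]) (auto simp: zero_le_mult_iff)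
 next
  show "continuous_on {sg..s} f"
   using sg s by (intro continuous_on_subset[OF cont]) auto
 qed
next
 case False
 then have le: "s <= sg" by simp
 show ?thesis
 proof (rule DERIV_nonpos_imp_decreasing_open[OF le])
  fix x assume x: "s < x" "x < sg"
  then have "0 <= f' x * (x - sg)"
   using sg s by (intro sign) auto
  then show "\<exists>y. DERIV f x :> y & y <= 0"
   using deriv[of x] x s sg by (intro exI[of _ "f' x"]) (auto simp: zero_le_mult_iff)
 next
  show "continuous_on {s..sg} f"
   using sg s by (intro continuous_on_subset[OF cont]) auto
 qed
qed

text \<open>The derivative of \<open>kl sg\<close> is \<open>u - sg\<close> times the weight
  \<open>1 / (u * (1 - u))\<close>, so a bound for the weight integrates to a quadratic
  bound.\<close>

lemma kl_lower:
 assumes "0 <= sg" "sg <= 1" "0 < s" "s < 1"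
  and "!!u. 0 < u ==> u < 1 ==> \<bar>u - sg\<bar> <= \<bar>s - sg\<bar> ==> 2 * c <= 1 / (u * (1 - u))"
 shows "c * (s - sg)\<^sup>2 <= kl sg s"
proof -
 have "kl sg sg - c * (sg - sg)\<^sup>2 <= kl sg s - c * (s - sg)\<^sup>2"
 proof (rule le_by_deriv_sign[where f = "%s. kl sg s - c * (s - sg)\<^sup>2" and f' = "%u. (u - sg) / (u * (1 - u)) - c * (2 * (u - sg))"])
  show "continuous_on ({0<..<1} \<union> {sg}) (%s. kl sg s - c * (s - sg)\<^sup>2)"
   using assms by (intro continuous_intros continuous_on_kl)
  fix u :: real assume u: "0 < u" "u < 1"
  show "((%s. kl sg s - c * (s - sg)\<^sup>2) has_real_derivative (u - sg) / (u * (1 - u)) - c * (2 * (u - sg))) (at u)"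
   using u by (auto intro!: derivative_eq_intros DERIV_kl)
  assume "\<bar>u - sg\<bar> <= \<bar>s - sg\<bar>"
  then have "0 <= (1 / (u * (1 - u)) - 2 * c) * (u - sg)\<^sup>2"
   using assms(5)[OF u] by (intro mult_nonneg_nonneg) auto
  also have "(1 / P - 2 * c) * d\<^sup>2 = (d / P - c * (2 * d)) * d" for P d :: real
   by (simp add: algebra_simps power2_eq_square)
  finally show "0 <= ((u - sg) / (u * (1 - u)) - c * (2 * (u - sg))) * (u - sg)" .
 qed (use assms in auto)
 then show ?thesis by simp
qed

lemma kl_upper:
 assumes "0 <= sg" "sg <= 1" "0 < s" "s < 1"
  and "!!u. 0 < u ==> u < 1 ==> \<bar>u - sg\<bar> <= \<bar>s - sg\<bar> ==> 1 / (u * (1 - u)) <= 2 * c"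
 shows "kl sg s <= c * (s - sg)\<^sup>2"
proof -
 have "c * (sg - sg)\<^sup>2 - kl sg sg <= c * (s - sg)\<^sup>2 - kl sg s"
 proof (rule le_by_deriv_sign[where f = "%s. c * (s - sg)\<^sup>2 - kl sg s" and f' = "%u. c * (2 * (u - sg)) - (u - sg) / (u * (1 - u))"])
  show "continuous_on ({0<..<1} \<union> {sg}) (%s. c * (s - sg)\<^sup>2 - kl sg s)"
   using assms by (intro continuous_intros continuous_on_kl)
  fix u :: real assume u: "0 < u" "u < 1"
  show "((%s. c * (s - sg)\<^sup>2 - kl sg s) has_real_derivative c * (2 * (u - sg)) - (u - sg) / (u * (1 - u))) (at u)"
   using u by (auto intro!: derivative_eq_intros DERIV_kl)
  assume "\<bar>u - sg\<bar> <= \<bar>s - sg\<bar>"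
  then have "0 <= (2 * c - 1 / (u * (1 - u))) * (u - sg)\<^sup>2"
   using assms(5)[OF u] by (intro mult_nonneg_nonneg) auto
  also have "(2 * c - 1 / P) * d\<^sup>2 = (c * (2 * d) - d / P) * d" for P d :: real
   by (simp add: algebra_simps power2_eq_square)
  finally show "0 <= (c * (2 * (u - sg)) - (u - sg) / (u * (1 - u))) * (u - sg)" .
 qed (use assms in auto)
 then show ?thesis by simp
qed

lemma four_le_inverse:
 assumes "0 < u" "u < (1::real)"
 shows "4 <= 1 / (u * (1 - u))"
proof -
 have "0 <= (2 * u - 1)\<^sup>2" by simp
 then have "4 * (u * (1 - u)) <= 1"
  by (simp add: power2_eq_square algebra_simps)
 then show ?thesis
  using assms by (simp add: le_divide_eq)
qed

lemma kl_Pinsker: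
 assumes "0 <= sg" "sg <= 1" "0 < s" "s < 1"
 shows "2 * (s - sg)\<^sup>2 <= kl sg s"
 by (rule kl_lower) (use assms four_le_inverse in auto)

lemma kl_nonneg:
 assumes "0 <= sg" "sg <= 1" "0 < s" "s < 1"
 shows "0 <= kl sg s"
 using kl_Pinsker[OF assms] by (rule order_trans[rotated]) simp

lemma contraction_in_unit:
 assumes "0 < s" "s < 1" "0 <= sg" "sg <= 1" "0 < ta" "ta <= (1::real)"
 shows "0 < sg + ta * (s - sg)" "sg + ta * (s - sg) < 1"
proof -
 have "sg + ta * (s - sg) = (1 - ta) * sg + ta * s"
  by (simp add: algebra_simps)
 moreover have "0 < ta * s" "0 <= (1 - ta) * sg" "(1 - ta) * sg <= (1 - ta)" "ta * s < ta"
  using assms by (auto simp: mult_left_le)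
 ultimately show "0 < sg + ta * (s - sg)" "sg + ta * (s - sg) < 1"
  by linarith+
qed

text \<open>Convexity of \<open>kl sg\<close> along the segment that ends at its zero
  \<open>sg\<close>. The comparison of derivatives treats end points and interior points
  \<open>sg\<close> alike.\<close>

lemma kl_contraction:
 assumes sg: "0 <= sg" "sg <= 1" and s: "0 < s" "s < 1" and ta: "0 < ta" "ta <= 1"
 shows "kl sg (sg + ta * (s - sg)) <= ta * kl sg s"
proof -
 let ?w = "%u. sg + ta * (u - sg)"
 have "ta * kl sg sg - kl sg (?w sg) <= ta * kl sg s - kl sg (?w s)"
 proof (rule le_by_deriv_sign[where f = "%u. ta * kl sg u - kl sg (?w u)" and f' = "%u. ta * ((u - sg) / (u * (1 - u))) - (?w u - sg) / (?w u * (1 - ?w u)) * ta"])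
  have "continuous_on ({0<..<1} \<union> {sg}) (%u. kl sg (?w u))"
   using contraction_in_unit sg ta
   by (intro continuous_on_compose2[OF continuous_on_kl[OF sg]] continuous_intros) auto
  then show "continuous_on ({0<..<1} \<union> {sg}) (%u. ta * kl sg u - kl sg (?w u))"
   by (intro continuous_intros continuous_on_kl sg)
  fix u :: real assume u: "0 < u" "u < 1"
  note w = contraction_in_unit[OF u sg ta]
  have "(?w has_real_derivative ta) (at u)"
   by (auto intro!: derivative_eq_intros)
  from DERIV_chain2[OF DERIV_kl[OF w] this]
  show "((%u. ta * kl sg u - kl sg (?w u)) has_real_derivative
    ta * ((u - sg) / (u * (1 - u))) - (?w u - sg) / (?w u * (1 - ?w u)) * ta) (at u)"
   using u by (intro DERIV_diff DERIV_cmult DERIV_kl)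
  \<comment> \<open>The exact defect in the concavity of x (1 - x).\<close>
  have "?w u * (1 - ?w u) - ta * (u * (1 - u)) = (1 - ta) * (sg * (1 - sg)) + ta * (1 - ta) * (u - sg)\<^sup>2"
   by (simp add: algebra_simps power2_eq_square)
  also have "... >= 0"
   using sg ta by (intro add_nonneg_nonneg mult_nonneg_nonneg) auto
  finally have "ta * (u * (1 - u)) <= ?w u * (1 - ?w u)" by simp
  then have "ta / (?w u * (1 - ?w u)) <= 1 / (u * (1 - u))"
   using u w by (simp add: divide_simps mult_ac)
  then have "0 <= ta * (1 / (u * (1 - u)) - ta / (?w u * (1 - ?w u))) * (u - sg)\<^sup>2"
   using ta by (intro mult_nonneg_nonneg) auto
  also have "... = (ta * ((u - sg) / (u * (1 - u))) - (?w u - sg) / (?w u * (1 - ?w u)) * ta) * (u - sg)"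
  proof -
   have "ta * (1 / P - ta / Q) * d\<^sup>2 = (ta * (d / P) - (ta * d) / Q * ta) * d" for P Q d :: real
    by (simp add: algebra_simps power2_eq_square)
   then show ?thesis by simp
  qed
  finally show "0 <= (ta * ((u - sg) / (u * (1 - u))) - (?w u - sg) / (?w u * (1 - ?w u)) * ta) * (u - sg)" .
 qed (use assms in auto)
 then show ?thesis by simp
qed

section \<open>The reference integral and its asymptotics\<close>

lemma set_integrable_unit_interval:
 fixes f :: "real => real"
 assumes "continuous_on {0<..<1} f" "!!x. 0 < x ==> x < 1 ==> \<bar>f x\<bar> <= B"
 shows "set_integrable lborel {0<..<1} f"
proof -
 have meas: "(%x. indicator {0<..<1} x *\<^sub>R f x) : bm lborel"
  using borel_measurable_continuous_on_indicator[OF _ assms(1)] by simp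
 have int: "integrable lborel (%x. indicator {0<..<1::real} x * B)"
  by (intro integrable_mult_left integrable_real_indicator) auto
 have "norm (indicator {0<..<1} x *\<^sub>R f x) <= norm (indicator {0<..<1::real} x * B)" for x
  using assms(2)[of x] by (cases "x : {0<..<1}") auto
 then show ?thesis
  unfolding set_integrable_def
  by (intro Bochner_Integration.integrable_bound[OF int meas] AE_I2)
qed

lemma set_integral_unit_mono:
 fixes f g :: "real => real"
 assumes "set_integrable lborel {0<..<1} f" "set_integrable lborel {0<..<1} g"
  and "!!x. 0 < x ==> x < 1 ==> f x <= g x"
 shows "(LBINT s:{0<..<1}. f s) <= (LBINT s:{0<..<1}. g s)"
 using assms by (intro set_integral_mono) auto

lemma set_integral_unit_const: "(LBINT s:{0<..<1::real}. (c::real)) = c"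
 by (simp add: set_lebesgue_integral_def)

text \<open>For \<open>x = n + m\<close> and \<open>sg = n / x\<close> this is the Beta integral of
  \<open>s ^ n * (1 - s) ^ m\<close> divided by the maximum of its integrand. It is the yardstick by
  which the other Laplace integrals are measured.\<close>

definition lapl :: "real => real => real" where
 "lapl x sg = (LBINT s:{0<..<1}. exp (- x * kl sg s))"

lemma lapl_integrable:
 assumes "0 <= sg" "sg <= 1" "0 <= x"
 shows "set_integrable lborel {0<..<1} (%s. exp (- x * kl sg s))"
 using assms
 by (intro set_integrable_unit_interval[where B = 1] continuous_intros
    continuous_on_subset[OF continuous_on_kl[OF assms(1,2)]]) (auto intro: kl_nonneg mult_nonneg_nonneg)

text \<open>The contraction towards \<open>sg\<close> by the factor \<open>ta = x / y\<close> maps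
  the unit interval into itself, and by \<open>kl_contraction\<close> the exponent for
  \<open>y\<close> at the image is no worse than the exponent for \<open>x\<close>. The Jacobian
  \<open>ta\<close> is the only loss.\<close>

lemma lapl_contraction:
 assumes sg: "0 <= sg" "sg <= 1" and xy: "0 < x" "x <= y"
 shows "x * lapl x sg <= y * lapl y sg"
proof -
 define ta where "ta = x / y"
 have ta: "0 < ta" "ta <= 1" and y: "y > 0"
  using xy by (auto simp: ta_def divide_le_eq)
 let ?w = "%u. (sg - ta * sg) + ta * u"
 have w_eq: "?w u = sg + ta * (u - sg)" for u
  by (simp add: algebra_simps)
 let ?g = "%s. indicator {0<..<1} s * exp (- y * kl sg s)"
 have g: "integrable lborel ?g"
  using lapl_integrable[OF sg, of y] y by (simp add: set_integrable_def)
 have "lapl x sg <= (\<integral>u. ?g (?w u) \<partial>lborel)"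
  unfolding lapl_def set_lebesgue_integral_def
 proof (rule integral_mono)
  show "integrable lborel (%u. indicator {0<..<1} u *\<^sub>R exp (- x * kl sg u))"
   using lapl_integrable[OF sg, of x] xy by (simp add: set_integrable_def)
  show "integrable lborel (%u. ?g (?w u))"
   using ta by (intro lborel_integrable_real_affine g) auto
  fix u :: real
  show "indicator {0<..<1} u *\<^sub>R exp (- x * kl sg u) <= ?g (?w u)"
  proof (cases "u : {0<..<1}")
   case True
   have "y * kl sg (?w u) <= y * (ta * kl sg u)"
    unfolding w_eq using True sg ta y by (intro mult_left_mono kl_contraction) auto
   also have "... = x * kl sg u"
    using y by (simp add: ta_def)
   finally show ?thesis
    using True contraction_in_unit[of u sg ta] sg ta unfolding w_eq by simp
  qed simp
 qed
 moreover have "lapl y sg = ta * (\<integral>u. ?g (?w u) \<partial>lborel)"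
  using lborel_integral_real_affine[of ta ?g "sg - ta * sg"] ta
  by (simp add: lapl_def set_lebesgue_integral_def)
 ultimately have "ta * lapl x sg <= lapl y sg"
  using ta by (simp add: mult_left_mono)
 then show ?thesis
  using y by (simp add: ta_def field_simps)
qed

text \<open>By the contraction inequality only \<open>x = 1\<close> has to be estimated, and between
  1/4 and 3/4 the divergence is at most \<open>ln 4\<close>. The rate \<open>1 / x\<close> is the
  true one at the end points; it suffices against exponentially small tails.\<close>

lemma lapl_ge:
 assumes sg: "0 <= sg" "sg <= 1" and x: "1 <= x"
 shows "1 / (8 * x) <= lapl x sg"
proof -
 have neg: "a * ln a <= 0" if "0 <= a" "a <= 1" for a :: real
  using that mult_nonneg_nonpos[of a "ln a"] by (cases "a = 0") simp_all
 have "indicator {1/4<..<3/4} s * (1/4) <= exp (- 1 * kl sg s)" for s :: real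
 proof (cases "s : {1/4<..<3/4}")
  case True
  have "ln (1/4) <= ln s" "ln (1/4) <= ln (1 - s)"
   using True by (auto simp del: ln_div)
  then have "- ln s <= ln 4" "- ln (1 - s) <= ln 4"
   by (auto simp: ln_div)
  then have "sg * - ln s <= sg * ln 4" "(1 - sg) * - ln (1 - s) <= (1 - sg) * ln 4"
   using sg mult_left_mono[of "- ln s" "ln 4" sg] mult_left_mono[of "- ln (1 - s)" "ln 4" "1 - sg"]
   by simp_all
  moreover have "sg * ln 4 + (1 - sg) * ln 4 = ln (4::real)"
   by (simp add: algebra_simps)
  ultimately have "kl sg s <= ln 4"
   using neg[of sg] neg[of "1 - sg"] sg unfolding kl_def by simp
  then have "exp (- ln 4) <= exp (- 1 * kl sg s)"
   by simp
  then show ?thesis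
   using True by (simp add: exp_minus)
 qed simp
 note pw = this
 have eqf: "indicator {0<..<1} s *\<^sub>R (indicator {1/4<..<3/4} s * (1/4)) = indicator {1/4<..<3/4} s * (1/4::real)"
  for s :: real
  by (auto simp: indicator_def)
 have "emeasure lborel {1/4<..<3/4::real} = ennreal (3/4 - 1/4)"
  by (rule emeasure_lborel_Ioo) simp
 then have fin: "emeasure lborel {1/4<..<3/4::real} < \<infinity>"
  by (simp only: infinity_ennreal_def ennreal_less_top)
 have "1 / 8 = (\<integral>s. indicator {1/4<..<3/4::real} s * (1/4::real) \<partial>lborel)"
  by simp
 also have "... = (LBINT s:{0<..<1::real}. indicator {1/4<..<3/4} s * (1/4))"
  unfolding set_lebesgue_integral_def eqf ..
 also have "... <= lapl 1 sg"
  unfolding lapl_def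
 proof (rule set_integral_unit_mono[OF _ lapl_integrable[OF sg] pw])
  show "set_integrable lborel {0<..<1::real} (%s. indicator {1/4<..<3/4} s * (1/4::real))"
   unfolding set_integrable_def eqf
   by (intro integrable_mult_left integrable_real_indicator fin) simp
 qed simp
 finally have "1/8 <= lapl 1 sg" .
 also have "... <= x * lapl x sg"
  using lapl_contraction[OF sg, of 1 x] x by simp
 finally show ?thesis
  using x by (simp add: field_simps)
qed

lemma lapl_pos:
 assumes "0 <= sg" "sg <= 1" "1 <= x"
 shows "0 < lapl x sg"
 using lapl_ge[OF assms] assms by (smt (verit) divide_pos_pos)

lemma inverse_near:
 fixes w0 ep :: real
 assumes "0 < w0" "w0 < 1" "0 < ep"
 shows "\<exists>d>0. \<forall>u. \<bar>u - w0\<bar> < d --> \<bar>1 / (u * (1 - u)) - 1 / (w0 * (1 - w0))\<bar> < ep"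
proof -
 have "isCont (%u. 1 / (u * (1 - u))) w0"
  using assms by (intro continuous_intros) auto
 then show ?thesis
  using assms(3) unfolding continuous_at_eps_delta dist_real_def by blast
qed

text \<open>On the scale \<open>1 / sqrt x\<close> the weight \<open>1 / (w * (1 - w))\<close> is
  nearly its value at \<open>sg0\<close>, so the lower and the upper quadratic bound for
  \<open>kl\<close> coincide in the limit.\<close>

lemma kl_rescaled_tendsto:
 fixes x sg :: "nat => real"
 assumes sg: "!!k. 0 <= sg k" "!!k. sg k <= 1" "sg ---> sg0" "0 < sg0" "sg0 < 1"
  and x: "filterlim x at_top sequentially"
 shows "(%k. x k * kl (sg k) (sg k + u / sqrt (x k))) ---> u\<^sup>2 / (2 * (sg0 * (1 - sg0)))"
  and "eventually (%k. sg k + u / sqrt (x k) : {0<..<1}) sequentially"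
proof -
 have sq: "filterlim (%k. sqrt (x k)) at_top sequentially"
  using filterlim_compose[OF sqrt_at_top x] .
 have "(%k. u / sqrt (x k)) ---> 0"
  by (rule real_tendsto_divide_at_top[OF tendsto_const sq])
 then have s: "(%k. sg k + u / sqrt (x k)) ---> sg0"
  using tendsto_add[OF sg(3)] by fastforce
 show ev01: "eventually (%k. sg k + u / sqrt (x k) : {0<..<1}) sequentially"
  using order_tendstoD[OF s] sg(4,5) by (auto simp: eventually_conj_iff)
 have x0: "eventually (%k. x k > 0) sequentially"
  using x by (simp add: filterlim_at_top_dense)
 define v where "v = 1 / (sg0 * (1 - sg0))"
 show "(%k. x k * kl (sg k) (sg k + u / sqrt (x k))) ---> u\<^sup>2 / (2 * (sg0 * (1 - sg0)))"
 proof (rule tendstoI)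
  fix r :: real assume r: "r > 0"
  define ep where "ep = r / (u\<^sup>2 + 1)"
  have u1: "0 < u\<^sup>2 + 1"
   by (simp add: add_nonneg_pos)
  have ep: "ep > 0" "ep * u\<^sup>2 < r"
  proof -
   show "ep > 0" using r u1 by (simp add: ep_def)
   have "r * u\<^sup>2 < r * (u\<^sup>2 + 1)" using r by simp
   then show "ep * u\<^sup>2 < r" using u1 by (simp add: ep_def divide_less_eq)
  qed
  obtain d where d: "d > 0" "!!u. \<bar>u - sg0\<bar> < d ==> \<bar>1 / (u * (1 - u)) - v\<bar> < ep"
   using inverse_near[OF sg(4,5) ep(1)] unfolding v_def by blast
  have "eventually (%k. \<bar>sg k - sg0\<bar> < d / 3) sequentially"
   using tendstoD[OF sg(3), of "d/3"] d by (simp add: dist_real_def)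
  moreover have "eventually (%k. \<bar>sg k + u / sqrt (x k) - sg0\<bar> < d / 3) sequentially"
   using tendstoD[OF s, of "d/3"] d by (simp add: dist_real_def)
  ultimately show "eventually (%k. dist (x k * kl (sg k) (sg k + u / sqrt (x k))) (u\<^sup>2 / (2 * (sg0 * (1 - sg0)))) < r) sequentially"
   using ev01 x0
  proof eventually_elim
   case (elim k)
   let ?s = "sg k + u / sqrt (x k)"
   have near: "\<bar>1 / (w * (1 - w)) - v\<bar> < ep" if "\<bar>w - sg k\<bar> <= \<bar>?s - sg k\<bar>" for w
    using that elim d(1) by (intro d(2)) linarith
   have lo: "(v - ep) / 2 * (?s - sg k)\<^sup>2 <= kl (sg k) ?s"
    using elim sg(1,2) near by (intro kl_lower) (auto simp: abs_less_iff, fastforce?)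
   have hi: "kl (sg k) ?s <= (v + ep) / 2 * (?s - sg k)\<^sup>2"
    using elim sg(1,2) near by (intro kl_upper) (auto simp: abs_less_iff, fastforce?)
   have sq: "x k * (c * (?s - sg k)\<^sup>2) = c * u\<^sup>2" for c
    using elim by (simp add: power_divide)
   have "(v - ep) / 2 * u\<^sup>2 <= x k * kl (sg k) ?s"
    using mult_left_mono[OF lo, of "x k"] elim unfolding sq by simp
   moreover have "x k * kl (sg k) ?s <= (v + ep) / 2 * u\<^sup>2"
    using mult_left_mono[OF hi, of "x k"] elim unfolding sq by simp
   ultimately have "\<bar>x k * kl (sg k) ?s - v / 2 * u\<^sup>2\<bar> <= ep * u\<^sup>2 / 2"
    by (simp add: abs_le_iff field_simps)
   also have "... < r"
    using ep r by (smt (verit) field_sum_of_halves)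
   finally show ?case
    by (simp add: dist_real_def v_def mult_ac)
  qed
 qed
qed

text \<open>After the substitution \<open>s = sg k + u / sqrt (x k)\<close> Pinsker's inequality
  gives a majorant independent of \<open>k\<close>, and dominated convergence leads to a Gaussian
  integral of variance \<open>sg0 * (1 - sg0)\<close>.\<close>

lemma lapl_tendsto:
 fixes x sg :: "nat => real"
 assumes sg: "!!k. 0 <= sg k" "!!k. sg k <= 1" "sg ---> sg0" "0 < sg0" "sg0 < 1"
  and x: "filterlim x at_top sequentially" "!!k. x k > 0"
 shows "(%k. sqrt (x k) * lapl (x k) (sg k)) ---> sqrt (2 * pi * (sg0 * (1 - sg0)))"
proof -
 define v where "v = sg0 * (1 - sg0)"
 have v: "v > 0" using sg by (simp add: v_def)
 let ?f = "%k u. indicator {0<..<1} (sg k + u / sqrt (x k)) * exp (- x k * kl (sg k) (sg k + u / sqrt (x k)))"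
 let ?g = "%k s. indicator {0<..<1} s * exp (- x k * kl (sg k) s)"
 have g: "integrable lborel (?g k)" for k
  using lapl_integrable[OF sg(1)[of k] sg(2)[of k], of "x k"] x(2)[of k] by (simp add: set_integrable_def)
 have eq: "lapl (x k) (sg k) = (1 / sqrt (x k)) * (\<integral>u. ?f k u \<partial>lborel)" for k
  using lborel_integral_real_affine[of "1 / sqrt (x k)" "?g k" "sg k"] x(2)[of k]
  by (simp add: lapl_def set_lebesgue_integral_def)
 have "(%k. \<integral>u. ?f k u \<partial>lborel) ---> (\<integral>u. exp (- (u\<^sup>2 / (2 * v))) \<partial>lborel)"
 \<comment> \<open>The majorant is exp(-2 u^2), written as a multiple of the normal density of
   standard deviation 1/2.\<close>
 proof (rule integral_dominated_convergence[where w = "%u. sqrt (2 * pi * (1/2)\<^sup>2) * normal_density 0 (1/2) u"])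
  show "(%u. exp (- (u\<^sup>2 / (2 * v)))) : bm lborel"
   by measurable
  show "?f k : bm lborel" for k
   using lborel_integrable_real_affine[OF g[of k], of "1 / sqrt (x k)" "sg k"] x(2)[of k]
   by (simp add: borel_measurable_integrable)
  show "integrable lborel (%u. sqrt (2 * pi * (1/2)\<^sup>2) * normal_density 0 (1/2) u)"
   by (intro integrable_mult_right) auto
  show "AE u in lborel. (%k. ?f k u) ---> exp (- (u\<^sup>2 / (2 * v)))"
  proof (rule AE_I2)
   fix u
   have "(%k. exp (- x k * kl (sg k) (sg k + u / sqrt (x k)))) ---> exp (- (u\<^sup>2 / (2 * v)))"
    using tendsto_exp[OF tendsto_minus[OF kl_rescaled_tendsto(1)[OF sg x(1), of u]]] by (simp add: v_def)
   moreover have "eventually (%k. exp (- x k * kl (sg k) (sg k + u / sqrt (x k))) = ?f k u) sequentially"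
    using kl_rescaled_tendsto(2)[OF sg x(1), of u] by eventually_elim simp
   ultimately show "(%k. ?f k u) ---> exp (- (u\<^sup>2 / (2 * v)))"
    by (rule Lim_transform_eventually)
  qed
  show "AE u in lborel. norm (?f k u) <= sqrt (2 * pi * (1/2)\<^sup>2) * normal_density 0 (1/2) u" for k
  proof (rule AE_I2)
   fix u
   have "?f k u <= exp (- 2 * u\<^sup>2)"
   proof (cases "sg k + u / sqrt (x k) : {0<..<1}")
    case True
    then have "2 * (sg k + u / sqrt (x k) - sg k)\<^sup>2 <= kl (sg k) (sg k + u / sqrt (x k))"
     using sg by (intro kl_Pinsker) auto
    then have "2 * u\<^sup>2 <= x k * kl (sg k) (sg k + u / sqrt (x k))"
     using x(2)[of k] by (simp add: power_divide field_simps)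
    then show ?thesis
     using True by simp
   qed simp
   also have "... = sqrt (2 * pi * (1/2)\<^sup>2) * normal_density 0 (1/2) u"
    by (simp add: normal_density_def power2_eq_square)
   finally show "norm (?f k u) <= sqrt (2 * pi * (1/2)\<^sup>2) * normal_density 0 (1/2) u"
    by simp
  qed
 qed
 moreover have "(\<integral>u. exp (- (u\<^sup>2 / (2 * v))) \<partial>lborel) = sqrt (2 * pi * v)"
 proof -
  have "exp (- (u\<^sup>2 / (2 * v))) = sqrt (2 * pi * v) * normal_density 0 (sqrt v) u" for u
   using v by (simp add: normal_density_def)
  then show ?thesis
   using v by simp
 qed
 ultimately show ?thesis
  using x(2) by (simp add: eq v_def less_imp_neq[symmetric])
qed

text \<open>At the end points no Laplace asymptotics is needed: there \<open>ka\<^sub>0 = 1\<close> and the contraction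
 inequality suffices.\<close>

lemma lapl_ratio:
 fixes x sg :: "nat => real"
 assumes sg: "!!k. 0 <= sg k" "!!k. sg k <= 1" "sg ---> sg0"
  and x: "filterlim x at_top sequentially" "!!k. x k >= 1"
  and ka0: "0 < ka0" "(0 < sg0 & sg0 < 1) \<or> ka0 = 1" and et: "0 < et"
 shows "\<exists>e0>0. e0 < ka0 & (\<forall>e. 0 < e --> e < e0 --> (\<forall>\<^sub>F k in sequentially.
   lapl ((ka0 - e) * x k) (sg k) <= (1 / sqrt ka0 + et) * lapl (x k) (sg k) \<and>
   (1 / sqrt ka0 - et) * lapl (x k) (sg k) <= lapl ((ka0 + e) * x k) (sg k)))"
 using ka0(2)
proof
 assume sg0: "0 < sg0 & sg0 < 1"
 have Lpos: "lapl (x k) (sg k) > 0" for k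
  by (intro lapl_pos sg x)
 have lim: "(%k. lapl (ta * x k) (sg k) / lapl (x k) (sg k)) ---> 1 / sqrt ta" if ta: "ta > 0" for ta
 proof -
  have x0: "x k > 0" for k using x(2)[of k] by linarith
  have xt: "filterlim (%k. ta * x k) at_top sequentially"
   using ta x(1) by (intro filterlim_tendsto_pos_mult_at_top[OF tendsto_const])
  have "(%k. (sqrt (ta * x k) * lapl (ta * x k) (sg k)) / (sqrt (x k) * lapl (x k) (sg k)) / sqrt ta)
    ---> sqrt (2 * pi * (sg0 * (1 - sg0))) / sqrt (2 * pi * (sg0 * (1 - sg0))) / sqrt ta"
   using sg0 ta x0 by (intro tendsto_divide lapl_tendsto[OF sg] tendsto_const xt x) auto
  moreover have "(sqrt (ta * x k) * lapl (ta * x k) (sg k)) / (sqrt (x k) * lapl (x k) (sg k)) / sqrt ta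
    = lapl (ta * x k) (sg k) / lapl (x k) (sg k)" for k
   using ta x0[of k] by (simp add: real_sqrt_mult)
  ultimately show ?thesis
   using sg0 by simp
 qed
 have "((%e. 1 / sqrt (ka0 - e)) \<longlongrightarrow> 1 / sqrt (ka0 - 0)) (at_right 0)"
  using ka0 by (intro tendsto_intros) auto
 then have 1: "\<forall>\<^sub>F e in at_right 0. 1 / sqrt (ka0 - e) < 1 / sqrt ka0 + et"
  using et by (intro order_tendstoD(2)) auto
 have "((%e. 1 / sqrt (ka0 + e)) \<longlongrightarrow> 1 / sqrt (ka0 + 0)) (at_right 0)"
  using ka0 by (intro tendsto_intros) auto
 then have 2: "\<forall>\<^sub>F e in at_right 0. 1 / sqrt ka0 - et < 1 / sqrt (ka0 + e)"
  using et by (intro order_tendstoD(1)) auto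
 from eventually_conj[OF 1 2] obtain b where b: "b > 0"
  "!!e. 0 < e ==> e < b ==> 1 / sqrt (ka0 - e) < 1 / sqrt ka0 + et & 1 / sqrt ka0 - et < 1 / sqrt (ka0 + e)"
  unfolding eventually_at_right_field by auto
 show ?thesis
 proof (intro exI[of _ "min b (ka0 / 2)"] conjI allI impI)
  fix e assume e: "0 < e" "e < min b (ka0 / 2)"
  have "\<forall>\<^sub>F k in sequentially. lapl ((ka0 - e) * x k) (sg k) / lapl (x k) (sg k) < 1 / sqrt ka0 + et"
   using b(2)[of e] e by (intro order_tendstoD(2)[OF lim]) auto
  moreover have "\<forall>\<^sub>F k in sequentially. 1 / sqrt ka0 - et < lapl ((ka0 + e) * x k) (sg k) / lapl (x k) (sg k)"
   using b(2)[of e] e ka0 by (intro order_tendstoD(1)[OF lim]) auto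
  ultimately show "\<forall>\<^sub>F k in sequentially.
   lapl ((ka0 - e) * x k) (sg k) <= (1 / sqrt ka0 + et) * lapl (x k) (sg k) \<and>
   (1 / sqrt ka0 - et) * lapl (x k) (sg k) <= lapl ((ka0 + e) * x k) (sg k)"
  proof eventually_elim
   case (elim k)
   then show ?case
    using Lpos[of k] by (simp add: divide_less_eq less_divide_eq)
  qed
 qed (use b ka0 in auto)
next
 assume "ka0 = 1"
 \<comment> \<open>For \<open>e\<close> below \<open>et / (1 + et)\<close> the product of
   \<open>1 + et\<close> and \<open>1 - e\<close> exceeds 1, which absorbs the loss in the
   contraction inequality.\<close>
 define e0 where "e0 = min (1/2) (et / (1 + et))"
 have e0: "0 < e0" "e0 < 1"
  using et by (auto simp: e0_def)
 show ?thesis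
 proof (intro exI[of _ e0] conjI allI impI)
  fix e assume e: "0 < e" "e < e0"
  then have "e * (1 + et) < et"
   using et by (simp add: e0_def less_divide_eq)
  then have e1: "1 <= (1 + et) * (1 - e)" "e < et"
   using e et by (auto simp: algebra_simps intro: le_less_trans[of _ "e * (1+et)"])
  then have e2: "(1 - et) * (1 + e) <= 1"
   using e et by (simp add: algebra_simps) (smt (verit) mult_nonneg_nonneg)
  show "\<forall>\<^sub>F k in sequentially.
   lapl ((ka0 - e) * x k) (sg k) <= (1 / sqrt ka0 + et) * lapl (x k) (sg k) \<and>
   (1 / sqrt ka0 - et) * lapl (x k) (sg k) <= lapl ((ka0 + e) * x k) (sg k)"
  proof (intro always_eventually allI conjI)
   fix k
   define l where "l y = lapl (y * x k) (sg k)" for y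
   have xk: "x k > 0" using x(2)[of k] by linarith
   have l1: "l 1 > 0"
    unfolding l_def using lapl_pos[of "sg k" "x k"] sg x by simp
   have "(1 - e) * x k * l (1 - e) <= x k * l 1"
    unfolding l_def using lapl_contraction[of "sg k" "(1 - e) * x k" "x k"] sg xk e e0
    by (simp add: mult_le_cancel_right1)
   then have "(1 - e) * l (1 - e) <= l 1"
    using xk by (simp add: mult.commute mult.left_commute)
   also have "... <= (1 + et) * (1 - e) * l 1"
    using e1 l1 by simp
   finally have "(1 - e) * l (1 - e) <= (1 - e) * ((1 + et) * l 1)"
    by (simp only: mult_ac)
   then show "lapl ((ka0 - e) * x k) (sg k) <= (1 / sqrt ka0 + et) * lapl (x k) (sg k)"
    using e e0 \<open>ka0 = 1\<close> by (simp add: l_def)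
   have "x k * l 1 <= (1 + e) * x k * l (1 + e)"
    unfolding l_def using lapl_contraction[of "sg k" "x k" "(1 + e) * x k"] sg xk e e0
    by (simp add: mult_le_cancel_right1)
   then have "l 1 <= (1 + e) * l (1 + e)"
    using xk by (simp add: mult.commute mult.left_commute)
   moreover have "(1 - et) * (1 + e) * l 1 <= 1 * l 1"
    using e2 l1 by (intro mult_right_mono) auto
   ultimately have "(1 + e) * ((1 - et) * l 1) <= (1 + e) * l (1 + e)"
    by (simp add: mult_ac)
   then show "(1 / sqrt ka0 - et) * lapl (x k) (sg k) <= lapl ((ka0 + e) * x k) (sg k)"
    using e \<open>ka0 = 1\<close> by (simp add: l_def)
  qed
 qed (use e0 \<open>ka0 = 1\<close> in auto)
qed

text \<open>The phase has \<open>ka\<close> times the derivative of \<open>x * kl sg\<close>. As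
  \<open>ka\<close> will be merely continuous, the phase is compared with multiples of
  \<open>kl\<close> through the quotient of the derivatives.\<close>

locale kl_phase =
 fixes sg x :: real and Ph ka :: "real => real"
 assumes sg: "0 <= sg" "sg <= 1" and x: "x >= 1"
  and Ph_cont: "continuous_on ({0<..<1} \<union> {sg}) Ph" and Ph_self: "Ph sg = 0"
  and Ph_deriv: "!!u. 0 < u ==> u < 1 ==>
   (Ph has_real_derivative x * ka u * ((u - sg) / (u * (1 - u)))) (at u)"
begin

lemma Ph_lower:
 assumes s: "0 < s" "s < 1"
  and c: "!!u. 0 < u ==> u < 1 ==> \<bar>u - sg\<bar> <= \<bar>s - sg\<bar> ==> c <= ka u"
 shows "c * x * kl sg s <= Ph s"
proof -
 have "Ph sg - c * x * kl sg sg <= Ph s - c * x * kl sg s"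
 proof (rule le_by_deriv_sign[where f = "%s. Ph s - c * x * kl sg s" and
   f' = "%u. x * ka u * ((u - sg) / (u * (1 - u))) - c * x * ((u - sg) / (u * (1 - u)))", OF sg s])
  show "continuous_on ({0<..<1} \<union> {sg}) (%s. Ph s - c * x * kl sg s)"
   by (intro continuous_intros Ph_cont continuous_on_kl sg)
  fix u :: real assume u: "0 < u" "u < 1"
  show "((%s. Ph s - c * x * kl sg s) has_real_derivative
    x * ka u * ((u - sg) / (u * (1 - u))) - c * x * ((u - sg) / (u * (1 - u)))) (at u)"
   using u by (intro DERIV_diff Ph_deriv DERIV_cmult DERIV_kl)
  assume "\<bar>u - sg\<bar> <= \<bar>s - sg\<bar>"
  then have "0 <= x * (ka u - c) * (1 / (u * (1 - u))) * (u - sg)\<^sup>2"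
   using c[OF u] u x by (intro mult_nonneg_nonneg) auto
  also have "x * (ka u - c) * (1 / P) * d\<^sup>2 = (x * ka u * (d / P) - c * x * (d / P)) * d" for P d :: real
   by (simp add: algebra_simps power2_eq_square diff_divide_distrib)
  finally show "0 <= (x * ka u * ((u - sg) / (u * (1 - u))) - c * x * ((u - sg) / (u * (1 - u)))) * (u - sg)" .
 qed
 then show ?thesis by (simp add: Ph_self)
qed

lemma Ph_upper:
 assumes s: "0 < s" "s < 1"
  and c: "!!u. 0 < u ==> u < 1 ==> \<bar>u - sg\<bar> <= \<bar>s - sg\<bar> ==> ka u <= c"
 shows "Ph s <= c * x * kl sg s"
proof -
 have "c * x * kl sg sg - Ph sg <= c * x * kl sg s - Ph s"
 proof (rule le_by_deriv_sign[where f = "%s. c * x * kl sg s - Ph s" and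
   f' = "%u. c * x * ((u - sg) / (u * (1 - u))) - x * ka u * ((u - sg) / (u * (1 - u)))", OF sg s])
  show "continuous_on ({0<..<1} \<union> {sg}) (%s. c * x * kl sg s - Ph s)"
   by (intro continuous_intros Ph_cont continuous_on_kl sg)
  fix u :: real assume u: "0 < u" "u < 1"
  show "((%s. c * x * kl sg s - Ph s) has_real_derivative
    c * x * ((u - sg) / (u * (1 - u))) - x * ka u * ((u - sg) / (u * (1 - u)))) (at u)"
   using u by (intro DERIV_diff Ph_deriv DERIV_cmult DERIV_kl)
  assume "\<bar>u - sg\<bar> <= \<bar>s - sg\<bar>"
  then have "0 <= x * (c - ka u) * (1 / (u * (1 - u))) * (u - sg)\<^sup>2"
   using c[OF u] u x by (intro mult_nonneg_nonneg) auto
  also have "x * (c - ka u) * (1 / P) * d\<^sup>2 = (c * x * (d / P) - x * ka u * (d / P)) * d" for P d :: real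
   by (simp add: algebra_simps power2_eq_square diff_divide_distrib)
  finally show "0 <= (c * x * ((u - sg) / (u * (1 - u))) - x * ka u * ((u - sg) / (u * (1 - u)))) * (u - sg)" .
 qed
 then show ?thesis by (simp add: Ph_self)
qed

context
 fixes V :: "real => real" and et Vm :: real
 assumes et: "0 < et" "!!u. 0 < u ==> u < 1 ==> et <= ka u"
  and V_cont: "continuous_on {0<..<1} V" and V: "!!u. 0 < u ==> u < 1 ==> 0 <= V u & V u <= Vm"
begin

lemma Ph_ge:
 assumes s: "0 < s" "s < 1"
 shows "et * x * kl sg s <= Ph s" "0 <= Ph s" "2 * et * x * (s - sg)\<^sup>2 <= Ph s"
proof -
 show *: "et * x * kl sg s <= Ph s"
  by (intro Ph_lower s et)
 show "0 <= Ph s"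
  by (rule order_trans[OF _ *]) (use et x kl_nonneg[OF sg s] in simp)
 have "et * x * (2 * (s - sg)\<^sup>2) <= et * x * kl sg s"
  using et x by (intro mult_left_mono kl_Pinsker sg s) auto
 with * show "2 * et * x * (s - sg)\<^sup>2 <= Ph s"
  by (simp add: mult_ac)
qed

lemma integrable_weighted: "set_integrable lborel {0<..<1} (%s. exp (- Ph s) * V s)"
proof (rule set_integrable_unit_interval[where B = Vm])
 show "continuous_on {0<..<1} (%s. exp (- Ph s) * V s)"
  by (intro continuous_intros V_cont continuous_on_subset[OF Ph_cont]) auto
 fix s :: real assume s: "0 < s" "s < 1"
 have "exp (- Ph s) * V s <= 1 * Vm"
  using Ph_ge[OF s] V[OF s] by (intro mult_mono) auto
 then show "\<bar>exp (- Ph s) * V s\<bar> <= Vm"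
  using V[OF s] by (simp add: abs_mult)
qed


text \<open>Within distance \<open>de\<close> of \<open>sg\<close> the factor \<open>ka\<close> and
  the amplitude \<open>V\<close> are almost constant, so the phase lies between two multiples of
  \<open>kl\<close>. Farther away Pinsker's inequality makes everything exponentially small.\<close>

lemma weighted_sandwich:
 assumes near: "!!u. 0 < u ==> u < 1 ==> \<bar>u - sg\<bar> <= de ==> \<bar>ka u - ka0\<bar> <= ep & \<bar>V u - V0\<bar> <= t"
  and de: "0 <= de" and ep: "0 <= ep" "ep < ka0" and t: "0 <= t" "t <= V0"
 shows "(LBINT s:{0<..<1}. exp (- Ph s) * V s) \<le>
   (V0 + t) * lapl ((ka0 - ep) * x) sg + Vm * exp (- (2 * et * x * de\<^sup>2))"
  and "(V0 - t) * (lapl ((ka0 + ep) * x) sg - exp (- (2 * ka0 * x * de\<^sup>2))) \<le>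
   (LBINT s:{0<..<1}. exp (- Ph s) * V s)"
proof -
 have Vm: "0 <= Vm" using V[of "1/2"] by auto
 have int: "set_integrable lborel {0<..<1} (%s. exp (- (c * x) * kl sg s))" if "0 <= c" for c
  using that x by (intro lapl_integrable sg) auto
 have const: "set_integrable lborel {0<..<1} (%s::real. c :: real)" for c
  by (rule set_integrable_unit_interval[where B = "\<bar>c\<bar>"]) auto
 have "(LBINT s:{0<..<1}. exp (- Ph s) * V s) \<le>
   (LBINT s:{0<..<1}. (V0 + t) * exp (- ((ka0 - ep) * x) * kl sg s) + Vm * exp (- (2 * et * x * de\<^sup>2)))"
 proof (rule set_integral_unit_mono[OF integrable_weighted])
  show "set_integrable lborel {0<..<1} (%s. (V0 + t) * exp (- ((ka0 - ep) * x) * kl sg s) + Vm * exp (- (2 * et * x * de\<^sup>2)))"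
   using ep by (intro set_integral_add(1) set_integrable_mult_right int const) auto
  fix s :: real assume s: "0 < s" "s < 1"
  show "exp (- Ph s) * V s <= (V0 + t) * exp (- ((ka0 - ep) * x) * kl sg s) + Vm * exp (- (2 * et * x * de\<^sup>2))"
  proof (cases "\<bar>s - sg\<bar> <= de")
   case True
   have "(ka0 - ep) * x * kl sg s <= Ph s"
    using True near by (intro Ph_lower s) (smt (verit))
   then have "V s * exp (- Ph s) <= (V0 + t) * exp (- ((ka0 - ep) * x) * kl sg s)"
    using near[OF s True] V[OF s] by (intro mult_mono) auto
   moreover have "0 <= Vm * exp (- (2 * et * x * de\<^sup>2))"
    using Vm by simp
   ultimately show ?thesis
    by (simp add: mult.commute)
  next
   case False
   then have "de\<^sup>2 <= (s - sg)\<^sup>2"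
    using de by (simp add: abs_le_square_iff[symmetric])
   then have "2 * et * x * de\<^sup>2 <= 2 * et * x * (s - sg)\<^sup>2"
    using et x by (intro mult_left_mono) auto
   with Ph_ge(3)[OF s] have "V s * exp (- Ph s) <= Vm * exp (- (2 * et * x * de\<^sup>2))"
    using V[OF s] by (intro mult_mono) auto
   moreover have "0 <= (V0 + t) * exp (- ((ka0 - ep) * x) * kl sg s)"
    using t by simp
   ultimately show ?thesis
    by (simp add: mult.commute)
  qed
 qed
 also have "... = (V0 + t) * lapl ((ka0 - ep) * x) sg + Vm * exp (- (2 * et * x * de\<^sup>2))"
 proof -
  have "set_integrable lborel {0<..<1} (%s. (V0 + t) * exp (- ((ka0 - ep) * x) * kl sg s))"
   using ep by (intro set_integrable_mult_right int) auto
  from set_integral_add(2)[OF this const] show ?thesis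
   by (simp only: set_integral_mult_right lapl_def set_integral_unit_const)
 qed
 finally show "(LBINT s:{0<..<1}. exp (- Ph s) * V s) \<le>
   (V0 + t) * lapl ((ka0 - ep) * x) sg + Vm * exp (- (2 * et * x * de\<^sup>2))" .
 \<comment> \<open>The subtracted constant makes the minorant nonpositive at distance more than
   \<open>de\<close> from \<open>sg\<close>, where the integrand is only known to be
   nonnegative.\<close>
 have "(V0 - t) * (lapl ((ka0 + ep) * x) sg - exp (- (2 * ka0 * x * de\<^sup>2))) =
   (LBINT s:{0<..<1}. (V0 - t) * (exp (- ((ka0 + ep) * x) * kl sg s) - exp (- (2 * ka0 * x * de\<^sup>2))))"
 proof -
  have "set_integrable lborel {0<..<1} (%s. exp (- ((ka0 + ep) * x) * kl sg s))"
   using ep by (intro int) auto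
  from set_integral_diff(2)[OF this const] show ?thesis
   by (simp only: set_integral_mult_right lapl_def set_integral_unit_const)
 qed
 also have "... <= (LBINT s:{0<..<1}. exp (- Ph s) * V s)"
 proof (rule set_integral_unit_mono[OF _ integrable_weighted])
  show "set_integrable lborel {0<..<1} (%s. (V0 - t) * (exp (- ((ka0 + ep) * x) * kl sg s) - exp (- (2 * ka0 * x * de\<^sup>2))))"
   using ep by (intro set_integrable_mult_right set_integral_diff(1) int const) auto
  fix s :: real assume s: "0 < s" "s < 1"
  show "(V0 - t) * (exp (- ((ka0 + ep) * x) * kl sg s) - exp (- (2 * ka0 * x * de\<^sup>2))) <= exp (- Ph s) * V s"
  proof (cases "\<bar>s - sg\<bar> <= de")
   case True
   have "Ph s <= (ka0 + ep) * x * kl sg s"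
    using True near by (intro Ph_upper s) (smt (verit))
   then have "(V0 - t) * exp (- ((ka0 + ep) * x) * kl sg s) <= V s * exp (- Ph s)"
    using near[OF s True] V[OF s] by (intro mult_mono) auto
   moreover have "0 <= (V0 - t) * exp (- (2 * ka0 * x * de\<^sup>2))"
    using t by simp
   ultimately show ?thesis
    by (simp add: right_diff_distrib mult.commute)
  next
   case False
   then have "de\<^sup>2 <= (s - sg)\<^sup>2"
    using de by (simp add: abs_le_square_iff[symmetric])
   then have "2 * ka0 * x * de\<^sup>2 <= ka0 * x * (2 * (s - sg)\<^sup>2)"
    using ep x by simp
   also have "... <= (ka0 + ep) * x * kl sg s"
    using ep x by (intro mult_mono kl_Pinsker sg s) auto
   finally have "(V0 - t) * (exp (- ((ka0 + ep) * x) * kl sg s) - exp (- (2 * ka0 * x * de\<^sup>2))) <= 0"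
    using t by (intro mult_nonneg_nonpos) auto
   also have "0 <= exp (- Ph s) * V s"
    using V[OF s] by simp
   finally show ?thesis .
  qed
 qed
 finally show "(V0 - t) * (lapl ((ka0 + ep) * x) sg - exp (- (2 * ka0 * x * de\<^sup>2))) \<le>
   (LBINT s:{0<..<1}. exp (- Ph s) * V s)" .
qed

end

end

text \<open>The factor \<open>8 * x k\<close> is the reciprocal of the lower bound in
  \<open>lapl_ge\<close>: the tails are negligible even relative to the reference integral.\<close>

lemma linear_times_exp_decay:
 fixes x :: "nat => real"
 assumes "filterlim x at_top sequentially" "c > 0" "t > 0"
 shows "\<forall>\<^sub>F k in sequentially. C * exp (- (c * x k)) * (8 * x k) < t"
proof -
 have "filterlim (%k. c * x k) at_top sequentially"
  using assms by (intro filterlim_tendsto_pos_mult_at_top[OF tendsto_const])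
 from filterlim_compose[OF tendsto_power_div_exp_0[of 1] this]
 have "(%k. C * 8 / c * ((c * x k) ^ 1 / exp (c * x k))) ---> C * 8 / c * 0"
  by (intro tendsto_intros)
 moreover have "C * 8 / c * ((c * x k) ^ 1 / exp (c * x k)) = C * exp (- (c * x k)) * (8 * x k)" for k
  using assms(2) by (simp add: exp_minus field_simps)
 ultimately show ?thesis
  using assms(3) by (intro order_tendstoD(2)) auto
qed

text \<open>Near \<open>sg0\<close> the phase is almost \<open>ka sg0\<close> times the reference
  phase, and rescaling the exponent by a constant divides the reference integral by its square root.
  The quotient by \<open>lapl\<close> has a limit also at the end points, where \<open>lapl\<close>
  itself has another order of magnitude.\<close>

lemma weighted_laplace_tendsto:
 fixes x sg :: "nat => real" and Ph :: "nat => real => real"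
 assumes ph: "!!k. kl_phase (sg k) (x k) (Ph k) ka"
  and sg: "sg ---> sg0" and x: "filterlim x at_top sequentially"
  and ka: "continuous_on {0..1} ka" "!!u. 0 <= u ==> u <= 1 ==> 0 < ka u"
  and V: "continuous_on {0..1} V" "!!u. 0 <= u ==> u <= 1 ==> 0 < V u"
  and ends: "(0 < sg0 & sg0 < 1) \<or> ka sg0 = 1"
 shows "(%k. (LBINT s:{0<..<1}. exp (- Ph k s) * V s) / lapl (x k) (sg k)) ---> V sg0 / sqrt (ka sg0)"
proof (rule tendstoI)
 fix r :: real assume r: "r > 0"
 have sg01: "0 <= sg k" "sg k <= 1" and x1: "x k >= 1" for k
  using ph[of k] by (auto simp: kl_phase_def)
 have sg0: "0 <= sg0" "sg0 <= 1"
  using sg sg01 by (auto intro: LIMSEQ_le_const LIMSEQ_le_const2)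
 define c V0 ka0 where "c = 1 / sqrt (ka sg0)" and "V0 = V sg0" and "ka0 = ka sg0"
 have pos: "c > 0" "V0 > 0" "ka0 > 0"
  using ka(2)[OF sg0] V(2)[OF sg0] by (auto simp: c_def V0_def ka0_def)
 obtain et where et: "0 < et" "!!u. 0 < u ==> u < 1 ==> et <= ka u"
 proof -
  obtain u0 where "u0 : {0..1}" "\<forall>y\<in>{0..1}. ka u0 <= ka y"
   using continuous_attains_inf[OF _ _ ka(1)] by auto
  then show ?thesis using ka(2)[of u0] by (intro that[of "ka u0"]) auto
 qed
 obtain Vm where Vm: "!!u. 0 < u ==> u < 1 ==> 0 <= V u & V u <= Vm"
 proof -
  obtain u0 where "u0 : {0..1}" "\<forall>y\<in>{0..1}. V y <= V u0"
   using continuous_attains_sup[OF _ _ V(1)] by auto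
  then show ?thesis using V(2) by (intro that[of "V u0"]) (auto intro: less_imp_le)
 qed
 have Vc: "continuous_on {0<..<1} V"
  using V(1) by (rule continuous_on_subset) auto
 \<comment> \<open>The order of the choices is: \<open>t\<close> from \<open>r\<close>, then
   \<open>ep\<close> from \<open>t\<close>, then \<open>de\<close> from \<open>ep\<close> and
   \<open>t\<close>, and finally \<open>k\<close>.\<close>
 have "((%t. (V0 + t) * (c + t) + t) \<longlongrightarrow> (V0 + 0) * (c + 0) + 0) (at_right 0)"
  by (intro tendsto_intros)
 then have 1: "\<forall>\<^sub>F t in at_right 0. (V0 + t) * (c + t) + t < V0 * c + r"
  using r by (intro order_tendstoD(2)) auto
 have "((%t. (V0 - t) * (c - t) - t) \<longlongrightarrow> (V0 - 0) * (c - 0) - 0) (at_right 0)"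
  by (intro tendsto_intros)
 then have 2: "\<forall>\<^sub>F t in at_right 0. V0 * c - r < (V0 - t) * (c - t) - t"
  using r by (intro order_tendstoD(1)) auto
 obtain b where b: "b > 0" "!!t. 0 < t ==> t < b ==>
   (V0 + t) * (c + t) + t < V0 * c + r & V0 * c - r < (V0 - t) * (c - t) - t"
  using eventually_conj[OF 1 2] unfolding eventually_at_right_field by auto
 define t where "t = min (b / 2) (min (c / 2) (V0 / 2))"
 have t: "0 < t" "t < b" "t < c" "t < V0"
  using b(1) pos by (auto simp: t_def min_def)
 note tb = b(2)[OF t(1,2)]
 obtain e0 where e0: "e0 > 0" "e0 < ka0" "!!e. 0 < e ==> e < e0 ==> \<forall>\<^sub>F k in sequentially.
   lapl ((ka0 - e) * x k) (sg k) <= (c + t) * lapl (x k) (sg k) \<and>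
   (c - t) * lapl (x k) (sg k) <= lapl ((ka0 + e) * x k) (sg k)"
  using lapl_ratio[OF sg01 sg x x1, of ka0 t] ends pos t
  unfolding c_def ka0_def by blast
 define ep where "ep = e0 / 2"
 have ep: "0 < ep" "ep < e0" "ep < ka0"
  using e0 by (auto simp: ep_def)
 obtain d1 where d1: "d1 > 0" "!!u. u : {0..1} ==> \<bar>u - sg0\<bar> < d1 ==> \<bar>ka u - ka0\<bar> < ep"
  using ka(1) ep(1) sg0 unfolding continuous_on_iff dist_real_def ka0_def
  by (metis atLeastAtMost_iff)
 obtain d2 where d2: "d2 > 0" "!!u. u : {0..1} ==> \<bar>u - sg0\<bar> < d2 ==> \<bar>V u - V0\<bar> < t"
  using V(1) t(1) sg0 unfolding continuous_on_iff dist_real_def V0_def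
  by (metis atLeastAtMost_iff)
 \<comment> \<open>A third of the radius for the distance from \<open>u\<close> to
   \<open>sg k\<close> and another for the distance from \<open>sg k\<close> to
   \<open>sg0\<close>.\<close>
 define de where "de = min d1 d2 / 3"
 have de: "de > 0" using d1 d2 by (simp add: de_def)
 have ev1: "\<forall>\<^sub>F k in sequentially. \<bar>sg k - sg0\<bar> < de"
  using tendstoD[OF sg de] by (simp add: dist_real_def)
 have ev2: "\<forall>\<^sub>F k in sequentially. Vm * exp (- ((2 * et * de\<^sup>2) * x k)) * (8 * x k) < t"
  using et de t by (intro linear_times_exp_decay x) auto
 have ev3: "\<forall>\<^sub>F k in sequentially. (V0 - t) * exp (- ((2 * ka0 * de\<^sup>2) * x k)) * (8 * x k) < t"
  using pos de t by (intro linear_times_exp_decay x) auto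
 show "\<forall>\<^sub>F k in sequentially.
   dist ((LBINT s:{0<..<1}. exp (- Ph k s) * V s) / lapl (x k) (sg k)) (V sg0 / sqrt (ka sg0)) < r"
  using ev1 ev2 ev3 e0(3)[OF ep(1,2)]
 proof eventually_elim
  case (elim k)
  interpret kl_phase "sg k" "x k" "Ph k" ka by (rule ph)
  define X L where "X = (LBINT s:{0<..<1}. exp (- Ph k s) * V s)" and "L = lapl (x k) (sg k)"
  have L: "L > 0" "1 / (8 * x k) <= L"
   unfolding L_def by (intro lapl_pos lapl_ge sg01 x1)+
  have L8: "1 <= 8 * x k * L"
   using L(2) x1[of k] by (simp add: divide_le_eq mult_ac)
  have near: "\<bar>ka u - ka0\<bar> <= ep & \<bar>V u - V0\<bar> <= t" if "0 < u" "u < 1" "\<bar>u - sg k\<bar> <= de" for u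
  proof -
   have "\<bar>u - sg0\<bar> < d1" "\<bar>u - sg0\<bar> < d2"
    using that elim(1) de unfolding de_def by linarith+
   then show ?thesis
    using d1(2)[of u] d2(2)[of u] that by auto
  qed
  note sandwich = weighted_sandwich[where de = de and ep = ep and t = t, OF et Vc Vm near]
  have "X <= (V0 + t) * lapl ((ka0 - ep) * x k) (sg k) + Vm * exp (- (2 * et * x k * de\<^sup>2))"
   unfolding X_def using de ep t by (intro sandwich) auto
  also have "... <= (V0 + t) * ((c + t) * L) + t * L"
  proof (rule add_mono)
   show "(V0 + t) * lapl ((ka0 - ep) * x k) (sg k) <= (V0 + t) * ((c + t) * L)"
    using elim t pos unfolding L_def by (intro mult_left_mono) auto
   have Vm0: "0 <= Vm" using Vm[of "1/2"] by auto
   have "Vm * exp (- (2 * et * x k * de\<^sup>2)) * 1 <= Vm * exp (- (2 * et * x k * de\<^sup>2)) * (8 * x k * L)"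
    using L8 Vm0 by (intro mult_left_mono) auto
   also have "... = (Vm * exp (- ((2 * et * de\<^sup>2) * x k)) * (8 * x k)) * L"
    by (simp add: mult_ac)
   also have "... <= t * L"
    using elim L by (intro mult_right_mono) auto
   finally show "Vm * exp (- (2 * et * x k * de\<^sup>2)) <= t * L" by simp
  qed
  also have "... = ((V0 + t) * (c + t) + t) * L"
   by (simp add: algebra_simps)
  also have "... < (V0 * c + r) * L"
   using tb L by (intro mult_strict_right_mono) auto
  finally have up: "X / L < V0 * c + r"
   using L by (simp add: divide_less_eq)
  have "(V0 * c - r) * L < ((V0 - t) * (c - t) - t) * L"
   using tb L by (intro mult_strict_right_mono) auto
  also have "... = (V0 - t) * ((c - t) * L) - t * L"
   by (simp add: algebra_simps)
  also have "... <= (V0 - t) * lapl ((ka0 + ep) * x k) (sg k) - (V0 - t) * exp (- (2 * ka0 * x k * de\<^sup>2))"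
  proof (rule diff_mono)
   show "(V0 - t) * ((c - t) * L) <= (V0 - t) * lapl ((ka0 + ep) * x k) (sg k)"
    using elim t pos unfolding L_def by (intro mult_left_mono) auto
   have "(V0 - t) * exp (- (2 * ka0 * x k * de\<^sup>2)) * 1 <= (V0 - t) * exp (- (2 * ka0 * x k * de\<^sup>2)) * (8 * x k * L)"
    using L8 t by (intro mult_left_mono) auto
   also have "... = ((V0 - t) * exp (- ((2 * ka0 * de\<^sup>2) * x k)) * (8 * x k)) * L"
    by (simp add: mult_ac)
   also have "... <= t * L"
    using elim L by (intro mult_right_mono) auto
   finally show "(V0 - t) * exp (- (2 * ka0 * x k * de\<^sup>2)) <= t * L" by simp
  qed
  also have "... = (V0 - t) * (lapl ((ka0 + ep) * x k) (sg k) - exp (- (2 * ka0 * x k * de\<^sup>2)))"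
   by (simp add: algebra_simps)
  also have "... <= X"
   unfolding X_def using de ep t by (intro sandwich) auto
  finally have "V0 * c - r < X / L"
   using L by (simp add: less_divide_eq)
  with up show ?case
   unfolding dist_real_def X_def[symmetric] L_def[symmetric] by (simp add: c_def V0_def abs_less_iff)
 qed
qed

section \<open>The singular values of the Leray transform\<close>

lemma Beta_integral_nat:
 "(LBINT s:{0<..<1}. s ^ n * (1 - s) ^ m) = fact n * fact m / (fact (n + m + 1) :: real)"
proof -
 let ?f = "%s::real. s ^ n * (1 - s) ^ m"
 have int: "set_integrable lborel {0<..<1} ?f"
  by (rule set_integrable_unit_interval[where B = 1])
    (auto intro!: continuous_intros mult_le_one power_le_one simp: abs_mult power_abs)
 have "((%t. t powr (real (n + 1) - 1) * (1 - t) powr (real (m + 1) - 1)) has_integral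
   Beta (real (n + 1)) (real (m + 1))) {0<..<1}"
  using has_integral_Beta_real[of "real (n + 1)" "real (m + 1)"] by (simp add: has_integral_Icc_iff_Ioo)
 then have "(?f has_integral Beta (real (n + 1)) (real (m + 1))) {0<..<1}"
  by (rule has_integral_eq[rotated]) (auto simp: powr_realpow)
 then have "(LBINT s:{0<..<1}. ?f s) = Beta (real (n + 1)) (real (m + 1))"
  using set_borel_integral_eq_integral(2)[OF int] by (simp add: integral_unique)
 also have "... = fact n * fact m / fact (n + m + 1)"
  using Gamma_fact[of n, where 'a = real] Gamma_fact[of m, where 'a = real]
   Gamma_fact[of "n + m + 1", where 'a = real]
  by (simp add: Beta_def algebra_simps)
 finally show ?thesis .
qed

text \<open>What analysis needs to know of the domain: the curve of the moduli, parametrized by s,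
  and the density \<open>W\<close> of the measure. The two differential equations are those of the
  model curve with s proportional to the p-th power of \<open>r\<close> and 1 - s to that of
  \<open>t\<close>, with a variable exponent \<open>p\<close>.\<close>

locale reinhardt_curve =
 fixes r t p W :: "real => real"
 assumes p_cont: "continuous_on {0..1} p" and p_gt: "!!s. 0 <= s ==> s <= 1 ==> 1 < p s"
  and p0: "p 0 = 2" and p1: "p 1 = 2"
  and r_cont: "continuous_on {0<..1} r" and t_cont: "continuous_on {0..<1} t"
  and r_pos: "!!s. 0 < s ==> s <= 1 ==> 0 < r s" and t_pos: "!!s. 0 <= s ==> s < 1 ==> 0 < t s"
  and r_deriv: "!!s. 0 < s ==> s < 1 ==> (r has_real_derivative r s / (p s * s)) (at s)"
  and t_deriv: "!!s. 0 < s ==> s < 1 ==> (t has_real_derivative - (t s / (p s * (1 - s)))) (at s)"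
  and W_cont: "continuous_on {0..1} W" and W_pos: "!!s. 0 <= s ==> s <= 1 ==> 0 < W s"
begin

definition A :: "nat => nat => real" where
 "A n m = (LBINT s:{0<..<1}. ((s / r s) ^ n * ((1 - s) / t s) ^ m)\<^sup>2 / W s)"

definition B :: "nat => nat => real" where
 "B n m = (LBINT s:{0<..<1}. (r s ^ n * t s ^ m)\<^sup>2 * W s)"

definition K :: "nat => nat => real" where
 "K n m = fact (n + m + 1) / (fact n * fact m)"

definition lam :: "nat => nat => real" where
 "lam n m = (K n m)\<^sup>2 * A n m * B n m"

definition lim_lam :: "real => real" where
 "lim_lam s = p s / (2 * sqrt (p s - 1))"

text \<open>Minus the logarithm of the integrand of \<open>B\<close> without its weight, shifted so
  as to vanish at \<open>n / (n + m)\<close>. If \<open>n\<close> or \<open>m\<close> is 0, the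
  logarithm that is singular there is multiplied by 0.\<close>

definition PhiB :: "nat => nat => real => real" where
 "PhiB n m s = (let sg = real n / (real n + real m) in
   2 * (n * (ln (r sg) - ln (r s)) + m * (ln (t sg) - ln (t s))))"

definition PhiA :: "nat => nat => real => real" where
 "PhiA n m s = (let sg = real n / (real n + real m) in
   2 * (n * ((ln sg - ln (r sg)) - (ln s - ln (r s))) +
     m * ((ln (1 - sg) - ln (t sg)) - (ln (1 - s) - ln (t s)))))"

lemma r_ne [simp]: "0 < s ==> s <= 1 ==> r s ~= 0" and t_ne [simp]: "0 <= s ==> s < 1 ==> t s ~= 0"
 using r_pos[of s] t_pos[of s] by auto

lemma p_pos: "0 <= s ==> s <= 1 ==> 0 < p s"
 using p_gt[of s] by simp

lemma sigma_cases:
 assumes "n + m >= 1"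
 obtains "n = 0" "real n / (real n + real m) = 0" "m > 0"
  | "m = 0" "real n / (real n + real m) = 1" "n > 0"
  | "0 < real n / (real n + real m)" "real n / (real n + real m) < 1" "n > 0" "m > 0"
proof (cases "n = 0 \<or> m = 0")
 case True
 then show ?thesis using assms that by auto
next
 case False
 then have "0 < real n / (real n + real m)" "real n / (real n + real m) < 1"
  by auto
 with False show ?thesis using that by auto
qed

lemma sigma01: "0 <= real n / (real n + real m)" "real n / (real n + real m) <= 1"
 by (auto simp: divide_le_eq)

lemma ln_r_cont: "continuous_on {0<..1} (%s. ln (r s))"
 by (intro continuous_intros r_cont) auto

lemma ln_t_cont: "continuous_on {0..<1} (%s. ln (t s))"
 by (intro continuous_intros t_cont) auto

lemma DERIV_ln_r:
 assumes "0 < s" "s < 1"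
 shows "((%s. ln (r s)) has_real_derivative 1 / (p s * s)) (at s)"
 using DERIV_chain2[OF DERIV_ln r_deriv[OF assms]] r_pos[of s] assms by (simp add: divide_simps)

lemma DERIV_ln_t:
 assumes "0 < s" "s < 1"
 shows "((%s. ln (t s)) has_real_derivative - 1 / (p s * (1 - s))) (at s)"
 using DERIV_chain2[OF DERIV_ln t_deriv[OF assms]] t_pos[of s] assms by (simp add: divide_simps)

text \<open>With N = n + m and n = N sg, the logarithmic derivatives of \<open>r\<close> and
  \<open>t\<close> combine to N (u - sg) / (p u (1 - u)); the square in the integrand contributes
  the factor 2.\<close>

lemma kl_phase_B:
 assumes "n + m >= 1"
 shows "kl_phase (real n / (real n + real m)) (real n + real m) (PhiB n m) (%s. 2 / p s)"
proof
 let ?sg = "real n / (real n + real m)"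
 show "0 <= ?sg" "?sg <= 1" by (rule sigma01)+
 show "(real n + real m) >= 1" using assms by simp
 show "PhiB n m ?sg = 0" by (simp add: PhiB_def Let_def)
 show "continuous_on ({0<..<1} \<union> {?sg}) (PhiB n m)"
  using assms
 proof (cases rule: sigma_cases)
  case 1
  then show ?thesis unfolding PhiB_def[abs_def] Let_def
   by (auto intro!: continuous_intros continuous_on_subset[OF ln_t_cont])
 next
  case 2
  then show ?thesis unfolding PhiB_def[abs_def] Let_def
   by (auto intro!: continuous_intros continuous_on_subset[OF ln_r_cont])
 next
  case 3
  then show ?thesis unfolding PhiB_def[abs_def] Let_def
   by (intro continuous_intros continuous_on_subset[OF ln_r_cont] continuous_on_subset[OF ln_t_cont]) auto
 qed
 fix u :: real assume u: "0 < u" "u < 1"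
 have "(PhiB n m has_real_derivative 2 * (n * (0 - 1 / (p u * u)) + m * (0 - (- 1 / (p u * (1 - u)))))) (at u)"
  unfolding PhiB_def[abs_def] Let_def
  by (intro DERIV_cmult DERIV_add DERIV_diff DERIV_const DERIV_ln_r DERIV_ln_t u)
 also have "2 * (n * (0 - 1 / (p u * u)) + m * (0 - (- 1 / (p u * (1 - u))))) =
   (real n + real m) * (2 / p u) * ((u - ?sg) / (u * (1 - u)))"
  using u p_pos[of u] assms by (simp add: divide_simps) (simp add: algebra_simps)
 finally show "(PhiB n m has_real_derivative (real n + real m) * (2 / p u) * ((u - ?sg) / (u * (1 - u)))) (at u)" .
qed

text \<open>Passing from \<open>r\<close> and \<open>t\<close> to \<open>s / r\<close> and
  \<open>(1 - s) / t\<close> replaces 1/p by 1 - 1/p, the reciprocal of the conjugate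
  exponent.\<close>

lemma kl_phase_A:
 assumes "n + m >= 1"
 shows "kl_phase (real n / (real n + real m)) (real n + real m) (PhiA n m) (%s. 2 - 2 / p s)"
proof
 let ?sg = "real n / (real n + real m)"
 show "0 <= ?sg" "?sg <= 1" by (rule sigma01)+
 show "(real n + real m) >= 1" using assms by simp
 show "PhiA n m ?sg = 0" by (simp add: PhiA_def Let_def)
 show "continuous_on ({0<..<1} \<union> {?sg}) (PhiA n m)"
  using assms
 proof (cases rule: sigma_cases)
  case 1
  then show ?thesis unfolding PhiA_def[abs_def] Let_def
   by (auto intro!: continuous_intros continuous_on_subset[OF ln_t_cont])
 next
  case 2
  then show ?thesis unfolding PhiA_def[abs_def] Let_def
   by (auto intro!: continuous_intros continuous_on_subset[OF ln_r_cont])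
 next
  case 3
  have "{0<..<1} \<union> {?sg} = {0<..<1}"
   using 3 by auto
  moreover have "continuous_on {0<..<1::real} ln" "continuous_on {0<..<1} (%s::real. ln (1 - s))"
   by (rule continuous_on_ln, auto intro: continuous_intros)+
  moreover have "continuous_on {0<..<1} (%s. ln (r s))" "continuous_on {0<..<1} (%s. ln (t s))"
   by (rule continuous_on_subset[OF ln_r_cont] continuous_on_subset[OF ln_t_cont], auto)+
  ultimately show ?thesis
   unfolding PhiA_def[abs_def] Let_def
   by (simp only:) (intro continuous_on_mult continuous_on_add continuous_on_diff continuous_on_const)
 qed
 fix u :: real assume u: "0 < u" "u < 1"
 have "((%s. ln (1 - s)) has_real_derivative (1 / (1 - u)) * (0 - 1)) (at u)"
  using u by (intro DERIV_chain2[where f = ln] DERIV_ln_divide DERIV_diff DERIV_const DERIV_ident) auto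
 then have ln1: "((%s. ln (1 - s)) has_real_derivative - 1 / (1 - u)) (at u)"
  by simp
 have ln: "(ln has_real_derivative 1 / u) (at u)"
  using u by (intro DERIV_ln_divide)
 have "(PhiA n m has_real_derivative 2 * (n * (0 - (1 / u - 1 / (p u * u))) +
   m * (0 - (- 1 / (1 - u) - (- 1 / (p u * (1 - u))))))) (at u)"
  unfolding PhiA_def[abs_def] Let_def
  by (intro DERIV_cmult DERIV_add DERIV_diff DERIV_const DERIV_ln_r DERIV_ln_t ln ln1 u)
 also have "2 * (n * (0 - (1 / u - 1 / (p u * u))) + m * (0 - (- 1 / (1 - u) - (- 1 / (p u * (1 - u)))))) =
   (real n + real m) * (2 - 2 / p u) * ((u - ?sg) / (u * (1 - u)))"
  using u p_pos[of u] assms by (simp add: divide_simps) (simp add: algebra_simps)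
 finally show "(PhiA n m has_real_derivative (real n + real m) * (2 - 2 / p u) * ((u - ?sg) / (u * (1 - u)))) (at u)" .
qed

lemma power_eq_exp_ln: "0 < x ==> x ^ n = exp (n * ln (x::real))"
 by (simp add: exp_of_nat_mult)

definition XB :: "nat => nat => real" where
 "XB n m = (LBINT s:{0<..<1}. exp (- PhiB n m s) * W s)"

definition XA :: "nat => nat => real" where
 "XA n m = (LBINT s:{0<..<1}. exp (- PhiA n m s) * (1 / W s))"

lemma integrand_B:
 assumes "0 < s" "s < 1"
 shows "(r s ^ n * t s ^ m)\<^sup>2 * W s =
  exp (2 * (n * ln (r (real n / (real n + real m))) + m * ln (t (real n / (real n + real m))))) * (exp (- PhiB n m s) * W s)"
proof -
 have "(r s ^ n * t s ^ m)\<^sup>2 = exp (2 * (n * ln (r s) + m * ln (t s)))"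
  using assms by (simp add: power_eq_exp_ln r_pos t_pos exp_add[symmetric] exp_double[symmetric] del: power_mult_distrib)
 also have "... = exp (2 * (n * ln (r (real n / (real n + real m))) + m * ln (t (real n / (real n + real m))))) * exp (- PhiB n m s)"
  by (simp add: PhiB_def Let_def exp_add[symmetric] algebra_simps)
 finally show ?thesis by simp
qed

lemma integrand_A:
 assumes "0 < s" "s < 1"
 shows "((s / r s) ^ n * ((1 - s) / t s) ^ m)\<^sup>2 / W s =
  exp (2 * (n * (ln (real n / (real n + real m)) - ln (r (real n / (real n + real m)))) + m * (ln (1 - real n / (real n + real m)) - ln (t (real n / (real n + real m)))))) *
   (exp (- PhiA n m s) * (1 / W s))"
proof -
 have "((s / r s) ^ n * ((1 - s) / t s) ^ m)\<^sup>2 = exp (2 * (n * (ln s - ln (r s)) + m * (ln (1 - s) - ln (t s))))"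
  using assms by (simp add: power_eq_exp_ln r_pos t_pos exp_add[symmetric] exp_double[symmetric] ln_div
   del: power_mult_distrib power_divide)
 also have "... = exp (2 * (n * (ln (real n / (real n + real m)) - ln (r (real n / (real n + real m)))) + m * (ln (1 - real n / (real n + real m)) - ln (t (real n / (real n + real m)))))) *
   exp (- PhiA n m s)"
  by (simp add: PhiA_def Let_def exp_add[symmetric] algebra_simps)
 finally show ?thesis by simp
qed

lemma B_eq: "B n m = exp (2 * (n * ln (r (real n / (real n + real m))) + m * ln (t (real n / (real n + real m))))) * XB n m"
 unfolding B_def XB_def set_integral_mult_right[symmetric]
 by (intro set_lebesgue_integral_cong allI impI integrand_B) auto

lemma A_eq: "A n m = exp (2 * (n * (ln (real n / (real n + real m)) - ln (r (real n / (real n + real m)))) +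
  m * (ln (1 - real n / (real n + real m)) - ln (t (real n / (real n + real m)))))) * XA n m"
 unfolding A_def XA_def set_integral_mult_right[symmetric]
 by (intro set_lebesgue_integral_cong allI impI integrand_A) auto

text \<open>The factorials form a Beta integral, which is the reference integral times the maximum
  of its integrand. This takes the place of Stirling's formula.\<close>

lemma inverse_K_eq:
 assumes "n + m >= 1"
 shows "1 / K n m = exp (n * ln (real n / (real n + real m)) + m * ln (1 - real n / (real n + real m))) * lapl (real n + real m) (real n / (real n + real m))"
proof -
 let ?sg = "real n / (real n + real m)"
 have sg: "(real n + real m) * ?sg = n" "(real n + real m) * (1 - ?sg) = m"
  using assms by (auto simp: field_simps)
 have "1 / K n m = (LBINT s:{0<..<1}. s ^ n * (1 - s) ^ m)"
  by (simp add: K_def Beta_integral_nat)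
 also have "... = (LBINT s:{0<..<1}. exp (n * ln ?sg + m * ln (1 - ?sg)) * exp (- (real n + real m) * kl ?sg s))"
 proof (rule set_lebesgue_integral_cong; (intro allI impI)?)
  fix s :: real assume s: "s : {0<..<1}"
  have "(real n + real m) * kl ?sg s =
   ((real n + real m) * ?sg) * ln ?sg - ((real n + real m) * ?sg) * ln s +
   ((real n + real m) * (1 - ?sg)) * ln (1 - ?sg) - ((real n + real m) * (1 - ?sg)) * ln (1 - s)"
   unfolding kl_def by (simp only: ring_distribs mult.assoc)
  then have e: "- ((real n + real m) * kl ?sg s) =
    n * ln s + m * ln (1 - s) - (n * ln ?sg + m * ln (1 - ?sg))"
   unfolding sg by linarith
  have "s ^ n * (1 - s) ^ m = exp (n * ln s + m * ln (1 - s))"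
   using s by (simp add: power_eq_exp_ln exp_add)
  also have "... = exp ((n * ln ?sg + m * ln (1 - ?sg)) + - ((real n + real m) * kl ?sg s))"
   unfolding e by simp
  finally show "s ^ n * (1 - s) ^ m = exp (n * ln ?sg + m * ln (1 - ?sg)) * exp (- (real n + real m) * kl ?sg s)"
   by (simp only: exp_add mult_minus_left)
 qed simp
 also have "... = exp (n * ln ?sg + m * ln (1 - ?sg)) * lapl (real n + real m) ?sg"
  by (simp add: lapl_def)
 finally show ?thesis .
qed

lemma K_pos: "K n m > 0"
 by (simp add: K_def)

text \<open>At the common maximum point the two integrands multiply to the square of the Beta
  integrand, because \<open>r\<close> and \<open>t\<close> cancel. Hence all exponential factors
  drop out.\<close>

lemma lam_eq:
 assumes "n + m >= 1"
 shows "lam n m = (XA n m / lapl (real n + real m) (real n / (real n + real m))) * (XB n m / lapl (real n + real m) (real n / (real n + real m)))"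
proof -
 let ?sg = "real n / (real n + real m)"
 define E where "E = exp (n * ln ?sg + m * ln (1 - ?sg))"
 define L where "L = lapl (real n + real m) ?sg"
 have E: "E > 0" by (simp add: E_def)
 have L: "L > 0" unfolding L_def using assms sigma01[of n m] by (intro lapl_pos) auto
 have "1 / K n m = E * L"
  using inverse_K_eq[OF assms] by (simp add: E_def L_def)
 then have K: "K n m = 1 / (E * L)"
  by (metis inverse_eq_divide inverse_inverse_eq)
 have "A n m * B n m = E\<^sup>2 * (XA n m * XB n m)"
 proof -
  have "exp (2 * (n * (ln ?sg - ln (r ?sg)) + m * (ln (1 - ?sg) - ln (t ?sg)))) *
    exp (2 * (n * ln (r ?sg) + m * ln (t ?sg))) = E\<^sup>2"
   unfolding E_def exp_double[symmetric] exp_add[symmetric] by (simp add: algebra_simps)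
  then show ?thesis
   unfolding A_eq B_eq by (simp add: mult_ac)
 qed
 then show ?thesis
  unfolding lam_def mult.assoc K L_def[symmetric] using E L by (simp add: power2_eq_square)
qed

lemma kappa_B: "continuous_on {0..1} (%s. 2 / p s)" "0 <= s ==> s <= 1 ==> 0 < 2 / p s"
 using p_pos by (auto intro!: continuous_intros p_cont simp: less_imp_neq[symmetric])

lemma kappa_A: "continuous_on {0..1} (%s. 2 - 2 / p s)" "0 <= s ==> s <= 1 ==> 0 < 2 - 2 / p s"
proof -
 show "continuous_on {0..1} (%s. 2 - 2 / p s)"
  using p_pos by (auto intro!: continuous_intros p_cont simp: less_imp_neq[symmetric])
 assume "0 <= s" "s <= 1"
 then show "0 < 2 - 2 / p s"
  using p_gt[of s] by (simp add: divide_less_eq)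
qed

lemma V_A: "continuous_on {0..1} (%s. 1 / W s)" "0 <= s ==> s <= 1 ==> 0 < 1 / W s"
 using W_pos by (auto intro!: continuous_intros W_cont simp: less_imp_neq[symmetric])

text \<open>The amplitudes \<open>W\<close> and \<open>1 / W\<close> cancel, which makes the limit
  independent of the measure, and the product of the two constants is 4 (p - 1) / p^2.\<close>

lemma lim_lam_eq:
 assumes "0 <= s" "s <= 1"
 shows "(1 / W s) / sqrt (2 - 2 / p s) * (W s / sqrt (2 / p s)) = lim_lam s"
proof -
 have p: "p s > 1" and W: "W s > 0" using assms p_gt W_pos by auto
 have "sqrt (2 - 2 / p s) * sqrt (2 / p s) = sqrt (4 * (p s - 1) / (p s)\<^sup>2)"
  unfolding real_sqrt_mult[symmetric] using p by (simp add: field_simps power2_eq_square)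
 also have "... = 2 * sqrt (p s - 1) / p s"
  using p by (simp only: real_sqrt_divide real_sqrt_mult) simp
 finally have "1 / (sqrt (2 - 2 / p s) * sqrt (2 / p s)) = lim_lam s"
  by (simp add: lim_lam_def)
 then show ?thesis
  using W by (simp add: field_simps)
qed

lemma lam_tendsto:
 fixes n m :: "nat => nat"
 assumes N: "filterlim (%k. n k + m k) at_top sequentially"
  and sg: "(%k. real (n k) / (real (n k) + real (m k))) ---> sg0"
 shows "(%k. lam (n k) (m k)) ---> lim_lam sg0"
proof -
 have ev: "\<forall>\<^sub>F k in sequentially. n k + m k >= 1"
  using N by (simp add: filterlim_at_top)
 have sg0: "0 <= sg0" "sg0 <= 1"
  using sg sigma01 by (auto intro: LIMSEQ_le_const LIMSEQ_le_const2)
 \<comment> \<open>At the end points \<open>p = 2\<close>, so that both factors \<open>2 / p\<close>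
   and \<open>2 - 2 / p\<close> equal 1.\<close>
 have ends: "0 < sg0 & sg0 < 1 \<or> 2 / p sg0 = 1" "0 < sg0 & sg0 < 1 \<or> 2 - 2 / p sg0 = 1"
  using sg0 p0 p1 by (cases "sg0 = 0"; cases "sg0 = 1"; auto)+
 obtain k0 where k0: "!!k. k >= k0 ==> n k + m k >= 1"
  using ev unfolding eventually_sequentially by auto
 define n' m' where "n' k = n (k + k0)" and "m' k = m (k + k0)" for k
 have nm: "n' k + m' k >= 1" for k
  using k0[of "k + k0"] by (simp add: n'_def m'_def)
 have sg': "(%k. real (n' k) / (real (n' k) + real (m' k))) ---> sg0"
  using LIMSEQ_ignore_initial_segment[OF sg, of k0] by (simp add: n'_def m'_def)
 have N': "filterlim (%k. (real (n' k) + real (m' k))) at_top sequentially"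
  unfolding n'_def m'_def
  using filterlim_compose[OF filterlim_real_sequentially
    filterlim_compose[OF N filterlim_add_const_nat_at_top[of k0]]]
  by (simp add: add.commute)
 have 1: "(%k. XB (n' k) (m' k) / lapl (real (n' k) + real (m' k)) (real (n' k) / (real (n' k) + real (m' k)))) ---> W sg0 / sqrt (2 / p sg0)"
  unfolding XB_def
  by (rule weighted_laplace_tendsto[OF kl_phase_B[OF nm] sg' N' kappa_B W_cont W_pos ends(1)])
 have 2: "(%k. XA (n' k) (m' k) / lapl (real (n' k) + real (m' k)) (real (n' k) / (real (n' k) + real (m' k)))) ---> (1 / W sg0) / sqrt (2 - 2 / p sg0)"
  unfolding XA_def
  by (rule weighted_laplace_tendsto[OF kl_phase_A[OF nm] sg' N' kappa_A V_A ends(2)])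
 have "(%k. lam (n' k) (m' k)) ---> lim_lam sg0"
  using tendsto_mult[OF 2 1] unfolding lim_lam_eq[OF sg0] by (simp add: lam_eq[OF nm])
 then show ?thesis
  unfolding n'_def m'_def by (rule LIMSEQ_offset)
qed

lemma continuous_lim_lam: "continuous_on {0..1} lim_lam"
 unfolding lim_lam_def[abs_def] using p_gt
 by (intro continuous_intros p_cont) (auto, fastforce)

text \<open>Up to constant factors the integrands are a bounded continuous weight times the
  exponential of minus a nonnegative phase.\<close>

lemma integrable_A: "set_integrable lborel {0<..<1} (%s. ((s / r s) ^ n * ((1 - s) / t s) ^ m)\<^sup>2 / W s)"
 and integrable_B: "set_integrable lborel {0<..<1} (%s. (r s ^ n * t s ^ m)\<^sup>2 * W s)"
proof -
 obtain u0 where u0: "u0 : {0..1}" "\<forall>y\<in>{0..1}. W y <= W u0"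
  using continuous_attains_sup[OF _ _ W_cont] by auto
 obtain u1 where u1: "u1 : {0..1}" "\<forall>y\<in>{0..1}. 1 / W y <= 1 / W u1"
  using continuous_attains_sup[OF _ _ V_A(1)] by auto
 obtain v0 where v0: "v0 : {0..1}" "\<forall>y\<in>{0..1}. 2 / p v0 <= 2 / p y"
  using continuous_attains_inf[OF _ _ kappa_B(1)] by auto
 obtain v1 where v1: "v1 : {0..1}" "\<forall>y\<in>{0..1}. 2 - 2 / p v1 <= 2 - 2 / p y"
  using continuous_attains_inf[OF _ _ kappa_A(1)] by auto
 have iA: "set_integrable lborel {0<..<1} (%s. exp (- PhiA n m s) * (1 / W s))"
  and iB: "set_integrable lborel {0<..<1} (%s. exp (- PhiB n m s) * W s)"
 proof -
  have "set_integrable lborel {0<..<1} (%s. exp (- PhiA n m s) * (1 / W s)) \<and>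
   set_integrable lborel {0<..<1} (%s. exp (- PhiB n m s) * W s)"
  proof (cases "n + m >= 1")
   case True
   interpret A: kl_phase "real n / (real n + real m)" "real n + real m" "PhiA n m" "%s. 2 - 2 / p s"
    by (rule kl_phase_A[OF True])
   interpret B: kl_phase "real n / (real n + real m)" "real n + real m" "PhiB n m" "%s. 2 / p s"
    by (rule kl_phase_B[OF True])
   show ?thesis
   proof
    show "set_integrable lborel {0<..<1} (%s. exp (- PhiA n m s) * (1 / W s))"
     by (rule A.integrable_weighted[where et = "2 - 2 / p v1" and Vm = "1 / W u1"])
       (use v1 u1 kappa_A(2)[of v1] V_A in \<open>auto intro: continuous_on_subset less_imp_le\<close>)
    show "set_integrable lborel {0<..<1} (%s. exp (- PhiB n m s) * W s)"
     by (rule B.integrable_weighted[where et = "2 / p v0" and Vm = "W u0"])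
       (use v0 u0 kappa_B(2)[of v0] W_pos W_cont in \<open>auto intro: continuous_on_subset less_imp_le\<close>)
   qed
  next
   case False
   then have 0: "PhiA n m s = 0" "PhiB n m s = 0" for s
    by (simp_all add: PhiA_def PhiB_def Let_def not_le)
   have "set_integrable lborel {0<..<1} (%s. 1 / W s)"
    by (rule set_integrable_unit_interval[where B = "1 / W u1"])
      (use u1 V_A W_pos in \<open>auto intro: continuous_on_subset simp: less_imp_le\<close>)
   moreover have "set_integrable lborel {0<..<1} W"
    by (rule set_integrable_unit_interval[where B = "W u0"])
      (use u0 W_cont W_pos in \<open>auto intro: continuous_on_subset simp: less_imp_le\<close>)
   ultimately show ?thesis
    by (simp add: 0)
  qed
  then show "set_integrable lborel {0<..<1} (%s. exp (- PhiA n m s) * (1 / W s))"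
   "set_integrable lborel {0<..<1} (%s. exp (- PhiB n m s) * W s)" by auto
 qed
 show "set_integrable lborel {0<..<1} (%s. ((s / r s) ^ n * ((1 - s) / t s) ^ m)\<^sup>2 / W s)"
  by (subst set_integrable_cong[OF refl refl integrand_A]) ((rule set_integrable_mult_right, rule iA) | simp)+
 show "set_integrable lborel {0<..<1} (%s. (r s ^ n * t s ^ m)\<^sup>2 * W s)"
  by (subst set_integrable_cong[OF refl refl integrand_B]) ((rule set_integrable_mult_right, rule iB) | simp)+
qed

lemma set_integral_unit_pos:
 fixes f :: "real => real"
 assumes "set_integrable lborel {0<..<1} f" "!!s. 0 < s ==> s < 1 ==> 0 < f s"
 shows "0 < (LBINT s:{0<..<1}. f s)"
proof -
 have nn: "0 <= indicator {0<..<1} s *\<^sub>R f s" for s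
  using assms(2)[of s] by (cases "s : {0<..<1}") auto
 have "0 <= (LBINT s:{0<..<1}. f s)"
  unfolding set_lebesgue_integral_def by (intro Bochner_Integration.integral_nonneg nn)
 moreover have "(LBINT s:{0<..<1}. f s) ~= 0"
 proof
  assume "(LBINT s:{0<..<1}. f s) = 0"
  then have "AE s in lborel. indicator {0<..<1} s *\<^sub>R f s = 0"
   unfolding set_lebesgue_integral_def using assms(1) nn
   by (subst (asm) integral_nonneg_eq_0_iff_AE) (auto simp: set_integrable_def)
  then have "AE s in lborel. s \<notin> {0<..<1::real}"
  proof eventually_elim
   case (elim s)
   then show ?case
    using assms(2)[of s] by (auto simp: indicator_def split: if_splits)
  qed
  then have "emeasure lborel {0<..<1::real} = 0"
   by (subst (asm) AE_iff_measurable[where N = "{0<..<1}"]) auto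
  then show False by simp
 qed
 ultimately show ?thesis by simp
qed

lemma A_pos: "A n m > 0" and B_pos: "B n m > 0"
proof -
 show "A n m > 0"
  unfolding A_def using W_pos r_pos t_pos
  by (intro set_integral_unit_pos integrable_A divide_pos_pos zero_less_power mult_pos_pos) auto
 show "B n m > 0"
  unfolding B_def using W_pos r_pos t_pos
  by (intro set_integral_unit_pos integrable_B zero_less_power mult_pos_pos) auto
qed

lemma lam_pos: "lam n m > 0"
 unfolding lam_def by (intro mult_pos_pos A_pos B_pos zero_less_power K_pos)

text \<open>An infinite set of exceptions contains pairs with \<open>n + m\<close> arbitrarily
  large. Along a subsequence the fractions \<open>n / (n + m)\<close> converge by compactness, and
  \<open>lam_tendsto\<close> gives a contradiction.\<close>

lemma lam_accumulates:
 assumes "e > 0"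
 shows "finite {(n, m). \<forall>s\<in>{0..1}. \<bar>lam n m - lim_lam s\<bar> >= e}"
proof (rule ccontr)
 let ?S = "{(n, m). \<forall>s\<in>{0..1}. \<bar>lam n m - lim_lam s\<bar> >= e}"
 assume inf: "infinite ?S"
 have "\<exists>z\<in>?S. fst z + snd z >= k" for k
 proof (rule ccontr)
  assume no: "\<not> (\<exists>z\<in>?S. k <= fst z + snd z)"
  have "?S \<subseteq> {..k} \<times> {..k}"
  proof (intro subsetI)
   fix z assume "z : ?S"
   with no have "fst z + snd z < k"
    by (meson not_le)
   then show "z : {..k} \<times> {..k}"
    by (cases z) auto
  qed
  then show False
   using inf finite_subset by blast
 qed
 then have "\<forall>k. \<exists>z. z : ?S & k <= fst z + snd z"
  by (simp only: Bex_def) blast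
 from choice[OF this] obtain z where Z: "\<forall>k. z k : ?S & k <= fst (z k) + snd (z k)"
  by (elim exE)
 have z: "z k : ?S" "k <= fst (z k) + snd (z k)" for k
  by (rule conjunct1[OF spec[OF Z]], rule conjunct2[OF spec[OF Z]])
 define n m where "n k = fst (z k)" and "m k = snd (z k)" for k
 have nm: "\<bar>lam (n k) (m k) - lim_lam s\<bar> >= e" if "s : {0..1}" for k s
  using z(1)[of k] that by (auto simp: n_def m_def)
 have "bounded (range (%k. real (n k) / (real (n k) + real (m k))))"
  using sigma01 by (intro boundedI[where B = 1]) auto
 from bounded_imp_convergent_subsequence[OF this]
 obtain l ro where ro: "strict_mono ro" "((%k. real (n k) / (real (n k) + real (m k))) \<circ> ro) ---> l" by blast
 have "k <= n (ro k) + m (ro k)" for k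
  using z(2)[of "ro k"] seq_suble[OF ro(1), of k] unfolding n_def m_def by linarith
 then have "filterlim (%k. n (ro k) + m (ro k)) at_top sequentially"
  by (intro filterlim_at_top_mono[OF filterlim_ident] always_eventually allI)
 then have lim: "(%k. lam (n (ro k)) (m (ro k))) ---> lim_lam l"
  using ro(2) by (intro lam_tendsto) (auto simp: o_def)
 have "l : {0..1}"
  using ro(2) sigma01 by (auto simp: o_def intro: LIMSEQ_le_const LIMSEQ_le_const2)
 moreover obtain k where "dist (lam (n (ro k)) (m (ro k))) (lim_lam l) < e"
  using tendstoD[OF lim assms] by (auto simp: eventually_sequentially)
 ultimately show False
  using nm[of l "ro k"] by (simp add: dist_real_def)
qed

lemma lam_limit_attained:
 assumes "0 <= s" "s <= 1"
 shows "\<exists>n m. inj (%k. (n k, m k)) & (%k. lam (n k) (m k)) ---> lim_lam s"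
proof -
 \<comment> \<open>Fractions with denominator exactly \<open>k\<close> approximate \<open>s\<close>;
   as \<open>n k + m k = k\<close>, the pairs are distinct.\<close>
 define n where "n k = nat \<lfloor>real k * s\<rfloor>" for k
 define m where "m k = k - n k" for k
 have nk: "n k <= k" for k
 proof -
  have "real k * s <= real k" using assms by (simp add: mult_left_le)
  then have "\<lfloor>real k * s\<rfloor> <= int k" by (simp add: floor_le_iff)
  then show ?thesis by (simp add: n_def)
 qed
 have nm: "n k + m k = k" for k using nk[of k] by (simp add: m_def)
 have "inj (%k. (n k, m k))"
  by (rule injI) (metis nm prod.inject)
 moreover have "(%k. lam (n k) (m k)) ---> lim_lam s"
 proof (rule lam_tendsto)
  show "filterlim (%k. n k + m k) at_top sequentially"
   unfolding nm by (rule filterlim_ident)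
  have lo: "s - 1 / real k <= real (n k) / real k" and hi: "real (n k) / real k <= s" if "k > 0" for k
  proof -
   have "real (n k) = of_int \<lfloor>real k * s\<rfloor>" using assms by (simp add: n_def)
   then have "real k * s - 1 <= real (n k)" "real (n k) <= real k * s"
    by linarith+
   moreover have "s - 1 / real k = (real k * s - 1) / real k"
    using that by (simp add: diff_divide_distrib)
   ultimately show "s - 1 / real k <= real (n k) / real k" "real (n k) / real k <= s"
    using that by (simp_all add: divide_right_mono divide_le_eq mult.commute)
  qed
  have "(%k. s - 1 / real k) ---> s - 0"
   by (intro tendsto_intros lim_1_over_n)
  then have lim: "(%k. s - 1 / real k) ---> s" by simp
  show "(%k. real (n k) / (real (n k) + real (m k))) ---> s"
   unfolding of_nat_add[symmetric] nm
   by (rule tendsto_sandwich[OF _ _ lim tendsto_const])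
     (auto simp: eventually_sequentially intro!: exI[of _ 1] lo hi)
 qed
 ultimately show ?thesis by blast
qed

text \<open>This is what makes the Leray transform bounded: all but finitely many values are within
  1 of the range of a continuous function on a compact interval.\<close>

lemma lam_bounded: "\<exists>C. \<forall>n m. lam n m <= C"
proof -
 obtain u0 where u0: "u0 : {0..1}" "\<forall>y\<in>{0..1}. lim_lam y <= lim_lam u0"
  using continuous_attains_sup[OF _ _ continuous_lim_lam] by auto
 let ?S = "{(n, m). \<forall>s\<in>{0..1}. \<bar>lam n m - lim_lam s\<bar> >= 1}"
 let ?C = "Max (insert (lim_lam u0 + 1) ((%(n, m). lam n m) ` ?S))"
 have fin: "finite ?S" by (rule lam_accumulates) simp
 have "lam n m <= ?C" for n m
 proof (cases "(n, m) : ?S")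
  case True
  then show ?thesis using fin by (intro Max_ge) force+
 next
  case False
  then obtain s where "s : {0..1}" "\<bar>lam n m - lim_lam s\<bar> < 1"
   by (auto simp: not_le)
  then have "lam n m <= lim_lam u0 + 1"
   using u0(2) by fastforce
  also have "... <= ?C" using fin by (intro Max_ge) auto
  finally show ?thesis .
 qed
 then show ?thesis by blast
qed

end

section \<open>Strongly convex Reinhardt domains\<close>

text \<open>Continuity of \<open>f\<close> is already available from concavity, so the implicit
  function theorem reduces to solving the first order expansion of \<open>F\<close> for the
  increment of \<open>f\<close>.\<close>

lemma implicit_DERIV:
 fixes F :: "real \<times> real => real" and f :: "real => real"
 assumes F: "(F has_derivative (%v. a * fst v + b * snd v)) (at (x, f x))" and b: "b ~= 0"
  and f: "isCont f x" and zero: "F (x, f x) = 0" "\<forall>\<^sub>F y in at x. F (y, f y) = 0"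
 shows "(f has_real_derivative - a / b) (at x)"
proof -
 \<comment> \<open>If the error in \<open>a * h + b * k\<close> is at most half of |b| times |h| +
   |k|, then |k| is at most \<open>C\<close> times |h|.\<close>
 define C where "C = (2 / \<bar>b\<bar>) * (\<bar>a\<bar> + \<bar>b\<bar> / 2)"
 have C: "C >= 0" by (simp add: C_def)
 have "\<exists>d>0. \<forall>y. norm (y - x) < d --> norm (f y - f x - (- a / b) * (y - x)) <= ep * norm (y - x)"
  if ep: "ep > 0" for ep
 proof -
  \<comment> \<open>The first bound yields the estimate of the increment by \<open>C\<close>, the
    second one then makes the error relative to |b| at most \<open>ep\<close>.\<close>
  define e where "e = min (\<bar>b\<bar> / 2) (ep * \<bar>b\<bar> / (1 + C))"
  have e: "e > 0" "e <= \<bar>b\<bar> / 2" "e * (1 + C) <= ep * \<bar>b\<bar>"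
  proof -
   show "e > 0" using b ep C by (auto simp: e_def)
   show "e <= \<bar>b\<bar> / 2" unfolding e_def by (rule min.cobounded1)
   have "e <= ep * \<bar>b\<bar> / (1 + C)" by (simp add: e_def)
   then show "e * (1 + C) <= ep * \<bar>b\<bar>" using C by (simp add: pos_le_divide_eq)
  qed
  obtain d1 where d1: "d1 > 0" "!!y. norm (y - (x, f x)) < d1 ==>
    norm (F y - F (x, f x) - (a * fst (y - (x, f x)) + b * snd (y - (x, f x)))) <= e * norm (y - (x, f x))"
   using F e(1) unfolding has_derivative_at_alt by blast
  obtain d2 where d2: "d2 > 0" "!!y. \<bar>y - x\<bar> < d2 ==> \<bar>f y - f x\<bar> < d1 / 2"
   using f d1(1) unfolding continuous_at_eps_delta dist_real_def by (meson half_gt_zero)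
  obtain d3 where d3: "d3 > 0" "!!y. y ~= x ==> \<bar>y - x\<bar> < d3 ==> F (y, f y) = 0"
   using zero(2) unfolding eventually_at dist_real_def by auto
  show ?thesis
  proof (intro exI[of _ "min (d1 / 2) (min d2 d3)"] conjI allI impI)
   fix y assume y: "norm (y - x) < min (d1 / 2) (min d2 d3)"
   define h k where "h = y - x" and "k = f y - f x"
   have "norm ((y, f y) - (x, f x)) <= \<bar>h\<bar> + \<bar>k\<bar>"
    using norm_Pair_le[of h k] by (simp add: h_def k_def)
   moreover have "\<bar>h\<bar> < d1 / 2" "\<bar>k\<bar> < d1 / 2"
    using y d2(2)[of y] by (auto simp: h_def k_def)
   ultimately have "norm ((y, f y) - (x, f x)) < d1" by linarith
   from d1(2)[OF this] have "\<bar>a * h + b * k\<bar> <= e * norm ((y, f y) - (x, f x))"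
    using d3(2)[of y] y zero(1) by (cases "y = x") (auto simp: h_def k_def)
   also have "... <= e * (\<bar>h\<bar> + \<bar>k\<bar>)"
    using \<open>norm ((y, f y) - (x, f x)) <= \<bar>h\<bar> + \<bar>k\<bar>\<close> e by (intro mult_left_mono) auto
   finally have *: "\<bar>a * h + b * k\<bar> <= e * (\<bar>h\<bar> + \<bar>k\<bar>)" .
   have "\<bar>b\<bar> * \<bar>k\<bar> <= \<bar>a * h + b * k\<bar> + \<bar>a\<bar> * \<bar>h\<bar>"
    using abs_triangle_ineq[of "a * h + b * k" "- (a * h)"] by (simp add: abs_mult)
   also have "... <= \<bar>b\<bar> / 2 * (\<bar>h\<bar> + \<bar>k\<bar>) + \<bar>a\<bar> * \<bar>h\<bar>"
    using order_trans[OF * mult_right_mono[OF e(2)]] by simp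
   finally have "\<bar>b\<bar> / 2 * \<bar>k\<bar> <= (\<bar>a\<bar> + \<bar>b\<bar> / 2) * \<bar>h\<bar>"
    by (simp only: ring_distribs)
   then have "\<bar>k\<bar> <= C * \<bar>h\<bar>"
    using b by (simp add: C_def field_simps)
   then have "\<bar>a * h + b * k\<bar> <= e * (\<bar>h\<bar> + C * \<bar>h\<bar>)"
    using * e by (smt (verit) mult_left_mono)
   also have "... = e * (1 + C) * \<bar>h\<bar>" by (simp add: algebra_simps)
   also have "... <= ep * \<bar>b\<bar> * \<bar>h\<bar>" using e by (intro mult_right_mono) auto
   finally have "\<bar>a * h + b * k\<bar> / \<bar>b\<bar> <= ep * \<bar>h\<bar>"
    using b by (simp add: pos_divide_le_eq mult_ac)
   moreover have "k - (- a / b) * h = (a * h + b * k) / b"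
    using b by (simp add: field_simps)
   ultimately show "norm (f y - f x - (- a / b) * (y - x)) <= ep * norm (y - x)"
    by (simp add: h_def[symmetric] k_def[symmetric] abs_divide)
  qed (use d1 d2 d3 in auto)
 qed
 then show ?thesis
  unfolding has_field_derivative_def has_derivative_at_alt by (auto intro!: bounded_linear_intros)
qed


section \<open>Geometry of the domain and its profile function\<close>

lemma torus_rot_inverse: "torus_rot (- a) (- b) (torus_rot a b z) = z"
 by (simp add: torus_rot_def cis_mult mult.assoc[symmetric])

locale C2_reinhardt =
 fixes D :: "C2 set" and ro :: "C2 => real" and G :: "C2 => C2" and H :: "C2 => C2 => C2"
  and U :: "C2 set"
 assumes opn: "open D" and cvx: "convex D" and bdd: "bounded D" and ne: "D ~= {}"
  and rh: "reinhardt D"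
  and U: "open U" "frontier D \<subseteq> U"
  and ro_deriv: "!!x. x : U ==> (ro has_derivative (%v. G x \<bullet> v)) (at x)"
  and G_deriv: "!!x. x : U ==> (G has_derivative H x) (at x)"
  and H_cont: "!!v. continuous_on U (%x. H x v)"
  and D_U: "D \<inter> U = {x : U. ro x < 0}"
  and G_ne: "!!zt. zt : frontier D ==> G zt ~= 0"
  and H_pos: "!!zt v. zt : frontier D ==> v ~= 0 ==> G zt \<bullet> v = 0 ==> 0 < H zt v \<bullet> v"
begin

lemma D_iff: "x : U ==> x : D \<longleftrightarrow> ro x < 0"
 using D_U by blast

lemma frontier_eq: "frontier D = closure D - D"
 using opn by (simp add: frontier_def interior_open)

lemma frontier_notin: "zt : frontier D ==> zt \<notin> D" and frontier_U: "zt : frontier D ==> zt : U"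
 using U(2) by (auto simp: frontier_eq)

lemma compact_frontier: "compact (frontier D)"
 using bdd by (simp add: compact_frontier_bounded)

lemma H_linear: "x : U ==> bounded_linear (H x)"
 using G_deriv by (rule has_derivative_bounded_linear)

lemma ro_frontier:
 assumes "zt : frontier D"
 shows "ro zt = 0"
proof (rule antisym)
 have zt: "zt : U" "zt \<notin> D" "zt : closure D"
  using assms U(2) by (auto simp: frontier_eq)
 show "ro zt >= 0"
  using zt D_iff[of zt] by simp
 show "ro zt <= 0"
 proof (rule ccontr)
  assume "\<not> ro zt <= 0"
  have "isCont ro zt" by (rule has_derivative_continuous[OF ro_deriv[OF zt(1)]])
  then have "\<forall>\<^sub>F x in nhds zt. ro x > 0"
   using \<open>\<not> ro zt <= 0\<close> by (intro order_tendstoD(1)) (auto simp: continuous_at_imp_continuous_at_within isCont_def tendsto_nhds_iff)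
  moreover have "\<forall>\<^sub>F x in nhds zt. x : U"
   using U(1) zt(1) by (rule eventually_nhds_in_open)
  ultimately have "\<forall>\<^sub>F x in nhds zt. x : U & ro x > 0"
   by eventually_elim simp
  then obtain e where e: "e > 0" "!!x. dist x zt < e ==> x : U & ro x > 0"
   unfolding eventually_nhds_metric by blast
  then obtain y where y: "y : D" "dist y zt < e"
   using zt(3) by (meson closure_approachable)
  then have "y : U" "ro y > 0" using e by auto
  then show False using y D_iff[of y] by simp
 qed
qed

text \<open>By convexity the segment from \<open>zt\<close> to a point \<open>w\<close> of
  \<open>D\<close> runs inside \<open>D\<close>, where \<open>ro\<close> is negative, so its
  derivative at \<open>zt\<close> cannot be positive. Strictness follows by moving \<open>w\<close>
  a little along the gradient inside the open set \<open>D\<close>.\<close>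

lemma support:
 assumes zt: "zt : frontier D" and w: "w : D"
 shows "G zt \<bullet> (w - zt) < 0"
proof -
 have le: "G zt \<bullet> (w - zt) <= 0" if w: "w : D" for w
 proof (rule ccontr)
  assume "\<not> ?thesis"
  then have pos: "G zt \<bullet> (w - zt) > 0" by simp
  have "((%t. ro (zt + t *\<^sub>R (w - zt))) has_derivative (%t. G zt \<bullet> (t *\<^sub>R (w - zt)))) (at 0)"
   by (rule has_derivative_compose[where g = ro and g' = "%v. G zt \<bullet> v"])
     (auto intro!: derivative_eq_intros ro_deriv frontier_U zt)
  then have "((%t. ro (zt + t *\<^sub>R (w - zt))) has_real_derivative (G zt \<bullet> (w - zt))) (at 0)"
   unfolding has_field_derivative_def by (simp add: mult_commute_abs)
  from DERIV_pos_inc_right[OF this pos] obtain d where d: "d > 0"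
   "!!h. 0 < h ==> h < d ==> ro zt < ro (zt + h *\<^sub>R (w - zt))"
   by auto
  have "((%h. zt + h *\<^sub>R (w - zt)) \<longlongrightarrow> zt + 0 *\<^sub>R (w - zt)) (at_right 0)"
   by (intro tendsto_intros)
  then have "((%h. zt + h *\<^sub>R (w - zt)) \<longlongrightarrow> zt) (at_right 0)" by simp
  then have "\<forall>\<^sub>F h in at_right 0. zt + h *\<^sub>R (w - zt) : U"
   using U(1) frontier_U[OF zt] by (rule topological_tendstoD)
  then obtain c where c: "c > 0" "!!h. 0 < h ==> h < c ==> zt + h *\<^sub>R (w - zt) : U"
   unfolding eventually_at_right_field by auto
  define h where "h = min (min c d) 1 / 2"
  have h: "0 < h" "h < c" "h < d" "h <= 1" using c(1) d(1) by (auto simp: h_def min_def)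
  have "zt - h *\<^sub>R (zt - w) : interior D"
   using zt w opn h by (intro mem_interior_closure_convex_shrink[OF cvx]) (auto simp: interior_open frontier_eq)
  then have "zt + h *\<^sub>R (w - zt) : D"
   using opn by (simp add: interior_open algebra_simps)
  then have "ro (zt + h *\<^sub>R (w - zt)) < 0" using c(2)[OF h(1,2)] D_iff by blast
  then show False using d(2)[OF h(1,3)] ro_frontier[OF zt] by simp
 qed
 obtain e where e: "e > 0" "ball w e \<subseteq> D"
  using opn w by (auto simp: open_contains_ball)
 define c where "c = e / (2 * norm (G zt))"
 have c: "c > 0" using e G_ne[OF zt] by (simp add: c_def)
 have "w + c *\<^sub>R G zt : ball w e"
  using e G_ne[OF zt] by (simp add: c_def dist_norm)
 then have "G zt \<bullet> (w + c *\<^sub>R G zt - zt) <= 0" using e by (intro le) auto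
 then have "G zt \<bullet> (w - zt) + c * (G zt \<bullet> G zt) <= 0"
  by (simp add: inner_diff_right inner_add_right)
 moreover have "c * (G zt \<bullet> G zt) > 0" using c G_ne[OF zt] by simp
 ultimately show ?thesis by linarith
qed

lemma rot_D: "torus_rot a b z : D \<longleftrightarrow> z : D"
 using rh unfolding reinhardt_def by (metis torus_rot_inverse)

lemma rot_frontier:
 assumes "zt : frontier D"
 shows "torus_rot a b zt : frontier D"
proof -
 have "torus_rot a b ` closure D \<subseteq> closure D"
 proof (rule image_closure_subset)
  show "continuous_on (closure D) (torus_rot a b)"
   unfolding torus_rot_def[abs_def] by (intro continuous_intros)
  show "torus_rot a b ` D \<subseteq> closure D" using rot_D closure_subset by blast
 qed simp
 then show ?thesis using assms by (auto simp: frontier_eq rot_D)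
qed

text \<open>A rotation by \<open>pi\<close> puts \<open>(- z1, z2)\<close> into \<open>D\<close>,
  and the segment from there to \<open>(z1, z2)\<close> contains the shrunk point. Together with
  rotations this makes \<open>D\<close> a complete Reinhardt domain.\<close>

lemma shrink_fst:
 assumes "(z1, z2) : D" "0 <= t" "t <= 1"
 shows "(of_real t * z1, z2) : D"
proof -
 have "torus_rot pi 0 (z1, z2) : D" using assms(1) by (simp add: rot_D)
 then have "(- z1, z2) : D" by (simp add: torus_rot_def)
 then have "((1 + t) / 2) *\<^sub>R (z1, z2) + ((1 - t) / 2) *\<^sub>R (- z1, z2) : D"
  using assms by (intro convexD[OF cvx]) (auto simp: field_simps)
 moreover have "((1 + t) / 2) *\<^sub>R (z1, z2) + ((1 - t) / 2) *\<^sub>R (- z1, z2) = (of_real t * z1, z2)"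
  by (simp add: scaleR_conv_of_real field_simps)
 ultimately show ?thesis by simp
qed

lemma shrink_snd:
 assumes "(z1, z2) : D" "0 <= t" "t <= 1"
 shows "(z1, of_real t * z2) : D"
proof -
 have "torus_rot 0 pi (z1, z2) : D" using assms(1) by (simp add: rot_D)
 then have "(z1, - z2) : D" by (simp add: torus_rot_def)
 then have "((1 + t) / 2) *\<^sub>R (z1, z2) + ((1 - t) / 2) *\<^sub>R (z1, - z2) : D"
  using assms by (intro convexD[OF cvx]) (auto simp: field_simps)
 moreover have "((1 + t) / 2) *\<^sub>R (z1, z2) + ((1 - t) / 2) *\<^sub>R (z1, - z2) = (z1, of_real t * z2)"
  by (simp add: scaleR_conv_of_real field_simps)
 ultimately show ?thesis by simp
qed

lemma complete:
 assumes z: "(z1, z2) : D" and w: "norm w1 <= norm z1" "norm w2 <= norm z2"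
 shows "(w1, w2) : D"
proof -
 have *: "\<exists>t a. 0 <= t & t <= 1 & w = cis a * (of_real t * z)" if "norm w <= norm z" for w z :: complex
 proof (cases "z = 0")
  case True
  then show ?thesis using that by (intro exI[of _ 0]) auto
 next
  case False
  have "w = cis (Arg w - Arg z) * (of_real (norm w / norm z) * z)"
  proof -
   have "w = of_real (norm w) * cis (Arg w)" "z = of_real (norm z) * cis (Arg z)"
    by (metis rcis_cmod_Arg rcis_def)+
   then have "cis (Arg w - Arg z) * (of_real (norm w / norm z) * (of_real (norm z) * cis (Arg z))) = w"
    using False by (simp add: cis_mult mult_ac flip: cis_divide)
   then show ?thesis using \<open>z = _\<close> by simp
  qed
  then show ?thesis using that False by (intro exI[of _ "norm w / norm z"] exI[of _ "Arg w - Arg z"]) auto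
 qed
 obtain t1 a1 where 1: "0 <= t1" "t1 <= 1" "w1 = cis a1 * (of_real t1 * z1)" using *[OF w(1)] by blast
 obtain t2 a2 where 2: "0 <= t2" "t2 <= 1" "w2 = cis a2 * (of_real t2 * z2)" using *[OF w(2)] by blast
 have "torus_rot a1 a2 (of_real t1 * z1, of_real t2 * z2) : D"
  unfolding rot_D by (intro shrink_fst shrink_snd z 1 2)
 then show ?thesis by (simp add: torus_rot_def 1(3) 2(3))
qed

lemma zero_in: "(0, 0) : D"
proof -
 obtain z1 z2 where "(z1, z2) : D" using ne by fastforce
 then show ?thesis by (rule complete) auto
qed

lemma moduli: "z : D \<longleftrightarrow> (of_real (norm (fst z)), of_real (norm (snd z))) : D"
 using complete[of "fst z" "snd z" "of_real (norm (fst z))" "of_real (norm (snd z))"]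
  complete[of "of_real (norm (fst z))" "of_real (norm (snd z))" "fst z" "snd z"] by auto

text \<open>The inequality is strict because an open set does not attain the supremum; below the
  supremum completeness applies.\<close>

lemma profile_iff:
 assumes r: "(of_real r, 0) : D" and t: "0 <= t"
 shows "(of_real r, of_real t) : D \<longleftrightarrow> t < profile D r"
proof -
 let ?S = "{t. 0 <= t & (cr r, cr t) : D}"
 obtain B where B: "!!z. z : D ==> norm z <= B" using bdd by (auto simp: bounded_iff)
 have "t <= B" if "t : ?S" for t
  using B[of "(of_real r, of_real t)"] norm_snd_le[of "cr t" "cr r"] that by simp
 then have bd: "bdd_above ?S" by (auto simp: bdd_above_def)
 have ne: "?S ~= {}" using r by (auto intro: exI[of _ 0])
 show ?thesis
 proof
  assume tD: "(of_real r, of_real t) : D"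
  obtain e where e: "e > 0" "ball (cr r, cr t) e \<subseteq> D"
   using opn tD by (meson open_contains_ball)
  have "(cr r, cr (t + e/2)) : ball (cr r, cr t) e"
   using e by (simp add: dist_Pair_Pair dist_norm)
  then have "t + e / 2 : ?S" using e t by auto
  then have "t + e / 2 <= profile D r" unfolding profile_def by (rule cSup_upper[OF _ bd])
  then show "t < profile D r" using e by simp
 next
  assume "t < profile D r"
  then obtain t' where t': "t' : ?S" "t < t'" unfolding profile_def using less_cSup_iff[OF ne bd] by auto
  then have "(cr r, cr t') : D" by simp
  then show "(of_real r, of_real t) : D"
   by (rule complete) (use t t' in simp_all)
 qed
qed

text \<open>The hypotheses are symmetric under exchange of the coordinates. Everything about the
  axis z2 = 0 is obtained from the axis z1 = 0 in this way.\<close>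

lemma swapped: "C2_reinhardt (prod.swap ` D) (%x. ro (prod.swap x)) (%x. prod.swap (G (prod.swap x)))
  (%x v. prod.swap (H (prod.swap x) (prod.swap v))) (prod.swap ` U)"
proof -
 have lin: "linear (prod.swap :: C2 => C2)" by (rule linearI) auto
 have blin: "bounded_linear (prod.swap :: C2 => C2)" using lin by (simp add: linear_conv_bounded_linear)
 have sw: "(prod.swap has_derivative prod.swap) (at x)" for x :: C2
  by (rule bounded_linear_imp_has_derivative[OF blin])
 have inner: "prod.swap x \<bullet> y = x \<bullet> prod.swap y" for x y :: C2
  by (simp add: inner_prod_def)
 have inj: "inj (prod.swap :: C2 => C2)" by simp
 have surj: "surj (prod.swap :: C2 => C2)" by simp
 have oD: "open (prod.swap ` D)" using opn lin surj by (rule open_surjective_linear_image)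
 have fr: "frontier (prod.swap ` D) = prod.swap ` frontier D"
  unfolding frontier_eq using oD closure_injective_linear_image[OF lin inj, of D] inj
  by (simp add: frontier_def interior_open image_set_diff)
 have swU: "prod.swap x : U" if "x : prod.swap ` U" for x using that by auto
 show ?thesis
 proof
  show "open (prod.swap ` D)" by (rule oD)
  show "convex (prod.swap ` D)" by (rule convex_linear_image[OF lin cvx])
  show "bounded (prod.swap ` D)" by (rule bounded_linear_image[OF bdd blin])
  show "prod.swap ` D ~= {}" using ne by simp
  show "reinhardt (prod.swap ` D)"
   unfolding reinhardt_def
  proof (intro ballI allI)
   fix z a b assume "z : prod.swap ` D"
   then have "torus_rot b a (prod.swap z) : D" using rot_D by auto
   then have "prod.swap (torus_rot b a (prod.swap z)) : prod.swap ` D" by blast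
   then show "torus_rot a b z : prod.swap ` D" by (simp add: torus_rot_def)
  qed
  show "open (prod.swap ` U)" using U(1) lin surj by (rule open_surjective_linear_image)
  show "frontier (prod.swap ` D) \<subseteq> prod.swap ` U" unfolding fr using U(2) by blast
  fix x assume x: "x : prod.swap ` U"
  show "((%x. ro (prod.swap x)) has_derivative (%v. prod.swap (G (prod.swap x)) \<bullet> v)) (at x)"
   unfolding inner using has_derivative_compose[OF sw ro_deriv[OF swU[OF x]]] .
  show "((%x. prod.swap (G (prod.swap x))) has_derivative (%v. prod.swap (H (prod.swap x) (prod.swap v)))) (at x)"
   using has_derivative_compose[OF has_derivative_compose[OF sw G_deriv[OF swU[OF x]]] sw] .
 next
  fix v
  show "continuous_on (prod.swap ` U) (%x. prod.swap (H (prod.swap x) (prod.swap v)))"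
   by (intro continuous_on_compose2[OF linear_continuous_on[OF blin, of UNIV]]
      continuous_on_compose2[OF H_cont[of "prod.swap v"] linear_continuous_on[OF blin]]) auto
 next
  show "prod.swap ` D \<inter> prod.swap ` U = {x : prod.swap ` U. ro (prod.swap x) < 0}"
  proof -
   have "y : prod.swap ` A \<longleftrightarrow> prod.swap y : A" for y and A :: "C2 set" by force
   then show ?thesis using D_iff by (simp add: set_eq_iff) blast
  qed
 next
  fix zt assume zt: "zt : frontier (prod.swap ` D)"
  then have zt': "prod.swap zt : frontier D" unfolding fr by auto
  have sw0: "prod.swap x = 0 \<longleftrightarrow> x = 0" for x :: C2 by (cases x) (auto simp: prod_eq_iff)
  show "prod.swap (G (prod.swap zt)) ~= 0" using G_ne[OF zt'] by (simp add: sw0)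
  fix v assume "v ~= 0" "prod.swap (G (prod.swap zt)) \<bullet> v = 0"
  then show "0 < prod.swap (H (prod.swap zt) (prod.swap v)) \<bullet> v"
   using H_pos[OF zt', of "prod.swap v"] by (simp add: inner sw0)
 qed
qed

lemma frontier_swap: "frontier (prod.swap ` D) = prod.swap ` frontier D"
proof -
 interpret sw: C2_reinhardt "prod.swap ` D" "%x. ro (prod.swap x)" "%x. prod.swap (G (prod.swap x))"
  "%x v. prod.swap (H (prod.swap x) (prod.swap v))" "prod.swap ` U" by (rule swapped)
 have lin: "linear (prod.swap :: C2 => C2)" by (rule linearI) auto
 show ?thesis
  unfolding frontier_eq sw.frontier_eq using closure_injective_linear_image[OF lin, of D]
  by (simp add: image_set_diff)
qed

text \<open>The radius of \<open>D\<close> on the first axis, which is the height at 0 once the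
  coordinates are exchanged.\<close>

definition b1 :: real where "b1 = profile (prod.swap ` D) 0"
definition b2 :: real where "b2 = profile D 0"
text \<open>The function phi. It is studied on the symmetric interval around 0, where it is even, so
  that 0 is an interior point and the derivatives there are two-sided.\<close>

definition fy :: "real => real" where "fy = profile D"

lemma b1_iff: "0 <= r ==> (of_real r, 0) : D \<longleftrightarrow> r < b1"
proof -
 interpret sw: C2_reinhardt "prod.swap ` D" "%x. ro (prod.swap x)" "%x. prod.swap (G (prod.swap x))"
  "%x v. prod.swap (H (prod.swap x) (prod.swap v))" "prod.swap ` U" by (rule swapped)
 have sw: "(x, y) : prod.swap ` D \<longleftrightarrow> (y, x) : D" for x y by force
 assume "0 <= r"
 then show ?thesis
  using sw.profile_iff[of 0 r] zero_in unfolding b1_def by (simp add: sw)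
qed

lemma in_b1: "\<bar>x\<bar> < b1 ==> (of_real x, 0) : D"
 using b1_iff[of "\<bar>x\<bar>"] moduli[of "(of_real x, 0)"] by simp

lemma b1_pos: "0 < b1"
 using b1_iff[of 0] zero_in by simp

lemma fy_iff: "\<bar>x\<bar> < b1 ==> 0 <= t ==> (of_real x, of_real t) : D \<longleftrightarrow> t < fy x"
 unfolding fy_def by (rule profile_iff[OF in_b1])

lemma fy_pos: "\<bar>x\<bar> < b1 ==> 0 < fy x"
 using fy_iff[of x 0] in_b1 by simp

lemma b2_eq: "b2 = fy 0" by (simp add: b2_def fy_def)

lemma fy_frontier:
 assumes "\<bar>x\<bar> < b1"
 shows "(of_real x, of_real (fy x)) : frontier D"
proof -
 have "(of_real x, of_real (fy x)) \<notin> D" using fy_iff[OF assms] fy_pos[OF assms] by simp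
 moreover have "(of_real x, of_real (fy x)) : closure D"
 proof (subst closure_approachable, intro allI impI)
  fix e :: real assume e: "e > 0"
  define t where "t = max 0 (fy x - e / 2)"
  have "(cr x, cr t) : D"
   using fy_pos[OF assms] e by (subst fy_iff[OF assms]) (auto simp: t_def)
  moreover have "dist (cr x, cr t) (of_real x, of_real (fy x)) < e"
  proof -
   have "dist (cr t) (of_real (fy x)) = \<bar>t - fy x\<bar>"
    by (simp add: dist_norm flip: of_real_diff)
   also have "... < e" using e fy_pos[OF assms] by (auto simp: t_def)
   finally show ?thesis by (simp add: dist_Pair_Pair)
  qed
  ultimately show "\<exists>y\<in>D. dist y (of_real x, of_real (fy x)) < e" by blast
 qed
 ultimately show ?thesis by (simp add: frontier_eq)
qed

lemma fy_even: "\<bar>x\<bar> < b1 ==> fy (- x) = fy x"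
proof -
 have "(of_real (- x), of_real t) : D \<longleftrightarrow> (of_real x, of_real t) : D" for t
  by (subst (1 2) moduli) simp
 then show "fy (- x) = fy x" by (simp add: fy_def profile_def)
qed

text \<open>Concavity supplies the continuity that \<open>implicit_DERIV\<close> asks for. The
  factor \<open>l < 1\<close> moves the two boundary points into \<open>D\<close>, where convexity
  can be used.\<close>

lemma fy_concave: "convex_on {-b1<..<b1} (%x. - fy x)"
proof (rule convex_onI)
 fix t x y :: real assume t: "0 < t" "t < 1" and xy: "x : {-b1<..<b1}" "y : {-b1<..<b1}"
 let ?z = "(1 - t) *\<^sub>R x + t *\<^sub>R y"
 have "?z : {-b1<..<b1}" by (rule convexD[OF convex_real_interval(8) xy]) (use t in auto)
 then have z: "\<bar>?z\<bar> < b1" by auto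
 have x: "\<bar>x\<bar> < b1" and y: "\<bar>y\<bar> < b1" using xy by auto
 have "(1 - t) * fy x + t * fy y <= fy ?z"
 proof (rule field_le_mult_one_interval)
  fix l :: real assume l: "0 < l" "l < 1"
  have "(of_real x, of_real (l * fy x)) : D" "(of_real y, of_real (l * fy y)) : D"
   using fy_iff[OF x, of "l * fy x"] fy_iff[OF y, of "l * fy y"] fy_pos[OF x] fy_pos[OF y] l by auto
  then have "(1 - t) *\<^sub>R (of_real x, of_real (l * fy x)) + t *\<^sub>R (of_real y, of_real (l * fy y)) : D"
   using t by (intro convexD[OF cvx]) auto
  also have "(1 - t) *\<^sub>R (of_real x, of_real (l * fy x)) + t *\<^sub>R (of_real y, of_real (l * fy y)) =
    (cr ?z, cr (l * ((1 - t) * fy x + t * fy y)))"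
   by (simp add: scaleR_conv_of_real algebra_simps)
  finally have "l * ((1 - t) * fy x + t * fy y) < fy ?z"
   using fy_iff[OF z, of "l * ((1 - t) * fy x + t * fy y)"] l t fy_pos[OF x] fy_pos[OF y] by simp
  then show "l * ((1 - t) * fy x + t * fy y) <= fy ?z" by simp
 qed
 then show "- fy ?z <= (1 - t) * - fy x + t * - fy y" by simp
qed (rule convex_real_interval)

lemma fy_cont: "continuous_on {-b1<..<b1} fy"
 using continuous_on_minus[OF convex_on_continuous[OF _ fy_concave]] by simp

definition g1 :: "real => real" where "g1 x = Re (fst (G (of_real x, of_real (fy x))))"
definition g2 :: "real => real" where "g2 x = Re (snd (G (of_real x, of_real (fy x))))"
definition fy1 :: "real => real" where "fy1 x = - g1 x / g2 x"
text \<open>Differentiating \<open>ro = 0\<close> twice along the graph: the Hessian on the tangent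
  vector \<open>(1, fy1 x)\<close> plus \<open>g2 x * fy2 x\<close> is 0.\<close>

definition fy2 :: "real => real" where
 "fy2 x = - (H (of_real x, of_real (fy x)) (1, of_real (fy1 x)) \<bullet> (1, of_real (fy1 x))) / g2 x"

lemma g2_pos:
 assumes "\<bar>x\<bar> < b1"
 shows "0 < g2 x"
proof -
 have "G (of_real x, of_real (fy x)) \<bullet> ((of_real x, 0) - (of_real x, of_real (fy x))) < 0"
  by (rule support[OF fy_frontier[OF assms] in_b1[OF assms]])
 then have "0 < g2 x * fy x"
  by (simp add: g2_def inner_prod_def inner_complex_def)
 then show ?thesis using fy_pos[OF assms] by (simp add: zero_less_mult_iff)
qed

lemma fy_isCont: "\<bar>x\<bar> < b1 ==> isCont fy x"
 using fy_cont by (simp add: continuous_on_eq_continuous_at abs_less_iff)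

lemma eventually_b1: "\<bar>x\<bar> < b1 ==> \<forall>\<^sub>F y in nhds x. \<bar>y\<bar> < b1"
proof -
 assume "\<bar>x\<bar> < b1"
 then have "x : {-b1<..<b1}" by auto
 from eventually_nhds_in_open[OF open_greaterThanLessThan this] show ?thesis
  by eventually_elim auto
qed

lemma DERIV_fy:
 assumes x: "\<bar>x\<bar> < b1"
 shows "(fy has_real_derivative fy1 x) (at x)"
 unfolding fy1_def
proof (rule implicit_DERIV[where F = "%v. ro (of_real (fst v), of_real (snd v))"])
 have "((%v. (cr (fst v), cr (snd v))) has_derivative
   (%v. (cr (fst v), cr (snd v)))) (at (x, fy x))"
  by (auto intro!: derivative_eq_intros)
 from has_derivative_compose[OF this, of ro "%v. G (of_real x, of_real (fy x)) \<bullet> v"] ro_deriv[OF frontier_U[OF fy_frontier[OF x]]]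
 have "((%v. ro (of_real (fst v), of_real (snd v))) has_derivative
   (%v. G (of_real x, of_real (fy x)) \<bullet> (of_real (fst v), of_real (snd v)))) (at (x, fy x))"
  by simp
 then show "((%v. ro (of_real (fst v), of_real (snd v))) has_derivative (%v. g1 x * fst v + g2 x * snd v)) (at (x, fy x))"
  by (simp add: g1_def g2_def inner_prod_def inner_complex_def)
 show "g2 x ~= 0" using g2_pos[OF x] by simp
 show "isCont fy x" by (rule fy_isCont[OF x])
 show "ro (of_real (fst (x, fy x)), of_real (snd (x, fy x))) = 0"
  using ro_frontier[OF fy_frontier[OF x]] by simp
 show "\<forall>\<^sub>F y in at x. ro (of_real (fst (y, fy y)), of_real (snd (y, fy y))) = 0"
  using eventually_b1[OF x] unfolding eventually_at_filter
  by eventually_elim (simp add: ro_frontier fy_frontier)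
qed

lemma DERIV_g:
 assumes x: "\<bar>x\<bar> < b1"
 shows "(g1 has_real_derivative Re (fst (H (of_real x, of_real (fy x)) (1, of_real (fy1 x))))) (at x)"
  and "(g2 has_real_derivative Re (snd (H (of_real x, of_real (fy x)) (1, of_real (fy1 x))))) (at x)"
proof -
 let ?z = "%x. (cr x, cr (fy x))"
 have "(fy has_derivative (%h. fy1 x * h)) (at x)"
  using DERIV_fy[OF x] by (simp add: has_field_derivative_def)
 then have "(?z has_derivative (%h. (of_real h, of_real (fy1 x * h)))) (at x)"
  by (auto intro!: derivative_eq_intros)
 from has_derivative_compose[OF this G_deriv[OF frontier_U[OF fy_frontier[OF x]]]]
 have d: "((%x. G (?z x)) has_derivative (%h. H (?z x) (of_real h, of_real (fy1 x * h)))) (at x)" .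
 interpret H: bounded_linear "H (?z x)" by (rule H_linear[OF frontier_U[OF fy_frontier[OF x]]])
 have "H (?z x) (of_real h, of_real (fy1 x * h)) = h *\<^sub>R H (?z x) (1, of_real (fy1 x))" for h
  unfolding H.scaleR[symmetric] by (simp add: scaleR_conv_of_real mult.commute)
 with d have d: "((%x. G (?z x)) has_derivative (%h. h *\<^sub>R H (?z x) (1, of_real (fy1 x)))) (at x)" by simp
 have "((%x. Re (fst (G (?z x)))) has_derivative (%h. Re (fst (h *\<^sub>R H (?z x) (1, of_real (fy1 x)))))) (at x)"
  by (intro has_derivative_Re has_derivative_fst d)
 then show "(g1 has_real_derivative Re (fst (H (?z x) (1, of_real (fy1 x))))) (at x)"
  unfolding has_field_derivative_def g1_def[abs_def] by (simp add: mult_commute_abs)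
 have "((%x. Re (snd (G (?z x)))) has_derivative (%h. Re (snd (h *\<^sub>R H (?z x) (1, of_real (fy1 x)))))) (at x)"
  by (intro has_derivative_Re has_derivative_snd d)
 then show "(g2 has_real_derivative Re (snd (H (?z x) (1, of_real (fy1 x))))) (at x)"
  unfolding has_field_derivative_def g2_def[abs_def] by (simp add: mult_commute_abs)
qed

lemma DERIV_fy1:
 assumes x: "\<bar>x\<bar> < b1"
 shows "(fy1 has_real_derivative fy2 x) (at x)"
proof -
 let ?h = "H (of_real x, of_real (fy x)) (1, of_real (fy1 x))"
 have g2: "g2 x ~= 0" using g2_pos[OF x] by simp
 have "(fy1 has_real_derivative ((- Re (fst ?h)) * g2 x - (- g1 x) * Re (snd ?h)) / (g2 x * g2 x)) (at x)"
  unfolding fy1_def[abs_def] by (intro DERIV_divide DERIV_minus DERIV_g[unfolded fy1_def] x g2)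
 also have "((- Re (fst ?h)) * g2 x - (- g1 x) * Re (snd ?h)) / (g2 x * g2 x) = fy2 x"
  using g2 by (simp add: fy2_def inner_prod_def inner_complex_def) (simp add: fy1_def field_simps)
 finally show ?thesis .
qed

lemma fy2_neg:
 assumes x: "\<bar>x\<bar> < b1"
 shows "fy2 x < 0"
proof -
 have "0 < H (of_real x, of_real (fy x)) (1, of_real (fy1 x)) \<bullet> (1, of_real (fy1 x))"
 proof (rule H_pos[OF fy_frontier[OF x]])
  show "G (of_real x, of_real (fy x)) \<bullet> (1, of_real (fy1 x)) = 0"
   using g2_pos[OF x] by (simp add: inner_prod_def inner_complex_def g1_def[symmetric] g2_def[symmetric] fy1_def)
 qed (simp add: zero_prod_def)
 then show ?thesis using g2_pos[OF x] by (simp add: fy2_def divide_neg_pos)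
qed

lemma fy1_cont: "continuous_on {-b1<..<b1} fy1"
 by (rule DERIV_continuous_on[OF DERIV_fy1[THEN has_field_derivative_at_within]]) auto

lemma fy2_cont: "continuous_on {-b1<..<b1} fy2"
proof -
 let ?I = "{-b1<..<b1}"
 let ?z = "%x. (cr x, cr (fy x))"
 have z: "continuous_on ?I ?z" by (intro continuous_intros fy_cont)
 have zU: "?z ` ?I \<subseteq> U" using frontier_U fy_frontier by auto
 have Hz: "continuous_on ?I (%x. H (?z x) v)" for v
  by (rule continuous_on_compose2[OF H_cont z zU])
 have eq: "H (?z x) (1, of_real (fy1 x)) = H (?z x) (1, 0) + fy1 x *\<^sub>R H (?z x) (0, 1)" if "x : ?I" for x
 proof -
  interpret H: bounded_linear "H (?z x)" using that zU by (intro H_linear) auto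
  show ?thesis unfolding H.scaleR[symmetric] H.add[symmetric] by (simp add: scaleR_conv_of_real)
 qed
 have g2: "continuous_on ?I g2"
  by (rule DERIV_continuous_on[OF DERIV_g(2)[THEN has_field_derivative_at_within]]) auto
 have "continuous_on ?I (%x. - ((H (?z x) (1, 0) + fy1 x *\<^sub>R H (?z x) (0, 1)) \<bullet> (1, of_real (fy1 x))) / g2 x)"
 proof (intro continuous_intros Hz fy1_cont g2 ballI)
  fix x assume "x : ?I"
  then have "\<bar>x\<bar> < b1" by auto
  from g2_pos[OF this] show "g2 x ~= 0" by simp
 qed
 then show ?thesis
  by (rule continuous_on_eq) (simp add: fy2_def eq)
qed

lemma fy1_zero: "fy1 0 = 0"
proof -
 have "((%x. fy (- x)) has_real_derivative fy1 (- 0) * (- 1)) (at 0)"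
  by (rule DERIV_chain2[OF DERIV_fy]) (use b1_pos in \<open>auto intro!: derivative_eq_intros\<close>)
 moreover have "\<forall>\<^sub>F x in nhds 0. fy (- x) = fy x"
  using eventually_b1[of 0] b1_pos by (auto elim!: eventually_mono intro: fy_even)
 ultimately have "(fy has_real_derivative fy1 (- 0) * (- 1)) (at 0)"
  by (subst (asm) DERIV_cong_ev[OF refl _ refl]) auto
 moreover have "(fy has_real_derivative fy1 0) (at 0)"
  using b1_pos by (intro DERIV_fy) simp
 ultimately have "fy1 (- 0) * (- 1) = fy1 0"
  by (rule DERIV_unique)
 then show ?thesis by simp
qed

lemma fy1_neg:
 assumes "0 < x" "x < b1"
 shows "fy1 x < 0"
proof -
 have "\<exists>y. (fy1 has_real_derivative y) (at u) & y < 0" if "0 <= u" "u <= x" for u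
  using that assms DERIV_fy1[of u] fy2_neg[of u] by (intro exI[of _ "fy2 u"]) auto
 then have "fy1 x < fy1 0"
  by (intro DERIV_neg_imp_decreasing[OF assms(1)]) auto
 then show ?thesis by (simp add: fy1_zero)
qed

lemma deriv_fy: "\<bar>x\<bar> < b1 ==> deriv fy x = fy1 x"
 by (rule DERIV_imp_deriv[OF DERIV_fy])

lemma deriv2_fy:
 assumes x: "\<bar>x\<bar> < b1"
 shows "deriv (deriv fy) x = fy2 x"
proof (rule DERIV_imp_deriv)
 have "\<forall>\<^sub>F y in nhds x. deriv fy y = fy1 y"
  using eventually_b1[OF x] by eventually_elim (rule deriv_fy)
 then show "(deriv fy has_real_derivative fy2 x) (at x)"
  using DERIV_fy1[OF x] by (subst DERIV_cong_ev[OF refl _ refl]) auto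
qed

text \<open>A vertical segment in the boundary would be a direction in which the Hessian vanishes.\<close>

lemma frontier_fst_less:
 assumes zt: "zt : frontier D" and nz: "snd zt ~= 0"
 shows "norm (fst zt) < b1"
proof (rule ccontr)
 define r t where "r = norm (fst zt)" and "t = norm (snd zt)"
 assume "\<not> norm (fst zt) < b1"
 then have r: "r >= b1" by (simp add: r_def)
 have t: "t > 0" using nz by (simp add: t_def)
 have "torus_rot (- Arg (fst zt)) (- Arg (snd zt)) zt = (of_real r, of_real t)"
  unfolding torus_rot_def r_def t_def
  by (metis cis_rcis_eq mult.commute cis_mult cis_zero rcis_cmod_Arg rcis_def mult.assoc mult.right_neutral add.left_inverse)
 then have rt: "(of_real r, of_real t) : frontier D" using rot_frontier[OF zt] by metis
 have notin: "(cr r, cr u) \<notin> D" if "u >= 0" for u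
 proof
  assume "(cr r, cr u) : D"
  then have "(cr r, 0) : D" by (rule complete) auto
  then show False using b1_iff[of r] r b1_pos by simp
 qed
 have fr: "(cr r, cr u) : frontier D" if u: "0 <= u" "u <= t" for u
 proof -
  have "(%z. (fst z, of_real (u / t) * snd z)) ` closure D \<subseteq> closure D"
  proof (rule image_closure_subset)
   show "(%z. (fst z, of_real (u / t) * snd z)) ` D \<subseteq> closure D"
    using shrink_snd[of _ _ "u / t"] u t closure_subset by fastforce
  qed (use t in \<open>auto intro!: continuous_intros\<close>)
  moreover have "(of_real r, of_real t) : closure D" using rt by (simp add: frontier_eq)
  ultimately have "(cr r, cr (u / t) * of_real t) : closure D" by fastforce
  then show ?thesis using notin[of u] u t by (simp add: frontier_eq)
 qed
 let ?c = "%u. (cr r, cr u)"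
 have cd: "(?c has_derivative (%h. h *\<^sub>R (0, 1))) (at u)" for u
  by (auto intro!: derivative_eq_intros simp: scaleR_conv_of_real)
 have G0: "G (?c u) \<bullet> (0, 1) = 0" if u: "0 < u" "u < t" for u
 proof -
  have "((%u. ro (?c u)) has_derivative (%h. G (?c u) \<bullet> (h *\<^sub>R (0, 1)))) (at u)"
   using u by (intro has_derivative_compose[OF cd] ro_deriv frontier_U fr) auto
  then have "((%u. ro (?c u)) has_real_derivative G (?c u) \<bullet> (0, 1)) (at u)"
   by (simp only: has_field_derivative_def inner_scaleR_right mult_commute_abs)
  moreover have "\<forall>\<^sub>F v in nhds u. ro (?c v) = 0"
   using eventually_nhds_in_open[of "{0<..<t}" u] u by (auto elim!: eventually_mono intro!: ro_frontier fr)
  ultimately have "((%u. 0) has_real_derivative G (?c u) \<bullet> (0, 1)) (at u)"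
   by (subst (asm) DERIV_cong_ev[OF refl _ refl]) auto
  then show ?thesis using DERIV_unique[OF _ DERIV_const] by blast
 qed
 let ?u = "t / 2"
 have u: "0 < ?u" "?u < t" using t by auto
 have "((%u. G (?c u) \<bullet> (0, 1)) has_derivative (%h. H (?c ?u) (h *\<^sub>R (0, 1)) \<bullet> (0, 1))) (at ?u)"
  using u by (intro has_derivative_inner_left has_derivative_compose[OF cd] G_deriv frontier_U fr) auto
 moreover have "H (?c ?u) (h *\<^sub>R (0, 1)) = h *\<^sub>R H (?c ?u) (0, 1)" for h
  using H_linear[OF frontier_U[OF fr[of ?u]]] u by (intro linear_simps(5)) auto
 ultimately have "((%u. G (?c u) \<bullet> (0, 1)) has_real_derivative H (?c ?u) (0, 1) \<bullet> (0, 1)) (at ?u)"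
  by (simp only: has_field_derivative_def inner_scaleR_left mult_commute_abs)
 moreover have "\<forall>\<^sub>F v in nhds ?u. G (?c v) \<bullet> (0, 1) = 0"
  using eventually_nhds_in_open[of "{0<..<t}" ?u] u by (auto elim!: eventually_mono intro!: G0)
 ultimately have "((%u. 0) has_real_derivative H (?c ?u) (0, 1) \<bullet> (0, 1)) (at ?u)"
  by (subst (asm) DERIV_cong_ev[OF refl _ refl]) auto
 then have "H (?c ?u) (0, 1) \<bullet> (0, 1) = 0" using DERIV_unique[OF _ DERIV_const] by blast
 moreover have "0 < H (?c ?u) (0, 1) \<bullet> (0, 1)"
  using u by (intro H_pos fr G0) (auto simp: zero_prod_def)
 ultimately show False by simp
qed

lemma frontier_snd_eq:
 assumes zt: "zt : frontier D" and r: "norm (fst zt) < b1"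
 shows "norm (snd zt) = fy (norm (fst zt))"
proof (rule antisym)
 have r': "\<bar>norm (fst zt)\<bar> < b1" using r by simp
 have "zt \<notin> D" using zt by (rule frontier_notin)
 then show "fy (norm (fst zt)) <= norm (snd zt)"
  using fy_iff[OF r', of "norm (snd zt)"] moduli[of zt] by (simp add: not_less)
 have ztc: "zt : closure D" using zt by (simp add: frontier_eq)
 have "norm (snd z) <= fy (norm (fst z))" if "z : D" "norm (fst z) < b1" for z
  using fy_iff[of "norm (fst z)" "norm (snd z)"] moduli[of z] that by simp
 moreover have "norm (fst z) < b1" if "z : D" for z
  using b1_iff[of "norm (fst z)"] complete[of "fst z" "snd z" "of_real (norm (fst z))" 0] that by simp
 ultimately have le: "norm (snd z) <= fy (norm (fst z))" if "z : D" for z using that by blast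
 obtain w where w: "!!k. w k : D" "w ---> zt"
  using ztc unfolding closure_sequential by blast
 have "(%k. norm (snd (w k))) ---> norm (snd zt)" by (intro tendsto_intros w)
 moreover have "(%k. fy (norm (fst (w k)))) ---> fy (norm (fst zt))"
  by (intro isCont_tendsto_compose[OF fy_isCont[OF r']] tendsto_intros w)
 ultimately show "norm (snd zt) <= fy (norm (fst zt))"
  using le w(1) by (intro LIMSEQ_le) auto
qed

end

section \<open>The functions s and p of the radius\<close>

context C2_reinhardt
begin

definition Sf :: "real => real" where "Sf r = - r * fy1 r / (fy r - r * fy1 r)"
definition Pf :: "real => real" where
 "Pf r = 1 + r * fy r * fy2 r / (fy1 r * (fy r - r * fy1 r))"

lemma den_pos:
 assumes "0 <= r" "r < b1"
 shows "0 < fy r - r * fy1 r"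
proof (cases "r = 0")
 case True
 then show ?thesis using fy_pos[of 0] b1_pos by simp
next
 case False
 then have "fy1 r < 0" using assms by (intro fy1_neg) auto
 then have "r * fy1 r <= 0" using assms by (simp add: mult_nonneg_nonpos)
 then show ?thesis using fy_pos[of r] assms by simp
qed

lemma Sf_range:
 assumes "0 < r" "r < b1"
 shows "0 < Sf r" "Sf r < 1"
proof -
 have "fy1 r < 0" using assms by (rule fy1_neg)
 then have "r * fy1 r < 0" using assms by (simp add: mult_pos_neg)
 moreover have "fy r > 0" using assms by (intro fy_pos) simp
 moreover have d: "0 < fy r - r * fy1 r" using assms by (intro den_pos) auto
 ultimately show "0 < Sf r" by (simp add: Sf_def divide_neg_pos)
 show "Sf r < 1" unfolding Sf_def using \<open>fy r > 0\<close> by (subst pos_divide_less_eq[OF d]) simp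
qed

lemma Pf_gt:
 assumes "0 < r" "r < b1"
 shows "1 < Pf r"
proof -
 have "fy1 r < 0" using assms by (rule fy1_neg)
 moreover have "fy r > 0" "fy2 r < 0" using assms by (intro fy_pos fy2_neg, simp)+
 ultimately have "0 < r * fy r * fy2 r / (fy1 r * (fy r - r * fy1 r))"
  using den_pos[of r] assms by (intro divide_neg_neg mult_pos_neg mult_neg_pos mult_pos_pos) auto
 then show ?thesis by (simp add: Pf_def)
qed

lemma Sf_deriv_eq:
 assumes "0 < r" "r < b1"
 shows "Pf r * Sf r / r = (- r * fy r * fy2 r - fy1 r * (fy r - r * fy1 r)) / (fy r - r * fy1 r)\<^sup>2"
proof -
 define d where "d = fy r - r * fy1 r"
 have "d ~= 0" "fy1 r ~= 0" "r ~= 0"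
  using den_pos[of r] fy1_neg[of r] assms by (auto simp: d_def)
 then show ?thesis
  unfolding Pf_def Sf_def d_def[symmetric] by (simp add: field_simps power2_eq_square)
qed

text \<open>Thus p is the derivative of log s with respect to log r, as for the model in which s is
  a multiple of the p-th power of r.\<close>

lemma DERIV_Sf:
 assumes "0 < r" "r < b1"
 shows "(Sf has_real_derivative Pf r * Sf r / r) (at r)"
proof -
 have r: "\<bar>r\<bar> < b1" using assms by simp
 have d: "fy r - r * fy1 r ~= 0" using den_pos[of r] assms by simp
 have "((%r. - (r * fy1 r) / (fy r - r * fy1 r)) has_real_derivative
   ((- (1 * fy1 r + fy2 r * r)) * (fy r - r * fy1 r) - (- (r * fy1 r)) * (fy1 r - (1 * fy1 r + fy2 r * r))) /
    ((fy r - r * fy1 r) * (fy r - r * fy1 r))) (at r)"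
  by (intro DERIV_divide DERIV_minus DERIV_diff DERIV_mult DERIV_ident DERIV_fy DERIV_fy1 r d)
 also have "((- (1 * fy1 r + fy2 r * r)) * (fy r - r * fy1 r) - (- (r * fy1 r)) * (fy1 r - (1 * fy1 r + fy2 r * r))) /
    ((fy r - r * fy1 r) * (fy r - r * fy1 r)) = Pf r * Sf r / r"
  unfolding Sf_deriv_eq[OF assms] by (simp add: power2_eq_square algebra_simps)
 finally show ?thesis unfolding Sf_def[abs_def] by simp
qed

lemma DERIV_Sf_pos: "0 < r ==> r < b1 ==> 0 < Pf r * Sf r / r"
 using Pf_gt[of r] Sf_range[of r] by simp

lemma Sf_strict_mono:
 assumes "0 < x" "x < y" "y < b1"
 shows "Sf x < Sf y"
proof (rule DERIV_pos_imp_increasing[OF assms(2)])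
 fix u assume "x <= u" "u <= y"
 then have "0 < u" "u < b1" using assms by auto
 then show "\<exists>d. DERIV Sf u :> d & 0 < d" using DERIV_Sf DERIV_Sf_pos by blast
qed

lemma Sf_less_iff: "0 < x ==> x < b1 ==> 0 < y ==> y < b1 ==> Sf x < Sf y \<longleftrightarrow> x < y"
 using Sf_strict_mono[of x y] Sf_strict_mono[of y x] by (cases x y rule: linorder_cases) auto

lemma Sf_inj: "inj_on Sf {0<..<b1}"
 by (rule inj_onI) (metis Sf_less_iff greaterThanLessThan_iff less_irrefl linorder_neqE_linordered_idom)

lemma fy_strict_antimono:
 assumes "0 < x" "x < y" "y < b1"
 shows "fy y < fy x"
proof (rule DERIV_neg_imp_decreasing[OF assms(2)])
 fix u assume "x <= u" "u <= y"
 then have "0 < u" "u < b1" using assms by auto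
 then show "\<exists>d. DERIV fy u :> d & d < 0" using DERIV_fy[of u] fy1_neg[of u] by auto
qed

lemma Pf_cont: "continuous_on {0<..<b1} Pf"
proof -
 have sub: "{0<..<b1} \<subseteq> {-b1<..<b1}" using b1_pos by auto
 have "fy1 r * (fy r - r * fy1 r) ~= 0" if "r : {0<..<b1}" for r
  using that den_pos[of r] fy1_neg[of r] by auto
 then show ?thesis
  unfolding Pf_def[abs_def]
  by (intro continuous_intros continuous_on_subset[OF fy_cont sub] continuous_on_subset[OF fy1_cont sub]
    continuous_on_subset[OF fy2_cont sub] ballI)
qed

definition c0 :: real where "c0 = - fy2 0 / fy 0"

lemma c0_pos: "0 < c0"
 using fy2_neg[of 0] fy_pos[of 0] b1_pos by (simp add: c0_def divide_neg_pos)

text \<open>By symmetry \<open>fy1\<close> vanishes at 0, and the quotient \<open>fy1 r / r\<close>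
  tends to \<open>fy2 0 < 0\<close>; dividing by \<open>r\<close> removes the indeterminacy in both
  expressions. The value 2 is the one that \<open>osc_exponent\<close> has on the axes.\<close>

lemma limits_at_0:
 shows "((%r. Sf r / r\<^sup>2) \<longlongrightarrow> c0) (at_right 0)" "(Pf \<longlongrightarrow> 2) (at_right 0)"
proof -
 have b0: "\<bar>0::real\<bar> < b1" using b1_pos by simp
 have "((%h. (fy1 (0 + h) - fy1 0) / h) \<longlongrightarrow> fy2 0) (at 0)"
  using DERIV_fy1[OF b0] by (simp add: DERIV_def)
 then have q: "((%h. fy1 h / h) \<longlongrightarrow> fy2 0) (at_right 0)"
  by (simp add: fy1_zero filterlim_at_split)
 have c: "(f \<longlongrightarrow> f 0) (at_right 0)" if "continuous_on {-b1<..<b1} f" for f :: "real => real"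
 proof -
  have "isCont f 0" using that b1_pos by (simp add: continuous_on_eq_continuous_at)
  then show ?thesis by (simp add: isCont_def filterlim_at_split)
 qed
 note fyc = c[OF fy_cont] and fy1c = c[OF fy1_cont] and fy2c = c[OF fy2_cont]
 have d: "((%r. fy r - r * fy1 r) \<longlongrightarrow> fy 0 - 0 * fy1 0) (at_right 0)"
  by (intro tendsto_intros fyc fy1c)
 have p0: "fy 0 > 0" "fy2 0 < 0" using fy_pos[OF b0] fy2_neg[OF b0] by auto
 have ev: "\<forall>\<^sub>F r in at_right 0. 0 < r & r < b1"
  using b1_pos by (auto simp: eventually_at_right_field)
 have "((%r. - (fy1 r / r) / (fy r - r * fy1 r)) \<longlongrightarrow> - fy2 0 / (fy 0 - 0 * fy1 0)) (at_right 0)"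
  using p0 by (intro tendsto_intros q d) auto
 then have "((%r. - (fy1 r / r) / (fy r - r * fy1 r)) \<longlongrightarrow> c0) (at_right 0)"
  by (simp add: c0_def)
 moreover have "\<forall>\<^sub>F r in at_right 0. - (fy1 r / r) / (fy r - r * fy1 r) = Sf r / r\<^sup>2"
  using ev by eventually_elim (simp add: Sf_def power2_eq_square)
 ultimately show "((%r. Sf r / r\<^sup>2) \<longlongrightarrow> c0) (at_right 0)"
  by (rule Lim_transform_eventually)
 have "((%r. 1 + fy r * fy2 r / ((fy1 r / r) * (fy r - r * fy1 r))) \<longlongrightarrow>
   1 + fy 0 * fy2 0 / (fy2 0 * (fy 0 - 0 * fy1 0))) (at_right 0)"
  using p0 by (intro tendsto_intros q d fyc fy2c) auto
 then have "((%r. 1 + fy r * fy2 r / ((fy1 r / r) * (fy r - r * fy1 r))) \<longlongrightarrow> 2) (at_right 0)"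
  using p0 by simp
 moreover have "\<forall>\<^sub>F r in at_right 0. 1 + fy r * fy2 r / ((fy1 r / r) * (fy r - r * fy1 r)) = Pf r"
  using ev by eventually_elim (simp add: Pf_def mult_ac)
 ultimately show "(Pf \<longlongrightarrow> 2) (at_right 0)"
  by (rule Lim_transform_eventually)
qed

lemma Sf_tendsto_0: "(Sf \<longlongrightarrow> 0) (at_right 0)"
proof -
 have "((%r. Sf r / r\<^sup>2 * r\<^sup>2) \<longlongrightarrow> c0 * 0\<^sup>2) (at_right 0)"
  by (intro tendsto_intros limits_at_0)
 moreover have "\<forall>\<^sub>F r::real in at_right 0. Sf r / r\<^sup>2 * r\<^sup>2 = Sf r"
  by (auto simp: eventually_at_right_field intro!: exI[of _ 1])
 ultimately show ?thesis by (simp add: tendsto_cong)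
qed

end

section \<open>Exchange of the coordinates and inversion of s\<close>

locale C2_reinhardt_pair = C2_reinhardt +
 sw: C2_reinhardt "prod.swap ` D" "%x. ro (prod.swap x)" "%x. prod.swap (G (prod.swap x))"
  "%x v. prod.swap (H (prod.swap x) (prod.swap v))" "prod.swap ` U"

lemma (in C2_reinhardt) pair: "C2_reinhardt_pair D ro G H U"
 by (intro C2_reinhardt_pair.intro C2_reinhardt_axioms swapped)

context C2_reinhardt_pair
begin

lemma sw_b: "sw.b1 = b2" "sw.b2 = b1"
 by (simp_all add: sw.b1_def b2_def sw.b2_def b1_def image_image)

lemma b2_pos: "0 < b2"
 using sw.b1_pos by (simp add: sw_b)

lemma fy_inverse:
 assumes r: "0 < r" "r < b1"
 shows "0 < fy r" "fy r < b2" "sw.fy (fy r) = r"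
proof -
 have r': "\<bar>r\<bar> < b1" using r by simp
 show p: "0 < fy r" by (rule fy_pos[OF r'])
 have "prod.swap (cr r, cr (fy r)) : prod.swap ` frontier D"
  using fy_frontier[OF r'] by (rule imageI)
 then have fr: "(cr (fy r), cr r) : frontier (prod.swap ` D)"
  by (simp add: frontier_swap)
 show less: "fy r < b2" using sw.frontier_fst_less[OF fr] r p by (simp add: sw_b)
 show "sw.fy (fy r) = r" using sw.frontier_snd_eq[OF fr] r p less by (simp add: sw_b)
qed

lemma ch_inverse:
 assumes t: "0 < t" "t < b2"
 shows "0 < sw.fy t" "sw.fy t < b1" "fy (sw.fy t) = t"
proof -
 have t': "\<bar>t\<bar> < sw.b1" using t by (simp add: sw_b)
 show p: "0 < sw.fy t" by (rule sw.fy_pos[OF t'])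
 have "(cr t, cr (sw.fy t)) : prod.swap ` frontier D"
  using sw.fy_frontier[OF t'] by (simp add: frontier_swap)
 then have fr: "(cr (sw.fy t), cr t) : frontier D"
  by force
 show less: "sw.fy t < b1" using frontier_fst_less[OF fr] t p by simp
 show "fy (sw.fy t) = t" using frontier_snd_eq[OF fr] t p less by simp
qed

lemma sw_derivs:
 assumes r: "0 < r" "r < b1"
 shows "sw.fy1 (fy r) * fy1 r = 1" "sw.fy2 (fy r) * fy1 r * fy1 r + fy2 r * sw.fy1 (fy r) = 0"
proof -
 have 1: "sw.fy1 (fy x) * fy1 x = 1" if x: "0 < x" "x < b1" for x
 proof -
  have x': "\<bar>x\<bar> < b1" "\<bar>fy x\<bar> < sw.b1" using x fy_inverse[OF x] by (auto simp: sw_b)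
  have "((%x. sw.fy (fy x)) has_real_derivative sw.fy1 (fy x) * fy1 x) (at x)"
   by (rule DERIV_chain2[OF sw.DERIV_fy[OF x'(2)] DERIV_fy[OF x'(1)]])
  moreover have "\<forall>\<^sub>F y in nhds x. sw.fy (fy y) = y"
  proof -
   have "x : {0<..<b1}" using x by simp
   from eventually_nhds_in_open[OF open_greaterThanLessThan this] show ?thesis
    by eventually_elim (simp add: fy_inverse)
  qed
  ultimately have "((%x. x) has_real_derivative sw.fy1 (fy x) * fy1 x) (at x)"
   by (subst (asm) DERIV_cong_ev[OF refl _ refl]) auto
  then show ?thesis using DERIV_unique[OF _ DERIV_ident] by blast
 qed
 show "sw.fy1 (fy r) * fy1 r = 1" by (rule 1[OF r])
 have r': "\<bar>r\<bar> < b1" "\<bar>fy r\<bar> < sw.b1" using r fy_inverse[OF r] by (auto simp: sw_b)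
 have "((%x. sw.fy1 (fy x) * fy1 x) has_real_derivative
   (sw.fy2 (fy r) * fy1 r) * fy1 r + fy2 r * sw.fy1 (fy r)) (at r)"
  by (intro DERIV_mult DERIV_chain2[OF sw.DERIV_fy1[OF r'(2)] DERIV_fy[OF r'(1)]] DERIV_fy1[OF r'(1)])
 moreover have "\<forall>\<^sub>F x in nhds r. sw.fy1 (fy x) * fy1 x = 1"
 proof -
  have "r : {0<..<b1}" using r by simp
  from eventually_nhds_in_open[OF open_greaterThanLessThan this] show ?thesis
   by eventually_elim (simp add: 1)
 qed
 ultimately have "((%x. 1) has_real_derivative (sw.fy2 (fy r) * fy1 r) * fy1 r + fy2 r * sw.fy1 (fy r)) (at r)"
  by (subst (asm) DERIV_cong_ev[OF refl _ refl]) auto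
 then show "sw.fy2 (fy r) * fy1 r * fy1 r + fy2 r * sw.fy1 (fy r) = 0"
  using DERIV_unique[OF _ DERIV_const] by blast
qed

text \<open>\<open>sw.fy\<close> is the inverse function of \<open>fy\<close>. Inserting its first
  two derivatives shows that the exchange replaces s by 1 - s and leaves p alone.\<close>

lemma sw_SP:
 assumes r: "0 < r" "r < b1"
 shows "sw.Sf (fy r) = 1 - Sf r" "sw.Pf (fy r) = Pf r"
proof -
 define f f1 f2 x1 x2 d where "f = fy r" and "f1 = fy1 r" and "f2 = fy2 r" and "x1 = sw.fy1 (fy r)"
  and "x2 = sw.fy2 (fy r)" and "d = f - r * f1"
 have nz: "d ~= 0" "f1 ~= 0" "r ~= 0" "f ~= 0"
  using den_pos[of r] fy1_neg[of r] fy_inverse[OF r] r by (auto simp: d_def f_def f1_def)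
 have x1: "x1 = 1 / f1" using sw_derivs(1)[OF r] nz by (simp add: x1_def f1_def field_simps)
 have "x2 * f1 * f1 = - f2 * x1" using sw_derivs(2)[OF r] by (simp add: x1_def x2_def f1_def f2_def)
 then have x2: "x2 = - f2 / (f1 * f1 * f1)" using nz by (simp add: x1 field_simps)
 have d': "r - f * x1 = - d / f1" using nz by (simp add: x1 d_def field_simps)
 have "sw.Sf (fy r) = - f * x1 / (r - f * x1)"
  using fy_inverse(3)[OF r] by (simp add: sw.Sf_def f_def x1_def)
 also have "... = f / d" using nz unfolding d' by (simp add: x1)
 also have "... = 1 - Sf r" using nz unfolding Sf_def f_def[symmetric] f1_def[symmetric] d_def[symmetric]
  by (simp add: field_simps d_def)
 finally show "sw.Sf (fy r) = 1 - Sf r" .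
 have "sw.Pf (fy r) = 1 + f * r * x2 / (x1 * (r - f * x1))"
  using fy_inverse(3)[OF r] by (simp add: sw.Pf_def f_def x1_def x2_def)
 also have "... = 1 + r * f * f2 / (f1 * d)"
  using nz unfolding d' by (simp add: x1 x2 field_simps)
 finally show "sw.Pf (fy r) = Pf r" by (simp add: Pf_def f_def f1_def f2_def d_def)
qed

text \<open>Small values occur near the first axis; values near 1 are one minus the small values of
  the exchanged domain. The intermediate value theorem does the rest.\<close>

lemma Sf_surj:
 assumes s: "0 < s" "s < 1"
 shows "\<exists>r. 0 < r & r < b1 & Sf r = s"
proof -
 have "\<forall>\<^sub>F r in at_right 0. Sf r < s" by (rule order_tendstoD(2)[OF Sf_tendsto_0 s(1)])
 moreover have "\<forall>\<^sub>F r in at_right 0. r < b1" using b1_pos by (auto simp: eventually_at_right_field)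
 moreover have "\<forall>\<^sub>F r in at_right 0. (0::real) < r" by (auto simp: eventually_at_right_field intro: exI[of _ 1])
 ultimately have "\<forall>\<^sub>F r in at_right 0. Sf r < s & 0 < r & r < b1" by eventually_elim simp
 from eventually_happens[OF this] obtain x where x: "Sf x < s" "0 < x" "x < b1" by auto
 have "\<forall>\<^sub>F t in at_right 0. sw.Sf t < 1 - s" by (rule order_tendstoD(2)[OF sw.Sf_tendsto_0]) (use s in simp)
 moreover have "\<forall>\<^sub>F t in at_right 0. t < b2" using b2_pos by (auto simp: eventually_at_right_field)
 moreover have "\<forall>\<^sub>F r in at_right 0. (0::real) < r" by (auto simp: eventually_at_right_field intro: exI[of _ 1])
 ultimately have "\<forall>\<^sub>F t in at_right 0. sw.Sf t < 1 - s & 0 < t & t < b2" by eventually_elim simp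
 from eventually_happens[OF this] obtain t where t: "sw.Sf t < 1 - s" "0 < t" "t < b2" by auto
 define y where "y = sw.fy t"
 have y: "0 < y" "y < b1" "fy y = t" using ch_inverse[OF t(2,3)] by (auto simp: y_def)
 then have sy: "s < Sf y" using sw_SP(1)[of y] t by simp
 then have "x < y" using Sf_less_iff[of x y] x y by simp
 have "continuous_on {x..y} Sf"
  by (rule DERIV_continuous_on[OF DERIV_Sf[THEN has_field_derivative_at_within]]) (use x y in auto)
 from IVT'[OF _ _ _ this, of s] obtain z where "x <= z" "z <= y" "Sf z = s"
  using x sy \<open>x < y\<close> by auto
 then show ?thesis using x y by (intro exI[of _ z]) auto
qed

section \<open>The boundary curve parametrized by s\<close>

definition ri :: "real => real" where "ri = inv_into {0<..<b1} Sf"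

lemma ri:
 assumes "0 < s" "s < 1"
 shows "0 < ri s" "ri s < b1" "Sf (ri s) = s"
proof -
 have "s : Sf ` {0<..<b1}" using Sf_surj[OF assms] by auto
 from inv_into_into[OF this] f_inv_into_f[OF this] show "0 < ri s" "ri s < b1" "Sf (ri s) = s"
  by (auto simp: ri_def)
qed

lemma ri_Sf: "0 < r ==> r < b1 ==> ri (Sf r) = r"
 unfolding ri_def by (rule inv_into_f_f[OF Sf_inj]) simp

lemma ri_less_iff: "0 < s ==> s < 1 ==> 0 < s' ==> s' < 1 ==> ri s < ri s' \<longleftrightarrow> s < s'"
 using Sf_less_iff[of "ri s" "ri s'"] ri by simp

lemma ri_tendsto_0: "(ri \<longlongrightarrow> 0) (at_right 0)"
proof (rule tendstoI)
 fix e :: real assume e: "e > 0"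
 define x where "x = min e b1 / 2"
 have x: "0 < x" "x < b1" "x < e" using e b1_pos by (auto simp: x_def min_def)
 show "\<forall>\<^sub>F s in at_right 0. dist (ri s) 0 < e"
  unfolding eventually_at_right_field
 proof (intro exI[of _ "Sf x"] conjI allI impI)
  fix s assume "0 < s" "s < Sf x"
  moreover have "Sf x < 1" using Sf_range[OF x(1,2)] by simp
  ultimately have s: "0 < s" "s < 1" by auto
  have "ri s < x" using ri_less_iff[OF s, of "Sf x"] \<open>s < Sf x\<close> Sf_range[OF x(1,2)] ri_Sf[OF x(1,2)] by simp
  then show "dist (ri s) 0 < e" using ri[OF s] x by simp
 qed (rule Sf_range[OF x(1,2)])
qed

lemma ri_at_right: "filterlim ri (at_right 0) (at_right 0)"
proof -
 have "\<forall>\<^sub>F s in at_right 0. ri s > 0"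
  unfolding eventually_at_right_field using ri by (intro exI[of _ 1]) auto
 then show ?thesis using ri_tendsto_0 by (rule tendsto_imp_filterlim_at_right[rotated])
qed

lemma fyri_at_left: "filterlim (%s. fy (ri s)) (at_right 0) (at_left 1)"
proof (rule tendsto_imp_filterlim_at_right)
 show "((%s. fy (ri s)) \<longlongrightarrow> 0) (at_left 1)"
 proof (rule tendstoI)
  fix e :: real assume e: "e > 0"
  define t where "t = min e b2 / 2"
  have t: "0 < t" "t < b2" "t < e" using e b2_pos by (auto simp: t_def min_def)
  define x where "x = sw.fy t"
  have x: "0 < x" "x < b1" "fy x = t" using ch_inverse[OF t(1,2)] by (auto simp: x_def)
  show "\<forall>\<^sub>F s in at_left 1. dist (fy (ri s)) 0 < e"
   unfolding eventually_at_left_field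
  proof (intro exI[of _ "Sf x"] conjI allI impI)
   fix s assume "Sf x < s" "s < 1"
   moreover have "0 < Sf x" using Sf_range[OF x(1,2)] by simp
   ultimately have s: "0 < s" "s < 1" by auto
   have "x < ri s" using ri_less_iff[OF _ _ s, of "Sf x"] \<open>Sf x < s\<close> Sf_range[OF x(1,2)] ri_Sf[OF x(1,2)] by simp
   then have "fy (ri s) < t" using fy_strict_antimono[OF x(1) _ ri(2)[OF s]] x by simp
   then show "dist (fy (ri s)) 0 < e" using t fy_inverse(1)[OF ri(1,2)[OF s]] by simp
  qed (rule Sf_range[OF x(1,2)])
 qed
 show "\<forall>\<^sub>F s in at_left 1. fy (ri s) > 0"
  unfolding eventually_at_left_field using fy_inverse(1)[OF ri(1,2)] by (intro exI[of _ 0]) auto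
qed

lemma DERIV_ri:
 assumes s: "0 < s" "s < 1"
 shows "(ri has_real_derivative ri s / (Pf (ri s) * s)) (at s)"
proof -
 note r = ri[OF s]
 have "((inverse (Pf (ri s) * Sf (ri s) / ri s)) = ri s / (Pf (ri s) * s))"
  using r by (simp add: field_simps)
 moreover have "(ri has_real_derivative inverse (Pf (ri s) * Sf (ri s) / ri s)) (at (Sf (ri s)))"
  unfolding has_field_derivative_def
 proof (rule has_derivative_inverse_strong[where S = "{0<..<b1}" and f = Sf])
  show "continuous_on {0<..<b1} Sf"
   by (rule DERIV_continuous_on[OF DERIV_Sf[THEN has_field_derivative_at_within]]) auto
  show "(Sf has_derivative (*) (Pf (ri s) * Sf (ri s) / ri s)) (at (ri s))"
   using DERIV_Sf[OF r(1,2)] by (simp add: has_field_derivative_def)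
  show "(*) (Pf (ri s) * Sf (ri s) / ri s) \<circ> (*) (inverse (Pf (ri s) * Sf (ri s) / ri s)) = id"
   using DERIV_Sf_pos[OF r(1,2)] by (auto simp: fun_eq_iff)
  show "ri s : {0<..<b1}" using r by auto
  show "!!z. z : {0<..<b1} ==> ri (Sf z) = z" using ri_Sf by auto
 qed simp
 ultimately show ?thesis using r by simp
qed

text \<open>The moduli of the coordinates as functions of s, continued by constants beyond [0,1] so
  that they are continuous on the whole line and need no domain restriction in measurability
  arguments.\<close>

definition rr :: "real => real" where
 "rr s = (if s <= 0 then 0 else if s < 1 then ri s else b1)"
definition tt :: "real => real" where
 "tt s = (if s <= 0 then b2 else if s < 1 then fy (ri s) else 0)"
definition pp :: "real => real" where
 "pp s = (if 0 < s & s < 1 then Pf (ri s) else 2)"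
text \<open>The density of surface measure with respect to ds dtheta1 dtheta2, as
  \<open>sqrt_gram_det\<close> shows. The outer values are its limits at the two axes.\<close>

definition jj :: "real => real" where
 "jj s = (if s <= 0 then b2 / (2 * c0) else if s < 1 then
   rr s * tt s / pp s * sqrt ((rr s / s)\<^sup>2 + (tt s / (1 - s))\<^sup>2) else b1 / (2 * sw.c0))"

lemma interior_eqs: "0 < s ==> s < 1 ==> rr s = ri s & tt s = fy (ri s) & pp s = Pf (ri s)"
 by (simp add: rr_def tt_def pp_def)

lemma nhds_eqs:
 assumes s: "0 < s" "s < 1"
 shows "\<forall>\<^sub>F u in nhds s. rr u = ri u" "\<forall>\<^sub>F u in nhds s. tt u = fy (ri u)"
  "\<forall>\<^sub>F u in nhds s. pp u = Pf (ri u)"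
proof -
 have "s : {0<..<1}" using s by simp
 note ev = eventually_nhds_in_open[OF open_greaterThanLessThan this]
 show "\<forall>\<^sub>F u in nhds s. rr u = ri u" "\<forall>\<^sub>F u in nhds s. tt u = fy (ri u)"
  "\<forall>\<^sub>F u in nhds s. pp u = Pf (ri u)"
  using ev by (eventually_elim, simp add: interior_eqs)+
qed

lemma DERIV_rr:
 assumes s: "0 < s" "s < 1"
 shows "(rr has_real_derivative rr s / (pp s * s)) (at s)"
 using DERIV_ri[OF s] nhds_eqs(1)[OF s] by (subst DERIV_cong_ev[OF refl _ refl]) (auto simp: interior_eqs s)

lemma DERIV_tt:
 assumes s: "0 < s" "s < 1"
 shows "(tt has_real_derivative - (tt s / (pp s * (1 - s)))) (at s)"
proof -
 note r = ri[OF s]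
 define x where "x = ri s"
 have x: "0 < x" "x < b1" "Sf x = s" using r by (auto simp: x_def)
 have nz: "fy x - x * fy1 x ~= 0" "fy x ~= 0" "fy1 x ~= 0" "Pf x ~= 0"
  using den_pos[of x] fy_inverse(1)[of x] fy1_neg[of x] Pf_gt[of x] x by auto
 have "1 - s = fy x / (fy x - x * fy1 x)"
  unfolding x(3)[symmetric] Sf_def using nz by (simp add: field_simps)
 then have 1: "fy x / (1 - s) = fy x - x * fy1 x" using nz by simp
 have "s * (fy x - x * fy1 x) = - x * fy1 x"
  unfolding x(3)[symmetric] Sf_def using nz by simp
 then have 2: "fy1 x * x / s = - (fy x - x * fy1 x)"
  using s by (simp add: field_simps)
 have "fy1 x * (x / (Pf x * s)) = (fy1 x * x / s) / Pf x" by simp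
 also have "... = - (fy x / (Pf x * (1 - s)))" unfolding 2 1[symmetric] by simp
 finally have eq: "fy1 (ri s) * (ri s / (Pf (ri s) * s)) = - (fy (ri s) / (Pf (ri s) * (1 - s)))"
  by (simp add: x_def)
 have "((%s. fy (ri s)) has_real_derivative fy1 (ri s) * (ri s / (Pf (ri s) * s))) (at s)"
  using r by (intro DERIV_chain2[OF DERIV_fy DERIV_ri] s) auto
 then show ?thesis
  unfolding eq using nhds_eqs(2)[OF s] by (subst DERIV_cong_ev[OF refl _ refl]) (auto simp: interior_eqs s)
qed

lemma rr_tt_pos: "0 < s ==> s < 1 ==> 0 < rr s" "0 < s ==> s < 1 ==> 0 < tt s"
 using ri fy_inverse(1) by (auto simp: interior_eqs)

lemma at_right_0_eq: "\<forall>\<^sub>F s in at_right (0::real). 0 < s & s < 1"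
 by (auto simp: eventually_at_right_field intro!: exI[of _ 1])

lemma at_left_1_eq: "\<forall>\<^sub>F s in at_left (1::real). 0 < s & s < 1"
 by (auto simp: eventually_at_left_field intro!: exI[of _ 0])

lemma rr_tt_0: "(rr \<longlongrightarrow> 0) (at_right 0)" "(tt \<longlongrightarrow> b2) (at_right 0)" "(pp \<longlongrightarrow> 2) (at_right 0)"
  "((%s. (rr s)\<^sup>2 / s) \<longlongrightarrow> 1 / c0) (at_right 0)"
proof -
 show "(rr \<longlongrightarrow> 0) (at_right 0)"
  by (rule Lim_transform_eventually[OF ri_tendsto_0])
    (use at_right_0_eq in eventually_elim, simp add: interior_eqs)
 have "((%s. fy (ri s)) \<longlongrightarrow> fy 0) (at_right 0)"
  by (rule isCont_tendsto_compose[OF fy_isCont ri_tendsto_0]) (simp add: b1_pos)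
 then show "(tt \<longlongrightarrow> b2) (at_right 0)"
  unfolding b2_eq by (rule Lim_transform_eventually)
    (use at_right_0_eq in eventually_elim, simp add: interior_eqs)
 show "(pp \<longlongrightarrow> 2) (at_right 0)"
  by (rule Lim_transform_eventually[OF filterlim_compose[OF limits_at_0(2) ri_at_right]])
    (use at_right_0_eq in eventually_elim, simp add: interior_eqs)
 have "((%s. 1 / (Sf (ri s) / (ri s)\<^sup>2)) \<longlongrightarrow> 1 / c0) (at_right 0)"
  using c0_pos by (intro tendsto_intros filterlim_compose[OF limits_at_0(1) ri_at_right]) auto
 then show "((%s. (rr s)\<^sup>2 / s) \<longlongrightarrow> 1 / c0) (at_right 0)"
  by (rule Lim_transform_eventually) (use at_right_0_eq in eventually_elim, simp add: interior_eqs ri)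
qed

lemma rr_tt_1: "(rr \<longlongrightarrow> b1) (at_left 1)" "(tt \<longlongrightarrow> 0) (at_left 1)" "(pp \<longlongrightarrow> 2) (at_left 1)"
  "((%s. (tt s)\<^sup>2 / (1 - s)) \<longlongrightarrow> 1 / sw.c0) (at_left 1)"
proof -
 have t0: "((%s. fy (ri s)) \<longlongrightarrow> 0) (at_left 1)"
  using fyri_at_left by (simp add: filterlim_at)
 then show "(tt \<longlongrightarrow> 0) (at_left 1)"
  by (rule Lim_transform_eventually) (use at_left_1_eq in eventually_elim, simp add: interior_eqs)
 have "((%s. sw.fy (fy (ri s))) \<longlongrightarrow> sw.fy 0) (at_left 1)"
  by (rule isCont_tendsto_compose[OF sw.fy_isCont t0]) (simp add: sw.b1_pos)
 then have "((%s. sw.fy (fy (ri s))) \<longlongrightarrow> b1) (at_left 1)"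
  by (simp add: sw.b2_eq[symmetric] sw_b)
 then show "(rr \<longlongrightarrow> b1) (at_left 1)"
  by (rule Lim_transform_eventually) (use at_left_1_eq in eventually_elim, simp add: interior_eqs fy_inverse ri)
 show "(pp \<longlongrightarrow> 2) (at_left 1)"
  by (rule Lim_transform_eventually[OF filterlim_compose[OF sw.limits_at_0(2) fyri_at_left]])
    (use at_left_1_eq in eventually_elim, simp add: interior_eqs sw_SP ri)
 have "((%s. 1 / (sw.Sf (fy (ri s)) / (fy (ri s))\<^sup>2)) \<longlongrightarrow> 1 / sw.c0) (at_left 1)"
  using sw.c0_pos by (intro tendsto_intros filterlim_compose[OF sw.limits_at_0(1) fyri_at_left]) auto
 then show "((%s. (tt s)\<^sup>2 / (1 - s)) \<longlongrightarrow> 1 / sw.c0) (at_left 1)"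
  by (rule Lim_transform_eventually) (use at_left_1_eq in eventually_elim, simp add: interior_eqs sw_SP ri)
qed

lemma rr_cont: "continuous_on {0..1} rr" and tt_cont: "continuous_on {0..1} tt" and pp_cont: "continuous_on {0..1} pp"
proof -
 show "continuous_on {0..1} rr"
  by (rule continuous_on_IccI)
    (use rr_tt_0 rr_tt_1 in \<open>auto simp: rr_def[of 0] rr_def[of 1] isCont_def[symmetric] intro: DERIV_isCont[OF DERIV_rr]\<close>)
 show "continuous_on {0..1} tt"
  by (rule continuous_on_IccI)
    (use rr_tt_0 rr_tt_1 in \<open>auto simp: tt_def[of 0] tt_def[of 1] isCont_def[symmetric] intro: DERIV_isCont[OF DERIV_tt]\<close>)
 have "isCont pp s" if s: "0 < s" "s < 1" for s
 proof -
  have "isCont Pf (ri s)" using Pf_cont ri[OF s] by (simp add: continuous_on_eq_continuous_at)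
  then have "isCont (%s. Pf (ri s)) s"
   by (rule isCont_o2[OF DERIV_isCont[OF DERIV_ri[OF s]]])
  then show ?thesis using nhds_eqs(3)[OF s] by (subst isCont_cong) auto
 qed
 then show "continuous_on {0..1} pp"
  by (intro continuous_on_IccI)
    (use rr_tt_0 rr_tt_1 in \<open>auto simp: pp_def[of 0] pp_def[of 1] isCont_def[symmetric]\<close>)
qed

lemma pp_gt: "1 < pp s"
 using Pf_gt ri by (auto simp: pp_def)

lemma jj_interior: "0 < s ==> s < 1 ==> jj s = rr s * tt s / pp s * sqrt ((rr s / s)\<^sup>2 + (tt s / (1 - s))\<^sup>2)"
 by (simp add: jj_def)

lemma jj_pos: "0 < jj s"
proof -
 have "0 < jj s" if s: "0 < s" "s < 1"
  unfolding jj_interior[OF s] using rr_tt_pos[OF s] pp_gt[of s] s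
  by (intro mult_pos_pos divide_pos_pos) (auto intro!: add_pos_pos)
 then show ?thesis
  using b1_pos b2_pos c0_pos sw.c0_pos by (auto simp: jj_def)
qed

text \<open>At 0 the quotient \<open>rr s / s\<close> is unbounded, of order s^(-1/2). Drawing the
  factor \<open>rr s\<close> under the root turns it into \<open>(rr s)^2 / s\<close>, which
  converges; at 1 the same is done with \<open>tt\<close>.\<close>

lemma jj_cont: "continuous_on {0..1} jj"
proof (rule continuous_on_IccI)
 have ev0: "\<forall>\<^sub>F s in at_right 0. tt s / pp s * sqrt (((rr s)\<^sup>2 / s)\<^sup>2 + (rr s * tt s / (1 - s))\<^sup>2) = jj s"
  using at_right_0_eq
 proof eventually_elim
  case (elim s)
  then have r: "rr s > 0" by (simp add: rr_tt_pos)
  have "((rr s)\<^sup>2 / s)\<^sup>2 + (rr s * tt s / (1 - s))\<^sup>2 = (rr s)\<^sup>2 * ((rr s / s)\<^sup>2 + (tt s / (1 - s))\<^sup>2)"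
   by (simp add: power2_eq_square algebra_simps)
  then have "sqrt (((rr s)\<^sup>2 / s)\<^sup>2 + (rr s * tt s / (1 - s))\<^sup>2) = rr s * sqrt ((rr s / s)\<^sup>2 + (tt s / (1 - s))\<^sup>2)"
   using r by (simp add: real_sqrt_mult)
  then show ?case using elim by (simp add: jj_interior mult_ac)
 qed
 have "((%s. tt s / pp s * sqrt (((rr s)\<^sup>2 / s)\<^sup>2 + (rr s * tt s / (1 - s))\<^sup>2)) \<longlongrightarrow>
   b2 / 2 * sqrt ((1 / c0)\<^sup>2 + (0 * b2 / (1 - 0))\<^sup>2)) (at_right 0)"
  by (intro tendsto_intros rr_tt_0) auto
 moreover have "b2 / 2 * sqrt ((1 / c0)\<^sup>2 + (0 * b2 / (1 - 0))\<^sup>2) = jj 0"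
  using c0_pos by (simp add: jj_def)
 ultimately show "(jj \<longlongrightarrow> jj 0) (at_right 0)"
  using Lim_transform_eventually[OF _ ev0] by simp
 have ev1: "\<forall>\<^sub>F s in at_left 1. rr s / pp s * sqrt ((rr s * tt s / s)\<^sup>2 + ((tt s)\<^sup>2 / (1 - s))\<^sup>2) = jj s"
  using at_left_1_eq
 proof eventually_elim
  case (elim s)
  then have t: "tt s > 0" by (simp add: rr_tt_pos)
  have "(rr s * tt s / s)\<^sup>2 + ((tt s)\<^sup>2 / (1 - s))\<^sup>2 = (tt s)\<^sup>2 * ((rr s / s)\<^sup>2 + (tt s / (1 - s))\<^sup>2)"
   by (simp add: power2_eq_square algebra_simps)
  then have "sqrt ((rr s * tt s / s)\<^sup>2 + ((tt s)\<^sup>2 / (1 - s))\<^sup>2) = tt s * sqrt ((rr s / s)\<^sup>2 + (tt s / (1 - s))\<^sup>2)"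
   using t by (simp add: real_sqrt_mult)
  then show ?case using elim by (simp add: jj_interior mult_ac)
 qed
 have "((%s. rr s / pp s * sqrt ((rr s * tt s / s)\<^sup>2 + ((tt s)\<^sup>2 / (1 - s))\<^sup>2)) \<longlongrightarrow>
   b1 / 2 * sqrt ((b1 * 0 / 1)\<^sup>2 + (1 / sw.c0)\<^sup>2)) (at_left 1)"
  by (intro tendsto_intros rr_tt_1) auto
 moreover have "b1 / 2 * sqrt ((b1 * 0 / 1)\<^sup>2 + (1 / sw.c0)\<^sup>2) = jj 1"
  using sw.c0_pos by (simp add: jj_def)
 ultimately show "(jj \<longlongrightarrow> jj 1) (at_left 1)"
  using Lim_transform_eventually[OF _ ev1] by simp
 fix s :: real assume s: "0 < s" "s < 1"
 have c': "isCont f s" if "continuous_on {0..1} f" for f :: "real => real"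
 proof -
  have "continuous_on {0<..<1} f" by (rule continuous_on_subset[OF that]) auto
  then show ?thesis using s by (simp add: continuous_on_eq_continuous_at)
 qed
 note c = c'[OF rr_cont] c'[OF tt_cont] c'[OF pp_cont]
 have "s : {0<..<1}" using s by simp
 from eventually_nhds_in_open[OF open_greaterThanLessThan this]
 have ev: "\<forall>\<^sub>F u in nhds s. jj u = rr u * tt u / pp u * sqrt ((rr u / u)\<^sup>2 + (tt u / (1 - u))\<^sup>2)"
  by eventually_elim (simp add: jj_interior)
 have "isCont (%u. rr u * tt u / pp u * sqrt ((rr u / u)\<^sup>2 + (tt u / (1 - u))\<^sup>2)) s"
  using s pp_gt[of s] by (intro continuous_intros c) auto
 then show "(jj \<longlongrightarrow> jj s) (at s)"
  unfolding isCont_def[symmetric] using ev by (subst isCont_cong) auto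
qed simp

lemma curve_in_frontier:
 assumes "0 <= s" "s <= 1"
 shows "(cr (rr s), cr (tt s)) : frontier D"
proof -
 have "(cr (rr s), cr (tt s)) : frontier D" if s: "0 < s" "s < 1" for s
  using fy_frontier[of "ri s"] ri[OF s] s by (simp add: interior_eqs)
 then have "(%s. (cr (rr s), cr (tt s))) ` {0<..<1} \<subseteq> frontier D" by auto
 moreover have "continuous_on (closure {0<..<1}) (%s. (cr (rr s), cr (tt s)))"
  by (simp add: continuous_intros rr_cont tt_cont)
 ultimately have "(%s. (cr (rr s), cr (tt s))) ` closure {0<..<1} \<subseteq> frontier D"
  by (intro image_closure_subset) auto
 then show ?thesis using assms by auto
qed

lemma s_coord_curve:
 assumes s: "0 < s" "s < 1" and zt: "norm (fst zt) = rr s"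
 shows "s_coord D zt = s"
proof -
 have r: "\<bar>ri s\<bar> < b1" using ri[OF s] by simp
 show ?thesis
  using ri(3)[OF s] deriv_fy[OF r] zt s
  by (simp add: s_coord_def Let_def interior_eqs fy_def[symmetric] Sf_def)
qed

lemma osc_exponent_curve:
 assumes s: "0 < s" "s < 1" and zt: "norm (fst zt) = rr s" "fst zt * snd zt ~= 0"
 shows "osc_exponent D zt = pp s"
proof -
 have r: "\<bar>ri s\<bar> < b1" using ri[OF s] by simp
 show ?thesis
  using deriv_fy[OF r] deriv2_fy[OF r] zt s
  by (simp add: osc_exponent_def Let_def interior_eqs fy_def[symmetric] Pf_def)
qed

lemma frontier_curve:
 assumes zt: "zt : frontier D" "fst zt ~= 0" "snd zt ~= 0"
 shows "\<exists>s. 0 < s & s < 1 & norm (fst zt) = rr s & norm (snd zt) = tt s"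
proof -
 define r where "r = norm (fst zt)"
 have r: "0 < r" "r < b1" using frontier_fst_less[OF zt(1,3)] zt(2) by (auto simp: r_def)
 have "norm (snd zt) = fy r" unfolding r_def by (rule frontier_snd_eq[OF zt(1)]) (use r in \<open>simp add: r_def\<close>)
 then show ?thesis
  using Sf_range[OF r] ri_Sf[OF r] by (intro exI[of _ "Sf r"]) (simp add: interior_eqs r_def)
qed

end

section \<open>The Leray kernel in coordinates\<close>

text \<open>The mean value theorem, applied first in the direction \<open>u\<close> and then in the
  direction \<open>v\<close>.\<close>

lemma second_difference:
 fixes f :: "'a::real_inner => real"
 assumes f: "!!x. x : ball x0 d ==> (f has_derivative (%v. G x \<bullet> v)) (at x)"
  and G: "!!x. x : ball x0 d ==> (G has_derivative H x) (at x)"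
  and h: "0 < h" "h * norm u + h * norm v < d"
 shows "\<exists>y\<in>ball x0 d. f (x0 + h *\<^sub>R u + h *\<^sub>R v) - f (x0 + h *\<^sub>R u) - f (x0 + h *\<^sub>R v) + f x0 = h * h * (H y v \<bullet> u)"
proof -
 have inb: "x0 + s *\<^sub>R u + t *\<^sub>R v : ball x0 d" if "0 <= s" "s <= h" "0 <= t" "t <= h" for s t
 proof -
  have "norm (s *\<^sub>R u + t *\<^sub>R v) <= s * norm u + t * norm v"
   using norm_triangle_ineq[of "s *\<^sub>R u" "t *\<^sub>R v"] that by simp
  also have "... <= h * norm u + h * norm v"
   using that by (intro add_mono mult_right_mono) auto
  finally have "norm (s *\<^sub>R u + t *\<^sub>R v) < d" using h by simp
  moreover have "dist x0 (x0 + s *\<^sub>R u + t *\<^sub>R v) = norm (s *\<^sub>R u + t *\<^sub>R v)"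
  proof -
   have "x0 - (x0 + s *\<^sub>R u + t *\<^sub>R v) = - (s *\<^sub>R u + t *\<^sub>R v)" by simp
   then show ?thesis by (simp only: dist_norm norm_minus_cancel)
  qed
  ultimately show ?thesis by simp
 qed
 have d1: "((%s. f (x0 + s *\<^sub>R u + t *\<^sub>R v)) has_real_derivative G (x0 + s *\<^sub>R u + t *\<^sub>R v) \<bullet> u) (at s)"
  if "0 <= s" "s <= h" "0 <= t" "t <= h" for s t
 proof -
  have "((%s. x0 + s *\<^sub>R u + t *\<^sub>R v) has_derivative (%k. k *\<^sub>R u)) (at s)"
   by (auto intro!: derivative_eq_intros)
  from has_derivative_compose[OF this f[OF inb[OF that]]]
  show ?thesis by (simp only: has_field_derivative_def inner_scaleR_right mult_commute_abs)
 qed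
 have d2: "((%t. G (x0 + s *\<^sub>R u + t *\<^sub>R v) \<bullet> u) has_real_derivative H (x0 + s *\<^sub>R u + t *\<^sub>R v) v \<bullet> u) (at t)"
  if "0 <= s" "s <= h" "0 <= t" "t <= h" for s t
 proof -
  have "((%t. x0 + s *\<^sub>R u + t *\<^sub>R v) has_derivative (%k. k *\<^sub>R v)) (at t)"
   by (auto intro!: derivative_eq_intros)
  from has_derivative_inner_left[OF has_derivative_compose[OF this G[OF inb[OF that]]]]
  have "((%t. G (x0 + s *\<^sub>R u + t *\<^sub>R v) \<bullet> u) has_derivative (%k. H (x0 + s *\<^sub>R u + t *\<^sub>R v) (k *\<^sub>R v) \<bullet> u)) (at t)" .
  moreover have "H (x0 + s *\<^sub>R u + t *\<^sub>R v) (k *\<^sub>R v) = k *\<^sub>R H (x0 + s *\<^sub>R u + t *\<^sub>R v) v" for k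
   by (rule linear_simps(5)[OF has_derivative_bounded_linear[OF G[OF inb[OF that]]]])
  ultimately show ?thesis by (simp only: has_field_derivative_def inner_scaleR_left mult_commute_abs)
 qed
 have "\<exists>z>0. z < h & (f (x0 + h *\<^sub>R u + h *\<^sub>R v) - f (x0 + h *\<^sub>R u + 0 *\<^sub>R v)) - (f (x0 + 0 *\<^sub>R u + h *\<^sub>R v) - f (x0 + 0 *\<^sub>R u + 0 *\<^sub>R v))
   = (h - 0) * (G (x0 + z *\<^sub>R u + h *\<^sub>R v) \<bullet> u - G (x0 + z *\<^sub>R u + 0 *\<^sub>R v) \<bullet> u)"
  by (rule MVT2[OF h(1), where f = "%s. f (x0 + s *\<^sub>R u + h *\<^sub>R v) - f (x0 + s *\<^sub>R u + 0 *\<^sub>R v)"])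
    (use h in \<open>intro DERIV_diff d1; simp\<close>)
 then obtain z where z: "0 < z" "z < h"
  "f (x0 + h *\<^sub>R u + h *\<^sub>R v) - f (x0 + h *\<^sub>R u) - f (x0 + h *\<^sub>R v) + f x0
   = h * (G (x0 + z *\<^sub>R u + h *\<^sub>R v) \<bullet> u - G (x0 + z *\<^sub>R u + 0 *\<^sub>R v) \<bullet> u)" by auto
 have "\<exists>y>0. y < h & G (x0 + z *\<^sub>R u + h *\<^sub>R v) \<bullet> u - G (x0 + z *\<^sub>R u + 0 *\<^sub>R v) \<bullet> u = (h - 0) * (H (x0 + z *\<^sub>R u + y *\<^sub>R v) v \<bullet> u)"
  by (rule MVT2[OF h(1), where f = "%t. G (x0 + z *\<^sub>R u + t *\<^sub>R v) \<bullet> u"]) (use z in \<open>intro d2; simp\<close>)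
 then obtain y where y: "0 < y" "y < h"
  "G (x0 + z *\<^sub>R u + h *\<^sub>R v) \<bullet> u - G (x0 + z *\<^sub>R u + 0 *\<^sub>R v) \<bullet> u = h * (H (x0 + z *\<^sub>R u + y *\<^sub>R v) v \<bullet> u)" by auto
 show ?thesis
  using z y inb[of z y] by (intro bexI[of _ "x0 + z *\<^sub>R u + y *\<^sub>R v"]) (simp_all add: mult.assoc)
qed

text \<open>The second difference is symmetric in \<open>u\<close> and \<open>v\<close>, and divided
  by \<open>h * h\<close> it is a value of the Hessian near \<open>x0\<close> in either order.
  Continuity of \<open>H\<close> removes the intermediate points.\<close>

lemma hessian_symmetric:
 fixes f :: "'a::real_inner => real"
 assumes U: "open U" "x0 : U"
  and f: "!!x. x : U ==> (f has_derivative (%v. G x \<bullet> v)) (at x)"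
  and G: "!!x. x : U ==> (G has_derivative H x) (at x)"
  and H: "!!v. continuous_on U (%x. H x v)"
 shows "H x0 u \<bullet> v = H x0 v \<bullet> u"
proof (rule ccontr)
 assume ne: "H x0 u \<bullet> v ~= H x0 v \<bullet> u"
 define e where "e = \<bar>H x0 u \<bullet> v - H x0 v \<bullet> u\<bar> / 2"
 have e: "e > 0" using ne by (simp add: e_def)
 have near: "\<exists>d>0. \<forall>y\<in>ball x0 d. \<bar>H y a \<bullet> b - H x0 a \<bullet> b\<bar> < e" for a b
 proof -
  have "isCont (%x. H x a \<bullet> b) x0"
   using H[of a] U by (auto intro!: continuous_intros simp: continuous_on_eq_continuous_at)
  then obtain d where "d > 0" "\<forall>y. dist y x0 < d --> \<bar>H y a \<bullet> b - H x0 a \<bullet> b\<bar> < e"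
   using e unfolding continuous_at_eps_delta dist_real_def by blast
  then show ?thesis by (intro exI[of _ d] conjI ballI) (simp_all only: mem_ball dist_commute[of x0])
 qed
 obtain d0 where d0: "d0 > 0" "ball x0 d0 \<subseteq> U" using U by (meson open_contains_ball)
 obtain d1 where d1: "d1 > 0" "!!y. y : ball x0 d1 ==> \<bar>H y u \<bullet> v - H x0 u \<bullet> v\<bar> < e" using near by blast
 obtain d2 where d2: "d2 > 0" "!!y. y : ball x0 d2 ==> \<bar>H y v \<bullet> u - H x0 v \<bullet> u\<bar> < e" using near by blast
 define d where "d = min d0 (min d1 d2)"
 have d: "d > 0" "ball x0 d \<subseteq> U" "ball x0 d \<subseteq> ball x0 d1" "ball x0 d \<subseteq> ball x0 d2"
  using d0 d1(1) d2(1) by (auto simp: d_def)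
 define m where "m = norm u + norm v + 1"
 have nn: "m > 0" unfolding m_def by (simp add: add_nonneg_pos)
 define h where "h = d / (2 * m)"
 have h: "h > 0" "h * norm u + h * norm v < d"
 proof -
  show "h > 0" using d nn by (simp add: h_def)
  have "h * norm u + h * norm v <= h * m" using \<open>h > 0\<close> by (simp add: m_def algebra_simps)
  also have "... = d / 2" using nn by (simp add: h_def)
  finally show "h * norm u + h * norm v < d" using d by simp
 qed
 have fd: "!!x. x : ball x0 d ==> (f has_derivative (%v. G x \<bullet> v)) (at x)"
  and Gd: "!!x. x : ball x0 d ==> (G has_derivative H x) (at x)" using f G d(2) by auto
 obtain y where y: "y : ball x0 d"
  "f (x0 + h *\<^sub>R u + h *\<^sub>R v) - f (x0 + h *\<^sub>R u) - f (x0 + h *\<^sub>R v) + f x0 = h * h * (H y v \<bullet> u)"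
  using second_difference[OF fd Gd h] by blast
 have h': "h * norm v + h * norm u < d" using h(2) by simp
 obtain z where z: "z : ball x0 d"
  "f (x0 + h *\<^sub>R v + h *\<^sub>R u) - f (x0 + h *\<^sub>R v) - f (x0 + h *\<^sub>R u) + f x0 = h * h * (H z u \<bullet> v)"
  using second_difference[OF fd Gd h(1) h'] by blast
 have "x0 + h *\<^sub>R v + h *\<^sub>R u = x0 + h *\<^sub>R u + h *\<^sub>R v" by (simp add: add_ac)
 then have "f (x0 + h *\<^sub>R v + h *\<^sub>R u) = f (x0 + h *\<^sub>R u + h *\<^sub>R v)" by (rule arg_cong)
 then have "h * h * (H y v \<bullet> u) = h * h * (H z u \<bullet> v)" using y(2) z(2) by linarith
 then have "H y v \<bullet> u = H z u \<bullet> v" using h by simp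
 moreover have "\<bar>H z u \<bullet> v - H x0 u \<bullet> v\<bar> < e" using z(1) d(3) by (intro d1(2)) auto
 moreover have "\<bar>H y v \<bullet> u - H x0 v \<bullet> u\<bar> < e" using y(1) d(4) by (intro d2(2)) auto
 ultimately have "\<bar>H x0 u \<bullet> v - H x0 v \<bullet> u\<bar> < 2 * e" by linarith
 then show False by (simp add: e_def)
qed

lemma has_vector_derivative_pair:
 assumes "(f has_vector_derivative f') (at x)" "(g has_vector_derivative g') (at x)"
 shows "((%x. (f x, g x)) has_vector_derivative (f', g')) (at x)"
 using has_derivative_Pair[OF assms[unfolded has_vector_derivative_def]]
 by (simp add: has_vector_derivative_def)

lemma DERIV_cis_affine:
 "((%u. cis (a + al * u)) has_vector_derivative \<i> * of_real al * cis (a + al * u)) (at u)"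
 unfolding has_vector_derivative_complex_iff by (auto intro!: derivative_eq_intros)

lemma inner_of_real_cis: "(of_real c * cis x) \<bullet> (of_real e * cis x) = c * e"
proof -
 have "cis x \<bullet> cis x = 1" by (simp add: inner_complex_def power2_eq_square[symmetric])
 then show ?thesis by (simp add: scaleR_conv_of_real[symmetric])
qed

section \<open>Gradient and Hessian along curves in the boundary\<close>

context C2_reinhardt
begin

lemma H_sym: "zt : U ==> H zt u \<bullet> v = H zt v \<bullet> u"
 by (rule hessian_symmetric[OF U(1) _ ro_deriv G_deriv H_cont])

text \<open>Differentiate \<open>ro (c u) = 0\<close> once and twice. The Hessian on a tangent
  vector can thus be read off from the acceleration of a boundary curve, without computing with
  \<open>ro\<close> itself.\<close>

lemma frontier_curve_derivs:
 assumes I: "open I" "u0 : I" and c: "!!u. u : I ==> c u : frontier D"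
  and c1: "!!u. u : I ==> (c has_vector_derivative c1 u) (at u)"
  and c2: "(c1 has_vector_derivative c2) (at u0)"
 shows "G (c u0) \<bullet> c1 u0 = 0" "H (c u0) (c1 u0) \<bullet> c1 u0 + G (c u0) \<bullet> c2 = 0"
proof -
 have 1: "G (c u) \<bullet> c1 u = 0" if u: "u : I" for u
 proof -
  have "((%u. ro (c u)) has_derivative (%h. G (c u) \<bullet> (h *\<^sub>R c1 u))) (at u)"
   by (rule has_derivative_compose[OF c1[OF u, unfolded has_vector_derivative_def] ro_deriv[OF frontier_U[OF c[OF u]]]])
  then have "((%u. ro (c u)) has_real_derivative G (c u) \<bullet> c1 u) (at u)"
   by (simp only: has_field_derivative_def inner_scaleR_right mult_commute_abs)
  moreover have "\<forall>\<^sub>F v in nhds u. ro (c v) = 0"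
   using eventually_nhds_in_open[OF I(1) u] by eventually_elim (simp add: ro_frontier c)
  ultimately have "((%u. 0) has_real_derivative G (c u) \<bullet> c1 u) (at u)"
   by (subst (asm) DERIV_cong_ev[OF refl _ refl]) auto
  then show ?thesis using DERIV_unique[OF _ DERIV_const] by blast
 qed
 show "G (c u0) \<bullet> c1 u0 = 0" by (rule 1[OF I(2)])
 note fU = frontier_U[OF c[OF I(2)]]
 have "((%u. G (c u)) has_derivative (%h. H (c u0) (h *\<^sub>R c1 u0))) (at u0)"
  by (rule has_derivative_compose[OF c1[OF I(2), unfolded has_vector_derivative_def] G_deriv[OF fU]])
 moreover have "H (c u0) (h *\<^sub>R c1 u0) = h *\<^sub>R H (c u0) (c1 u0)" for h
  by (rule linear_simps(5)[OF H_linear[OF fU]])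
 ultimately have "((%u. G (c u)) has_derivative (%h. h *\<^sub>R H (c u0) (c1 u0))) (at u0)" by simp
 from has_derivative_inner[OF this c2[unfolded has_vector_derivative_def]]
 have d: "((%u. G (c u) \<bullet> c1 u) has_derivative
   (%h. G (c u0) \<bullet> (h *\<^sub>R c2) + (h *\<^sub>R H (c u0) (c1 u0)) \<bullet> c1 u0)) (at u0)" .
 have "(%h. G (c u0) \<bullet> (h *\<^sub>R c2) + (h *\<^sub>R H (c u0) (c1 u0)) \<bullet> c1 u0) =
   (*) (H (c u0) (c1 u0) \<bullet> c1 u0 + G (c u0) \<bullet> c2)"
  by (simp add: fun_eq_iff algebra_simps)
 with d have "((%u. G (c u) \<bullet> c1 u) has_real_derivative (H (c u0) (c1 u0) \<bullet> c1 u0 + G (c u0) \<bullet> c2)) (at u0)"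
  by (simp only: has_field_derivative_def)
 moreover have "\<forall>\<^sub>F u in nhds u0. G (c u) \<bullet> c1 u = 0"
  using eventually_nhds_in_open[OF I] by eventually_elim (rule 1)
 ultimately have "((%u. 0) has_real_derivative (H (c u0) (c1 u0) \<bullet> c1 u0 + G (c u0) \<bullet> c2)) (at u0)"
  by (subst (asm) DERIV_cong_ev[OF refl _ refl]) auto
 then show "H (c u0) (c1 u0) \<bullet> c1 u0 + G (c u0) \<bullet> c2 = 0" using DERIV_unique[OF _ DERIV_const] by blast
qed

definition pt :: "real => real => real => C2" where
 "pt a b r = torus_rot a b (of_real r, of_real (fy r))"

lemma pt_frontier: "\<bar>r\<bar> < b1 ==> pt a b r : frontier D"
 unfolding pt_def by (intro rot_frontier fy_frontier)

lemma profile_curve: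
 assumes r: "\<bar>r\<bar> < b1"
 shows "G (pt a b r) \<bullet> (cis a, cis b * of_real (fy1 r)) = 0"
  "H (pt a b r) (cis a, cis b * of_real (fy1 r)) \<bullet> (cis a, cis b * of_real (fy1 r)) +
    G (pt a b r) \<bullet> (0, cis b * of_real (fy2 r)) = 0"
proof -
 have *: "(%u. pt a b u) = (%u. (cis a * of_real u, cis b * of_real (fy u)))"
  by (simp add: pt_def torus_rot_def)
 have ofr: "((%u. c * cr (f u)) has_vector_derivative c * cr f') (at u)"
  if "(f has_real_derivative f') (at u)" for f f' c u
  by (intro has_vector_derivative_mult_right has_vector_derivative_of_real that)
 have d1: "((%u. pt a b u) has_vector_derivative (cis a, cis b * of_real (fy1 u))) (at u)" if "u : {-b1<..<b1}" for u
 proof -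
  have u: "\<bar>u\<bar> < b1" using that by auto
  have "((%u. cis a * cr u) has_vector_derivative cis a * cr 1) (at u)"
   by (intro ofr DERIV_ident)
  then show ?thesis
   unfolding * using has_vector_derivative_pair[OF _ ofr[OF DERIV_fy[OF u], of "cis b"]] by fastforce
 qed
 have "((%u. cis a) has_vector_derivative 0) (at r)" by (rule has_vector_derivative_const)
 then have d2: "((%u. (cis a, cis b * of_real (fy1 u))) has_vector_derivative (0, cis b * of_real (fy2 r))) (at r)"
  by (rule has_vector_derivative_pair[OF _ ofr[OF DERIV_fy1[OF r], of "cis b"]])
 have I: "open {-b1<..<b1}" "r : {-b1<..<b1}" using r by auto
 have fr: "pt a b u : frontier D" if "u : {-b1<..<b1}" for u using that by (intro pt_frontier) auto
 show "G (pt a b r) \<bullet> (cis a, cis b * of_real (fy1 r)) = 0"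
  "H (pt a b r) (cis a, cis b * of_real (fy1 r)) \<bullet> (cis a, cis b * of_real (fy1 r)) +
    G (pt a b r) \<bullet> (0, cis b * of_real (fy2 r)) = 0"
  using frontier_curve_derivs[OF I fr d1 d2] by auto
qed

text \<open>A one-parameter torus orbit with angular speeds \<open>al\<close> and \<open>bt\<close>
  stays in the boundary. With suitable speeds its velocity is \<open>\<i>\<close> times the tangent
  of the profile curve.\<close>

lemma orbit_curve:
 assumes r: "\<bar>r\<bar> < b1"
 shows "G (pt a b r) \<bullet> (\<i> * of_real (al * r) * cis a, \<i> * of_real (bt * fy r) * cis b) = 0"
  "H (pt a b r) (\<i> * of_real (al * r) * cis a, \<i> * of_real (bt * fy r) * cis b) \<bullet>
    (\<i> * of_real (al * r) * cis a, \<i> * of_real (bt * fy r) * cis b) +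
    G (pt a b r) \<bullet> (of_real (- al\<^sup>2 * r) * cis a, of_real (- bt\<^sup>2 * fy r) * cis b) = 0"
proof -
 define c where "c u = pt (a + al * u) (b + bt * u) r" for u
 define c1 where "c1 u = (of_real r * (\<i> * of_real al * cis (a + al * u)), of_real (fy r) * (\<i> * of_real bt * cis (b + bt * u)))" for u
 have d1: "(c has_vector_derivative c1 u) (at u)" for u
 proof -
  have "c = (%u. (of_real r * cis (a + al * u), of_real (fy r) * cis (b + bt * u)))"
   by (simp add: c_def pt_def torus_rot_def mult.commute fun_eq_iff)
  then show ?thesis
   unfolding c1_def by (auto intro!: has_vector_derivative_pair has_vector_derivative_mult_right DERIV_cis_affine)
 qed
 have "c1 = (%u. ((of_real r * \<i> * of_real al) * cis (a + al * u), (of_real (fy r) * \<i> * of_real bt) * cis (b + bt * u)))"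
  by (simp add: c1_def mult.assoc fun_eq_iff)
 then have d2: "(c1 has_vector_derivative ((of_real r * \<i> * of_real al) * (\<i> * of_real al * cis (a + al * 0)),
   (of_real (fy r) * \<i> * of_real bt) * (\<i> * of_real bt * cis (b + bt * 0)))) (at 0)"
  by (simp only:) (intro has_vector_derivative_pair has_vector_derivative_mult_right DERIV_cis_affine)
 have c0: "c 0 = pt a b r" "c1 0 = (\<i> * of_real (al * r) * cis a, \<i> * of_real (bt * fy r) * cis b)"
  by (simp_all add: c_def c1_def mult_ac)
 have c2: "((of_real r * \<i> * of_real al) * (\<i> * of_real al * cis (a + al * 0)),
   (of_real (fy r) * \<i> * of_real bt) * (\<i> * of_real bt * cis (b + bt * 0))) =
   (of_real (- al\<^sup>2 * r) * cis a, of_real (- bt\<^sup>2 * fy r) * cis b)"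
  by (simp add: power2_eq_square complex_eq_iff)
 show "G (pt a b r) \<bullet> (\<i> * of_real (al * r) * cis a, \<i> * of_real (bt * fy r) * cis b) = 0"
  "H (pt a b r) (\<i> * of_real (al * r) * cis a, \<i> * of_real (bt * fy r) * cis b) \<bullet>
    (\<i> * of_real (al * r) * cis a, \<i> * of_real (bt * fy r) * cis b) +
    G (pt a b r) \<bullet> (of_real (- al\<^sup>2 * r) * cis a, of_real (- bt\<^sup>2 * fy r) * cis b) = 0"
  using frontier_curve_derivs[of UNIV 0 c c1, OF _ _ _ d1 d2] pt_frontier[OF r]
  unfolding c2 c0[symmetric] by (auto simp: c_def)
qed

lemma real_multiple_of_cis:
 assumes "g \<bullet> (\<i> * cis a) = 0"
 shows "g = of_real (g \<bullet> cis a) * cis a"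
proof -
 have 1: "Re g * sin a = Im g * cos a" using assms by (simp add: inner_complex_def)
 have 2: "(sin a)\<^sup>2 + (cos a)\<^sup>2 = 1" by simp
 have "Re g * (cos a)\<^sup>2 + Im g * sin a * cos a = Re g"
 proof -
  have "Im g * sin a * cos a = Re g * (sin a)\<^sup>2" using 1 by (simp add: power2_eq_square mult_ac)
  then show ?thesis using 2 by (metis add.commute distrib_left mult.right_neutral)
 qed
 moreover have "Re g * cos a * sin a + Im g * (sin a)\<^sup>2 = Im g"
 proof -
  have "Re g * cos a * sin a = Im g * (cos a)\<^sup>2" using 1 by (simp add: power2_eq_square mult_ac)
  then show ?thesis using 2 by (metis add.commute distrib_left mult.right_neutral)
 qed
 ultimately show ?thesis
  by (simp add: complex_eq_iff inner_complex_def power2_eq_square distrib_right)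
qed

text \<open>The torus orbits force each component of the gradient to be a real multiple of the
  radial direction, the profile curve fixes the ratio of the two multiples, and
  \<open>support\<close> the sign.\<close>

lemma gradient_pt:
 assumes r: "0 < r" "r < b1"
 obtains B where "B > 0" "G (pt a b r) = (of_real (- B * fy1 r) * cis a, of_real B * cis b)"
proof -
 have r': "\<bar>r\<bar> < b1" using r by simp
 have p: "fy r > 0" by (rule fy_pos[OF r'])
 obtain g1 g2 where g: "G (pt a b r) = (g1, g2)" by fastforce
 have "g1 \<bullet> (\<i> * of_real r * cis a) = 0" using orbit_curve(1)[OF r', of a b 1 0] by (simp add: g inner_prod_def)
 moreover have "\<i> * of_real r * cis a = r *\<^sub>R (\<i> * cis a)" by (simp add: scaleR_conv_of_real mult_ac)
 ultimately have "g1 \<bullet> (\<i> * cis a) = 0" using r by (simp only: inner_scaleR_right) simp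
 from real_multiple_of_cis[OF this] obtain A where A: "g1 = of_real A * cis a" by blast
 have "g2 \<bullet> (\<i> * of_real (fy r) * cis b) = 0" using orbit_curve(1)[OF r', of a b 0 1] by (simp add: g inner_prod_def)
 moreover have "\<i> * of_real (fy r) * cis b = fy r *\<^sub>R (\<i> * cis b)" by (simp add: scaleR_conv_of_real mult_ac)
 ultimately have "g2 \<bullet> (\<i> * cis b) = 0" using p by (simp only: inner_scaleR_right) simp
 from real_multiple_of_cis[OF this] obtain B where B: "g2 = of_real B * cis b" by blast
 have cc: "cis x \<bullet> cis x = 1" for x by (simp add: inner_complex_def power2_eq_square[symmetric])
 have ofr: "(of_real y * z) = y *\<^sub>R z" for y :: real and z :: complex by (simp add: scaleR_conv_of_real)
 have "A + fy1 r * B = 0"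
  using profile_curve(1)[OF r', of a b] by (simp add: g A B inner_prod_def ofr mult.commute[of "cis b"] cc)
 then have AB: "A = - B * fy1 r" by (simp add: add_eq_0_iff mult.commute)
 have "torus_rot a b (of_real r, 0) : D" unfolding rot_D by (rule in_b1[OF r'])
 from support[OF pt_frontier[OF r'] this, of a b]
 have "(g1, g2) \<bullet> (torus_rot a b (of_real r, 0) - pt a b r) < 0" by (simp add: g)
 moreover have "torus_rot a b (of_real r, 0) - pt a b r = (0, - of_real (fy r) * cis b)"
  by (simp add: torus_rot_def pt_def mult.commute)
 ultimately have "0 < fy r * B" by (simp add: inner_prod_def B ofr cc)
 then have "0 < B * fy r" by (simp only: mult.commute)
 then have "B > 0" using p by (simp add: zero_less_mult_iff)
 moreover have "G (pt a b r) = (of_real (- B * fy1 r) * cis a, of_real B * cis b)"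
  by (simp add: g A B AB)
 ultimately show ?thesis using that by blast
qed

section \<open>Wirtinger derivatives and the density of the Leray form\<close>

lemma dz_ro:
 assumes "x : U"
 shows "dz 1 (cfun ro) x = cnj (fst (G x)) / 2" "dz 2 (cfun ro) x = cnj (snd (G x)) / 2"
proof -
 have "(cfun ro has_derivative (%v. cr (G x \<bullet> v))) (at x)"
  by (rule has_derivative_of_real[OF ro_deriv[OF assms]])
 then have fd: "frechet_derivative (cfun ro) (at x) = (%v. cr (G x \<bullet> v))"
  by (rule frechet_derivative_at[symmetric])
 show "dz 1 (cfun ro) x = cnj (fst (G x)) / 2" "dz 2 (cfun ro) x = cnj (snd (G x)) / 2"
  unfolding dz_def fd by (simp_all add: coord_vec_def inner_prod_def inner_complex_def complex_eq_iff)
qed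

lemma dzbar_dz_ro:
 assumes x: "x : U"
 shows "dzbar k (dz 1 (cfun ro)) x = (cnj (fst (H x (coord_vec k 1))) + \<i> * cnj (fst (H x (coord_vec k \<i>)))) / 4"
  "dzbar k (dz 2 (cfun ro)) x = (cnj (snd (H x (coord_vec k 1))) + \<i> * cnj (snd (H x (coord_vec k \<i>)))) / 4"
proof -
 have "((%x. cnj (fst (G x)) / 2) has_derivative (%v. cnj (fst (H x v)) / 2)) (at x)"
  using G_deriv[OF x] by (auto intro!: derivative_eq_intros has_derivative_cnj)
 then have "(dz 1 (cfun ro) has_derivative (%v. cnj (fst (H x v)) / 2)) (at x)"
  by (rule has_derivative_transform_within_open[OF _ U(1) x]) (simp only: dz_ro)
 then have 1: "frechet_derivative (dz 1 (cfun ro)) (at x) = (%v. cnj (fst (H x v)) / 2)"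
  by (rule frechet_derivative_at[symmetric])
 have "((%x. cnj (snd (G x)) / 2) has_derivative (%v. cnj (snd (H x v)) / 2)) (at x)"
  using G_deriv[OF x] by (auto intro!: derivative_eq_intros has_derivative_cnj)
 then have "(dz 2 (cfun ro) has_derivative (%v. cnj (snd (H x v)) / 2)) (at x)"
  by (rule has_derivative_transform_within_open[OF _ U(1) x]) (simp only: dz_ro)
 then have 2: "frechet_derivative (dz 2 (cfun ro)) (at x) = (%v. cnj (snd (H x v)) / 2)"
  by (rule frechet_derivative_at[symmetric])
 show "dzbar k (dz 1 (cfun ro)) x = (cnj (fst (H x (coord_vec k 1))) + \<i> * cnj (fst (H x (coord_vec k \<i>)))) / 4"
  "dzbar k (dz 2 (cfun ro)) x = (cnj (snd (H x (coord_vec k 1))) + \<i> * cnj (snd (H x (coord_vec k \<i>)))) / 4"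
  unfolding dzbar_def 1 2 by (simp_all add: field_simps)
qed

lemma H_expand:
 assumes x: "x : U"
 shows "H x (u1, u2) = Re u1 *\<^sub>R H x (1, 0) + Im u1 *\<^sub>R H x (\<i>, 0) + Re u2 *\<^sub>R H x (0, 1) + Im u2 *\<^sub>R H x (0, \<i>)"
proof -
 interpret H: bounded_linear "H x" by (rule H_linear[OF x])
 have "(u1, u2) = Re u1 *\<^sub>R (1, 0) + Im u1 *\<^sub>R (\<i>, 0) + Re u2 *\<^sub>R (0, 1) + Im u2 *\<^sub>R (0, \<i> :: complex)"
  by (simp add: complex_eq_iff)
 then show ?thesis by (simp only: H.add H.scaleR)
qed

text \<open>On the pair u, iu the form is 2i times the Levi form of u, and the Levi form is a
  quarter of the sum of the real Hessian at u and at iu, since the parts of types (2,0) and (0,2)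
  cancel in that sum. The symmetry of \<open>H\<close> enters here.\<close>

lemma delbar_del_eq:
 assumes x: "x : U"
 shows "delbar_del_form ro x (u1, u2) (\<i> * u1, \<i> * u2) =
  \<i> / 2 * of_real (H x (u1, u2) \<bullet> (u1, u2) + H x (\<i> * u1, \<i> * u2) \<bullet> (\<i> * u1, \<i> * u2))"
proof -
 obtain P1 P2 where P: "H x (1, 0) = (P1, P2)" by fastforce
 obtain Q1 Q2 where Q: "H x (\<i>, 0) = (Q1, Q2)" by fastforce
 obtain R1 R2 where R: "H x (0, 1) = (R1, R2)" by fastforce
 obtain S1 S2 where S: "H x (0, \<i>) = (S1, S2)" by fastforce
 note sym = H_sym[OF x]
 have s: "Re Q1 = Im P1" "Re R1 = Re P2" "Re S1 = Im P2" "Im R1 = Re Q2" "Im S1 = Im Q2" "Re S2 = Im R2"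
  using sym[of "(1, 0)" "(\<i>, 0)"] sym[of "(1, 0)" "(0, 1)"] sym[of "(1, 0)" "(0, \<i>)"]
   sym[of "(\<i>, 0)" "(0, 1)"] sym[of "(\<i>, 0)" "(0, \<i>)"] sym[of "(0, 1)" "(0, \<i>)"]
  by (simp_all add: P Q R S inner_prod_def inner_complex_def)
 have 1: "delbar_del_form ro x (u1, u2) (\<i> * u1, \<i> * u2) =
   (cnj P1 + \<i> * cnj Q1) / 4 * (cnj u1 * (\<i> * u1) - cnj (\<i> * u1) * u1) +
   (cnj P2 + \<i> * cnj Q2) / 4 * (cnj u1 * (\<i> * u2) - cnj (\<i> * u1) * u2) +
   ((cnj R1 + \<i> * cnj S1) / 4 * (cnj u2 * (\<i> * u1) - cnj (\<i> * u2) * u1) +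
   (cnj R2 + \<i> * cnj S2) / 4 * (cnj u2 * (\<i> * u2) - cnj (\<i> * u2) * u2))"
  by (simp add: delbar_del_form_def dzbar_dz_ro[OF x, unfolded One_nat_def] coord_def coord_vec_def P Q R S)
 have 2: "H x (u1, u2) \<bullet> (u1, u2) + H x (\<i> * u1, \<i> * u2) \<bullet> (\<i> * u1, \<i> * u2) =
   (Re P1 + Im Q1) * ((Re u1)\<^sup>2 + (Im u1)\<^sup>2) + (Re R2 + Im S2) * ((Re u2)\<^sup>2 + (Im u2)\<^sup>2) +
   2 * (Re P2 + Im Q2) * (Re u1 * Re u2 + Im u1 * Im u2) + 2 * (Im P2 - Re Q2) * (Re u1 * Im u2 - Im u1 * Re u2)"
  unfolding H_expand[OF x, of u1] H_expand[OF x, of "\<i> * u1"] P Q R S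
  by (simp add: inner_prod_def inner_complex_def s power2_eq_square algebra_simps)
 show ?thesis
  unfolding 1 2 by (simp add: complex_eq_iff s power2_eq_square) (simp add: field_simps)
qed

lemma outer_normal_eq:
 assumes "zt : U"
 shows "outer_normal ro zt = sgn (G zt)"
proof -
 have "frechet_derivative ro (at zt) = (%v. G zt \<bullet> v)"
  by (rule frechet_derivative_at[symmetric, OF ro_deriv[OF assms]])
 then show ?thesis by (simp add: outer_normal_def euclidean_representation)
qed

text \<open>The form \<open>del_form\<close> vanishes on the two complex tangent vectors of the
  frame, so one of the three terms of the wedge product survives: the length of the gradient times
  the Levi form.\<close>

lemma leray_density_eq:
 assumes zt: "zt : U" "G zt ~= 0"
 defines "n == sgn (G zt)"
 shows "leray_density ro zt w = of_real (norm (G zt) *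
   (H zt (- cnj (snd n), cnj (fst n)) \<bullet> (- cnj (snd n), cnj (fst n)) +
    H zt (\<i> * - cnj (snd n), \<i> * cnj (fst n)) \<bullet> (\<i> * - cnj (snd n), \<i> * cnj (fst n)))) /
   (of_real (4 * pi\<^sup>2) * (cnj (fst (G zt)) * (fst zt - fst w) + cnj (snd (G zt)) * (snd zt - snd w))\<^sup>2)"
proof -
 obtain g1 g2 where g: "G zt = (g1, g2)" by fastforce
 define N where "N = norm (G zt)"
 have N: "N > 0" using zt by (simp add: N_def)
 have n: "fst n = g1 / of_real N" "snd n = g2 / of_real N"
  by (simp_all add: n_def sgn_div_norm g N_def[unfolded g] scaleR_conv_of_real divide_inverse mult.commute)
 have N2: "g1 * cnj g1 + g2 * cnj g2 = (of_real N)\<^sup>2"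
 proof -
  have "N\<^sup>2 = (norm g1)\<^sup>2 + (norm g2)\<^sup>2" by (simp add: N_def g norm_Pair)
  then show ?thesis by (simp only: complex_norm_square[symmetric] of_real_power[symmetric] of_real_add[symmetric])
 qed
 have del: "del_form ro zt (u1, u2) = (cnj g1 * u1 + cnj g2 * u2) / 2" for u1 u2
  by (simp add: del_form_def dz_ro[OF zt(1), unfolded One_nat_def] coord_def g add_divide_distrib)
 have d1: "del_form ro zt (\<i> * fst n, \<i> * snd n) = \<i> * of_real N / 2"
 proof -
  have "cnj g1 * (\<i> * (g1 / of_real N)) + cnj g2 * (\<i> * (g2 / of_real N)) = \<i> * (g1 * cnj g1 + g2 * cnj g2) / of_real N"
   by (simp add: add_divide_distrib algebra_simps)
  also have "... = \<i> * of_real N" unfolding N2 using N by (simp add: power2_eq_square)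
  finally show ?thesis unfolding del n by simp
 qed
 have d2: "del_form ro zt (- cnj (snd n), cnj (fst n)) = 0" "del_form ro zt (- \<i> * cnj (snd n), \<i> * cnj (fst n)) = 0"
  unfolding del n by (simp_all add: mult_ac)
 have vec: "(- \<i> * cnj (snd n), \<i> * cnj (fst n)) = (\<i> * - cnj (snd n), \<i> * cnj (fst n))" by simp
 have ii: "\<i> * of_real N / 2 * (\<i> / 2 * of_real Y) = - (of_real (N * Y) / 4)" for Y :: real
  by (simp add: complex_eq_iff)
 have lf: "leray_form ro zt (\<i> * fst n, \<i> * snd n) (- cnj (snd n), cnj (fst n)) (- \<i> * cnj (snd n), \<i> * cnj (fst n)) =
   - (of_real (N * (H zt (- cnj (snd n), cnj (fst n)) \<bullet> (- cnj (snd n), cnj (fst n)) +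
    H zt (\<i> * - cnj (snd n), \<i> * cnj (fst n)) \<bullet> (\<i> * - cnj (snd n), \<i> * cnj (fst n)))) / 4)"
  unfolding leray_form_def d1 d2 unfolding vec delbar_del_eq[OF zt(1)]
  by (simp only: ii mult_zero_left add_0_right)
 have den: "(\<Sum>j\<in>{1,2}. dz j (cfun ro) zt * (coord j zt - coord j w)) =
   (cnj g1 * (fst zt - fst w) + cnj g2 * (snd zt - snd w)) / 2"
  by (simp add: dz_ro[OF zt(1), unfolded One_nat_def] coord_def g add_divide_distrib)
 have pi: "(2 * cr pi * \<i>)\<^sup>2 = - of_real (4 * pi\<^sup>2)"
  by (simp add: power_mult_distrib)
 show ?thesis
  unfolding leray_density_def Let_def outer_normal_eq[OF zt(1)] n_def[symmetric] lf den pi N_def[symmetric]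
  by (simp add: g power_divide)
qed

text \<open>The real part is \<open>G zt \<bullet> (zt - w)\<close>, which is positive by
  \<open>support\<close>.\<close>

lemma leray_denominator:
 assumes "zt : frontier D" "w : D"
 shows "cnj (fst (G zt)) * (fst zt - fst w) + cnj (snd (G zt)) * (snd zt - snd w) ~= 0"
proof
 assume "cnj (fst (G zt)) * (fst zt - fst w) + cnj (snd (G zt)) * (snd zt - snd w) = 0"
 then have "Re (cnj (fst (G zt)) * (fst zt - fst w) + cnj (snd (G zt)) * (snd zt - snd w)) = 0" by simp
 then have "G zt \<bullet> (w - zt) = 0"
  by (simp add: inner_prod_def inner_complex_def algebra_simps)
 then show False using support[OF assms] by simp
qed

lemma leray_density_cont:
 assumes w: "w : D"
 shows "continuous_on (frontier D) (%zt. leray_density ro zt w)"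
proof -
 let ?F = "frontier D"
 have G: "continuous_on ?F G"
  by (rule continuous_at_imp_continuous_on) (use frontier_U G_deriv in \<open>blast intro: has_derivative_continuous\<close>)
 have Hc: "continuous_on ?F (%zt. H zt (u1 zt, u2 zt))" if u: "continuous_on ?F u1" "continuous_on ?F u2" for u1 u2
 proof -
  have "continuous_on ?F (%zt. Re (u1 zt) *\<^sub>R H zt (1, 0) + Im (u1 zt) *\<^sub>R H zt (\<i>, 0) + Re (u2 zt) *\<^sub>R H zt (0, 1) + Im (u2 zt) *\<^sub>R H zt (0, \<i>))"
   by (intro continuous_intros u continuous_on_subset[OF H_cont U(2)])
  then show ?thesis by (rule continuous_on_eq) (rule H_expand[OF frontier_U, symmetric])
 qed
 have n: "continuous_on ?F (%zt. sgn (G zt))"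
  by (intro continuous_intros G) (use G_ne in blast)
 have c1: "continuous_on ?F (%zt. - cnj (snd (sgn (G zt))))" "continuous_on ?F (%zt. cnj (fst (sgn (G zt))))"
  by (intro continuous_intros n)+
 have c2: "continuous_on ?F (%zt. \<i> * - cnj (snd (sgn (G zt))))" "continuous_on ?F (%zt. \<i> * cnj (fst (sgn (G zt))))"
  by (intro continuous_intros n)+
 have "continuous_on ?F (%zt. of_real (norm (G zt) *
   (H zt (- cnj (snd (sgn (G zt))), cnj (fst (sgn (G zt)))) \<bullet> (- cnj (snd (sgn (G zt))), cnj (fst (sgn (G zt)))) +
    H zt (\<i> * - cnj (snd (sgn (G zt))), \<i> * cnj (fst (sgn (G zt)))) \<bullet> (\<i> * - cnj (snd (sgn (G zt))), \<i> * cnj (fst (sgn (G zt)))))) /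
   (of_real (4 * pi\<^sup>2) * (cnj (fst (G zt)) * (fst zt - fst w) + cnj (snd (G zt)) * (snd zt - snd w))\<^sup>2) :: complex)"
 proof (rule continuous_on_divide)
  show "continuous_on ?F (%zt. of_real (norm (G zt) *
   (H zt (- cnj (snd (sgn (G zt))), cnj (fst (sgn (G zt)))) \<bullet> (- cnj (snd (sgn (G zt))), cnj (fst (sgn (G zt)))) +
    H zt (\<i> * - cnj (snd (sgn (G zt))), \<i> * cnj (fst (sgn (G zt)))) \<bullet> (\<i> * - cnj (snd (sgn (G zt))), \<i> * cnj (fst (sgn (G zt)))))) :: complex)"
   by (rule continuous_on_of_real[OF continuous_on_mult[OF continuous_on_norm[OF G]
     continuous_on_add[OF continuous_on_inner[OF Hc[OF c1] continuous_on_Pair[OF c1]]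
      continuous_on_inner[OF Hc[OF c2] continuous_on_Pair[OF c2]]]]])
  show "continuous_on ?F (%zt. of_real (4 * pi\<^sup>2) * (cnj (fst (G zt)) * (fst zt - fst w) + cnj (snd (G zt)) * (snd zt - snd w))\<^sup>2 :: complex)"
   by (intro continuous_intros G)
  show "\<forall>zt\<in>?F. of_real (4 * pi\<^sup>2) * (cnj (fst (G zt)) * (fst zt - fst w) + cnj (snd (G zt)) * (snd zt - snd w))\<^sup>2 ~= 0"
  proof
   fix zt assume "zt : ?F"
   from leray_denominator[OF this w]
   show "of_real (4 * pi\<^sup>2) * (cnj (fst (G zt)) * (fst zt - fst w) + cnj (snd (G zt)) * (snd zt - snd w))\<^sup>2 ~= 0"
    by simp
  qed
 qed
 then show ?thesis
  by (rule continuous_on_eq) (simp only: leray_density_eq[OF frontier_U G_ne])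
qed

text \<open>A unimodular factor rotates the real plane spanned by u and iu, and the trace of the
  Hessian on this plane does not change.\<close>

lemma unimodular_levi:
 assumes x: "x : U" and l: "norm l = 1"
 shows "H x (l * u1, l * u2) \<bullet> (l * u1, l * u2) + H x (\<i> * (l * u1), \<i> * (l * u2)) \<bullet> (\<i> * (l * u1), \<i> * (l * u2)) =
   H x (u1, u2) \<bullet> (u1, u2) + H x (\<i> * u1, \<i> * u2) \<bullet> (\<i> * u1, \<i> * u2)"
proof -
 interpret H: bounded_linear "H x" by (rule H_linear[OF x])
 define v w where "v = (u1, u2)" and "w = (\<i> * u1, \<i> * u2)"
 have 1: "(l * u1, l * u2) = Re l *\<^sub>R v + Im l *\<^sub>R w" "(\<i> * (l * u1), \<i> * (l * u2)) = Re l *\<^sub>R w - Im l *\<^sub>R v"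
  by (simp_all add: v_def w_def complex_eq_iff algebra_simps)
 have "(Re l)\<^sup>2 + (Im l)\<^sup>2 = 1" using l by (metis cmod_power2 power_one)
 then have l2: "Re l * Re l + Im l * Im l = 1" by (simp add: power2_eq_square)
 have "H x (l * u1, l * u2) \<bullet> (l * u1, l * u2) + H x (\<i> * (l * u1), \<i> * (l * u2)) \<bullet> (\<i> * (l * u1), \<i> * (l * u2)) =
  (Re l * Re l + Im l * Im l) * (H x v \<bullet> v + H x w \<bullet> w)"
  unfolding 1 by (simp add: H.add H.diff H.scaleR inner_add_left inner_add_right inner_diff_left inner_diff_right algebra_simps)
 then show ?thesis unfolding l2 by (simp add: v_def w_def)
qed

text \<open>Up to a unimodular factor and a scale the complex tangent vector of the frame is the
  tangent of the profile curve. The Hessian on it comes from \<open>profile_curve\<close>, and that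
  on its \<open>\<i>\<close>-multiple from \<open>orbit_curve\<close>.\<close>

lemma leray_density_pt:
 assumes r: "0 < r" "r < b1" and w: "w : D"
 shows "leray_density ro (pt a b r) w =
  of_real ((- fy2 r - fy1 r / r + (fy1 r)\<^sup>2 / fy r) / (4 * pi\<^sup>2 * sqrt (1 + (fy1 r)\<^sup>2) * (fy r - r * fy1 r)\<^sup>2)) /
   (1 - cis (- a) * of_real (Sf r / r) * fst w - cis (- b) * of_real ((1 - Sf r) / fy r) * snd w)\<^sup>2"
proof -
 have r': "\<bar>r\<bar> < b1" using r by simp
 have p: "fy r > 0" by (rule fy_pos[OF r'])
 have den: "fy r - r * fy1 r > 0" using r by (intro den_pos) auto
 note fr = pt_frontier[OF r', of a b]
 note fU = frontier_U[OF fr]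
 obtain B where B: "B > 0" "G (pt a b r) = (of_real (- B * fy1 r) * cis a, of_real B * cis b)"
  by (rule gradient_pt[OF r])
 define k where "k = sqrt (1 + (fy1 r)\<^sup>2)"
 have k: "k > 0" "k * k = 1 + (fy1 r)\<^sup>2" by (auto simp: k_def add_pos_nonneg)
 have "norm (G (pt a b r)) = sqrt ((B * fy1 r)\<^sup>2 + B\<^sup>2)"
  by (simp add: B norm_Pair norm_mult power_mult_distrib)
 also have "(B * fy1 r)\<^sup>2 + B\<^sup>2 = B\<^sup>2 * (1 + (fy1 r)\<^sup>2)"
  by (simp add: power2_eq_square algebra_simps)
 also have "sqrt ... = B * k" using B(1) by (simp add: real_sqrt_mult k_def)
 finally have nG: "norm (G (pt a b r)) = B * k" .
 define n where "n = sgn (G (pt a b r))"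
 have n: "fst n = of_real (- fy1 r / k) * cis a" "snd n = of_real (1 / k) * cis b"
  unfolding n_def sgn_div_norm nG using B k(1) by (simp_all add: scaleR_conv_of_real field_simps)
 \<comment> \<open>The unimodular factor that carries the normalized tangent of the profile curve to
   the complex tangent vector of the frame.\<close>
 define l where "l = - cis (- a - b)"
 have l: "norm l = 1" by (simp add: l_def)
 have ta: "- cnj (snd n) = l * (of_real (1 / k) * cis a)" "cnj (fst n) = l * (of_real (1 / k) * (cis b * of_real (fy1 r)))"
  unfolding n l_def by (simp_all add: cis_cnj cis_mult mult_ac flip: mult.assoc)
 define Q where "Q u = H (pt a b r) u \<bullet> u" for u
 interpret H: bounded_linear "H (pt a b r)" by (rule H_linear[OF fU])
 have Qs: "Q (of_real c * u1, of_real c * u2) = c\<^sup>2 * Q (u1, u2)" for c u1 u2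
 proof -
  have "(of_real c * u1, of_real c * u2) = c *\<^sub>R (u1, u2)" by (simp add: scaleR_conv_of_real)
  then show ?thesis by (simp only: Q_def H.scaleR inner_scaleR_left inner_scaleR_right power2_eq_square mult.assoc)
 qed
 have "Q (- cnj (snd n), cnj (fst n)) + Q (\<i> * - cnj (snd n), \<i> * cnj (fst n)) =
   Q (of_real (1 / k) * cis a, of_real (1 / k) * (cis b * of_real (fy1 r))) +
   Q (\<i> * (of_real (1 / k) * cis a), \<i> * (of_real (1 / k) * (cis b * of_real (fy1 r))))"
  unfolding ta Q_def by (rule unimodular_levi[OF fU l])
 also have "... = (1 / k)\<^sup>2 * Q (cis a, cis b * of_real (fy1 r)) + (1 / k)\<^sup>2 * Q (\<i> * cis a, \<i> * (cis b * of_real (fy1 r)))"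
  unfolding Qs[symmetric] by (simp only: mult.left_commute[of \<i>])
 also have "Q (cis a, cis b * of_real (fy1 r)) = - B * fy2 r"
 proof -
  have "G (pt a b r) \<bullet> (0, cis b * of_real (fy2 r)) = B * fy2 r"
   unfolding B by (simp only: inner_prod_def fst_conv snd_conv mult.commute[of "cis b"] inner_of_real_cis inner_zero_right add_0)
  then show ?thesis using profile_curve(2)[OF r', of a b] by (simp add: Q_def)
 qed
 also have "Q (\<i> * cis a, \<i> * (cis b * of_real (fy1 r))) = B * (- fy1 r / r + (fy1 r)\<^sup>2 / fy r)"
 proof -
  \<comment> \<open>The angular speeds at which the velocity of the orbit is exactly
    \<open>\<i>\<close> times the tangent of the profile curve.\<close>
  define al bt where "al = 1 / r" and "bt = fy1 r / fy r"
  have ab: "al * r = 1" "bt * fy r = fy1 r" "al\<^sup>2 * r = 1 / r" "bt\<^sup>2 * fy r = (fy1 r)\<^sup>2 / fy r"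
   using r p by (auto simp: al_def bt_def power2_eq_square)
  have "Q (\<i> * cis a, \<i> * (cis b * of_real (fy1 r))) =
   - (G (pt a b r) \<bullet> (of_real (- al\<^sup>2 * r) * cis a, of_real (- bt\<^sup>2 * fy r) * cis b))"
   using orbit_curve(2)[OF r', of a b al bt] unfolding ab by (simp add: Q_def mult_ac)
  also have "G (pt a b r) \<bullet> (of_real (- al\<^sup>2 * r) * cis a, of_real (- bt\<^sup>2 * fy r) * cis b) =
    (- B * fy1 r) * (- al\<^sup>2 * r) + B * (- bt\<^sup>2 * fy r)"
   unfolding B by (simp only: inner_prod_def fst_conv snd_conv inner_of_real_cis)
  also have "... = B * fy1 r * (al\<^sup>2 * r) - B * (bt\<^sup>2 * fy r)"
   by simp
  finally show ?thesis unfolding ab by (simp add: algebra_simps)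
 qed
 finally have Qsum': "Q (- cnj (snd n), cnj (fst n)) + Q (\<i> * - cnj (snd n), \<i> * cnj (fst n)) =
   (1 / k)\<^sup>2 * (- B * fy2 r) + (1 / k)\<^sup>2 * (B * (- fy1 r / r + (fy1 r)\<^sup>2 / fy r))" .
 have "(1 / k)\<^sup>2 * (- B * X) + (1 / k)\<^sup>2 * (B * (- Y + Z)) = B / (k * k) * (- X - Y + Z)" for X Y Z
  using k(1) by (simp add: power2_eq_square field_simps)
 from this[of "fy2 r" "fy1 r / r" "(fy1 r)\<^sup>2 / fy r"] Qsum' have Qsum: "Q (- cnj (snd n), cnj (fst n)) + Q (\<i> * - cnj (snd n), \<i> * cnj (fst n)) =
   B / (k * k) * (- fy2 r - fy1 r / r + (fy1 r)\<^sup>2 / fy r)"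
  by (simp only: minus_divide_left)
 have d0: "cnj (fst (G (pt a b r))) * (fst (pt a b r) - fst w) + cnj (snd (G (pt a b r))) * (snd (pt a b r) - snd w) =
   of_real (B * (fy r - r * fy1 r)) * (1 - cis (- a) * of_real (Sf r / r) * fst w - cis (- b) * of_real ((1 - Sf r) / fy r) * snd w)"
 proof -
  have cc: "cnj (cis x) * cis x = 1" for x by (simp add: cis_cnj cis_mult)
  have "cnj (fst (G (pt a b r))) * (fst (pt a b r) - fst w) + cnj (snd (G (pt a b r))) * (snd (pt a b r) - snd w) =
    of_real (- B * fy1 r) * ((cnj (cis a) * cis a) * of_real r - cnj (cis a) * fst w) +
    of_real B * ((cnj (cis b) * cis b) * of_real (fy r) - cnj (cis b) * snd w)"
   unfolding B by (simp add: pt_def torus_rot_def algebra_simps)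
  also have "... = of_real (B * (fy r - r * fy1 r)) - cis (- a) * of_real (- B * fy1 r) * fst w - cis (- b) * of_real B * snd w"
   unfolding cc by (simp add: cis_cnj algebra_simps)
  also have "- B * fy1 r = (B * (fy r - r * fy1 r)) * (Sf r / r)"
   using r den by (simp add: Sf_def)
  also have "of_real (B * (fy r - r * fy1 r)) - cis (- a) * of_real ((B * (fy r - r * fy1 r)) * (Sf r / r)) * fst w - cis (- b) * of_real B * snd w
   = of_real (B * (fy r - r * fy1 r)) - cis (- a) * of_real ((B * (fy r - r * fy1 r)) * (Sf r / r)) * fst w
     - cis (- b) * of_real ((B * (fy r - r * fy1 r)) * ((1 - Sf r) / fy r)) * snd w"
  proof -
   have "(fy r - r * fy1 r) * (1 - Sf r) = fy r" using den by (simp add: Sf_def field_simps)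
   then have "B = (B * (fy r - r * fy1 r)) * ((1 - Sf r) / fy r)"
    using p by (simp add: field_simps)
   then show ?thesis by simp
  qed
  also have "... = of_real (B * (fy r - r * fy1 r)) * (1 - cis (- a) * of_real (Sf r / r) * fst w - cis (- b) * of_real ((1 - Sf r) / fy r) * snd w)"
  proof -
   have "of_real E - x * of_real (E * u) * y - z * of_real (E * v) * w' = of_real E * (1 - x * of_real u * y - z * of_real v * w')"
    for E u v :: real and x y z w' :: complex by (simp add: algebra_simps)
   then show ?thesis .
  qed
  finally show ?thesis .
 qed
 show ?thesis
  unfolding leray_density_eq[OF fU G_ne[OF fr]] n_def[symmetric] Q_def[symmetric] Qsum nG d0
 proof -
  define X where "X = (1 - cis (- a) * of_real (Sf r / r) * fst w - cis (- b) * of_real ((1 - Sf r) / fy r) * snd w)\<^sup>2"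
  define Y d where "Y = - fy2 r - fy1 r / r + (fy1 r)\<^sup>2 / fy r" and "d = fy r - r * fy1 r"
  have real: "B * k * (B / (k * k) * Y) / (4 * pi\<^sup>2 * (B * d)\<^sup>2) = Y / (4 * pi\<^sup>2 * k * d\<^sup>2)"
   using B(1) k(1) den by (simp add: d_def[symmetric] power2_eq_square field_simps)
  have "cr (B * k * (B / (k * k) * Y)) / (of_real (4 * pi\<^sup>2) * (of_real (B * d) * q)\<^sup>2) =
   of_real (B * k * (B / (k * k) * Y) / (4 * pi\<^sup>2 * (B * d)\<^sup>2)) / q\<^sup>2" for q
   by (simp add: power_mult_distrib)
  then show "cr (B * k * (B / (k * k) * (- fy2 r - fy1 r / r + (fy1 r)\<^sup>2 / fy r))) /
   (of_real (4 * pi\<^sup>2) * (of_real (B * (fy r - r * fy1 r)) * (1 - cis (- a) * of_real (Sf r / r) * fst w - cis (- b) * of_real ((1 - Sf r) / fy r) * snd w))\<^sup>2) =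
   of_real ((- fy2 r - fy1 r / r + (fy1 r)\<^sup>2 / fy r) / (4 * pi\<^sup>2 * sqrt (1 + (fy1 r)\<^sup>2) * (fy r - r * fy1 r)\<^sup>2)) /
   (1 - cis (- a) * of_real (Sf r / r) * fst w - cis (- b) * of_real ((1 - Sf r) / fy r) * snd w)\<^sup>2"
   unfolding Y_def[symmetric] d_def[symmetric] k_def[symmetric] real by simp
 qed
qed

end

context C2_reinhardt_pair
begin

text \<open>By the derivative formula for \<open>Sf\<close> the curvature term of the kernel is
  proportional to p, while \<open>jj\<close> contains 1/p. In the product p and all second
  derivatives disappear.\<close>

lemma leray_density_curve:
 assumes s: "0 < s" "s < 1" and w: "w : D"
 shows "leray_density ro (torus_rot a b (of_real (rr s), of_real (tt s))) w * of_real (jj s) =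
  1 / (of_real (4 * pi\<^sup>2) * (1 - cis (- a) * of_real (s / rr s) * fst w - cis (- b) * of_real ((1 - s) / tt s) * snd w)\<^sup>2)"
proof -
 define r where "r = ri s"
 have r: "0 < r" "r < b1" "Sf r = s" using ri[OF s] by (auto simp: r_def)
 have i: "rr s = r" "tt s = fy r" "pp s = Pf r" using interior_eqs[OF s] by (auto simp: r_def)
 define f f1 f2 d k where "f = fy r" and "f1 = fy1 r" and "f2 = fy2 r" and "d = f - r * f1" and "k = sqrt (1 + f1\<^sup>2)"
 have nz: "d > 0" "f > 0" "f1 < 0" "Pf r > 0" "k > 0"
  using den_pos[of r] fy_inverse(1)[of r] fy1_neg[of r] Pf_gt[of r] r
  by (auto simp: d_def f_def f1_def k_def add_pos_nonneg)
 have sd: "s * d = - r * f1" "(1 - s) * d = f"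
 proof -
  have "s = - r * f1 / d" using r(3) by (simp add: Sf_def f_def f1_def d_def)
  then show "s * d = - r * f1" using nz by simp
  then show "(1 - s) * d = f" by (simp add: left_diff_distrib) (simp add: d_def)
 qed
 have s1: "r / s = - d / f1" using sd(1) s nz by (simp add: field_simps)
 have s2: "f / (1 - s) = d" using sd(2) s nz by (simp add: field_simps)
 have "(r / s)\<^sup>2 + (f / (1 - s))\<^sup>2 = (d / - f1)\<^sup>2 * (1 + f1\<^sup>2)"
  unfolding s1 s2 using nz by (simp add: power2_eq_square field_simps)
 then have "sqrt ((r / s)\<^sup>2 + (f / (1 - s))\<^sup>2) = d / - f1 * k"
  using nz by (simp add: real_sqrt_mult k_def divide_nonneg_neg)
 then have j: "jj s = r * f / Pf r * (d / - f1 * k)"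
  unfolding jj_interior[OF s] i by (simp add: f_def)
 have P: "Pf r * s / r = (- r * f * f2 - f1 * d) / d\<^sup>2"
  using Sf_deriv_eq[OF r(1,2)] by (simp add: r(3) f_def f1_def f2_def d_def)
 have "s / r = - f1 / d" using s1 nz s r by (simp add: field_simps)
 then have "Pf r * (- f1 / d) = (- r * f * f2 - f1 * d) / d\<^sup>2" using P by (metis times_divide_eq_right)
 then have "- (r * f * f2) - f1 * d = - Pf r * f1 * d"
  using nz by (simp add: field_simps power2_eq_square)
 moreover have "(- f2 - f1 / r + f1\<^sup>2 / f) * (r * f) = - (r * f * f2) - f1 * d"
  using nz r by (simp add: d_def field_simps power2_eq_square)
 ultimately have num: "(- f2 - f1 / r + f1\<^sup>2 / f) * (r * f) = - Pf r * f1 * d" by simp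
 have "(- f2 - f1 / r + f1\<^sup>2 / f) / (4 * pi\<^sup>2 * k * d\<^sup>2) * jj s =
   ((- f2 - f1 / r + f1\<^sup>2 / f) * (r * f)) * ((1 / Pf r) * (d / - f1 * k) / (4 * pi\<^sup>2 * k * d\<^sup>2))"
  unfolding j by (simp add: mult_ac)
 also have "... = 1 / (4 * pi\<^sup>2)"
  unfolding num using nz by (simp add: power2_eq_square field_simps)
 finally have real: "(- f2 - f1 / r + f1\<^sup>2 / f) / (4 * pi\<^sup>2 * k * d\<^sup>2) * jj s = 1 / (4 * pi\<^sup>2)" .
 have "leray_density ro (torus_rot a b (of_real (rr s), of_real (tt s))) w * of_real (jj s) =
  of_real ((- f2 - f1 / r + f1\<^sup>2 / f) / (4 * pi\<^sup>2 * k * d\<^sup>2) * jj s) /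
   (1 - cis (- a) * of_real (s / r) * fst w - cis (- b) * of_real ((1 - s) / f) * snd w)\<^sup>2"
 proof -
  have "torus_rot a b (of_real (rr s), of_real (tt s)) = pt a b r" by (simp add: i pt_def)
  moreover have "cr y / z * of_real j = of_real (y * j) / z" for y z j
   by simp
  ultimately show ?thesis
   by (simp only: leray_density_pt[OF r(1,2) w] r(3) f_def f1_def f2_def d_def k_def)
 qed
 also have "... = 1 / (of_real (4 * pi\<^sup>2) * (1 - cis (- a) * of_real (s / rr s) * fst w - cis (- b) * of_real ((1 - s) / tt s) * snd w)\<^sup>2)"
  unfolding real i f_def[symmetric] by simp
 finally show ?thesis .
qed

end

section \<open>Surface measure in coordinates\<close>

definition chart :: "C2 set => (real \<times> real \<times> real) set => (real \<times> real \<times> real => C2) =>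
  (real \<times> real \<times> real => real \<times> real \<times> real => C2) => bool" where
 "chart S U ps ps' \<longleftrightarrow> open U & ps ` U \<subseteq> S & inj_on ps U \<and>
   (\<forall>x\<in>U. (ps has_derivative ps' x) (at x) & inj (ps' x)) \<and>
   (\<forall>v. continuous_on U (%x. ps' x v))"

lemma emeasure_chart:
 assumes "surface_measure S sg" "chart S U ps ps'" "A : sets sg" "A \<subseteq> ps ` U"
 shows "emeasure sg A = (\<integral>\<^sup>+ x\<in>{x\<in>U. ps x : A}.
  ennreal (sqrt (gram_det (ps' x (1, 0, 0)) (ps' x (0, 1, 0)) (ps' x (0, 0, 1)))) \<partial>lborel)"
 using assms unfolding surface_measure_def chart_def by simp

lemma chart_null:
 assumes "surface_measure S sg" "chart S U ps ps'" "A : sets sg" "A \<subseteq> ps ` U"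
  and ae: "AE x in lborel. x : U --> ps x \<notin> A"
 shows "A : null_sets sg"
proof -
 have "emeasure sg A = (\<integral>\<^sup>+ x. 0 \<partial>(lborel :: (real \<times> real \<times> real) measure))"
  unfolding emeasure_chart[OF assms(1-4)]
  by (rule nn_integral_cong_AE) (use ae in eventually_elim, auto simp: indicator_def)
 then show ?thesis using assms(3) by (simp add: null_sets_def)
qed

lemma AE_lborel_fst: "AE x in lborel :: (real \<times> real \<times> real) measure. fst x ~= c"
 and AE_lborel_fst_snd: "AE x in lborel :: (real \<times> real \<times> real) measure. fst (snd x) ~= c"
 and AE_lborel_snd_snd: "AE x in lborel :: (real \<times> real \<times> real) measure. snd (snd x) ~= c"
proof -
 have 1: "{c} \<times> UNIV : null_sets (lborel \<Otimes>\<^sub>M lborel :: (real \<times> 'b::euclidean_space) measure)" for c :: real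
  by (rule lborel.times_in_null_sets1) auto
 have 2: "UNIV \<times> {c} : null_sets (lborel \<Otimes>\<^sub>M lborel :: (real \<times> real) measure)" for c :: real
  by (rule lborel.times_in_null_sets2) auto
 show "AE x in lborel :: (real \<times> real \<times> real) measure. fst x ~= c"
  using 1[of c] unfolding lborel_prod by (rule AE_I'[of "{c} \<times> UNIV"]) auto
 have "UNIV \<times> ({c} \<times> UNIV) : null_sets (lborel \<Otimes>\<^sub>M lborel :: (real \<times> real \<times> real) measure)"
  by (rule lborel.times_in_null_sets2) (use 1[of c] in \<open>auto simp: lborel_prod\<close>)
 then show "AE x in lborel :: (real \<times> real \<times> real) measure. fst (snd x) ~= c"
  unfolding lborel_prod by (rule AE_I'[of "UNIV \<times> ({c} \<times> UNIV)"]) auto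
 have "UNIV \<times> (UNIV \<times> {c}) : null_sets (lborel \<Otimes>\<^sub>M lborel :: (real \<times> real \<times> real) measure)"
  by (rule lborel.times_in_null_sets2) (use 2[of c] in \<open>auto simp: lborel_prod\<close>)
 then show "AE x in lborel :: (real \<times> real \<times> real) measure. snd (snd x) ~= c"
  unfolding lborel_prod by (rule AE_I'[of "UNIV \<times> (UNIV \<times> {c})"]) auto
qed

text \<open>The angular windows are centred at \<open>c\<close> and \<open>d\<close>. The choices 0
  and \<open>pi\<close> give injective charts that together cover the circle.\<close>

definition torus_box :: "real => real => (real \<times> real \<times> real) set" where
 "torus_box c d = {0<..<1} \<times> {c - pi<..<c + pi} \<times> {d - pi<..<d + pi}"

text \<open>The plane cut along the ray opposite to \<open>cis c\<close>, that is the set of nonzero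
  numbers with an angle in the window centred at \<open>c\<close>.\<close>

definition slitp :: "real => complex set" where
 "slitp c = {z. cis (- c) * z \<notin> \<real>\<^sub>\<le>\<^sub>0}"

lemma open_slit_plane: "open (slitp c)"
proof -
 have "slitp c = - ((%z. cis (- c) * z) -` \<real>\<^sub>\<le>\<^sub>0)" by (auto simp: slitp_def)
 then show ?thesis
  by (auto intro!: open_Compl closed_vimage closed_nonpos_Reals_complex continuous_intros)
qed

lemma slitp_nonzero: "z : slitp c ==> z ~= 0"
 by (auto simp: slitp_def)

lemma slitp_cover:
 assumes "z ~= 0" shows "z : slitp 0 \<or> z : slitp pi"
 using assms by (auto simp: slitp_def complex_nonpos_Reals_iff complex_eq_iff)

lemma slitp_polar:
 assumes "z : slitp c"
 shows "\<exists>th. c - pi < th & th < c + pi & z = of_real (norm z) * cis th"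
proof -
 define u where "u = cis (- c) * z"
 have u: "u ~= 0" "u \<notin> \<real>\<^sub>\<le>\<^sub>0" using assms by (auto simp: slitp_def u_def)
 have "Arg u ~= pi"
  using u Arg_eq_pi_iff[of u] by (auto simp: complex_nonpos_Reals_iff Arg_eq_pi)
 then have 1: "- pi < Arg u" "Arg u < pi" using Arg_bounded[of u] by auto
 have "cis c * u = z" by (simp add: u_def cis_mult mult.assoc[symmetric])
 moreover have "u = of_real (norm u) * cis (Arg u)" using rcis_cmod_Arg[of u] by (simp add: rcis_def)
 ultimately have "z = of_real (norm u) * cis (c + Arg u)"
  by (metis cis_mult mult.left_commute)
 moreover have "norm u = norm z" by (simp add: u_def norm_mult)
 ultimately show ?thesis using 1 by (intro exI[of _ "c + Arg u"]) auto
qed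

lemma cis_inj_interval:
 assumes "c - pi < a" "a < c + pi" "c - pi < b" "b < c + pi" "cis a = cis b"
 shows "a = b"
proof -
 have "cis (a - c) = cis (b - c)" using assms(5) by (simp add: cis_divide[symmetric])
 then have "Arg (cis (a - c)) = Arg (cis (b - c))" by simp
 then show ?thesis using assms by (simp add: Arg_cis)
qed

section \<open>Charts across the coordinate axes\<close>

context C2_reinhardt
begin

text \<open>The norm is not differentiable at 0, but there \<open>fy1\<close> vanishes and the
  composition is still differentiable; the formula covers this case because
  \<open>sgn 0 = 0\<close>.\<close>

lemma has_derivative_fy_norm:
 fixes z :: complex
 assumes z: "norm z < b1"
 shows "((%z. fy (norm z)) has_derivative (%v. fy1 (norm z) * (v \<bullet> sgn z))) (at z)"
proof (cases "z = 0")
 case False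
 have "(fy has_derivative (%h. fy1 (norm z) * h)) (at (norm z))"
  using DERIV_fy[of "norm z"] z by (simp add: has_field_derivative_def)
 then show ?thesis by (rule has_derivative_compose[OF has_derivative_norm[OF False]])
next
 case True
 have "(fy has_derivative (%h. 0)) (at 0)"
  using DERIV_fy[of 0] b1_pos by (simp add: has_field_derivative_def fy1_zero lambda_zero)
 then have "((%t. norm (fy t - fy 0) / norm t) \<longlongrightarrow> 0) (at 0)"
  unfolding has_derivative_iff_norm by simp
 moreover have "filterlim (%z::complex. norm z) (at 0) (at 0)"
  by (auto simp: filterlim_at eventually_at_filter intro!: tendsto_eq_intros)
 ultimately have "((%z::complex. norm (fy (norm z) - fy 0) / norm (norm z)) \<longlongrightarrow> 0) (at 0)"
  by (rule filterlim_compose)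
 then show ?thesis unfolding has_derivative_iff_norm by (simp add: True fy1_zero)
qed

lemma continuous_fy_norm_derivative:
 "continuous_on (ball (0::complex) b1) (%z. fy1 (norm z) * (v \<bullet> sgn z))"
proof (rule continuous_at_imp_continuous_on, rule ballI)
 fix z :: complex assume "z : ball 0 b1"
 then have "norm z < b1" by simp
 then have "isCont fy1 (norm z)"
  by (intro DERIV_isCont[OF DERIV_fy1]) simp
 then have 1: "((%z::complex. fy1 (norm z)) \<longlongrightarrow> fy1 (norm z)) (at z)"
  by (rule isCont_tendsto_compose) (rule tendsto_norm, rule tendsto_ident_at)
 show "isCont (%z. fy1 (norm z) * (v \<bullet> sgn z)) z"
 proof (cases "z = 0")
  case False
  then show ?thesis unfolding isCont_def by (intro tendsto_intros 1) auto
 next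
  case True
  have "((%z. fy1 (norm z) * (v \<bullet> sgn z)) \<longlongrightarrow> 0) (at 0)"
  proof (rule Lim_null_comparison[OF always_eventually, OF allI])
   fix z :: complex
   have "\<bar>v \<bullet> sgn z\<bar> <= norm v * norm (sgn z)" by (rule Cauchy_Schwarz_ineq2)
   also have "... <= norm v * 1" by (intro mult_left_mono) (auto simp: norm_sgn)
   finally have "\<bar>v \<bullet> sgn z\<bar> <= norm v" by simp
   then show "norm (fy1 (norm z) * (v \<bullet> sgn z)) <= \<bar>fy1 (norm z)\<bar> * norm v"
    by (simp add: abs_mult mult_left_mono)
   show "((%z::complex. \<bar>fy1 (norm z)\<bar> * norm v) \<longlongrightarrow> 0) (at 0)"
    using 1 unfolding True by (auto intro!: tendsto_eq_intros simp: fy1_zero)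
  qed
  then show ?thesis by (simp add: True isCont_def fy1_zero)
 qed
qed

lemma frontier_graph:
 assumes "norm z < b1"
 shows "(z, of_real (fy (norm z)) * cis th) : frontier D"
proof -
 have "torus_rot (Arg z) th (of_real (norm z), of_real (fy (norm z))) : frontier D"
  using assms by (intro rot_frontier fy_frontier) simp
 moreover have "cis (Arg z) * of_real (norm z) = z"
  using rcis_cmod_Arg[of z] by (simp add: rcis_def mult.commute)
 ultimately show ?thesis by (simp add: torus_rot_def mult.commute)
qed

text \<open>The points on the coordinate axes are covered by the charts
 \<open>(x, y, th) \<mapsto> (x + iy, fy(|x + iy|) e\<^sup>i\<^sup>th)\<close>; taking \<open>f\<close> to be the swap treats the other axis.\<close>

lemma axis_null:
 fixes f :: "C2 => C2"
 assumes f: "bounded_linear f" "inj f" and sg: "surface_measure (f ` frontier D) sg"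
  and A: "A : sets sg" "A \<subseteq> f ` {zt\<in>frontier D. fst zt = 0 & snd zt : slitp c}"
 shows "A : null_sets sg"
proof -
 define z where "z = (%x :: real \<times> real \<times> real. Complex (fst x) (fst (snd x)))"
 define th where "th = (%x :: real \<times> real \<times> real. snd (snd x))"
 define V where "V = {x. norm (z x) < b1 & c - pi < th x & th x < c + pi}"
 define ps where "ps x = f (z x, of_real (fy (norm (z x))) * cis (th x))" for x
 define ps' where "ps' x v = f (z v, of_real (fy (norm (z x))) * (th v *\<^sub>R (\<i> * cis (th x))) +
  of_real (fy1 (norm (z x)) * (z v \<bullet> sgn (z x))) * cis (th x))" for x v
 have bl: "bounded_linear z" "bounded_linear th"
 proof -
  have "z = (%x. of_real (fst x) + \<i> * of_real (fst (snd x)))"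
   by (auto simp: z_def complex_eq_iff)
  then show "bounded_linear z"
   by (auto intro!: bounded_linear_add bounded_linear_const_mult bounded_linear_of_real
     bounded_linear_compose[OF bounded_linear_of_real] bounded_linear_fst
     bounded_linear_compose[OF bounded_linear_fst] bounded_linear_snd)
  show "bounded_linear th" unfolding th_def
   by (intro bounded_linear_compose[OF bounded_linear_snd] bounded_linear_snd)
 qed
 have cont: "continuous_on X z" "continuous_on X th" for X
  using bl by (auto intro: linear_continuous_on)
 have "chart (f ` frontier D) V ps ps'"
  unfolding chart_def
 proof (intro conjI ballI allI)
  show "open V" unfolding V_def
   by (intro open_Collect_conj open_Collect_less continuous_intros cont)
  show "ps ` V \<subseteq> f ` frontier D"
   unfolding ps_def by (rule image_subsetI, rule imageI, rule frontier_graph) (simp add: V_def)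
  show "inj_on ps V"
  proof (rule inj_onI)
   fix x y assume x: "x : V" and y: "y : V" and eq: "ps x = ps y"
   have pr: "(z x, of_real (fy (norm (z x))) * cis (th x)) = (z y, of_real (fy (norm (z y))) * cis (th y))"
    using eq by - (rule injD[OF f(2)], simp add: ps_def)
   then have zz: "z x = z y" by (simp only: prod.inject)
   have "of_real (fy (norm (z x))) * cis (th x) = of_real (fy (norm (z x))) * cis (th y)"
    using pr by (simp only: prod.inject zz)
   moreover have "fy (norm (z x)) > 0" using x by (intro fy_pos) (simp add: V_def)
   ultimately have "cis (th x) = cis (th y)" by simp
   then have "th x = th y" using x y by (intro cis_inj_interval[of c]) (auto simp: V_def)
   with zz show "x = y" by (simp add: z_def th_def prod_eq_iff)
  qed
 next
  fix x assume x: "x : V"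
  then have b: "norm (z x) < b1" by (simp add: V_def)
  show "(ps has_derivative ps' x) (at x)"
   unfolding ps_def ps'_def
   by (rule bounded_linear.has_derivative[OF f(1)], rule has_derivative_Pair,
     rule bounded_linear_imp_has_derivative[OF bl(1)], rule has_derivative_mult,
     rule bounded_linear.has_derivative[OF bounded_linear_of_real],
     rule has_derivative_compose[OF bounded_linear_imp_has_derivative[OF bl(1)] has_derivative_fy_norm[OF b]],
     rule has_derivative_cis, rule bounded_linear_imp_has_derivative[OF bl(2)])
  show "inj (ps' x)"
  proof (rule injI)
   fix v w assume "ps' x v = ps' x w"
   then have pr: "(z v, of_real (fy (norm (z x))) * (th v *\<^sub>R (\<i> * cis (th x))) + of_real (fy1 (norm (z x)) * (z v \<bullet> sgn (z x))) * cis (th x))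
    = (z w, of_real (fy (norm (z x))) * (th w *\<^sub>R (\<i> * cis (th x))) + of_real (fy1 (norm (z x)) * (z w \<bullet> sgn (z x))) * cis (th x))"
    by - (rule injD[OF f(2)], simp add: ps'_def)
   then have zz: "z v = z w" by (simp only: prod.inject)
   have "of_real (fy (norm (z x))) * (th v *\<^sub>R (\<i> * cis (th x))) = of_real (fy (norm (z x))) * (th w *\<^sub>R (\<i> * cis (th x)))"
    using pr by (simp only: prod.inject zz add_right_cancel)
   moreover have "fy (norm (z x)) > 0" using b by (intro fy_pos) simp
   ultimately have "th v = th w" by simp
   with zz show "v = w" by (simp add: z_def th_def prod_eq_iff)
  qed
 next
  fix v
  have m1: "continuous_on V (%x. fy1 (norm (z x)) * (z v \<bullet> sgn (z x)))"
   by (rule continuous_on_compose2[OF continuous_fy_norm_derivative cont(1)]) (auto simp: V_def)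
  have m2: "continuous_on V (%x. fy (norm (z x)))"
   by (rule continuous_on_compose2[OF fy_cont continuous_on_norm[OF cont(1)]])
    (use b1_pos in \<open>auto simp: V_def less_le_trans[of _ 0]\<close>)
  show "continuous_on V (%x. ps' x v)"
   unfolding ps'_def
   by (intro bounded_linear.continuous_on[OF f(1)] continuous_on_Pair continuous_on_add continuous_on_mult
     continuous_on_of_real[OF m1] continuous_on_of_real[OF m2] continuous_on_const
     continuous_on_scaleR continuous_on_cis cont)
 qed
 moreover have "A \<subseteq> ps ` V"
 proof
  fix et assume "et : A"
  then obtain zt where zt: "et = f zt" "zt : frontier D" "fst zt = 0" "snd zt : slitp c"
   using A(2) by blast
  from slitp_polar[OF zt(4)] obtain t where
   t: "c - pi < t" "t < c + pi" "snd zt = of_real (norm (snd zt)) * cis t" by blast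
  have "norm (snd zt) = fy 0" using frontier_snd_eq[OF zt(2)] zt(3) b1_pos by simp
  then have "zt = (0, of_real (fy 0) * cis t)" using t(3) zt(3) by (simp add: prod_eq_iff)
  moreover have "Complex 0 0 = 0" by (simp add: complex_eq_iff)
  ultimately have "et = ps (0, 0, t)" "(0, 0, t) : V"
   unfolding ps_def zt(1) using t(1,2) b1_pos by (simp_all add: z_def th_def V_def)
  then show "et : ps ` V" by (rule image_eqI)
 qed
 moreover have "AE x in lborel. x : V --> ps x \<notin> A"
  using AE_lborel_fst[of 0]
 proof eventually_elim
  case (elim x)
  show ?case
  proof (intro impI notI)
   assume "ps x : A"
   then obtain zt where "f (z x, of_real (fy (norm (z x))) * cis (th x)) = f zt" "fst zt = 0"
    using A(2) unfolding ps_def by blast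
   then have "z x = 0" using injD[OF f(2)] by (metis fst_conv)
   then show False using elim by (simp add: z_def complex_eq_iff)
  qed
 qed
 ultimately show ?thesis by (intro chart_null[OF sg _ A(1)])
qed

end

section \<open>The chart by s and the two angles\<close>

context C2_reinhardt_pair
begin

definition psi :: "real \<times> real \<times> real => C2" where
 "psi x = (of_real (rr (fst x)) * cis (fst (snd x)), of_real (tt (fst x)) * cis (snd (snd x)))"

lemma psi_torus_rot: "psi (s, a, b) = torus_rot a b (of_real (rr s), of_real (tt s))"
 by (simp add: psi_def torus_rot_def mult.commute)

lemma clamp_eqs: "rr s = rr (max 0 (min 1 s))" "tt s = tt (max 0 (min 1 s))" "jj s = jj (max 0 (min 1 s))"
 by (auto simp: rr_def tt_def jj_def)

lemma psi_frontier: "psi x : frontier D"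
proof -
 have "psi (fst x, fst (snd x), snd (snd x)) : frontier D"
  unfolding psi_torus_rot clamp_eqs(1,2)[of "fst x"]
  by (intro rot_frontier curve_in_frontier) auto
 then show ?thesis by simp
qed

lemma rr_cont_UNIV: "continuous_on A rr" and tt_cont_UNIV: "continuous_on A tt"
 and jj_cont_UNIV: "continuous_on A jj"
proof -
 have c: "continuous_on A (%s::real. max 0 (min 1 s))" by (intro continuous_intros)
 have i: "(%s::real. max 0 (min 1 s)) ` A \<subseteq> {0..1}" by auto
 show "continuous_on A rr"
  using continuous_on_compose2[OF rr_cont c i] by (simp only: clamp_eqs(1)[symmetric])
 show "continuous_on A tt"
  using continuous_on_compose2[OF tt_cont c i] by (simp only: clamp_eqs(2)[symmetric])
 show "continuous_on A jj"
  using continuous_on_compose2[OF jj_cont c i] by (simp only: clamp_eqs(3)[symmetric])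
qed

lemma psi_cont: "continuous_on A psi"
 unfolding psi_def
 by (intro continuous_intros continuous_on_compose2[OF rr_cont_UNIV] continuous_on_compose2[OF tt_cont_UNIV]) auto

lemma rr_inj: "0 < s ==> s < 1 ==> 0 < s' ==> s' < 1 ==> rr s = rr s' ==> s = s'"
 using ri_less_iff[of s s'] ri_less_iff[of s' s] interior_eqs[of s] interior_eqs[of s']
 by (cases s s' rule: linorder_cases) simp_all

lemma norm_psi: "0 <= s ==> s <= 1 ==> norm (fst (psi (s, a, b))) = rr s & norm (snd (psi (s, a, b))) = tt s"
 using rr_tt_pos[of s] b1_pos b2_pos by (cases "s = 0 \<or> s = 1") (auto simp: psi_def norm_mult rr_def tt_def)

definition psi' :: "real \<times> real \<times> real => real \<times> real \<times> real => C2" where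
 "psi' x v =
   (of_real (rr (fst x)) * (fst (snd v) *\<^sub>R (\<i> * cis (fst (snd x)))) +
    of_real (rr (fst x) / (pp (fst x) * fst x) * fst v) * cis (fst (snd x)),
   of_real (tt (fst x)) * (snd (snd v) *\<^sub>R (\<i> * cis (snd (snd x)))) +
    of_real (- (tt (fst x) / (pp (fst x) * (1 - fst x))) * fst v) * cis (snd (snd x)))"

lemma torus_chart: "chart (frontier D) (torus_box c d) psi psi'"
 unfolding chart_def
proof (intro conjI ballI allI)
 show "open (torus_box c d)" unfolding torus_box_def by (intro open_Times open_greaterThanLessThan)
 show "psi ` torus_box c d \<subseteq> frontier D" by (rule image_subsetI) (rule psi_frontier)
 show "inj_on psi (torus_box c d)"
 proof (rule inj_onI)
  fix x y assume x': "x : torus_box c d" and y': "y : torus_box c d" and eq': "psi x = psi y"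
  obtain s a b where xx: "x = (s, a, b)" by (rule prod_cases3)
  obtain s' a' b' where yy: "y = (s', a', b')" by (rule prod_cases3)
  have x: "(s, a, b) : torus_box c d" and y: "(s', a', b') : torus_box c d"
   and eq: "psi (s, a, b) = psi (s', a', b')" using x' y' eq' by (simp_all only: xx yy)
  from x y have b: "0 < s" "s < 1" "0 < s'" "s' < 1" by (auto simp: torus_box_def)
  have "norm (fst (psi (s, a, b))) = norm (fst (psi (s', a', b')))" by (simp only: eq)
  then have "rr s = rr s'" using norm_psi[of s a b] norm_psi[of s' a' b'] b by simp
  then have s: "s = s'" by (rule rr_inj[OF b])
  have "cis a = cis a'" "cis b = cis b'" using eq rr_tt_pos[OF b(1,2)] by (auto simp: s psi_def)
  then have "a = a'" "b = b'"
   using x y by (auto simp: torus_box_def intro: cis_inj_interval[of c] cis_inj_interval[of d])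
  with s show "x = y" by (simp add: xx yy)
 qed
next
 fix x assume x: "x : torus_box c d"
 then have s: "0 < fst x" "fst x < 1" by (auto simp: torus_box_def)
 have d: "((%x :: real \<times> real \<times> real. rr (fst x)) has_derivative (%v. rr (fst x) / (pp (fst x) * fst x) * fst v)) (at x)"
  "((%x :: real \<times> real \<times> real. tt (fst x)) has_derivative (%v. - (tt (fst x) / (pp (fst x) * (1 - fst x))) * fst v)) (at x)"
  using DERIV_rr[OF s] DERIV_tt[OF s]
  by (auto simp only: has_field_derivative_def intro!: has_derivative_compose[OF has_derivative_fst[OF has_derivative_ident]])
 show "(psi has_derivative psi' x) (at x)"
  unfolding psi_def psi'_def
  by (intro has_derivative_Pair has_derivative_mult has_derivative_cis
    bounded_linear.has_derivative[OF bounded_linear_of_real d(1)]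
    bounded_linear.has_derivative[OF bounded_linear_of_real d(2)]
    has_derivative_fst has_derivative_snd has_derivative_ident)
 show "inj (psi' x)"
 proof (rule injI)
  fix v w assume eq: "psi' x v = psi' x w"
  have "\<i> * of_real (rr (fst x) * fst (snd v)) + of_real (rr (fst x) / (pp (fst x) * fst x) * fst v) =
     \<i> * of_real (rr (fst x) * fst (snd w)) + of_real (rr (fst x) / (pp (fst x) * fst x) * fst w)"
   "\<i> * of_real (tt (fst x) * snd (snd v)) + of_real (- (tt (fst x) / (pp (fst x) * (1 - fst x))) * fst v) =
     \<i> * of_real (tt (fst x) * snd (snd w)) + of_real (- (tt (fst x) / (pp (fst x) * (1 - fst x))) * fst w)"
  proof -
   have e: "of_real r * (k *\<^sub>R (\<i> * cis a)) + of_real m * cis a = (\<i> * of_real (r * k) + of_real m) * cis a"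
    for r k m a by (simp add: scaleR_conv_of_real algebra_simps)
   show "\<i> * of_real (rr (fst x) * fst (snd v)) + of_real (rr (fst x) / (pp (fst x) * fst x) * fst v) =
     \<i> * of_real (rr (fst x) * fst (snd w)) + of_real (rr (fst x) / (pp (fst x) * fst x) * fst w)"
   "\<i> * of_real (tt (fst x) * snd (snd v)) + of_real (- (tt (fst x) / (pp (fst x) * (1 - fst x))) * fst v) =
     \<i> * of_real (tt (fst x) * snd (snd w)) + of_real (- (tt (fst x) / (pp (fst x) * (1 - fst x))) * fst w)"
    using eq by (simp_all only: psi'_def e prod.inject mult_cancel_right cis_neq_zero simp_thms)
  qed
  then have "rr (fst x) * fst (snd v) = rr (fst x) * fst (snd w)" "tt (fst x) * snd (snd v) = tt (fst x) * snd (snd w)"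
   "rr (fst x) / (pp (fst x) * fst x) * fst v = rr (fst x) / (pp (fst x) * fst x) * fst w"
   by (simp_all only: complex_eq_iff) (simp_all)
  then show "v = w" using rr_tt_pos[OF s] s pp_gt[of "fst x"] by (simp add: prod_eq_iff)
 qed
next
 fix v
 have sub: "fst ` torus_box c d \<subseteq> {0..1}" by (auto simp: torus_box_def)
 have p: "continuous_on (torus_box c d) (%x. pp (fst x))"
  by (rule continuous_on_compose2[OF pp_cont continuous_on_fst[OF continuous_on_id] sub])
 have r: "continuous_on (torus_box c d) (%x. rr (fst x))" "continuous_on (torus_box c d) (%x. tt (fst x))"
  by (rule continuous_on_compose2[OF rr_cont_UNIV continuous_on_fst[OF continuous_on_id] subset_UNIV]
    continuous_on_compose2[OF tt_cont_UNIV continuous_on_fst[OF continuous_on_id] subset_UNIV])+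
 have nz: "pp (fst x) * fst x ~= 0" "pp (fst x) * (1 - fst x) ~= 0" if "x : torus_box c d" for x
  using that pp_gt[of "fst x"] by (auto simp: torus_box_def)
 show "continuous_on (torus_box c d) (%x. psi' x v)"
  unfolding psi'_def using nz
  by (intro continuous_on_Pair continuous_on_add continuous_on_mult continuous_on_of_real continuous_on_const
    continuous_on_scaleR continuous_on_cis continuous_on_divide continuous_on_diff continuous_on_minus
    continuous_on_fst continuous_on_snd continuous_on_id p r ballI)
qed

text \<open>The two angular tangent vectors are orthogonal to each other and to the third one, so
  the Gram determinant is the product of three squared lengths.\<close>

lemma sqrt_gram_det:
 assumes "0 < fst x" "fst x < 1"
 shows "sqrt (gram_det (psi' x (1, 0, 0)) (psi' x (0, 1, 0)) (psi' x (0, 0, 1))) = jj (fst x)"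
proof -
 define s r t R T where "s = fst x" and "r = rr s" and "t = tt s" and "R = r / (pp s * s)" and "T = - (t / (pp s * (1 - s)))"
 define a b where "a = cis (fst (snd x))" and "b = cis (snd (snd x))"
 have pos: "r > 0" "t > 0" "pp s > 0" "s > 0" "s < 1"
  using rr_tt_pos[of s] pp_gt[of s] assms by (auto simp: r_def t_def s_def)
 have u: "a \<bullet> a = 1" "b \<bullet> b = 1" "(\<i> * a) \<bullet> (\<i> * a) = 1" "(\<i> * b) \<bullet> (\<i> * b) = 1"
  "a \<bullet> (\<i> * a) = 0" "(\<i> * a) \<bullet> a = 0" "b \<bullet> (\<i> * b) = 0" "(\<i> * b) \<bullet> b = 0"
  by (auto simp: a_def b_def inner_complex_def power2_eq_square[symmetric])
 have e: "psi' x (1, 0, 0) = (R *\<^sub>R a, T *\<^sub>R b)" "psi' x (0, 1, 0) = (r *\<^sub>R (\<i> * a), 0)"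
   "psi' x (0, 0, 1) = (0, t *\<^sub>R (\<i> * b))"
  by (simp_all add: psi'_def R_def T_def r_def t_def s_def a_def b_def scaleR_conv_of_real)
 have "gram_det (psi' x (1, 0, 0)) (psi' x (0, 1, 0)) (psi' x (0, 0, 1)) = (r * t)\<^sup>2 * (R\<^sup>2 + T\<^sup>2)"
  unfolding e gram_det_def det_3 inner_prod_def fst_conv snd_conv inner_scaleR_left inner_scaleR_right u
  by (simp add: power2_eq_square algebra_simps)
 also have "R\<^sup>2 + T\<^sup>2 = (1 / pp s)\<^sup>2 * ((r / s)\<^sup>2 + (t / (1 - s))\<^sup>2)"
 proof -
  have "R = 1 / pp s * (r / s)" "T = - (1 / pp s * (t / (1 - s)))" by (simp_all add: R_def T_def)
  then show ?thesis by (simp only: power2_minus power_mult_distrib distrib_left)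
 qed
 finally have "sqrt (gram_det (psi' x (1, 0, 0)) (psi' x (0, 1, 0)) (psi' x (0, 0, 1))) =
   r * t * ((1 / pp s) * sqrt ((r / s)\<^sup>2 + (t / (1 - s))\<^sup>2))"
  using pos by (simp add: real_sqrt_mult)
 then show ?thesis using jj_interior[of s] pos by (simp add: r_def t_def s_def)
qed

lemma psi_surj:
 assumes zt: "zt : frontier D" "fst zt : slitp c" "snd zt : slitp d"
 shows "zt : psi ` torus_box c d"
proof -
 have "fst zt ~= 0" "snd zt ~= 0" using zt(2,3) by (auto dest: slitp_nonzero)
 from frontier_curve[OF zt(1) this] obtain s where
  s: "0 < s" "s < 1" "norm (fst zt) = rr s" "norm (snd zt) = tt s" by blast
 from slitp_polar[OF zt(2)] obtain a where
  a: "c - pi < a" "a < c + pi" "fst zt = of_real (norm (fst zt)) * cis a" by blast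
 from slitp_polar[OF zt(3)] obtain b where
  b: "d - pi < b" "b < d + pi" "snd zt = of_real (norm (snd zt)) * cis b" by blast
 have "zt = psi (s, a, b)" using a(3) b(3) s by (simp add: psi_def prod_eq_iff)
 moreover have "(s, a, b) : torus_box c d" using a b s by (simp add: torus_box_def)
 ultimately show ?thesis by (rule image_eqI)
qed

end

section \<open>Product measures on the coordinate box\<close>

definition circ_m :: "real measure" where
 "circ_m = density lborel (%a. ennreal (indicator {-pi<..<pi} a))"

definition radial_m :: "(real => real) => real measure" where
 "radial_m W = density lborel (%s. ennreal (indicator {0<..<1} s * W s))"

text \<open>A product measure, for the sake of Fubini's theorem; \<open>coord_m_eq\<close> describes
  it as a density on three-dimensional space, which is the form in which the charts deliver
  it.\<close>

definition coord_m :: "(real => real) => (real \<times> real \<times> real) measure" where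
 "coord_m W = radial_m W \<Otimes>\<^sub>M (circ_m \<Otimes>\<^sub>M circ_m)"

lemma sigma_finite_density_real:
 "f : bm lborel ==> sigma_finite_measure (density lborel (%x. ennreal (f x)))"
 by (subst sigma_finite_measure.sigma_finite_iff_density_finite[OF sigma_finite_lborel]) auto

context
 fixes W :: "real => real"
 assumes W [measurable]: "W : bm borel" and W_nn: "!!s. 0 <= W s"
begin

lemma coord_m_eq:
 "coord_m W = density lborel (%x. ennreal (indicator (torus_box 0 0) x * W (fst x)))"
proof -
 have i: "(%a. ennreal (indicator {-pi<..<pi} a)) : bm lborel" by measurable
 have sf: "sigma_finite_measure circ_m"
  unfolding circ_m_def by (rule sigma_finite_density_real) measurable
 have 1: "circ_m \<Otimes>\<^sub>M circ_m =
   density lborel (%y. ennreal (indicator ({-pi<..<pi} \<times> {-pi<..<pi}) y))"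
  unfolding circ_m_def
  by (subst pair_measure_density[OF i i lborel.sigma_finite_measure_axioms sf[unfolded circ_m_def]])
   (auto simp: lborel_prod indicator_def intro!: arg_cong[where f = "density lborel"])
 have sf2: "sigma_finite_measure (density lborel (%y. ennreal (indicator ({-pi<..<pi} \<times> {-pi<..<pi}) y)))"
  by (rule sigma_finite_density_real) (simp add: borel_prod[symmetric])
 show ?thesis
  unfolding coord_m_def radial_m_def 1
  by (subst pair_measure_density[OF _ _ lborel.sigma_finite_measure_axioms sf2])
   (auto simp: lborel_prod indicator_def torus_box_def borel_prod[symmetric] intro!: arg_cong[where f = "density lborel"])
qed

end

context C2_reinhardt_pair
begin

text \<open>One chart covers the boundary except for points with a real coordinate, among them the
  axes. This exceptional set is null: on the axes by \<open>axis_null\<close>, elsewhere because it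
  consists of coordinate slices in the shifted charts.\<close>

lemma measure_coordinates:
 assumes sg: "surface_measure (frontier D) sg"
 shows "psi : measurable borel sg" "sg = distr (coord_m jj) sg psi"
proof -
 have sets: "sets sg = sets (restrict_space borel (frontier D))" and space: "space sg = frontier D"
  using sg by (auto simp: surface_measure_def)
 show psi [measurable]: "psi : measurable borel sg"
  unfolding measurable_cong_sets[OF refl sets]
  by (rule measurable_restrict_space2) (auto intro: psi_frontier borel_measurable_continuous_onI psi_cont)
 have mem: "frontier D \<inter> B : sets sg" if "B : sets borel" for B
  unfolding sets sets_restrict_space using that by (rule imageI)
 have slit [measurable]: "slitp c : sets borel" for c by (rule borel_open[OF open_slit_plane])
 have pre: "f -` B : sets borel" if "continuous_on UNIV f" "B : sets borel" for f :: "C2 => complex" and B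
  using measurable_sets_borel[OF borel_measurable_continuous_onI[OF that(1)] that(2)] .
 \<comment> \<open>Off \<open>Z\<close> both coordinates have nonzero imaginary part and thus lie in
   \<open>slitp 0\<close>. Taking all real values, and not only the nonpositive ones, lets the
   exceptional set be described by zeros of the sine in every chart.\<close>
 define Z where "Z = frontier D \<inter> ((Im \<circ> fst) -` {0} \<union> (Im \<circ> snd) -` {0})"
 have Zb: "((Im \<circ> fst) -` {0} \<union> (Im \<circ> snd) -` {0} :: C2 set) : sets borel"
  by (intro borel_closed closed_Un closed_vimage) (auto simp: o_def intro!: continuous_intros)
 have Z: "Z : sets sg" unfolding Z_def by (rule mem[OF Zb])
 have N1: "frontier D \<inter> (fst -` {0} \<inter> snd -` slitp c) : null_sets sg" for c
 proof (rule axis_null[of id])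
  show "frontier D \<inter> (fst -` {0} \<inter> snd -` slitp c) : sets sg"
   by (intro mem sets.Int pre) (auto intro!: continuous_intros slit)
 qed (use sg in \<open>auto simp: bounded_linear_ident id_def\<close>)
 have N2: "frontier D \<inter> (snd -` {0} \<inter> fst -` slitp c) : null_sets sg" for c
 proof (rule sw.axis_null[of prod.swap])
  have sw: "prod.swap ` prod.swap ` frontier D = frontier D" by (simp add: image_image)
  show "surface_measure (prod.swap ` frontier (prod.swap ` D)) sg"
   unfolding frontier_swap sw by (rule sg)
  show "bounded_linear (prod.swap :: C2 => C2)"
   unfolding prod.swap_def by (intro bounded_linear_Pair bounded_linear_fst bounded_linear_snd)
  show "frontier D \<inter> (snd -` {0} \<inter> fst -` slitp c) : sets sg"
   by (intro mem sets.Int pre) (auto intro!: continuous_intros slit)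
  show "frontier D \<inter> (snd -` {0} \<inter> fst -` slitp c) \<subseteq>
    prod.swap ` {zt : frontier (prod.swap ` D). fst zt = 0 & snd zt : slitp c}"
  proof
   fix zt assume zt: "zt : frontier D \<inter> (snd -` {0} \<inter> fst -` slitp c)"
   show "zt : prod.swap ` {zt : frontier (prod.swap ` D). fst zt = 0 & snd zt : slitp c}"
    by (rule image_eqI[of _ _ "prod.swap zt"]) (use zt in \<open>simp_all add: frontier_swap\<close>)
  qed
 qed simp
 have sin_ae: "AE x in lborel :: (real \<times> real \<times> real) measure.
   x : torus_box c d --> sin (fst (snd x)) ~= 0 & sin (snd (snd x)) ~= 0" if "c : {0, pi}" "d : {0, pi}" for c d
 proof -
  have *: "t = c \<or> t = c'" if "sin t = 0" "c : {0, pi}" "c' = pi - c" "c - pi < t" "t < c + pi" for t c c' :: real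
  proof -
   from that obtain i where i: "t = of_int i * pi" using sin_zero_iff_int2 by blast
   from that(2) consider "c = 0" | "c = pi" by blast
   then show ?thesis
   proof cases
    case 1
    then have "of_int i * pi < 1 * pi" "(-1) * pi < of_int i * pi" using that i by auto
    then have "real_of_int i < 1" "- 1 < real_of_int i" by (simp_all only: mult_less_cancel_right_pos[OF pi_gt_zero])
    then have "i = 0" by linarith
    then show ?thesis using i 1 by simp
   next
    case 2
    then have "of_int i * pi < 2 * pi" "0 * pi < of_int i * pi" using that i by auto
    then have "real_of_int i < 2" "0 < real_of_int i" by (simp_all only: mult_less_cancel_right_pos[OF pi_gt_zero])
    then have "i = 1" by linarith
    then show ?thesis using i 2 by simp
   qed
  qed
  show ?thesis
   using AE_lborel_fst_snd[of c] AE_lborel_fst_snd[of "pi - c"] AE_lborel_snd_snd[of d] AE_lborel_snd_snd[of "pi - d"]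
  proof eventually_elim
   case (elim x)
   show ?case
    using elim that *[of "fst (snd x)" c "pi - c"] *[of "snd (snd x)" d "pi - d"]
    by (auto simp only: torus_box_def mem_Times_iff greaterThanLessThan_iff)
  qed
 qed
 have Zpsi: "psi x \<notin> Z" if "0 < fst x" "fst x < 1" "sin (fst (snd x)) ~= 0" "sin (snd (snd x)) ~= 0" for x
  using that rr_tt_pos[of "fst x"] by (simp add: Z_def psi_def)
 \<comment> \<open>The charts with windows centred at 0 or \<open>pi\<close> see \<open>Z\<close> in
   their interior, where it is given by fixed values of one angle.\<close>
 have N3: "Z \<inter> (fst -` slitp c \<inter> snd -` slitp d) : null_sets sg" if "c : {0, pi}" "d : {0, pi}" for c d
 proof (rule chart_null[OF sg torus_chart])
  have "frontier D \<inter> (fst -` slitp c \<inter> snd -` slitp d) : sets sg"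
   by (intro mem sets.Int pre) (auto intro!: continuous_intros slit)
  then have "Z \<inter> (frontier D \<inter> (fst -` slitp c \<inter> snd -` slitp d)) : sets sg"
   by (rule sets.Int[OF Z])
  moreover have "Z \<inter> (frontier D \<inter> (fst -` slitp c \<inter> snd -` slitp d)) = Z \<inter> (fst -` slitp c \<inter> snd -` slitp d)"
   by (auto simp: Z_def)
  ultimately show "Z \<inter> (fst -` slitp c \<inter> snd -` slitp d) : sets sg" by simp
  show "Z \<inter> (fst -` slitp c \<inter> snd -` slitp d) \<subseteq> psi ` torus_box c d"
   unfolding Z_def by (rule subsetI) (rule psi_surj; simp)
  show "AE x in lborel. x : torus_box c d --> psi x \<notin> Z \<inter> (fst -` slitp c \<inter> snd -` slitp d)"
   using sin_ae[OF that]
  proof eventually_elim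
   case (elim x)
   show ?case using elim Zpsi[of x] by (auto simp only: torus_box_def mem_Times_iff greaterThanLessThan_iff)
  qed
 qed
 have ZN: "Z : null_sets sg"
 proof (rule null_sets_subset[OF _ Z])
  let ?N1 = "%c. frontier D \<inter> (fst -` {0} \<inter> snd -` slitp c)"
  let ?N2 = "%c. frontier D \<inter> (snd -` {0} \<inter> fst -` slitp c)"
  let ?N3 = "%c d. Z \<inter> (fst -` slitp c \<inter> snd -` slitp d)"
  show "(?N1 0 \<union> ?N1 pi) \<union> (?N2 0 \<union> ?N2 pi) \<union> ((?N3 0 0 \<union> ?N3 0 pi) \<union> (?N3 pi 0 \<union> ?N3 pi pi)) : null_sets sg"
   by (intro null_sets.Un N1 N2 N3) simp_all
  show "Z \<subseteq> (?N1 0 \<union> ?N1 pi) \<union> (?N2 0 \<union> ?N2 pi) \<union> ((?N3 0 0 \<union> ?N3 0 pi) \<union> (?N3 pi 0 \<union> ?N3 pi pi))"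
  proof
   fix zt assume zt: "zt : Z"
   then have fr: "zt : frontier D" by (simp add: Z_def)
   have "\<not> (fst zt = 0 & snd zt = 0)"
    using zero_in frontier_notin[OF fr] by (metis prod.collapse)
   then show "zt : (?N1 0 \<union> ?N1 pi) \<union> (?N2 0 \<union> ?N2 pi) \<union> ((?N3 0 0 \<union> ?N3 0 pi) \<union> (?N3 pi 0 \<union> ?N3 pi pi))"
    using slitp_cover[of "fst zt"] slitp_cover[of "snd zt"] zt fr by simp blast
  qed
 qed
 have jm [measurable]: "jj : bm borel" by (rule borel_measurable_continuous_onI[OF jj_cont_UNIV])
 have j0: "0 <= jj s" for s using jj_pos[of s] by simp
 have N: "coord_m jj = density lborel (%x. ennreal (indicator (torus_box 0 0) x * jj (fst x)))"
  by (rule coord_m_eq[OF jm j0])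
 have tb: "torus_box 0 0 : sets borel"
  unfolding torus_box_def by (intro borel_open open_Times open_greaterThanLessThan)
 have im: "(%x :: real \<times> real \<times> real. ennreal (indicator (torus_box 0 0) x * jj (fst x))) : bm lborel"
  using tb by (simp add: borel_prod[symmetric])
 show "sg = distr (coord_m jj) sg psi"
 proof (rule measure_eqI)
  fix A assume A: "A : sets sg"
  have pA: "psi -` A : sets borel" using measurable_sets[OF psi A] by simp
  have AZ: "A - Z : sets sg" using A Z by (rule sets.Diff)
  have sub: "A - Z \<subseteq> psi ` torus_box 0 0"
  proof
   fix zt assume zt: "zt : A - Z"
   then have fr: "zt : frontier D" using sets.sets_into_space[OF A] space by blast
   with zt show "zt : psi ` torus_box 0 0"
    by (intro psi_surj) (auto simp: Z_def slitp_def complex_nonpos_Reals_iff)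
  qed
  have "emeasure sg A = emeasure sg (A - Z)" by (rule emeasure_Diff_null_set[OF ZN A, symmetric])
  also have "... = (\<integral>\<^sup>+ x. ennreal (indicator (torus_box 0 0) x * jj (fst x)) * indicator (psi -` A) x \<partial>lborel)"
   unfolding emeasure_chart[OF sg torus_chart AZ sub]
  proof (rule nn_integral_cong_AE)
   show "AE x in lborel. ennreal (sqrt (gram_det (psi' x (1, 0, 0)) (psi' x (0, 1, 0)) (psi' x (0, 0, 1)))) *
      indicator {x : torus_box 0 0. psi x : A - Z} x =
      ennreal (indicator (torus_box 0 0) x * jj (fst x)) * indicator (psi -` A) x"
    using sin_ae[of 0 0, simplified]
   proof eventually_elim
    case (elim x)
    show ?case
    proof (cases "x : torus_box 0 0")
     case True
     then have "0 < fst x" "fst x < 1" by (auto simp: torus_box_def)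
     with True elim Zpsi[of x] sqrt_gram_det[of x] show ?thesis by (simp add: indicator_def)
    qed (simp add: indicator_def)
   qed
  qed
  also have "... = emeasure (distr (coord_m jj) sg psi) A"
   unfolding N using A im pA psi
   by (simp add: emeasure_distr emeasure_density)
  finally show "emeasure sg A = emeasure (distr (coord_m jj) sg psi) A" .
 qed simp
qed

end

lemma LBINT_circle: "(LINT a|circ_m. f a) = (LBINT a:{-pi<..<pi}. f a)" if "f : bm borel"
 for f :: "real => complex"
 using that unfolding circ_m_def set_lebesgue_integral_def
 by (subst integral_density) auto

lemma finite_circle: "finite_measure circ_m"
proof (rule finite_measureI)
 have "emeasure circ_m (space circ_m) = (\<integral>\<^sup>+a. indicator {-pi<..<pi} a \<partial>lborel)"
  unfolding circ_m_def by (simp add: emeasure_density ennreal_indicator)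
 then show "emeasure circ_m (space circ_m) ~= \<infinity>" by simp
qed

interpretation circle: finite_measure circ_m by (rule finite_circle)
interpretation circle_pair: pair_sigma_finite circ_m circ_m ..
abbreviation torus_m :: "(real \<times> real) measure" where
 "torus_m == circ_m \<Otimes>\<^sub>M circ_m"

interpretation torus: finite_measure torus_m
 by (rule finite_measure_pair_measure finite_circle)+

lemma sets_circle [measurable_cong, simp]: "sets circ_m = sets borel"
 by (simp add: circ_m_def)

lemma measurable_cis [measurable]: "cis : bm borel"
 by (intro borel_measurable_continuous_onI continuous_intros)

lemma circle_integral: "(LINT a|circ_m. cis (of_int k * a)) = (if k = 0 then of_real (2 * pi) else 0)"
proof -
 have "(LINT a|circ_m. cis (of_int k * a)) = (LBINT a:{-pi<..<pi}. cis (of_int k * a))"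
  by (rule LBINT_circle) measurable
 also have "... = (LBINT a:{-pi..pi}. cis (of_int k * a))"
 proof -
  have "AE a in lborel. a ~= pi" "AE a in lborel. a ~= - pi" by (rule AE_lborel_singleton)+
  then show ?thesis unfolding set_lebesgue_integral_def
   by (intro integral_cong_AE) (auto elim!: eventually_elim2 simp: indicator_def)
 qed
 also have "... = (if k = 0 then of_real (2 * pi) else 0)"
 proof (cases "k = 0")
  case True
  then show ?thesis unfolding set_lebesgue_integral_def by (simp add: scaleR_conv_of_real)
 next
  case False
  have "(LBINT a:{-pi..pi}. cis (of_int k * a)) = cis (of_int k * pi) / (\<i> * of_int k) - cis (of_int k * (- pi)) / (\<i> * of_int k)"
   unfolding set_lebesgue_integral_def
  proof (rule integral_FTC_Icc)
   fix x :: real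
   have "((%a. cis (of_int k * a)) has_derivative (%t. (of_int k * t) *\<^sub>R (\<i> * cis (of_int k * x)))) (at x within {-pi..pi})"
    by (intro derivative_intros)
   then have "((%a. cis (of_int k * a)) has_vector_derivative \<i> * of_int k * cis (of_int k * x)) (at x within {-pi..pi})"
    unfolding has_vector_derivative_def by (simp add: scaleR_conv_of_real mult_ac)
   from has_vector_derivative_divide[OF this, of "\<i> * of_int k"]
   show "((%a. cis (of_int k * a) / (\<i> * of_int k)) has_vector_derivative cis (of_int k * x)) (at x within {-pi..pi})"
    using False by simp
  qed (auto intro!: continuous_intros)
  also have "cis (of_int k * pi) = cis (of_int k * (- pi))"
   using sin_npi_int[of k] by (simp add: complex_eq_iff mult.commute)
  finally show ?thesis using False by simp
 qed
 finally show ?thesis .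
qed

lemma measurable_fst_borel [measurable]: "fst : bm (borel :: ('a::topological_space \<times> 'b::topological_space) measure)"
 and measurable_snd_borel [measurable]: "snd : bm (borel :: ('a::topological_space \<times> 'b::topological_space) measure)"
 by (intro borel_measurable_continuous_onI continuous_intros)+

lemma torus_integral:
 "(LINT y|torus_m. cis (of_int n * fst y + of_int m * snd y)) =
   (if n = 0 & m = 0 then of_real (4 * pi\<^sup>2) else 0)"
proof -
 have "integrable torus_m (%y. cis (of_int n * fst y + of_int m * snd y))"
  by (rule torus.integrable_const_bound[of _ 1]) auto
 from circle_pair.integral_fst'[OF this]
 have "(LINT y|torus_m. cis (of_int n * fst y + of_int m * snd y)) =
   (LINT a|circ_m. cis (of_int n * a) * (LINT b|circ_m. cis (of_int m * b)))"
  by (simp add: cis_mult[symmetric])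
 then show ?thesis by (simp add: circle_integral power2_eq_square)
qed

lemma measure_torus: "measure torus_m (space torus_m) = 4 * pi\<^sup>2"
proof -
 have "cr (measure torus_m (space torus_m)) = of_real (4 * pi\<^sup>2)"
  using torus_integral[of 0 0] by (simp add: scaleR_conv_of_real)
 then show ?thesis by (simp only: of_real_eq_iff)
qed

text \<open>It serves three densities in s: that of \<open>mu\<close>, that of surface measure, and
  the constant 1 of the Leray kernel in coordinates.\<close>

locale radial_weight =
 fixes W :: "real => real"
 assumes W_cont: "continuous_on UNIV W" and W_pos: "!!s. 0 < W s"
begin

abbreviation R where "R == radial_m W"
abbreviation P where "P == coord_m W"

lemma W_meas [measurable]: "W : bm borel"
 by (rule borel_measurable_continuous_onI[OF W_cont])

lemma sets_R [measurable_cong, simp]: "sets R = sets borel"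
 by (simp add: radial_m_def)

lemma sets_P [measurable_cong, simp]: "sets P = sets borel"
 unfolding coord_m_eq[OF W_meas less_imp_le[OF W_pos]] by simp

lemma finite_R: "finite_measure R"
proof (rule finite_measureI)
 have "compact (W ` {0..1})" by (rule compact_continuous_image[OF continuous_on_subset[OF W_cont]]) auto
 then have "bdd_above (W ` {0..1})" by (intro bounded_imp_bdd_above compact_imp_bounded)
 then obtain B where "\<forall>y\<in>W ` {0..1}. y <= B" unfolding bdd_above_def by (rule exE)
 then have B: "W s <= B" if "s : {0..1}" for s using that by simp
 have "emeasure R (space R) = (\<integral>\<^sup>+s. ennreal (indicator {0<..<1} s * W s) \<partial>lborel)"
  unfolding radial_m_def by (simp add: emeasure_density)
 also have "... <= (\<integral>\<^sup>+s. ennreal B * indicator {0<..<1} s \<partial>(lborel :: real measure))"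
  by (rule nn_integral_mono) (auto simp: indicator_def intro!: ennreal_leI B)
 also have "... < \<infinity>" by (simp add: nn_integral_cmult ennreal_mult_less_top)
 finally show "emeasure R (space R) ~= \<infinity>" by simp
qed

sublocale R: finite_measure R by (rule finite_R)
sublocale RP: pair_sigma_finite R torus_m ..
sublocale P: finite_measure P unfolding coord_m_def
 by (rule finite_measure_pair_measure finite_R torus.finite_measure_axioms)+

lemma AE_box: "AE x in P. x : torus_box 0 0"
 unfolding coord_m_eq[OF W_meas less_imp_le[OF W_pos]]
 by (subst AE_density) (auto simp: indicator_def torus_box_def borel_prod[symmetric] split: if_splits)

lemma integral_P:
 fixes f :: "real \<times> real \<times> real => complex"
 assumes "f : bm borel"
 shows "(LINT x|P. f x) = (LINT x|lborel. (indicator (torus_box 0 0) x * W (fst x)) *\<^sub>R f x)"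
  "integrable P f \<longleftrightarrow> integrable lborel (%x. (indicator (torus_box 0 0) x * W (fst x)) *\<^sub>R f x)"
 unfolding coord_m_eq[OF W_meas less_imp_le[OF W_pos]]
 using assms W_pos
 by (subst integral_density integrable_density; auto simp: torus_box_def borel_prod[symmetric] less_imp_le)+

lemma integral_R:
 fixes f :: "real => complex"
 assumes "f : bm borel"
 shows "(LINT x|R. f x) = (LBINT x:{0<..<1}. W x *\<^sub>R f x)"
  "integrable R f \<longleftrightarrow> set_integrable lborel {0<..<1} (%x. W x *\<^sub>R f x)"
 unfolding radial_m_def set_lebesgue_integral_def set_integrable_def
 using assms W_pos by (subst integral_density integrable_density; auto simp: less_imp_le)+

lemma angular_integral:
 fixes g :: "real => complex"
 assumes g: "integrable R g"
 shows "integrable P (%x. g (fst x) * cis (of_int n * fst (snd x) + of_int m * snd (snd x)))" (is ?i)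
  "(LINT x|P. g (fst x) * cis (of_int n * fst (snd x) + of_int m * snd (snd x))) =
    (if n = 0 & m = 0 then of_real (4 * pi\<^sup>2) * (LINT s|R. g s) else 0)"
proof -
 have [measurable]: "g : bm borel" using borel_measurable_integrable[OF g] by simp
 show i: ?i unfolding coord_m_def
 proof (rule RP.Fubini_integrable)
  show "integrable R (%x. LINT y|torus_m.
    norm (g (fst (x, y)) * cis (of_int n * fst (snd (x, y)) + of_int m * snd (snd (x, y)))))"
   using g by (simp add: norm_mult)
  show "AE x in R. integrable torus_m
    (%y. g (fst (x, y)) * cis (of_int n * fst (snd (x, y)) + of_int m * snd (snd (x, y))))"
   by (intro AE_I2 torus.integrable_const_bound[where B = "norm (g _)"]) (auto simp: norm_mult)
 qed measurable
 show "(LINT x|P. g (fst x) * cis (of_int n * fst (snd x) + of_int m * snd (snd x))) =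
    (if n = 0 & m = 0 then of_real (4 * pi\<^sup>2) * (LINT s|R. g s) else 0)"
  using RP.integral_fst'[OF i[unfolded coord_m_def]]
  by (cases "n = 0 & m = 0") (auto simp: coord_m_def torus_integral measure_torus scaleR_conv_of_real mult.commute)
qed

lemma integrable_radial:
 fixes g :: "real => complex"
 assumes "integrable P (%x. g (fst x))"
 shows "integrable R g"
proof -
 have "integrable R (%s. LINT y|torus_m. g s)"
  using RP.integrable_fst'[OF assms[unfolded coord_m_def]] by simp
 then have "integrable R (%s. (4 * pi\<^sup>2) *\<^sub>R g s)" by (simp add: measure_torus)
 from integrable_scaleR_right[OF this, of "1 / (4 * pi\<^sup>2)"] show ?thesis by simp
qed

end

section \<open>The measure mu in coordinates\<close>

locale C2_reinhardt_measure = C2_reinhardt_pair +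
 fixes sg mu :: "C2 measure" and h :: "C2 => real"
 assumes sg: "surface_measure (frontier D) sg"
  and h_cont: "continuous_on (frontier D) h"
  and h_pos: "!!zt. zt : frontier D ==> h zt > 0"
  and h_rot: "!!zt a b. zt : frontier D ==> h (torus_rot a b zt) = h zt"
  and mu_def: "mu = density sg (%zt. ennreal (h zt))"
begin

text \<open>The density W of \<open>mu\<close>; rotation invariance allows \<open>h\<close> to be
  evaluated at the angles 0.\<close>

definition weight :: "real => real" where "weight s = h (psi (s, 0, 0)) * jj s"

lemma h_psi: "h (psi (s, a, b)) = h (psi (s, 0, 0))"
proof -
 have "h (torus_rot a b (torus_rot 0 0 (of_real (rr s), of_real (tt s)))) = h (torus_rot 0 0 (of_real (rr s), of_real (tt s)))"
  using psi_frontier[of "(s, 0, 0)"] by (intro h_rot) (simp add: psi_torus_rot)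
 then show ?thesis by (simp add: psi_torus_rot torus_rot_def)
qed

lemma radial_weight_jj: "radial_weight jj"
 by standard (rule jj_cont_UNIV jj_pos)+

sublocale w: radial_weight weight
proof
 have "continuous_on UNIV (%s. h (psi (s, 0, 0)))"
  by (rule continuous_on_compose2[OF h_cont continuous_on_compose2[OF psi_cont[of UNIV]]])
   (auto intro!: continuous_intros psi_frontier)
 then show "continuous_on UNIV weight"
  unfolding weight_def by (intro continuous_on_mult jj_cont_UNIV)
 show "0 < weight s" for s unfolding weight_def by (intro mult_pos_pos h_pos psi_frontier jj_pos)
qed

sublocale j: radial_weight jj by (rule radial_weight_jj)

lemma psi_measurable [measurable]: "psi : measurable borel sg"
 by (rule measure_coordinates[OF sg])

lemma sets_mu: "sets mu = sets sg" and space_mu: "space mu = frontier D"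
 using sg by (auto simp: mu_def surface_measure_def)

lemma measurable_sg: "f : measurable borel N ==> f : measurable sg N" for N :: "'b measure"
 using sg by (subst measurable_cong_sets[of sg "restrict_space borel (frontier D)"])
  (auto simp: surface_measure_def intro: measurable_restrict_space1)

lemma mu_eq: "mu = distr (coord_m weight) mu psi"
proof -
 have hm [measurable]: "h : bm sg"
  using sg borel_measurable_continuous_on_restrict[OF h_cont]
  by (subst measurable_cong_sets[of sg "restrict_space borel (frontier D)"]) (auto simp: surface_measure_def)
 have "mu = density (distr (coord_m jj) sg psi) (%zt. ennreal (h zt))"
  unfolding mu_def by (subst measure_coordinates(2)[OF sg]) simp
 also have "... = distr (density (coord_m jj) (%x. ennreal (h (psi x)))) sg psi"
  by (rule density_distr) measurable
 also have "density (coord_m jj) (%x. ennreal (h (psi x))) = coord_m weight"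
  unfolding coord_m_eq[OF j.W_meas less_imp_le[OF jj_pos]]
   coord_m_eq[OF w.W_meas less_imp_le[OF w.W_pos]]
 proof (subst density_density_eq)
  show "(%x. ennreal (indicator (torus_box 0 0) x * jj (fst x))) : bm lborel"
   using j.W_meas by (simp add: torus_box_def borel_prod[symmetric])
  show "(%x. ennreal (h (psi x))) : bm lborel" by measurable
  have "ennreal (indicator (torus_box 0 0) x * jj (fst x)) * ennreal (h (psi x)) =
    ennreal (indicator (torus_box 0 0) x * weight (fst x))" for x
   using h_psi[of "fst x" "fst (snd x)" "snd (snd x)"] h_pos[OF psi_frontier[of x]] jj_pos[of "fst x"]
   by (simp add: weight_def ennreal_mult'[symmetric] mult_ac)
  then show "density lborel (%x. ennreal (indicator (torus_box 0 0) x * jj (fst x)) * ennreal (h (psi x))) =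
    density lborel (%x. ennreal (indicator (torus_box 0 0) x * weight (fst x)))"
   by simp
 qed
 also have "distr (coord_m weight) sg psi = distr (coord_m weight) mu psi"
  by (rule distr_cong) (simp_all add: sets_mu)
 finally show ?thesis .
qed

lemma psi_measurable_mu [measurable]: "psi : measurable borel mu"
 using psi_measurable by (simp add: measurable_cong_sets[OF refl sets_mu])

lemma psi_comp_measurable: "f : bm mu ==> (%x. f (psi x)) : bm borel"
 by (rule measurable_compose[OF psi_measurable_mu])

lemma integral_mu:
 fixes f :: "C2 => 'b::{banach, second_countable_topology}"
 assumes "f : bm mu"
 shows "(LINT zt|mu. f zt) = (LINT x|w.P. f (psi x))" "integrable mu f \<longleftrightarrow> integrable w.P (%x. f (psi x))"
 using assms by (subst (1) mu_eq, subst integral_distr integrable_distr_eq; simp add: measurable_cong_sets[OF w.sets_P refl] psi_measurable_mu)+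

lemma integral_sg:
 fixes f :: "C2 => complex"
 assumes "f : bm sg"
 shows "(LINT zt|sg. f zt) = (LINT x|j.P. f (psi x))" "integrable sg f \<longleftrightarrow> integrable j.P (%x. f (psi x))"
 using assms by (subst (1) measure_coordinates(2)[OF sg], subst integral_distr integrable_distr_eq; simp add: measurable_cong_sets[OF j.sets_P refl] psi_measurable)+


lemma finite_mu: "finite_measure mu"
 by (subst mu_eq, rule w.P.finite_measure_distr) (simp add: measurable_cong_sets[OF w.sets_P refl])

text \<open>On the box centred at 0 the angles lie strictly between \<open>- pi\<close> and
  \<open>pi\<close>, where \<open>Arg\<close> returns them.\<close>

lemma monomial_psi:
 assumes f: "monomial D n m f" and x: "x : torus_box 0 0"
 shows "f (psi x) = f (psi (fst x, 0, 0)) * cis (of_int n * fst (snd x) + of_int m * snd (snd x))"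
proof -
 obtain g where g: "!!zt. zt : frontier D ==> fst zt * snd zt ~= 0 ==>
   f zt = g (s_coord D zt) * cis (ang n m zt)"
  using f unfolding monomial_def by blast
 have *: "f (psi (s, a, b)) = g s * cis (of_int n * a + of_int m * b)"
  if s: "0 < s" "s < 1" and ab: "- pi < a" "a < pi" "- pi < b" "b < pi" for s a b
 proof -
  have "s_coord D (psi (s, a, b)) = s" using norm_psi[of s a b] s by (intro s_coord_curve) auto
  moreover have "Arg (fst (psi (s, a, b))) = a" "Arg (snd (psi (s, a, b))) = b"
   using Arg_rcis[of a "rr s"] Arg_rcis[of b "tt s"] rr_tt_pos[OF s] ab by (simp_all add: psi_def rcis_def)
  moreover have "fst (psi (s, a, b)) * snd (psi (s, a, b)) ~= 0"
   using rr_tt_pos[OF s] by (simp add: psi_def)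
  ultimately show ?thesis using g[OF psi_frontier, of "(s, a, b)"] by simp
 qed
 obtain s a b where e: "x = (s, a, b)" by (rule prod_cases3)
 show ?thesis using x *[of s a b] *[of s 0 0] by (simp add: e torus_box_def)
qed

lemma integral_monomial:
 assumes f: "monomial D n m f" and i: "integrable mu f"
 shows "integrable w.R (%s. f (psi (s, 0, 0)))"
  "(LINT zt|mu. f zt) = (if n = 0 & m = 0 then of_real (4 * pi\<^sup>2) * (LINT s|w.R. f (psi (s, 0, 0))) else 0)"
proof -
 have [measurable]: "f : bm mu" using i by (rule borel_measurable_integrable)
 have [measurable]: "(%x. f (psi x)) : bm borel" by (rule psi_comp_measurable) measurable
 have "integrable w.P (%x. f (psi x))" using i integral_mu(2)[of f] by simp
 then have 1: "integrable w.P (%x. f (psi x) * cis (- (of_int n * fst (snd x) + of_int m * snd (snd x))))"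
  by (rule Bochner_Integration.integrable_bound) (auto simp: norm_mult)
 have "integrable w.P (%x. f (psi (fst x, 0, 0)))"
  by (rule integrable_cong_AE_imp[OF 1])
   (use w.AE_box in \<open>auto elim!: eventually_mono simp: monomial_psi[OF f] mult.assoc cis_mult\<close>)
 then show R: "integrable w.R (%s. f (psi (s, 0, 0)))" by (rule w.integrable_radial)
 have "(LINT zt|mu. f zt) = (LINT x|w.P. f (psi x))" by (rule integral_mu) measurable
 also have "... = (LINT x|w.P. f (psi (fst x, 0, 0)) * cis (of_int n * fst (snd x) + of_int m * snd (snd x)))"
  by (rule integral_cong_AE) (use w.AE_box in \<open>auto elim!: eventually_mono simp: monomial_psi[OF f]\<close>)
 also have "... = (if n = 0 & m = 0 then of_real (4 * pi\<^sup>2) * (LINT s|w.R. f (psi (s, 0, 0))) else 0)"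
  by (rule w.angular_integral[OF R])
 finally show "(LINT zt|mu. f zt) = (if n = 0 & m = 0 then of_real (4 * pi\<^sup>2) * (LINT s|w.R. f (psi (s, 0, 0))) else 0)" .
qed

end

section \<open>The Leray integral of a monomial\<close>

text \<open>Expand 1/(1 - x)^2 as the series of (k + 1) x^k and each power by the binomial theorem.
  Orthogonality of the characters leaves the single term with k = n + m, whose coefficient is (n + m
  + 1) times a binomial coefficient.\<close>

lemma torus_leray_integral:
 assumes uv: "norm u + norm v < 1"
 shows "(LINT y|torus_m. cis (of_int n * fst y + of_int m * snd y) / (1 - cis (- fst y) * u - cis (- snd y) * v)\<^sup>2) =
  (if 0 <= n & 0 <= m then of_real (4 * pi\<^sup>2 * (fact (nat n + nat m + 1) / (fact (nat n) * fact (nat m)))) * u ^ nat n * v ^ nat m else 0)"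
proof -
 define q where "q = norm u + norm v"
 have q: "0 <= q" "q < 1" using uv by (auto simp: q_def)
 define x where "x = (%y :: real \<times> real. cis (- fst y) * u + cis (- snd y) * v)"
 define E where "E = (%y :: real \<times> real. cis (of_int n * fst y + of_int m * snd y))"
 define F where "F k y = of_nat (Suc k) * x y ^ k * E y" for k y
 have xq: "norm (x y) <= q" for y
  unfolding x_def q_def by (rule order_trans[OF norm_triangle_ineq]) (simp add: norm_mult)
 have [measurable]: "x : bm torus_m" "E : bm torus_m"
  unfolding x_def E_def by measurable
 have Fb: "norm (F k y) <= real (Suc k) * q ^ k" for k y
  unfolding F_def using xq[of y] by (simp add: norm_mult norm_power E_def power_mono mult_left_mono del: of_nat_Suc)
 have sq: "summable (%k. real (Suc k) * q ^ k)"
  using geometric_deriv_sums[of q] q by (auto simp: sums_iff)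
 have Fm: "F k : bm torus_m" for k unfolding F_def[abs_def] by measurable
 have Fi: "integrable torus_m (F k)" for k
  by (rule torus.integrable_const_bound[OF AE_I2[OF Fb] Fm])
 have "(%k. LINT y|torus_m. F k y) sums (LINT y|torus_m. (\<Sum>k. F k y))"
 proof (rule sums_integral[OF Fi])
  show "AE y in torus_m. summable (%k. norm (F k y))"
   by (intro AE_I2 summable_comparison_test'[OF sq]) (use Fb in auto)
  show "summable (%k. LINT y|torus_m. norm (F k y))"
  proof (rule summable_comparison_test'[OF summable_mult[OF sq, of "4 * pi\<^sup>2"]])
   fix k :: nat
   have "(LINT y|torus_m. norm (F k y)) <= (LINT y|torus_m. real (Suc k) * q ^ k)"
    by (rule integral_mono) (use Fi Fb in auto)
   then show "norm (LINT y|torus_m. norm (F k y)) <= 4 * pi\<^sup>2 * (real (Suc k) * q ^ k)"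
    by (simp add: measure_torus del: of_nat_Suc)
  qed
 qed
 moreover have "(\<Sum>k. F k y) = E y / (1 - cis (- fst y) * u - cis (- snd y) * v)\<^sup>2" for y
 proof -
  have "norm (x y) < 1" using xq[of y] q by simp
  from sums_mult2[OF geometric_deriv_sums[OF this], of "E y"]
  have "(%k. F k y) sums (1 / (1 - x y)\<^sup>2 * E y)" by (simp only: F_def)
  then show ?thesis by (simp add: sums_iff x_def diff_diff_eq)
 qed
 ultimately have sums: "(%k. LINT y|torus_m. F k y) sums
   (LINT y|torus_m. E y / (1 - cis (- fst y) * u - cis (- snd y) * v)\<^sup>2)" by simp
 have Fint: "(LINT y|torus_m. F k y) = of_nat (Suc k) * (\<Sum>j\<le>k. of_nat (k choose j) * u ^ j * v ^ (k - j) *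
   (if n = int j & m = int (k - j) then of_real (4 * pi\<^sup>2) else 0))" for k
 proof -
  have "F k y = of_nat (Suc k) * (\<Sum>j\<le>k. of_nat (k choose j) * u ^ j * v ^ (k - j) *
   cis (of_int (n - int j) * fst y + of_int (m - int (k - j)) * snd y))" for y
  proof -
   have 1: "cis (- fst y) ^ j * cis (- snd y) ^ l * E y = cis (of_int (n - int j) * fst y + of_int (m - int l) * snd y)" for j l
    unfolding E_def Complex.DeMoivre cis_mult by (rule arg_cong[of _ _ cis]) (simp add: algebra_simps)
   have 2: "(a * u) ^ j * (b * v) ^ l * e = u ^ j * v ^ l * (a ^ j * b ^ l * e)" for a b e and j l :: nat
    by (simp add: power_mult_distrib mult_ac)
   have "(cis (- fst y) * u) ^ j * (cis (- snd y) * v) ^ l * E y = u ^ j * v ^ l * cis (of_int (n - int j) * fst y + of_int (m - int l) * snd y)" for j l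
    by (simp only: 1 2)
   then have "of_nat (k choose j) * (cis (- fst y) * u) ^ j * (cis (- snd y) * v) ^ (k - j) * E y =
    of_nat (k choose j) * u ^ j * v ^ (k - j) * cis (of_int (n - int j) * fst y + of_int (m - int (k - j)) * snd y)" for j
    by (simp only: mult.assoc)
   then show ?thesis unfolding F_def x_def binomial_ring
    by (simp only: sum_distrib_right mult.assoc[of "of_nat (Suc k)"])
  qed
  moreover have "integrable torus_m (%y. of_nat (k choose j) * u ^ j * v ^ (k - j) *
   cis (of_int (n - int j) * fst y + of_int (m - int (k - j)) * snd y))" for j
   by (intro integrable_mult_right torus.integrable_const_bound[of _ 1]) auto
  ultimately show ?thesis
   by (simp only: integral_mult_right_zero Bochner_Integration.integral_sum torus_integral right_minus_eq)
 qed
 show ?thesis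
 proof (cases "0 <= n & 0 <= m")
  case False
  then have "(LINT y|torus_m. F k y) = 0" for k
   unfolding Fint by (intro mult_eq_0_iff[THEN iffD2] disjI2 sum.neutral) auto
  then have "(%k. 0 :: complex) sums (LINT y|torus_m. E y / (1 - cis (- fst y) * u - cis (- snd y) * v)\<^sup>2)"
   using sums by simp
  then show ?thesis using False by (auto simp: E_def sums_iff)
 next
  case True
  define N M where "N = nat n" and "M = nat m"
  have NM: "n = int N" "m = int M" using True by (auto simp: N_def M_def)
  \<comment> \<open>The contribution of degree \<open>k\<close> when the exponents are
    \<open>N\<close> and \<open>k - N\<close>; only \<open>k = N + M\<close> matches both
    frequencies.\<close>
  let ?c = "%k. of_nat (Suc k) * (of_nat (k choose N) * u ^ N * v ^ M * of_real (4 * pi\<^sup>2)) :: complex"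
  have "(LINT y|torus_m. F k y) = (if k = N + M then ?c k else 0)" for k
  proof -
   have "(\<Sum>j\<le>k. of_nat (k choose j) * u ^ j * v ^ (k - j) * (if n = int j & m = int (k - j) then of_real (4 * pi\<^sup>2) else 0)) =
    (\<Sum>j\<le>k. if j = N then of_nat (k choose j) * u ^ j * v ^ (k - j) * (if M = k - N then of_real (4 * pi\<^sup>2) else 0) else 0)"
    by (rule sum.cong) (auto simp: NM)
   also have "... = (if k = N + M then of_nat (k choose N) * u ^ N * v ^ M * of_real (4 * pi\<^sup>2) else 0)"
    by (subst sum.delta) (auto simp: binomial_eq_0)
   finally show ?thesis unfolding Fint by simp
  qed
  then have "(%k. LINT y|torus_m. F k y) sums ?c (N + M)"
   using sums_single[of "N + M" ?c] by simp
  from sums_unique2[OF sums this]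
  have c1: "(LINT y|torus_m. E y / (1 - cis (- fst y) * u - cis (- snd y) * v)\<^sup>2) = ?c (N + M)" .
  let ?X = "fact (N + M + 1) / (fact N * fact M) :: real"
  have c2: "of_nat (Suc (N + M)) * of_nat (N + M choose N) = (of_real ?X :: complex)"
  proof -
   have "(of_nat (N + M choose N) :: complex) = fact (N + M) / (fact N * fact M)"
    using binomial_fact[of N "N + M", where 'a = complex] by simp
   then show ?thesis by (simp del: of_nat_Suc)
  qed
  have c3: "?c (N + M) = of_real (4 * pi\<^sup>2 * ?X) * u ^ N * v ^ M"
  proof -
   have "?c (N + M) = (of_nat (Suc (N + M)) * of_nat (N + M choose N)) * (of_real (4 * pi\<^sup>2) * u ^ N * v ^ M)"
    by (simp only: mult_ac)
   also have "... = of_real ?X * (of_real (4 * pi\<^sup>2) * u ^ N * v ^ M)" by (simp only: c2)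
   also have "... = of_real (4 * pi\<^sup>2 * ?X) * u ^ N * v ^ M" by (simp only: of_real_mult mult_ac)
   finally show ?thesis .
  qed
  show ?thesis
   using c1 True unfolding c3 by (simp only: E_def N_def[symmetric] M_def[symmetric] simp_thms if_True)
 qed
qed

context C2_reinhardt_pair
begin

text \<open>Apply \<open>support\<close> at the boundary point with coordinates \<open>rr s\<close>
  and \<open>tt s\<close> to the point of the moduli of \<open>w\<close>, which lies in
  \<open>D\<close> as well. The estimate makes the geometric expansion of the kernel
  converge.\<close>

lemma tangent_less_1:
 assumes s: "0 < s" "s < 1" and w: "w : D"
 shows "s / rr s * norm (fst w) + (1 - s) / tt s * norm (snd w) < 1"
proof -
 define r where "r = ri s"
 have r: "0 < r" "r < b1" "Sf r = s" using ri[OF s] by (auto simp: r_def)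
 have i: "rr s = r" "tt s = fy r" using interior_eqs[OF s] by (auto simp: r_def)
 define d where "d = fy r - r * fy1 r"
 have nz: "d > 0" "fy r > 0" using den_pos[of r] fy_inverse(1)[of r] r by (auto simp: d_def)
 have s1: "s / r = - fy1 r / d" using r nz by (simp add: Sf_def d_def[symmetric] flip: r(3))
 have "1 - s = fy r / d" unfolding r(3)[symmetric] Sf_def d_def[symmetric] using nz by (simp add: d_def field_simps)
 then have s2: "(1 - s) / fy r = 1 / d" using nz by simp
 obtain B where B: "B > 0" "G (pt 0 0 r) = (of_real (- B * fy1 r) * cis 0, of_real B * cis 0)"
  by (rule gradient_pt[OF r(1,2), of 0 0])
 have pt: "pt 0 0 r = (of_real r, of_real (fy r))" by (simp add: pt_def torus_rot_def)
 have w': "(of_real (norm (fst w)), of_real (norm (snd w))) : D" using moduli w by simp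
 have "pt 0 0 r : frontier D" unfolding pt using r by (intro fy_frontier) simp
 from support[OF this w', unfolded B, unfolded pt]
 have "- B * fy1 r * (norm (fst w) - r) + B * (norm (snd w) - fy r) < 0"
  by (simp add: inner_prod_def inner_complex_def)
 then have "B * (- fy1 r * norm (fst w) + norm (snd w) - d) < 0" by (simp add: d_def algebra_simps)
 then have "- fy1 r * norm (fst w) + norm (snd w) < d" using B(1) by (simp add: mult_less_0_iff)
 then have "(- fy1 r * norm (fst w) + norm (snd w)) / d < 1" using nz by simp
 then show ?thesis unfolding i s1 s2 by (simp add: add_divide_distrib diff_divide_distrib)
qed

end

context C2_reinhardt_measure
begin

sublocale o: radial_weight "%_. 1" by standard auto

lemma rr_meas [measurable]: "rr : bm borel" and tt_meas [measurable]: "tt : bm borel"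
 by (intro borel_measurable_continuous_onI rr_cont_UNIV tt_cont_UNIV)+

lemma integrable_L2: "f : L2 mu ==> integrable mu f"
proof -
 interpret finite_measure mu by (rule finite_mu)
 have "(%_. 1) : L2 mu" by (simp add: L2_def)
 then show "f : L2 mu ==> integrable mu f" using L2_mult_integrable[of f mu "%_. 1"] by simp
qed

text \<open>In the coordinates the kernel depends on the angles only through the torus integral
  computed above, whose factor 4 pi^2 cancels the constant of the kernel. What remains is an
  integral over s times the monomial in \<open>w\<close>.\<close>

lemma leray_integral_monomial:
 assumes f: "f : L2 mu" "monomial D n m f" and w: "w : D"
 shows "leray_integral ro sg f w = (if 0 <= n & 0 <= m then
  of_real (fact (nat n + nat m + 1) / (fact (nat n) * fact (nat m))) *
  (LINT s|o.R. f (psi (s, 0, 0)) * of_real ((s / rr s) ^ nat n * ((1 - s) / tt s) ^ nat m)) * fst w ^ nat n * snd w ^ nat m else 0)"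
proof -
 define d where "d zt = leray_density ro zt w" for zt
 have dc: "continuous_on (frontier D) d" unfolding d_def by (rule leray_density_cont[OF w])
 have fm [measurable]: "f : bm mu" using f(1) by (rule L2_measurable)
 have fsg: "f : bm sg" using fm by (simp add: measurable_cong_sets[OF sets_mu refl])
 have dsg: "d : bm sg"
  using sg borel_measurable_continuous_on_restrict[OF dc]
  by (subst measurable_cong_sets[of sg "restrict_space borel (frontier D)"]) (auto simp: surface_measure_def)
 have fpsi [measurable]: "(%x. f (psi x)) : bm borel" by (rule psi_comp_measurable[OF fm])
 have dpsi [measurable]: "(%x. d (psi x)) : bm borel"
  by (intro borel_measurable_continuous_onI continuous_on_compose2[OF dc psi_cont] image_subsetI psi_frontier)
 have jm [measurable]: "jj : bm borel" by (rule j.W_meas)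
 define g where "g x = f (psi x) * (d (psi x) * of_real (jj (fst x)))" for x
 have gm [measurable]: "g : bm borel" unfolding g_def by measurable
 have f0 [measurable]: "(%s. f (psi (s, 0, 0))) : bm borel"
  by (rule measurable_compose[OF _ fpsi]) (intro borel_measurable_continuous_onI continuous_intros)
 define g' where "g' x = f (psi (fst x, 0, 0)) * of_real (1 / (4 * pi\<^sup>2)) * (cis (of_int n * fst (snd x) + of_int m * snd (snd x)) /
   (1 - cis (- fst (snd x)) * (of_real (fst x / rr (fst x)) * fst w) - cis (- snd (snd x)) * (of_real ((1 - fst x) / tt (fst x)) * snd w))\<^sup>2)" for x
 have g'm [measurable]: "g' : bm borel"
  unfolding g'_def using measurable_compose[OF measurable_fst_borel f0] by measurable
 have gg': "g x = g' x" if x: "x : torus_box 0 0" for x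
 proof -
  have s: "0 < fst x" "fst x < 1" using x by (auto simp: torus_box_def)
  have "psi x = torus_rot (fst (snd x)) (snd (snd x)) (of_real (rr (fst x)), of_real (tt (fst x)))"
   using psi_torus_rot[of "fst x" "fst (snd x)" "snd (snd x)"] by simp
  then have "d (psi x) * of_real (jj (fst x)) = 1 / (of_real (4 * pi\<^sup>2) * (1 - cis (- fst (snd x)) * of_real (fst x / rr (fst x)) * fst w -
    cis (- snd (snd x)) * of_real ((1 - fst x) / tt (fst x)) * snd w)\<^sup>2)"
   unfolding d_def using leray_density_curve[OF s w] by simp
  then show ?thesis unfolding g_def g'_def monomial_psi[OF f(2) x] by (simp add: mult.assoc)
 qed
 have AE: "AE x in o.P. g x = g' x" using o.AE_box by eventually_elim (rule gg')
 have "leray_integral ro sg f w = (LINT x|j.P. f (psi x) * d (psi x))"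
  unfolding leray_integral_def d_def[symmetric] by (intro integral_sg borel_measurable_times fsg dsg)
 also have "... = (LINT x|lborel. (indicator (torus_box 0 0) x * jj (fst x)) *\<^sub>R (f (psi x) * d (psi x)))"
  by (rule j.integral_P) measurable
 also have "... = (LINT x|lborel. (indicator (torus_box 0 0) x * 1) *\<^sub>R g x)"
  unfolding g_def by (intro Bochner_Integration.integral_cong refl) (simp add: scaleR_conv_of_real mult_ac)
 also have "... = (LINT x|o.P. g x)" by (rule o.integral_P[symmetric]) measurable
 also have "... = (LINT x|o.P. g' x)" using AE by (intro integral_cong_AE) measurable
 finally have L: "leray_integral ro sg f w = (LINT x|o.P. g' x)" .
 \<comment> \<open>On the compact boundary the kernel is bounded by a multiple of \<open>h\<close>,
   so the integrability of \<open>f\<close> with respect to \<open>mu\<close> carries over.\<close>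
 have "integrable o.P g"
 proof -
  have "continuous_on (frontier D) (%zt. norm (d zt) / h zt)"
   using h_pos by (intro continuous_intros dc h_cont) (auto simp: less_imp_neq[symmetric])
  then have "bdd_above ((%zt. norm (d zt) / h zt) ` frontier D)"
   by (intro bounded_imp_bdd_above compact_imp_bounded compact_continuous_image compact_frontier)
  then obtain C where "\<forall>y\<in>(%zt. norm (d zt) / h zt) ` frontier D. y <= C" unfolding bdd_above_def by (rule exE)
  then have C0: "norm (d (psi x)) / h (psi x) <= C" for x by (rule bspec[OF _ imageI[OF psi_frontier]])
  have C: "norm (d (psi x)) <= C * h (psi x)" for x
   using C0[of x] h_pos[OF psi_frontier[of x]] by (simp only: pos_divide_le_eq)
  have "integrable lborel (%x. (indicator (torus_box 0 0) x * weight (fst x)) *\<^sub>R f (psi x))"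
   using integrable_L2[OF f(1)] integral_mu(2)[OF fm] w.integral_P(2)[OF fpsi] by simp
  then have "integrable lborel (%x. C *\<^sub>R ((indicator (torus_box 0 0) x * weight (fst x)) *\<^sub>R f (psi x)))"
   by (rule integrable_scaleR_right)
  then have "integrable lborel (%x. (indicator (torus_box 0 0) x * 1) *\<^sub>R g x)"
  proof (rule Bochner_Integration.integrable_bound)
   show "(%x. (indicator (torus_box 0 0) x * 1) *\<^sub>R g x) : bm lborel"
   proof -
    have [measurable]: "torus_box 0 0 : sets borel"
     unfolding torus_box_def by (intro borel_open open_Times open_greaterThanLessThan)
    show ?thesis by measurable
   qed
   have "norm ((indicator (torus_box 0 0) x * 1) *\<^sub>R g x) \<le>
     norm (C *\<^sub>R ((indicator (torus_box 0 0) x * weight (fst x)) *\<^sub>R f (psi x)))" for x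
   proof -
    have "norm (d (psi x)) * jj (fst x) <= C * h (psi x) * jj (fst x)"
     using C[of x] jj_pos[of "fst x"] by (intro mult_right_mono) auto
    also have "... = C * weight (fst x)"
     using h_psi[of "fst x" "fst (snd x)" "snd (snd x)"] by (simp add: weight_def)
    also have "... <= \<bar>C\<bar> * weight (fst x)" using w.W_pos[of "fst x"] by (intro mult_right_mono) auto
    finally have "norm (f (psi x)) * (norm (d (psi x)) * jj (fst x)) <= norm (f (psi x)) * (\<bar>C\<bar> * weight (fst x))"
     by (rule mult_left_mono) simp
    then show ?thesis using jj_pos[of "fst x"] w.W_pos[of "fst x"]
     by (auto simp: indicator_def g_def norm_mult abs_mult mult_ac)
   qed
   then show "AE x in lborel. norm ((indicator (torus_box 0 0) x * 1) *\<^sub>R g x) \<le>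
     norm (C *\<^sub>R ((indicator (torus_box 0 0) x * weight (fst x)) *\<^sub>R f (psi x)))" by (rule AE_I2)
  qed
  then show ?thesis using o.integral_P(2)[OF gm] by simp
 qed
 then have g'i: "integrable o.P g'"
  by (rule integrable_cong_AE_imp) (use AE in \<open>auto elim: eventually_mono\<close>)
 define Q where "Q = (if 0 <= n & 0 <= m then of_real (fact (nat n + nat m + 1) / (fact (nat n) * fact (nat m))) * fst w ^ nat n * snd w ^ nat m else 0 :: complex)"
 have AEs: "AE s in o.R. 0 < s & s < 1"
  unfolding radial_m_def by (subst AE_density) (auto simp: indicator_def split: if_splits)
 have "(LINT x|o.P. g' x) = (LINT s|o.R. LINT y|torus_m. g' (s, y))"
  using o.RP.integral_fst'[of g'] g'i by (simp add: coord_m_def)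
 also have "... = (LINT s|o.R. Q * (f (psi (s, 0, 0)) * of_real ((s / rr s) ^ nat n * ((1 - s) / tt s) ^ nat m)))"
 proof (rule integral_cong_AE)
  show "(%s. LINT y|torus_m. g' (s, y)) : bm o.R"
   using o.RP.integrable_fst'[of g'] g'i by (auto simp: coord_m_def)
  show "AE s in o.R. (LINT y|torus_m. g' (s, y)) = Q * (f (psi (s, 0, 0)) * of_real ((s / rr s) ^ nat n * ((1 - s) / tt s) ^ nat m))"
   using AEs
  proof eventually_elim
   case (elim s)
   define u v where "u = of_real (s / rr s) * fst w" and "v = of_real ((1 - s) / tt s) * snd w"
   have "norm u = s / rr s * norm (fst w)" "norm v = (1 - s) / tt s * norm (snd w)"
    unfolding u_def v_def norm_mult norm_of_real using rr_tt_pos[of s] elim by simp_all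
   then have "norm u + norm v < 1" using tangent_less_1[of s, OF _ _ w] elim by simp
   from torus_leray_integral[OF this, of n m]
   have eq: "(LINT y|torus_m. g' (s, y)) = f (psi (s, 0, 0)) * of_real (1 / (4 * pi\<^sup>2)) *
     (if 0 <= n & 0 <= m then of_real (4 * pi\<^sup>2 * (fact (nat n + nat m + 1) / (fact (nat n) * fact (nat m)))) * u ^ nat n * v ^ nat m else 0)"
    unfolding g'_def fst_conv snd_conv u_def[symmetric] v_def[symmetric] by (simp only: integral_mult_right_zero)
   have alg: "F * of_real (1 / (4 * pi\<^sup>2)) * (of_real (4 * pi\<^sup>2 * X) * (of_real a * p) ^ N * (of_real b * q) ^ M) =
     of_real X * p ^ N * q ^ M * (F * of_real (a ^ N * b ^ M))"
    for F p q :: complex and X a b :: real and N M :: nat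
    by (simp add: power_mult_distrib)
   show ?case
   proof (cases "0 <= n & 0 <= m")
    case True
    show ?thesis unfolding eq Q_def u_def v_def if_P[OF True] by (rule alg)
   next
    case False
    show ?thesis unfolding eq Q_def if_not_P[OF False] by simp
   qed
  qed
 qed measurable
 finally show ?thesis unfolding L by (simp add: Q_def mult_ac)
qed

text \<open>Inside \<open>D\<close> the integral is a polynomial in \<open>w\<close>, whose limit at
  a boundary point is its value. The point is an accumulation point of \<open>D\<close>, which makes
  the limit unique.\<close>

lemma leray_boundary_monomial:
 assumes f: "f : L2 mu" "monomial D n m f" and nm: "0 <= n" "0 <= m" and zt: "zt : frontier D"
 shows "leray_boundary D ro sg f zt =
  of_real (fact (nat n + nat m + 1) / (fact (nat n) * fact (nat m))) *
  (LINT s|o.R. f (psi (s, 0, 0)) * of_real ((s / rr s) ^ nat n * ((1 - s) / tt s) ^ nat m)) * fst zt ^ nat n * snd zt ^ nat m"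
 unfolding leray_boundary_def
proof (rule tendsto_Lim)
 have "zt : closure (D - {zt})" using zt frontier_notin[OF zt] by (simp add: frontier_eq)
 then show "at zt within D ~= bot" using not_trivial_limit_within[of zt D] by simp
 define c where "c = of_real (fact (nat n + nat m + 1) / (fact (nat n) * fact (nat m))) *
  (LINT s|o.R. f (psi (s, 0, 0)) * of_real ((s / rr s) ^ nat n * ((1 - s) / tt s) ^ nat m))"
 have "((%w. c * fst w ^ nat n * snd w ^ nat m) \<longlongrightarrow> c * fst zt ^ nat n * snd zt ^ nat m) (at zt within D)"
  by (intro tendsto_intros)
 then have "(leray_integral ro sg f \<longlongrightarrow> c * fst zt ^ nat n * snd zt ^ nat m) (at zt within D)"
  by (rule Lim_transform_eventually)
   (auto simp: eventually_at_filter c_def leray_integral_monomial[OF f] nm intro!: always_eventually)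
 then show "(leray_integral ro sg f \<longlongrightarrow> of_real (fact (nat n + nat m + 1) / (fact (nat n) * fact (nat m))) *
  (LINT s|o.R. f (psi (s, 0, 0)) * of_real ((s / rr s) ^ nat n * ((1 - s) / tt s) ^ nat m)) * fst zt ^ nat n * snd zt ^ nat m) (at zt within D)"
  by (simp only: c_def)
qed

end

section \<open>Decomposition into monomials\<close>

lemma monomial_scale: "monomial D n m f ==> monomial D n m (%zt. c * f zt)"
proof -
 assume "monomial D n m f"
 then obtain g where "\<forall>zt\<in>frontier D. fst zt * snd zt ~= 0 -->
  f zt = g (s_coord D zt) * cis (ang n m zt)"
  unfolding monomial_def by (rule exE)
 then show ?thesis unfolding monomial_def by (intro exI[of _ "%s. c * g s"]) (simp add: mult.assoc)
qed

lemma monomial_sum: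
 assumes "!!i. i : X ==> monomial D n m (F i)"
 shows "monomial D n m (%zt. \<Sum>i\<in>X. F i zt)"
proof -
 have "\<forall>i\<in>X. \<exists>g. \<forall>zt\<in>frontier D. fst zt * snd zt ~= 0 -->
  F i zt = g (s_coord D zt) * cis (ang n m zt)"
  using assms unfolding monomial_def by (rule ballI)
 from bchoice[OF this] obtain g where g: "\<forall>i\<in>X. \<forall>zt\<in>frontier D. fst zt * snd zt ~= 0 -->
  F i zt = g i (s_coord D zt) * cis (ang n m zt)" by (rule exE)
 show ?thesis unfolding monomial_def
  by (rule exI[of _ "%s. \<Sum>i\<in>X. g i s"]) (use g in \<open>simp add: sum_distrib_right\<close>)
qed

lemma monomial_diff:
 assumes "monomial D n m f" "monomial D n m f'"
 shows "monomial D n m (%zt. f zt - f' zt)"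
proof -
 have "monomial D n m (%zt. \<Sum>i\<in>{True, False}. (if i then f else (%zt. - 1 * f' zt)) zt)"
  by (rule monomial_sum) (use assms(1) monomial_scale[OF assms(2), of "- 1"] in auto)
 then show ?thesis by simp
qed

lemma monomial_mult:
 assumes "monomial D n m f" "monomial D n' m' f'"
 shows "monomial D (n + n') (m + m') (%zt. f zt * f' zt)"
proof -
 obtain g where g: "\<forall>zt\<in>frontier D. fst zt * snd zt ~= 0 -->
  f zt = g (s_coord D zt) * cis (ang n m zt)"
  using assms(1) unfolding monomial_def by (rule exE)
 obtain g' where g': "\<forall>zt\<in>frontier D. fst zt * snd zt ~= 0 -->
  f' zt = g' (s_coord D zt) * cis (ang n' m' zt)"
  using assms(2) unfolding monomial_def by (rule exE)
 show ?thesis unfolding monomial_def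
 proof (rule exI[of _ "%s. g s * g' s"], intro ballI impI)
  fix zt assume z: "zt : frontier D" "fst zt * snd zt ~= 0"
  have e: "of_int (n + n') * A + of_int (m + m') * B = (of_int n * A + of_int m * B) + (of_int n' * A + of_int m' * B)"
   for A B :: real by (simp add: algebra_simps)
  show "f zt * f' zt = g (s_coord D zt) * g' (s_coord D zt) * cis (of_int (n + n') * Arg (fst zt) + of_int (m + m') * Arg (snd zt))"
   unfolding e cis_mult[symmetric] mp[OF bspec[OF g z(1)] z(2)] mp[OF bspec[OF g' z(1)] z(2)] by (simp only: mult_ac)
 qed
qed

lemma monomial_cnj:
 assumes "monomial D n m f"
 shows "monomial D (- n) (- m) (%zt. cnj (f zt))"
proof -
 obtain g where g: "\<forall>zt\<in>frontier D. fst zt * snd zt ~= 0 -->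
  f zt = g (s_coord D zt) * cis (ang n m zt)"
  using assms(1) unfolding monomial_def by (rule exE)
 show ?thesis unfolding monomial_def
  by (rule exI[of _ "%s. cnj (g s)"]) (use g in \<open>simp add: cis_cnj\<close>)
qed

lemma plim_mult:
 assumes "c ~= 0"
 shows "plim (%k x. u k y * c) x = plim u y * c"
proof -
 have "convergent (%k. u k y * c) \<longleftrightarrow> convergent (%k. u k y)"
  using assms by (rule convergent_mult_const_right_iff)
 moreover have "lim (%k. u k y * c) = lim (%k. u k y) * c" if "convergent (%k. u k y)"
  using that unfolding convergent_LIMSEQ_iff by (intro limI tendsto_mult_right)
 ultimately show ?thesis by (simp add: plim_def)
qed

lemma monomial_pointwise_limit:
 assumes "!!k. monomial D n m (u k)"
 shows "monomial D n m (plim u)"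
proof -
 have "\<forall>k. \<exists>g. \<forall>zt\<in>frontier D. fst zt * snd zt ~= 0 -->
  u k zt = g (s_coord D zt) * cis (ang n m zt)"
  using assms unfolding monomial_def by (rule allI)
 from choice[OF this] obtain g where g: "\<forall>k. \<forall>zt\<in>frontier D. fst zt * snd zt ~= 0 -->
  u k zt = g k (s_coord D zt) * cis (ang n m zt)" by (rule exE)
 show ?thesis unfolding monomial_def
 proof (intro exI[of _ "plim g"] ballI impI)
  fix zt assume z: "zt : frontier D" "fst zt * snd zt ~= 0"
  let ?c = "cis (ang n m zt)"
  have "(%k. u k zt) = (%k. g k (s_coord D zt) * ?c)" using g z by auto
  then have "plim u zt = plim (%k x. g k (s_coord D zt) * ?c) zt"
   by (simp only: plim_def)
  also have "... = plim g (s_coord D zt) * ?c" by (rule plim_mult) simp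
  finally show "plim u zt = plim g (s_coord D zt) * ?c" .
 qed
qed

text \<open>Zorn's lemma within \<open>V\<close>: a vector of \<open>V\<close> of nonzero norm
  orthogonal to a maximal orthonormal subset could be normalized and added to it.\<close>

lemma maximal_orthonormal:
 assumes V: "V \<subseteq> L2 M" and scale: "!!c v. v : V ==> (%x. c * v x) : V"
 shows "\<exists>E. orthonormal M E (%x. x) & E \<subseteq> V & (\<forall>w\<in>V. (\<forall>x\<in>E. inn M w x = 0) --> nr M w = 0)"
proof -
 let ?O = "{E. orthonormal M E (%x. x) & E \<subseteq> V}"
 have "{} : ?O" by (simp add: orthonormal_def)
 then have ne: "?O ~= {}" by (rule ex_in_conv[THEN iffD1, OF exI])
 have chain: "\<Union> C : ?O" if C: "C ~= {}" "subset.chain ?O C" for C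
 proof -
  have mem: "E : ?O" if "E : C" for E using C(2) that by (auto simp: subset.chain_def)
  have "orthonormal M (\<Union> C) (%x. x)"
   unfolding orthonormal_def
  proof (intro conjI ballI)
   fix x assume "x : \<Union> C"
   then show "x : L2 M" using mem V by auto
  next
   fix x y assume "x : \<Union> C" "y : \<Union> C"
   then obtain X Y where XY: "X : C" "x : X" "Y : C" "y : Y" by (elim UnionE)
   have "X \<subseteq> Y \<or> Y \<subseteq> X" using C(2) XY by (simp add: subset_chain_def)
   then have "\<exists>Z\<in>C. x : Z & y : Z" using XY by (meson subsetD)
   then obtain Z where Z: "Z : C" "x : Z" "y : Z" by (elim bexE conjE) (rule that)
   have "orthonormal M Z (%x. x)" using mem[OF Z(1)] by simp
   from orthonormal_inner[OF this Z(2,3)] show "inn M x y = (if x = y then 1 else 0)" .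
  qed
  moreover have "\<Union> C \<subseteq> V" by (rule Union_least) (use mem in auto)
  ultimately show ?thesis by simp
 qed
 have "\<exists>E\<in>?O. \<forall>X\<in>?O. E \<subseteq> X --> X = E" by (rule subset_Zorn_nonempty[OF ne chain])
 then obtain E where E: "E : ?O" and max: "\<forall>X\<in>?O. E \<subseteq> X --> X = E" by (rule bexE)
 have ON: "orthonormal M E (%x. x)" and EV: "E \<subseteq> V" using E by auto
 have "nr M w = 0" if w: "w : V" and orth: "\<forall>x\<in>E. inn M w x = 0" for w
 proof (rule ccontr)
  assume nz: "nr M w ~= 0"
  define z where "z = (%x. cr (1 / nr M w) * w x)"
  have zV: "z : V" unfolding z_def by (rule scale[OF w])
  have zz: "inn M z z = 1"
   unfolding l2_inner_self z_def l2_norm_scale using nz by (simp add: power2_eq_square norm_divide)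
  have zx: "inn M z x = 0" if "x : E" for x
   unfolding z_def l2_inner_scale_left using orth that by simp
  then have xz: "inn M x z = 0" if "x : E" for x using that by (subst l2_inner_commute) simp
  have "z \<notin> E" using zx zz by auto
  moreover have "insert z E : ?O"
   using ON EV zV V zz zx xz \<open>z \<notin> E\<close> by (auto simp: orthonormal_def)
  then have "insert z E = E" using max by blast
  ultimately show False by blast
 qed
 then show ?thesis using ON EV by blast
qed

text \<open>\<open>V\<close> is a set of functions and not of classes modulo null sets. Closure
  under \<open>plim\<close> replaces closedness and makes the Fourier sum a member of
  \<open>V\<close> itself, which is what keeps the components of a function genuine
  monomials.\<close>

lemma orthogonal_projection:
 assumes V: "V \<subseteq> L2 M" and scale: "!!c v. v : V ==> (%x. c * v x) : V"
  and diff: "!!v w. v : V ==> w : V ==> (%x. v x - w x) : V"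
  and sum: "!!X (F :: ('a => complex) => 'a => complex). finite X ==> (!!i. i : X ==> F i : V) ==> (%x. \<Sum>i\<in>X. F i x) : V"
  and lim: "!!u. (!!k. u k : V) ==> plim u : L2 M ==> plim u : V"
  and f: "f : L2 M"
 shows "\<exists>g\<in>V. \<forall>v\<in>V. inn M f v = inn M g v"
proof -
 obtain E where E: "orthonormal M E (%x. x)" "E \<subseteq> V"
  and max: "\<forall>w\<in>V. (\<forall>x\<in>E. inn M w x = 0) --> nr M w = 0"
 proof -
  have "\<exists>E. orthonormal M E (%x. x) & E \<subseteq> V & (\<forall>w\<in>V. (\<forall>x\<in>E. inn M w x = 0) --> nr M w = 0)"
   by (rule maximal_orthonormal[OF V]) (rule scale)
  then show ?thesis by (elim exE conjE) (rule that)
 qed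
 have ex: "\<exists>g\<in>V. l2_has_sum M (%x y. inn M p x * x y) g E & (\<forall>x\<in>E. inn M g x = inn M p x)"
  if p: "p : L2 M" for p
 proof -
  let ?c = "%x. inn M p x"
  obtain X where X: "!!k. finite (X k) & X k \<subseteq> E"
   "l2_has_sum M (%i x. ?c i * i x) (plim (%k x. \<Sum>i\<in>X k. ?c i * i x)) E"
   using Riesz_Fischer_orthonormal[OF E(1) Bessel_summable[OF E(1) p]] by (elim exE conjE) (rule that, erule spec)
  let ?g = "plim (%k x. \<Sum>i\<in>X k. ?c i * i x)"
  have gL: "?g : L2 M" using X(2) by (rule l2_has_sum_L2)
  have "?g : V"
   by (rule lim[OF _ gL], rule sum) (use X(1) E(2) in \<open>auto intro!: scale\<close>)
  moreover have "inn M ?g x = ?c x" if x: "x : E" for x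
  proof -
   have "((%z. inn M (%y. ?c z * z y) x) has_sum inn M ?g x) E"
    by (rule l2_has_sum_inner[OF X(2)]) (use x E(2) V in auto)
   moreover have "((%z. inn M (%y. ?c z * z y) x) has_sum ?c x) E"
    by (rule has_sum_finite_neutralI[of "{x}"]) (use x in \<open>auto simp: orthonormal_inner[OF E(1)]\<close>)
   ultimately show ?thesis by (rule has_sum_unique)
  qed
  ultimately show ?thesis using X(2) by (intro bexI[of _ ?g] conjI ballI)
 qed
 obtain g where g: "g : V" "\<forall>x\<in>E. inn M g x = inn M f x" using ex[OF f] by (elim bexE conjE) (rule that)
 have "inn M f v = inn M g v" if v: "v : V" for v
 proof -
  have vL: "v : L2 M" and gL: "g : L2 M" using v g(1) V by auto
  obtain w where w: "w : V" "l2_has_sum M (%x y. inn M v x * x y) w E" "\<forall>x\<in>E. inn M w x = inn M v x"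
   using ex[OF vL] by (elim bexE conjE) (rule that)
  have wL: "w : L2 M" using w(1) V by auto
  \<comment> \<open>By maximality of \<open>E\<close> every vector of \<open>V\<close> agrees almost
    everywhere with its Fourier sum, so the orthogonality of \<open>f - g\<close> to
    \<open>E\<close> extends to \<open>V\<close>.\<close>
  have "\<forall>x\<in>E. inn M (%y. v y - w y) x = 0"
   using w(3) E(2) V vL wL by (auto simp: l2_inner_diff_left subset_iff)
  then have "nr M (%y. v y - w y) = 0" using max diff[OF v w(1)] by blast
  then have "AE y in M. v y - w y = 0" using l2_norm_eq_0_iff[OF L2_diff[OF vL wL]] by simp
  then have vw: "AE y in M. v y = w y" by eventually_elim simp
  define d where "d = (%y. f y - g y)"
  have dL: "d : L2 M" unfolding d_def by (rule L2_diff[OF f gL])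
  have "((%x. inn M (%y. inn M v x * x y) d) has_sum inn M w d) E"
   by (rule l2_has_sum_inner[OF w(2) dL])
  moreover have "((%x. inn M (%y. inn M v x * x y) d) has_sum 0) E"
  proof (rule has_sum_0)
   fix x assume x: "x : E"
   then have xL: "x : L2 M" using E(2) V by auto
   have "inn M x d = 0"
    using g(2) x f gL xL l2_inner_commute[of M x f] l2_inner_commute[of M x g]
    by (simp add: d_def l2_inner_diff_right)
   then show "inn M (%y. inn M v x * x y) d = 0" by simp
  qed
  ultimately have "inn M w d = 0" by (rule has_sum_unique)
  then have "inn M v d = 0" using l2_inner_cong_AE(1)[OF vL wL dL vw] by simp
  then have "inn M d v = 0" by (subst l2_inner_commute) simp
  then show ?thesis using l2_inner_diff_left[OF f gL vL] by (simp add: d_def)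
 qed
 then show ?thesis using g(1) by blast
qed

text \<open>Finite sums of continuous monomials. They form an algebra that contains the real
  polynomials, which opens the way to the Stone-Weierstrass theorem.\<close>

inductive monomial_span :: "C2 set => (C2 => complex) => bool" for D where
 mono: "monomial D n m q ==> continuous_on (frontier D) q ==> monomial_span D q"
| add: "monomial_span D q ==> monomial_span D q' ==> monomial_span D (%zt. q zt + q' zt)"

lemma monomial_span_mult:
 assumes "monomial_span D q" "monomial_span D q'"
 shows "monomial_span D (%zt. q zt * q' zt)"
 using assms(1)
proof induction
 case (mono n m q)
 show ?case using assms(2)
 proof induction
  case (mono n' m' q')
  then show ?case using \<open>monomial D n m q\<close> \<open>continuous_on (frontier D) q\<close>
   by (intro monomial_span.mono[of D "n + n'" "m + m'"] monomial_mult continuous_on_mult)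
 next
  case (add q' q'')
  then show ?case unfolding distrib_left by (intro monomial_span.add)
 qed
next
 case (add q q'')
 then show ?case unfolding distrib_right by (intro monomial_span.add)
qed

section \<open>Completeness of the monomials\<close>

context C2_reinhardt_measure
begin

lemma monomial_coordinates:
 "monomial D 1 0 fst" "monomial D 0 1 snd" "monomial D 0 0 (%_. c)"
proof -
 have k: "fst zt = of_real (rr (s_coord D zt)) * cis (ang 1 0 zt) \<and>
   snd zt = of_real (tt (s_coord D zt)) * cis (ang 0 1 zt)"
  if zt: "zt : frontier D" "fst zt * snd zt ~= 0" for zt
 proof -
  obtain s where s: "0 < s" "s < 1" "norm (fst zt) = rr s" "norm (snd zt) = tt s"
   using frontier_curve[of zt] zt by auto
  have "s_coord D zt = s" by (rule s_coord_curve[OF s(1-3)])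
  then show ?thesis using rcis_cmod_Arg[of "fst zt"] rcis_cmod_Arg[of "snd zt"] s by (simp add: rcis_def)
 qed
 show "monomial D 1 0 fst" unfolding monomial_def
  by (rule exI[of _ "%s. of_real (rr s)"], intro ballI impI, rule conjunct1[OF k])
 show "monomial D 0 1 snd" unfolding monomial_def
  by (rule exI[of _ "%s. of_real (tt s)"], intro ballI impI, rule conjunct2[OF k])
 show "monomial D 0 0 (%_. c)" unfolding monomial_def by (intro exI[of _ "%_. c"]) simp
qed

lemma monomial_span_polynomial:
 assumes "real_polynomial_function p"
 shows "monomial_span D (%zt. of_real (p zt))"
 using assms
proof induction
 case (linear f)
 \<comment> \<open>A real linear form is the real part of a complex linear one; written with
   conjugates it is a sum of four monomials.\<close>
 define al bt where "al = Complex (f (1, 0) / 2) (- f (\<i>, 0) / 2)" and "bt = Complex (f (0, 1) / 2) (- f (0, \<i>) / 2)"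
 have f: "f zt = Re (fst zt) * f (1, 0) + Im (fst zt) * f (\<i>, 0) + (Re (snd zt) * f (0, 1) + Im (snd zt) * f (0, \<i>))" for zt
 proof -
  interpret bounded_linear f by (rule linear)
  have "zt = Re (fst zt) *\<^sub>R (1, 0) + Im (fst zt) *\<^sub>R (\<i>, 0) + (Re (snd zt) *\<^sub>R (0, 1) + Im (snd zt) *\<^sub>R (0, \<i>))"
   by (simp add: prod_eq_iff complex_eq_iff)
  then have "f zt = f (Re (fst zt) *\<^sub>R (1, 0) + Im (fst zt) *\<^sub>R (\<i>, 0) + (Re (snd zt) *\<^sub>R (0, 1) + Im (snd zt) *\<^sub>R (0, \<i>)))"
   by (rule arg_cong)
  then show ?thesis by (simp only: add scaleR real_scaleR_def)
 qed
 have e: "(%zt. cr (f zt)) =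
   (%zt. (al * fst zt + cnj al * cnj (fst zt)) + (bt * snd zt + cnj bt * cnj (snd zt)))"
  by (rule ext, subst f) (simp add: complex_eq_iff al_def bt_def algebra_simps)
 have 1: "monomial_span D (%zt. c * fst zt)" "monomial_span D (%zt. c * snd zt)" for c
  by (rule monomial_span.mono[OF monomial_scale[OF monomial_coordinates(1)]]
    monomial_span.mono[OF monomial_scale[OF monomial_coordinates(2)]], intro continuous_intros)+
 have 2: "monomial_span D (%zt. c * cnj (fst zt))" "monomial_span D (%zt. c * cnj (snd zt))" for c
  by (rule monomial_span.mono[OF monomial_scale[OF monomial_cnj[OF monomial_coordinates(1)]]]
    monomial_span.mono[OF monomial_scale[OF monomial_cnj[OF monomial_coordinates(2)]]], intro continuous_intros)+
 show ?case unfolding e by (intro monomial_span.add 1 2)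
next
 case (const c)
 show ?case by (rule monomial_span.mono[OF monomial_coordinates(3)]) (rule continuous_on_const)
next
 case (add f g)
 then show ?case unfolding of_real_add by (intro monomial_span.add)
next
 case (mult f g)
 then show ?case unfolding of_real_mult by (intro monomial_span_mult)
qed

lemma continuous_L2:
 fixes q :: "C2 => complex"
 assumes "continuous_on (frontier D) q"
 shows "q : L2 mu"
proof -
 interpret finite_measure mu by (rule finite_mu)
 have "bounded (q ` frontier D)" by (intro compact_imp_bounded compact_continuous_image assms compact_frontier)
 then obtain C where C: "\<forall>y\<in>q ` frontier D. norm y <= C" unfolding bounded_iff by (rule exE)
 have m: "q : bm mu"
  using sg borel_measurable_continuous_on_restrict[OF assms]
  by (subst measurable_cong_sets[of mu "restrict_space borel (frontier D)"]) (auto simp: surface_measure_def sets_mu)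
 show ?thesis
  by (rule L2_bound[OF m, of "%_. C\<^sup>2"]) (use C in \<open>auto simp: space_mu intro!: power_mono\<close>)
qed

text \<open>By Stone-Weierstrass \<open>f\<close> is orthogonal to all continuous real functions.
  Limits of these give the indicators of closed sets, and a Dynkin system argument all Borel
  sets.\<close>

lemma monomials_complete:
 assumes f: "f : L2 mu" and orth: "!!n m v. v : L2 mu ==> monomial D n m v ==> inn mu f v = 0"
 shows "AE zt in mu. f zt = 0"
proof -
 interpret finite_measure mu by (rule finite_mu)
 have fi: "integrable mu f" by (rule integrable_L2[OF f])
 have span: "q : L2 mu & inn mu f q = 0" if "monomial_span D q" for q
  using that
 proof induction
  case (mono n m q)
  then show ?case using continuous_L2[OF mono(2)] orth by simp
 next
  case (add q q')
  then show ?case using f by (simp add: L2_add l2_inner_add_right)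
 qed
 have cont0: "inn mu f (%zt. of_real (q zt)) = 0" if q: "continuous_on (frontier D) q" for q :: "C2 => real"
 proof (rule ccontr)
  assume nz: "inn mu f (%zt. of_real (q zt)) ~= 0"
  \<comment> \<open>The summand 1 keeps \<open>B\<close> positive and makes the final estimate
    strict.\<close>
  define B where "B = nr mu f * sqrt (measure mu (space mu)) + 1"
  have B: "B > 0" unfolding B_def by (simp add: add_nonneg_pos)
  define e where "e = norm (inn mu f (%zt. of_real (q zt))) / B"
  have e: "e > 0" using nz B by (simp add: e_def)
  obtain p where p: "real_polynomial_function p" "!!x. x : frontier D ==> \<bar>q x - p x\<bar> < e"
   using Stone_Weierstrass_real_polynomial_function[OF compact_frontier q e] by blast
  have qL: "(%zt. cr (q zt)) : L2 mu" by (intro continuous_L2 continuous_on_of_real q)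
  have pL: "(%zt. cr (p zt)) : L2 mu" "inn mu f (%zt. cr (p zt)) = 0"
   using span[OF monomial_span_polynomial[OF p(1)]] by auto
  let ?d = "%zt. cr (q zt) - cr (p zt)"
  have dL: "?d : L2 mu" by (rule L2_diff[OF qL pL(1)])
  have "(LINT zt|mu. (norm (?d zt))\<^sup>2) <= (LINT zt|mu. e\<^sup>2)"
  proof (rule integral_mono[OF L2_integrable[OF dL]])
   fix zt assume "zt : space mu"
   then have "norm (?d zt) <= e" using p(2)[of zt] by (simp add: space_mu flip: of_real_diff)
   then show "(norm (?d zt))\<^sup>2 <= e\<^sup>2" by (intro power_mono) auto
  qed simp
  then have "nr mu ?d <= e * sqrt (measure mu (space mu))"
   unfolding l2_norm_def using e
   by (intro real_le_lsqrt) (auto simp: power_mult_distrib mult.commute integral_nonneg_AE)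
  then have "norm (inn mu f ?d) <= nr mu f * (e * sqrt (measure mu (space mu)))"
   by (intro order_trans[OF l2_Cauchy_Schwarz[OF f dL]] mult_left_mono) auto
  also have "... < e * B" using e by (simp add: B_def algebra_simps)
  also have "... = norm (inn mu f (%zt. of_real (q zt)))" using B by (simp add: e_def)
  finally show False by (simp add: l2_inner_diff_right[OF qL pL(1) f] pL(2))
 qed
 have set0: "(LINT zt|mu. f zt * indicator A zt) = 0" if A: "A : sets borel" for A :: "C2 set"
 proof -
  have im: "(%zt. indicator A zt :: complex) : bm mu" if "A : sets borel" for A :: "C2 set"
   unfolding measurable_cong_sets[OF sets_mu refl] by (rule measurable_sg) (use that in simp)
  have ii: "integrable mu (%zt. f zt * indicator A zt)" if "A : sets borel" for A :: "C2 set"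
   by (rule Bochner_Integration.integrable_bound[OF fi]) (use im[OF that] fi in \<open>auto simp: indicator_def\<close>)
  have "Int_stable (Collect closed :: C2 set set)" "Collect closed \<subseteq> Pow (UNIV :: C2 set)" "A : sigma_sets UNIV (Collect closed)"
   using A by (auto simp: Int_stable_def borel_eq_closed)
  then show ?thesis
  proof (induction rule: sigma_sets_induct_disjoint)
   case (basic C)
   then have C: "closed C" by simp
   show ?case
   proof (cases "C = {}")
    case False
    \<comment> \<open>Continuous functions that equal 1 on \<open>C\<close> and tend to 0 off
      \<open>C\<close>.\<close>
    define u where "u k zt = max 0 (1 - real k * infdist zt C)" for k zt
    have uc: "continuous_on X (u k)" for k X unfolding u_def[abs_def]
     by (intro continuous_intros)
    have u01: "0 <= u k zt" "u k zt <= 1" for k zt by (auto simp: u_def infdist_nonneg)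
    have lim: "(%k. u k zt) ---> indicator C zt" for zt
    proof (cases "zt : C")
     case True
     then show ?thesis by (simp add: u_def)
    next
     case out: False
     then have d: "infdist zt C > 0" using in_closed_iff_infdist_zero[OF C False, of zt] infdist_nonneg[of zt C] by linarith
     have "\<forall>\<^sub>F k in sequentially. u k zt = 0"
     proof (rule eventually_mono[OF eventually_ge_at_top])
      fix k assume "nat \<lceil>1 / infdist zt C\<rceil> <= k"
      then have "1 / infdist zt C <= real k" by linarith
      then have "1 <= real k * infdist zt C" using d by (simp add: pos_divide_le_eq)
      then show "u k zt = 0" by (simp add: u_def)
     qed
     then show ?thesis using out by (simp add: tendsto_eventually)
    qed
    have "(%k. LINT zt|mu. f zt * of_real (u k zt)) ---> (LINT zt|mu. f zt * of_real (indicator C zt))"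
    proof (rule integral_dominated_convergence[where w = "%zt. norm (f zt)"])
     show "integrable mu (%zt. norm (f zt))" using fi by simp
     show "(%zt. f zt * of_real (indicator C zt)) : bm mu"
      using ii[OF borel_closed[OF C]] by (simp add: of_real_indicator borel_measurable_integrable)
     show "(%zt. f zt * of_real (u k zt)) : bm mu" for k
      by (intro borel_measurable_times borel_measurable_integrable[OF fi] L2_measurable continuous_L2 continuous_on_of_real uc)
     show "AE zt in mu. (%k. f zt * of_real (u k zt)) ---> f zt * of_real (indicator C zt)"
      by (intro AE_I2 tendsto_mult_left tendsto_of_real lim)
     show "AE zt in mu. norm (f zt * of_real (u k zt)) <= norm (f zt)" for k
      using u01[of k] by (intro AE_I2) (simp add: norm_mult mult_left_le)
    qed
    moreover have "(LINT zt|mu. f zt * of_real (u k zt)) = 0" for k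
     using cont0[OF uc[of "frontier D" k]] by (simp add: l2_inner_def)
    ultimately show ?thesis by (simp add: LIMSEQ_const_iff of_real_indicator)
   qed simp
  next
   case empty
   show ?case by simp
  next
   case (compl A)
   have A: "A : sets borel" using compl(1) by (simp add: borel_eq_closed)
   have "(LINT zt|mu. f zt) = 0" using cont0[of "%_. 1"] by (simp add: l2_inner_def)
   moreover have "f zt * indicator (UNIV - A) zt = f zt - f zt * indicator A zt" for zt by (auto simp: indicator_def)
   ultimately show ?case using compl(2) fi ii[OF A] by simp
  next
   case (union A)
   have A: "A i : sets borel" for i using union(2) by (auto simp: borel_eq_closed)
   have UA: "(\<Union>i. A i) : sets borel" using A by auto
   have "(%i. LINT zt|mu. f zt * indicator (\<Union>j<i. A j) zt) ---> (LINT zt|mu. f zt * indicator (\<Union>i. A i) zt)"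
   proof (rule integral_dominated_convergence[where w = "%zt. norm (f zt)"])
    show "integrable mu (%zt. norm (f zt))" using fi by simp
    show "(%zt. f zt * indicator (\<Union>i. A i) zt) : bm mu" using ii[OF UA] by (rule borel_measurable_integrable)
    show "(%zt. f zt * indicator (\<Union>j<i. A j) zt) : bm mu" for i
     by (rule borel_measurable_integrable[OF ii]) (use A in auto)
    show "AE zt in mu. (%i. f zt * indicator (\<Union>j<i. A j) zt) ---> f zt * indicator (\<Union>i. A i) zt"
     by (intro AE_I2 tendsto_mult_left LIMSEQ_indicator_UN)
    show "AE zt in mu. norm (f zt * indicator (\<Union>j<i. A j) zt) <= norm (f zt)" for i
     by (intro AE_I2) (simp add: indicator_def)
   qed
   moreover have "(LINT zt|mu. f zt * indicator (\<Union>j<i. A j) zt) = 0" for i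
   proof -
    have "indicator (\<Union>j<i. A j) zt = (\<Sum>j<i. indicator (A j) zt :: complex)" for zt
     by (rule indicator_UN_disjoint) (use union(1) in \<open>auto simp: disjoint_family_on_def\<close>)
    then show ?thesis
     by (simp only: sum_distrib_left Bochner_Integration.integral_sum[OF ii[OF A]] union(3) sum.neutral_const)
   qed
   ultimately show ?case by (simp add: LIMSEQ_const_iff)
  qed
 qed
 show ?thesis
 proof (rule density_zero[OF fi])
  fix A assume "A : sets mu"
  then obtain B where B: "B : sets borel" "A = frontier D \<inter> B"
   using sg by (auto simp: sets_mu surface_measure_def sets_restrict_space)
  have "set_lebesgue_integral mu A f = (LINT zt|mu. f zt * indicator B zt)"
   unfolding set_lebesgue_integral_def
   by (rule Bochner_Integration.integral_cong) (auto simp: space_mu B(2) indicator_def)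
  then show "set_lebesgue_integral mu A f = 0" using set0[OF B(1)] by simp
 qed
qed

lemma inner_monomials:
 assumes f: "f : L2 mu" "monomial D n m f" and g: "g : L2 mu" "monomial D n' m' g"
 shows "inn mu f g = (if n = n' & m = m' then of_real (4 * pi\<^sup>2) *
  (LINT s|w.R. f (psi (s, 0, 0)) * cnj (g (psi (s, 0, 0)))) else 0)"
 unfolding l2_inner_def
 using integral_monomial(2)[OF monomial_mult[OF f(2) monomial_cnj[OF g(2)]] L2_mult_integrable[OF f(1) g(1)]]
 by simp

text \<open>Different sectors are orthogonal, so one unit vector in each of them forms an
  orthonormal family.\<close>

lemma sector_orthonormal:
 assumes uL: "!!i. i : I ==> u i : L2 mu" and um: "!!i. i : I ==> monomial D (fst i) (snd i) (u i)"
  and un: "!!i. i : I ==> nr mu (u i) = 1"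
 shows "orthonormal mu I u"
 unfolding orthonormal_def
proof (intro conjI ballI uL)
 fix i j assume i: "i : I" and j: "j : I"
 show "inn mu (u i) (u j) = (if i = j then 1 else 0)"
 proof (cases "i = j")
  case True
  then show ?thesis using j by (simp add: l2_inner_self un)
 next
  case False
  then have ne: "\<not> (fst i = fst j & snd i = snd j)" by (simp add: prod_eq_iff)
  show ?thesis
   unfolding inner_monomials[OF uL[OF i] um[OF i] uL[OF j] um[OF j]] if_not_P[OF ne] if_not_P[OF False] ..
 qed
qed

text \<open>The abstract projection takes the place of the Fourier integral over the torus, and its
  result satisfies \<open>monomial\<close> at every point of the boundary off the axes, not just
  almost everywhere.\<close>

lemma sector_projection:
 assumes f: "f : L2 mu"
 shows "\<exists>g. g : L2 mu & monomial D n m g & (\<forall>v. v : L2 mu --> monomial D n m v --> inn mu f v = inn mu g v)"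
proof -
 let ?V = "{f : L2 mu. monomial D n m f}"
 have "\<exists>g\<in>?V. \<forall>v\<in>?V. inn mu f v = inn mu g v"
 proof (rule orthogonal_projection[OF _ _ _ _ _ f])
  show "?V \<subseteq> L2 mu" by simp
  show "(%x. c * v x) : ?V" if "v : ?V" for c v using that by (simp add: L2_scale monomial_scale)
  show "(%x. v x - w x) : ?V" if "v : ?V" "w : ?V" for v w using that by (simp add: L2_diff monomial_diff)
  show "(%x. \<Sum>i\<in>X. F i x) : ?V" if "finite X" "!!i. i : X ==> F i : ?V" for X F
   using that(2) by (simp add: L2_sum monomial_sum)
  show "plim u : ?V" if "!!k. u k : ?V" "plim u : L2 mu" for u
   using that by (simp add: monomial_pointwise_limit)
 qed
 then show ?thesis by (simp add: imp_conjL)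
qed

text \<open>The normalized components form an orthonormal family, so their series converges. The
  difference between \<open>f\<close> and its sum is orthogonal to every monomial and vanishes by
  completeness.\<close>

lemma sector_decomposition:
 assumes f: "f : L2 mu" and e0: "!!n m. e0 (n, m) : L2 mu" "!!n m. monomial D n m (e0 (n, m))" "!!i. nr mu (e0 i) = 1"
 shows "\<exists>F. (\<forall>n m. monomial D n m (F (n, m)) & F (n, m) : L2 mu) & l2_has_sum mu F f UNIV"
proof -
 obtain P where P: "\<forall>i. P i : L2 mu & monomial D (fst i) (snd i) (P i) \<and>
   (\<forall>v. v : L2 mu --> monomial D (fst i) (snd i) v --> inn mu f v = inn mu (P i) v)"
  using choice[OF allI[OF sector_projection[OF f]], of "%i. fst i" "%i. snd i"] by (rule exE)
 \<comment> \<open>In a sector where the component of \<open>f\<close> has norm 0 the vector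
   \<open>e0\<close> stands in, so that there is a unit vector for every index.\<close>
 define u where "u i = (if nr mu (P i) = 0 then e0 i else (%x. cr (1 / nr mu (P i)) * P i x))" for i
 have PL: "P i : L2 mu" and Pm: "monomial D (fst i) (snd i) (P i)"
  and Pv: "v : L2 mu ==> monomial D (fst i) (snd i) v ==> inn mu f v = inn mu (P i) v" for i v
  using spec[OF P, of i] by simp_all
 have u: "u i : L2 mu & monomial D (fst i) (snd i) (u i) & nr mu (u i) = 1" for i
 proof (cases "nr mu (P i) = 0")
  case True
  show ?thesis unfolding u_def if_P[OF True]
   using e0(1)[of "fst i" "snd i"] e0(2)[of "fst i" "snd i"] e0(3)[of i] by simp
 next
  case False
  have "nr mu (u i) = 1"
   unfolding u_def if_not_P[OF False] l2_norm_scale using False by (simp add: norm_divide)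
  then show ?thesis unfolding u_def if_not_P[OF False] by (intro conjI L2_scale monomial_scale PL Pm)
 qed
 then have uL: "u i : L2 mu" and um: "monomial D (fst i) (snd i) (u i)" and un: "nr mu (u i) = 1" for i by simp_all
 have ON: "orthonormal mu UNIV u" by (rule sector_orthonormal[OF uL um un])
 define F where "F i x = inn mu f (u i) * u i x" for i x
 have FL: "F i : L2 mu" and Fm: "monomial D (fst i) (snd i) (F i)" for i
  unfolding F_def by (intro L2_scale uL monomial_scale um)+
 obtain g where g: "l2_has_sum mu (%i x. inn mu f (u i) * u i x) g UNIV"
  using l2_has_sum_exists[OF ON Bessel_summable[OF ON f]] by (rule exE)
 then have g: "l2_has_sum mu F g UNIV" by (simp add: F_def[abs_def])
 have gL: "g : L2 mu" using g by (rule l2_has_sum_L2)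
 have Fv: "inn mu (F i) v = inn mu f v" if v: "v : L2 mu" "monomial D (fst i) (snd i) v" for i v
 proof -
  have fv: "inn mu f v = inn mu (P i) v" by (rule Pv[OF v])
  have fu: "inn mu f (u i) = inn mu (P i) (u i)" by (rule Pv[OF uL um])
  show ?thesis
  proof (cases "nr mu (P i) = 0")
   case True
   have "inn mu (P i) k = 0" if "k : L2 mu" for k using l2_Cauchy_Schwarz[OF PL that, of i] True by simp
   then show ?thesis unfolding F_def l2_inner_scale_left fv fu using v(1) uL[of i] by simp
  next
   case False
   have "inn mu (P i) (u i) = of_real (nr mu (P i))"
    unfolding u_def if_not_P[OF False] l2_inner_scale_right l2_inner_self using False by (simp add: power2_eq_square)
   then have "F i = P i" using False by (intro ext) (simp add: F_def fu, simp add: u_def)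
   then show ?thesis using fv by simp
  qed
 qed
 have "AE x in mu. f x - g x = 0"
 proof (rule monomials_complete[OF L2_diff[OF f gL]])
  fix n m v assume v: "v : L2 mu" "monomial D n m v"
  have "((%i. inn mu (F i) v) has_sum inn mu g v) UNIV" by (rule l2_has_sum_inner[OF g v(1)])
  moreover have "((%i. inn mu (F i) v) has_sum inn mu f v) UNIV"
  proof (rule has_sum_finite_neutralI[of "{(n, m)}"])
   show "inn mu (F i) v = 0" if "i : UNIV - {(n, m)}" for i
    using inner_monomials[OF FL[of i] Fm[of i] v] that by (auto simp: prod_eq_iff)
   show "inn mu f v = (\<Sum>i\<in>{(n, m)}. inn mu (F i) v)" using Fv[OF v(1), of "(n, m)"] v(2) by simp
  qed simp_all
  ultimately show "inn mu (%x. f x - g x) v = 0"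
   using has_sum_unique by (simp add: l2_inner_diff_left[OF f gL v(1)]) blast
 qed
 then have "AE x in mu. g x = f x" by eventually_elim simp
 from l2_has_sum_AE[OF g f this] show ?thesis using FL Fm by (intro exI[of _ F]) auto
qed

end

section \<open>The spectrum of the Leray transform\<close>

text \<open>The formula for \<open>leray_boundary\<close> is available only on the boundary, which
  is the space of \<open>mu\<close>.\<close>

lemma l2_has_sum_cong_space:
 assumes g: "l2_has_sum M F g I" and eq: "!!i x. i : I ==> x : space M ==> F i x = F' i x"
 shows "l2_has_sum M F' g I"
proof -
 have "F' i : L2 M" if "i : I" for i
 proof -
  have "F i : L2 M" using g that by (simp add: l2_has_sum_def)
  moreover have "F i : bm M \<longleftrightarrow> F' i : bm M"
   by (rule measurable_cong) (rule eq[OF that])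
  moreover have "integrable M (%x. (norm (F i x))\<^sup>2) \<longleftrightarrow> integrable M (%x. (norm (F' i x))\<^sup>2)"
   by (rule Bochner_Integration.integrable_cong) (simp_all add: eq[OF that])
  ultimately show ?thesis by (simp add: L2_def)
 qed
 moreover have "((%X. nr M (%x. (\<Sum>i\<in>X. F' i x) - g x)) \<longlongrightarrow> 0) (finite_subsets_at_top I)"
 proof (rule Lim_transform_eventually)
  show "((%X. nr M (%x. (\<Sum>i\<in>X. F i x) - g x)) \<longlongrightarrow> 0) (finite_subsets_at_top I)"
   using g by (simp add: l2_has_sum_def)
  show "\<forall>\<^sub>F X in finite_subsets_at_top I. nr M (%x. (\<Sum>i\<in>X. F i x) - g x) = nr M (%x. (\<Sum>i\<in>X. F' i x) - g x)"
  proof (rule eventually_finite_subsets_at_top_weakI)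
   fix X assume "finite X" "X \<subseteq> I"
   then have "(\<Sum>i\<in>X. F i x) = (\<Sum>i\<in>X. F' i x)" if "x : space M" for x
    using eq that by (intro sum.cong) auto
   then show "nr M (%x. (\<Sum>i\<in>X. F i x) - g x) = nr M (%x. (\<Sum>i\<in>X. F' i x) - g x)"
    unfolding l2_norm_def by (intro arg_cong[where f = sqrt] Bochner_Integration.integral_cong) simp_all
  qed
 qed
 ultimately show ?thesis using g by (simp add: l2_has_sum_def)
qed

context C2_reinhardt_measure
begin

lemma curve: "reinhardt_curve rr tt pp weight"
proof
 show "continuous_on {0..1} pp" by (rule pp_cont)
 show "1 < pp s" for s by (rule pp_gt)
 show "pp 0 = 2" "pp 1 = 2" by (simp_all add: pp_def)
 show "0 < rr s" if "0 < s" "s <= 1" for s using rr_tt_pos(1)[of s] b1_pos that by (cases "s = 1") (auto simp: rr_def)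
 show "0 < tt s" if "0 <= s" "s < 1" for s using rr_tt_pos(2)[of s] b2_pos that by (cases "s = 0") (auto simp: tt_def)
qed (rule rr_cont_UNIV tt_cont_UNIV DERIV_rr DERIV_tt continuous_on_subset[OF w.W_cont subset_UNIV] w.W_pos | assumption)+

sublocale rc: reinhardt_curve rr tt pp weight by (rule curve)

text \<open>The coordinate s, set to 0 where \<open>Sf\<close> is not under control, so that it is a
  Borel function on the whole space.\<close>

definition sc :: "C2 => real" where
 "sc zt = indicator {0<..<b1} (norm (fst zt)) *\<^sub>R Sf (norm (fst zt))"

text \<open>Off the axes the powers of \<open>sgn\<close> are the characters
  \<open>cis (n * Arg z)\<close>, in a form whose measurability is immediate.\<close>

definition mono :: "(real => complex) => int => int => C2 => complex" where
 "mono g n m zt = g (sc zt) * (sgn (fst zt) powi n * sgn (snd zt) powi m)"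

lemma sc_eq: "0 < s ==> s < 1 ==> norm (fst zt) = rr s ==> sc zt = s"
 using interior_eqs[of s] ri[of s] by (simp add: sc_def)

lemma mono_psi:
 assumes s: "0 < s" "s < 1"
 shows "mono g n m (psi (s, 0, 0)) = g s"
 using sc_eq[OF s, of "psi (s, 0, 0)"] norm_psi[of s 0 0] rr_tt_pos[OF s] s
 by (simp add: mono_def psi_def sgn_of_real)

lemma mono_monomial: "monomial D n m (mono g n m)"
 unfolding monomial_def
proof (rule exI[of _ g], intro ballI impI)
 fix zt assume zt: "zt : frontier D" "fst zt * snd zt ~= 0"
 then have nz: "fst zt ~= 0" "snd zt ~= 0" by auto
 obtain s where s: "0 < s" "s < 1" "norm (fst zt) = rr s" using frontier_curve[OF zt(1) nz] by (elim exE conjE) (rule that)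
 show "mono g n m zt = g (s_coord D zt) * cis (ang n m zt)"
  unfolding mono_def sc_eq[OF s] s_coord_curve[OF s] cis_Arg[OF nz(1), symmetric] cis_Arg[OF nz(2), symmetric]
   cis_power_int cis_mult using nz by (simp add: Arg_cis Arg_bounded)
qed

lemma mono_measurable:
 assumes [measurable]: "g : bm borel"
 shows "mono g n m : bm mu"
proof -
 have "continuous_on {0<..<b1} Sf"
  by (rule continuous_at_imp_continuous_on) (auto intro!: DERIV_isCont[OF DERIV_Sf])
 from borel_measurable_continuous_on_indicator[OF _ this]
 have [measurable]: "(%r. indicator {0<..<b1} r *\<^sub>R Sf r) : bm borel" by simp
 have p: "(%z :: complex. sgn z powi k) : bm borel" for k
  unfolding power_int_def by (cases "k >= 0") simp_all
 have "(%zt :: C2. sgn (fst zt) powi n) : bm borel" "(%zt :: C2. sgn (snd zt) powi m) : bm borel"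
  by (rule measurable_compose[OF _ p]; measurable)+
 moreover have "sc : bm borel" unfolding sc_def[abs_def] by measurable
 ultimately have "mono g n m : bm borel" unfolding mono_def[abs_def] by measurable
 then show ?thesis unfolding measurable_cong_sets[OF sets_mu refl] by (rule measurable_sg)
qed


lemma mono_L2:
 assumes g: "g : bm borel" and i: "set_integrable lborel {0<..<1} (%s. weight s * (norm (g s))\<^sup>2)"
 shows "mono g n m : L2 mu"
proof -
 note [measurable] = g mono_measurable[OF g]
 have "set_integrable lborel {0<..<1} (%s. cr (weight s * (norm (g s))\<^sup>2))"
  using i unfolding set_integrable_def by (simp add: scaleR_conv_of_real flip: of_real_mult)
 then have "integrable w.R (%s. cr ((norm (g s))\<^sup>2))"
  by (subst w.integral_R(2)) (simp_all add: scaleR_conv_of_real)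
 from w.angular_integral(1)[OF this, of 0 0]
 have "integrable w.P (%x. cr ((norm (g (fst x)))\<^sup>2))" by simp
 then have "integrable w.P (%x. (norm (g (fst x)))\<^sup>2)" by (simp only: complex_of_real_integrable_eq)
 moreover have "(%x. (norm (mono g n m (psi x)))\<^sup>2) : bm w.P"
  using psi_comp_measurable[OF mono_measurable[OF g, of n m]] by simp
 moreover have "AE x in w.P. (norm (g (fst x)))\<^sup>2 = (norm (mono g n m (psi x)))\<^sup>2"
  using w.AE_box
 proof eventually_elim
  case (elim x)
  then show ?case unfolding monomial_psi[OF mono_monomial elim]
   by (simp add: mono_psi torus_box_def mem_Times_iff norm_mult)
 qed
 ultimately have "integrable w.P (%x. (norm (mono g n m (psi x)))\<^sup>2)"
  by (rule integrable_cong_AE_imp)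
 then have "integrable mu (%zt. (norm (mono g n m zt))\<^sup>2)" by (subst integral_mu(2)) simp_all
 then show ?thesis by (simp add: L2_def)
qed

lemma norm_sector:
 assumes f: "f : L2 mu" "monomial D n m f" and g: "!!s. 0 < s ==> s < 1 ==> weight s * (norm (f (psi (s, 0, 0))))\<^sup>2 = g s"
 shows "(nr mu f)\<^sup>2 = 4 * pi\<^sup>2 * (LBINT s:{0<..<1}. g s)"
proof -
 have m: "(%s. f (psi (s, 0, 0))) : bm borel"
  by (rule measurable_compose[OF _ psi_comp_measurable[OF L2_measurable[OF f(1)]]])
   (intro borel_measurable_continuous_onI continuous_intros)
 have "cr ((nr mu f)\<^sup>2) = of_real (4 * pi\<^sup>2) * (LINT s|w.R. f (psi (s, 0, 0)) * cnj (f (psi (s, 0, 0))))"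
  using inner_monomials[OF f f] by (simp add: l2_inner_self)
 also have "(LINT s|w.R. f (psi (s, 0, 0)) * cnj (f (psi (s, 0, 0)))) =
   (LBINT s:{0<..<1}. weight s *\<^sub>R (f (psi (s, 0, 0)) * cnj (f (psi (s, 0, 0)))))"
  by (rule w.integral_R(1)) (use m in measurable)
 also have "... = (LBINT s:{0<..<1}. cr (g s))"
  by (rule set_lebesgue_integral_cong) (auto simp: g[symmetric] complex_norm_square[symmetric] scaleR_conv_of_real)
 also have "... = of_real (LBINT s:{0<..<1}. g s)" by (rule set_integral_complex_of_real)
 finally show ?thesis by (simp only: of_real_mult[symmetric] of_real_eq_iff)
qed

section \<open>Singular vectors and singular values\<close>

abbreviation QQ where "QQ == {(n, m). (0 :: int) <= n & (0 :: int) <= m}"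

definition A' where "A' i = rc.A (nat (fst i)) (nat (snd i))"
definition B' where "B' i = rc.B (nat (fst i)) (nat (snd i))"
definition EE where "EE i s = (s / rr s) ^ nat (fst i) * ((1 - s) / tt s) ^ nat (snd i)"
text \<open>The vector that represents the Leray functional of its sector in \<open>L2 mu\<close>,
  normalized. The inner product contains the weight, hence the division by it.\<close>

definition ee where "ee i = mono (%s. of_real (EE i s / weight s / sqrt (4 * pi\<^sup>2 * A' i))) (fst i) (snd i)"
definition vv where "vv i zt = of_real (1 / sqrt (4 * pi\<^sup>2 * B' i)) * (fst zt ^ nat (fst i) * snd zt ^ nat (snd i))"
text \<open>Unit vectors in all sectors, including those with negative indices: they fill the gaps
  in \<open>sector_decomposition\<close> and span an infinite-dimensional part of the
  kernel.\<close>

definition uu where "uu i = mono (%s. of_real (1 / sqrt (4 * pi\<^sup>2 * B' 0))) (fst i) (snd i)"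
definition tau where "tau i = sqrt (rc.lam (nat (fst i)) (nat (snd i)))"

lemma A'_pos: "0 < A' i" and B'_pos: "0 < B' i"
 unfolding A'_def B'_def by (rule rc.A_pos rc.B_pos)+

lemma EE_meas [measurable]: "EE i : bm borel"
 unfolding EE_def[abs_def] by measurable

lemma unit_vectors:
 "ee i : L2 mu & monomial D (fst i) (snd i) (ee i) & nr mu (ee i) = 1"
 "uu i : L2 mu & monomial D (fst i) (snd i) (uu i) & nr mu (uu i) = 1"
 "i : QQ ==> vv i : L2 mu & monomial D (fst i) (snd i) (vv i) & nr mu (vv i) = 1"
proof -
 have one: "nr mu f = 1" if "(nr mu f)\<^sup>2 = 4 * pi\<^sup>2 * (LBINT s:{0<..<1}. g s / (4 * pi\<^sup>2 * c))"
  "(LBINT s:{0<..<1}. g s) = c" "0 < c" for f g c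
 proof -
  have "(nr mu f)\<^sup>2 = 1" using that by simp
  then show ?thesis using l2_norm_nonneg[of mu f] by (simp add: power2_eq_1_iff)
 qed
 have W: "weight s ~= 0" for s using w.W_pos[of s] by simp
 have e1: "weight s * (norm (cr (EE i s / weight s / sqrt (4 * pi\<^sup>2 * A' i))))\<^sup>2 = (EE i s)\<^sup>2 / weight s / (4 * pi\<^sup>2 * A' i)" for s
  unfolding norm_of_real power2_abs power_divide real_sqrt_pow2[OF less_imp_le[OF mult_pos_pos[OF _ A'_pos]]]
  using W[of s] A'_pos[of i] by (simp add: power2_eq_square)
 have eL: "ee i : L2 mu" unfolding ee_def
  by (rule mono_L2, measurable, unfold e1, rule set_integrable_divide)
   (use rc.integrable_A[of "nat (fst i)" "nat (snd i)"] in \<open>simp add: EE_def\<close>)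
 moreover have em: "monomial D (fst i) (snd i) (ee i)" unfolding ee_def by (rule mono_monomial)
 moreover have "weight s * (norm (ee i (psi (s, 0, 0))))\<^sup>2 = (EE i s)\<^sup>2 / weight s / (4 * pi\<^sup>2 * A' i)" if "0 < s" "s < 1" for s
  unfolding ee_def mono_psi[OF that] by (rule e1)
 from one[OF norm_sector[OF eL em this] _ A'_pos] have "nr mu (ee i) = 1" by (simp only: A'_def rc.A_def EE_def simp_thms)
 ultimately show "ee i : L2 mu & monomial D (fst i) (snd i) (ee i) & nr mu (ee i) = 1" by simp
 have u1: "weight s * (norm (cr (1 / sqrt (4 * pi\<^sup>2 * B' 0))))\<^sup>2 = weight s / (4 * pi\<^sup>2 * B' 0)" for s
  unfolding norm_of_real power2_abs power_divide using B'_pos[of 0] by simp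
 have uL: "uu i : L2 mu" unfolding uu_def
  by (rule mono_L2, measurable, unfold u1, rule set_integrable_divide) (use rc.integrable_B[of 0 0] in simp)
 moreover have um: "monomial D (fst i) (snd i) (uu i)" unfolding uu_def by (rule mono_monomial)
 moreover have "weight s * (norm (uu i (psi (s, 0, 0))))\<^sup>2 = weight s / (4 * pi\<^sup>2 * B' 0)" if "0 < s" "s < 1" for s
  unfolding uu_def mono_psi[OF that] by (rule u1)
 from one[OF norm_sector[OF uL um this] _ B'_pos] have "nr mu (uu i) = 1" by (simp add: B'_def rc.B_def)
 ultimately show "uu i : L2 mu & monomial D (fst i) (snd i) (uu i) & nr mu (uu i) = 1" by simp
 assume i: "i : QQ"
 have vL: "vv i : L2 mu" unfolding vv_def[abs_def] by (intro continuous_L2 continuous_intros)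
 have "monomial D (int k) 0 (%zt. fst zt ^ k)" "monomial D 0 (int k) (%zt. snd zt ^ k)" for k
  by (induction k) (use monomial_coordinates monomial_mult[OF monomial_coordinates(1)] monomial_mult[OF monomial_coordinates(2)] in \<open>force\<close>)+
 from monomial_mult[OF this(1)[of "nat (fst i)"] this(2)[of "nat (snd i)"]]
 have m: "monomial D (fst i) (snd i) (vv i)" unfolding vv_def[abs_def] using i by (intro monomial_scale) auto
 moreover have "weight s * (norm (vv i (psi (s, 0, 0))))\<^sup>2 = (rr s ^ nat (fst i) * tt s ^ nat (snd i))\<^sup>2 * weight s / (4 * pi\<^sup>2 * B' i)" for s
 proof -
  have "vv i (psi (s, 0, 0)) = cr ((rr s ^ nat (fst i) * tt s ^ nat (snd i)) / sqrt (4 * pi\<^sup>2 * B' i))"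
   by (simp add: vv_def psi_def)
  then show ?thesis using B'_pos[of i] by (simp only: norm_of_real power2_abs power_divide) simp
 qed
 from one[OF norm_sector[OF vL m this] _ B'_pos] have "nr mu (vv i) = 1" by (simp only: B'_def rc.B_def simp_thms)
 ultimately show "vv i : L2 mu & monomial D (fst i) (snd i) (vv i) & nr mu (vv i) = 1" using vL by simp
qed

lemmas ee = unit_vectors(1)[THEN conjunct1] unit_vectors(1)[THEN conjunct2, THEN conjunct1] unit_vectors(1)[THEN conjunct2, THEN conjunct2]
lemmas uu = unit_vectors(2)[THEN conjunct1] unit_vectors(2)[THEN conjunct2, THEN conjunct1] unit_vectors(2)[THEN conjunct2, THEN conjunct2]
lemmas vv = unit_vectors(3)[THEN conjunct1] unit_vectors(3)[THEN conjunct2, THEN conjunct1] unit_vectors(3)[THEN conjunct2, THEN conjunct2]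

lemma orthonormal_ee: "orthonormal mu QQ ee"
 by (rule sector_orthonormal) (rule ee)+

lemma orthonormal_vv: "orthonormal mu QQ vv"
 by (rule sector_orthonormal) (erule vv)+

lemma tau_eq:
 "tau i = fact (nat (fst i) + nat (snd i) + 1) / (fact (nat (fst i)) * fact (nat (snd i))) * sqrt (A' i) * sqrt (B' i)"
 unfolding tau_def rc.lam_def real_sqrt_mult using rc.K_pos[of "nat (fst i)" "nat (snd i)"]
 by (simp add: rc.K_def A'_def B'_def)

text \<open>Dividing by the weight turns the integral over s into an inner product in
  \<open>L2 mu\<close>. The norms lost in normalizing \<open>ee\<close> and \<open>vv\<close>
  reappear in \<open>tau\<close>, which is thereby the singular value of the sector.\<close>

lemma leray_boundary_eq:
 assumes f: "f : L2 mu" "monomial D (fst i) (snd i) f" and i: "i : QQ" and zt: "zt : frontier D"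
 shows "leray_boundary D ro sg f zt = of_real (tau i) * inn mu f (ee i) * vv i zt"
proof -
 have fm: "(%s. f (psi (s, 0, 0))) : bm borel"
  by (rule measurable_compose[OF _ psi_comp_measurable[OF L2_measurable[OF f(1)]]])
   (intro borel_measurable_continuous_onI continuous_intros)
 have em: "(%s. ee i (psi (s, 0, 0))) : bm borel"
  by (rule measurable_compose[OF _ psi_comp_measurable[OF L2_measurable[OF conjunct1[OF unit_vectors(1)]]]])
   (intro borel_measurable_continuous_onI continuous_intros)
 define X where "X = (LINT s|o.R. f (psi (s, 0, 0)) * of_real (EE i s))"
 define c where "c = 1 / sqrt (4 * pi\<^sup>2 * A' i)"
 have "(LINT s|w.R. f (psi (s, 0, 0)) * cnj (ee i (psi (s, 0, 0)))) =
   (LBINT s:{0<..<1}. weight s *\<^sub>R (f (psi (s, 0, 0)) * cnj (ee i (psi (s, 0, 0)))))"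
  by (rule w.integral_R(1)) (use fm em in measurable)
 also have "... = (LBINT s:{0<..<1}. of_real c * (1 *\<^sub>R (f (psi (s, 0, 0)) * of_real (EE i s))))"
 proof (rule set_lebesgue_integral_cong)
  show "\<forall>s. s : {0<..<1} --> weight s *\<^sub>R (f (psi (s, 0, 0)) * cnj (ee i (psi (s, 0, 0)))) = of_real c * (1 *\<^sub>R (f (psi (s, 0, 0)) * of_real (EE i s)))"
  proof (intro allI impI)
   fix s :: real assume s: "s : {0<..<1}"
   have "weight s ~= 0" using w.W_pos[of s] by simp
   moreover have "ee i (psi (s, 0, 0)) = of_real (EE i s / weight s * c)" using s by (simp add: ee_def mono_psi c_def)
   ultimately show "weight s *\<^sub>R (f (psi (s, 0, 0)) * cnj (ee i (psi (s, 0, 0)))) = of_real c * (1 *\<^sub>R (f (psi (s, 0, 0)) * of_real (EE i s)))"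
    by (simp add: scaleR_conv_of_real)
  qed
 qed simp
 also have "... = of_real c * (LBINT s:{0<..<1}. 1 *\<^sub>R (f (psi (s, 0, 0)) * of_real (EE i s)))"
  by (rule set_integral_mult_right)
 also have "(LBINT s:{0<..<1}. 1 *\<^sub>R (f (psi (s, 0, 0)) * of_real (EE i s))) = X"
  unfolding X_def by (rule o.integral_R(1)[symmetric]) (use fm in measurable)
 finally have "inn mu f (ee i) = of_real (4 * pi\<^sup>2 * c) * X"
  using inner_monomials[OF f, of "ee i" "fst i" "snd i"] unit_vectors(1)[of i] by simp
 then have "of_real (tau i) * inn mu f (ee i) * vv i zt =
  of_real (tau i * (4 * pi\<^sup>2 * c) * (1 / sqrt (4 * pi\<^sup>2 * B' i))) * (X * (fst zt ^ nat (fst i) * snd zt ^ nat (snd i)))"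
  by (simp add: vv_def)
 also have "tau i * (4 * pi\<^sup>2 * c) * (1 / sqrt (4 * pi\<^sup>2 * B' i)) =
   fact (nat (fst i) + nat (snd i) + 1) / (fact (nat (fst i)) * fact (nat (snd i)))"
 proof -
  have "K * a * b * (4 * pi\<^sup>2 * (1 / (2 * pi * a))) * (1 / (2 * pi * b)) = K" if "a > 0" "b > 0" for K a b :: real
   using that by (simp add: power2_eq_square)
  moreover have "sqrt (4 * pi\<^sup>2 * x) = 2 * pi * sqrt x" for x by (simp add: real_sqrt_mult)
  ultimately show ?thesis unfolding tau_eq c_def using A'_pos[of i] B'_pos[of i] by (simp only: real_sqrt_gt_zero)
 qed
 finally show ?thesis using leray_boundary_monomial[OF f _ _ zt] i by (auto simp: X_def EE_def mult.assoc)
qed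

abbreviation LL where "LL == diagonal_op mu QQ ee vv (%i. cr (tau i))"
abbreviation LL' where "LL' == diagonal_op mu QQ vv ee (%i. cnj (cr (tau i)))"

lemma tau_nonneg: "0 <= tau i" and tau_square: "(tau i)\<^sup>2 = rc.lam (nat (fst i)) (nat (snd i))"
 using rc.lam_pos[of "nat (fst i)" "nat (snd i)"] by (simp_all add: tau_def)

lemma diagonal_LL: "\<exists>C. diagonal mu QQ ee vv (%i. cr (tau i)) C"
proof -
 obtain C where C: "!!n m. rc.lam n m <= C" using rc.lam_bounded by blast
 have "diagonal mu QQ ee vv (%i. cr (tau i)) (sqrt C)"
 proof (intro diagonal.intro orthonormal_ee orthonormal_vv)
  show "norm (cr (tau i)) <= sqrt C" for i using tau_nonneg[of i] C by (simp add: tau_def)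
  show "0 <= sqrt C" using less_imp_le[OF rc.lam_pos[of 0 0]] C[of 0 0] by simp
 qed
 then show ?thesis ..
qed

lemma leray_transform_LL: "leray_transform D ro sg mu LL"
 unfolding leray_transform_def
proof
 fix f assume f: "f : L2 mu"
 have u: "uu (n, m) : L2 mu" "monomial D n m (uu (n, m))" "nr mu (uu i) = 1" for n m i
  using unit_vectors(2)[of "(n, m)"] unit_vectors(2)[of i] by simp_all
 obtain F where F: "\<forall>n m. monomial D n m (F (n, m)) & F (n, m) : L2 mu" "l2_has_sum mu F f UNIV"
  using sector_decomposition[OF f u] by (elim exE conjE) (rule that)
 have Fm: "monomial D (fst i) (snd i) (F i)" and FL: "F i : L2 mu" for i
  using F(1) by (cases i; simp)+
 have in_eq: "inn mu f (ee i) = inn mu (F i) (ee i)" for i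
 proof (rule has_sum_unique[OF l2_has_sum_inner[OF F(2)] has_sum_finite_neutralI[of "{i}"]])
  show "ee i : L2 mu" by (rule ee)
  show "inn mu (F j) (ee i) = 0" if "j : UNIV - {i}" for j
  proof -
   have "\<not> (fst j = fst i & snd j = snd i)" using that by (auto simp: prod_eq_iff)
   then show ?thesis unfolding inner_monomials[OF FL Fm ee(1,2)] by (rule if_not_P)
  qed
 qed simp_all
 obtain C where "diagonal mu QQ ee vv (%i. cr (tau i)) C" using diagonal_LL by (rule exE)
 then interpret diagonal mu QQ ee vv "%i. cr (tau i)" C .
 have "l2_has_sum mu (%(n, m). leray_boundary D ro sg (F (n, m))) (LL f) QQ"
 proof (rule l2_has_sum_cong_space[OF has_sum_T[OF f]])
  fix i zt assume i: "i : QQ" and zt: "zt : space mu"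
  have "(case i of (n, m) => leray_boundary D ro sg (F (n, m))) zt = leray_boundary D ro sg (F i) zt"
   by (cases i) simp
  then show "(cr (tau i) * inn mu f (ee i)) * vv i zt = (case i of (n, m) => leray_boundary D ro sg (F (n, m))) zt"
   using leray_boundary_eq[OF FL Fm i] zt by (simp only: in_eq space_mu)
 qed
 then show "\<exists>F. (\<forall>n m. monomial D n m (F (n, m))) & l2_has_sum mu F f UNIV \<and>
   l2_has_sum mu (%(n, m). leray_boundary D ro sg (F (n, m))) (LL f) QQ"
  using F by (intro exI[of _ F]) simp
qed

lemma limit_sequence:
 assumes "0 <= s" "s <= 1"
 shows "\<exists>q :: nat => int \<times> int. inj q & range q \<subseteq> QQ & (%k. (tau (q k))\<^sup>2) ---> rc.lim_lam s"
proof -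
 obtain n m where nm: "inj (%k. (n k, m k))" "(%k. rc.lam (n k) (m k)) ---> rc.lim_lam s"
  using rc.lam_limit_attained[OF assms] by (elim exE conjE) (rule that)
 show ?thesis
 proof (rule exI[of _ "%k. (int (n k), int (m k))"], intro conjI injI)
  fix x y assume "(int (n x), int (m x)) = (int (n y), int (m y))"
  then have "(n x, m x) = (n y, m y)" by simp
  then show "x = y" by (rule injD[OF nm(1)])
 qed (simp add: image_subset_iff, simp add: tau_square nm(2))
qed

lemma finite_away:
 assumes "e > 0"
 shows "finite {i : QQ. \<forall>s\<in>{0..1}. e <= \<bar>(tau i)\<^sup>2 - rc.lim_lam s\<bar>}"
proof (rule finite_imageD)
 show "finite ((%i. (nat (fst i), nat (snd i))) ` {i : QQ. \<forall>s\<in>{0..1}. e <= \<bar>(tau i)\<^sup>2 - rc.lim_lam s\<bar>})"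
  by (rule finite_subset[OF image_subsetI rc.lam_accumulates[OF assms]]) (simp add: tau_square)
 show "inj_on (%i. (nat (fst i), nat (snd i))) {i : QQ. \<forall>s\<in>{0..1}. e <= \<bar>(tau i)\<^sup>2 - rc.lim_lam s\<bar>}"
 proof (rule inj_onI)
  fix i j :: "int \<times> int"
  assume "i : {i : QQ. \<forall>s\<in>{0..1}. e <= \<bar>(tau i)\<^sup>2 - rc.lim_lam s\<bar>}" "j : {i : QQ. \<forall>s\<in>{0..1}. e <= \<bar>(tau i)\<^sup>2 - rc.lim_lam s\<bar>}"
   and "(nat (fst i), nat (snd i)) = (nat (fst j), nat (snd j))"
  then show "i = j" by (cases i, cases j) (simp add: eq_nat_nat_iff)
 qed
qed

text \<open>The accumulation points of the eigenvalues are exactly the values of the limit function,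
  a compact set; the sectors with negative indices contribute 0.\<close>

lemma spectrum_LL: "l2_essential_spectrum mu (%f. LL' (LL f)) = {0} \<union> (%s. cr (rc.lim_lam s)) ` {0..1}"
proof -
 obtain C where "diagonal mu QQ ee vv (%i. cr (tau i)) C" using diagonal_LL by (rule exE)
 then interpret diagonal mu QQ ee vv "%i. cr (tau i)" C .
 interpret sd: self_diagonal mu QQ ee "%i. cr ((norm (cr (tau i)))\<^sup>2)" "C\<^sup>2" "%f. LL' (LL f)"
  by (rule self_diagonal_adjoint)
 \<comment> \<open>These sectors have negative first index \<open>- int k - 1\<close>, so their
   vectors are orthogonal to every \<open>ee i\<close>.\<close>
 have w: "uu (- int k - 1, 0) : L2 mu" "monomial D (- int k - 1) 0 (uu (- int k - 1, 0))" for k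
  using unit_vectors(2)[of "(- int k - 1, 0)"] by simp_all
 show ?thesis
 proof (rule sd.essential_spectrum_eq[of "%k. uu (- int k - 1, 0)"])
  have "orthonormal mu UNIV uu" by (rule sector_orthonormal) (rule uu)+
  then show "orthonormal mu UNIV (%k. uu (- int k - 1, 0))"
   by (rule orthonormal_reindex) (auto simp: inj_on_def)
  show "inn mu (uu (- int k - 1, 0)) (ee i) = 0" if "i : QQ" for k i
   unfolding inner_monomials[OF w ee(1,2)] using that by (intro if_not_P) auto
  show "\<exists>q::nat => int \<times> int. inj q & range q \<subseteq> QQ & (%k. cr ((norm (cr (tau (q k))))\<^sup>2)) ---> c"
   if "c : (%s. cr (rc.lim_lam s)) ` {0..1}" for c
  proof -
   obtain s where s: "0 <= s" "s <= 1" "c = of_real (rc.lim_lam s)" using \<open>c : _\<close> by auto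
   obtain q where "inj q" "range q \<subseteq> QQ" "(%k. (tau (q k))\<^sup>2) ---> rc.lim_lam s"
    using limit_sequence[OF s(1,2)] by (elim exE conjE) (rule that)
   then show ?thesis by (intro exI[of _ q] conjI) (simp_all only: s(3) norm_of_real power2_abs tendsto_of_real)
  qed
  show "\<exists>de>0. finite {i : QQ. norm (cr ((norm (cr (tau i)))\<^sup>2) - c) < de}"
   if c: "c \<notin> (%s. cr (rc.lim_lam s)) ` {0..1}" for c
  proof -
   have "compact ((%s. cr (rc.lim_lam s)) ` {0..1})"
    by (intro compact_continuous_image continuous_on_of_real rc.continuous_lim_lam) simp
   then have cl: "closed ((%s. cr (rc.lim_lam s)) ` {0..1})" by (rule compact_imp_closed)
   \<comment> \<open>The point \<open>c\<close> has positive distance \<open>d\<close> from the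
     compact set of limit values. An eigenvalue within half of \<open>d\<close> from
     \<open>c\<close> is at least half of \<open>d\<close> away from all limit values, and
     \<open>finite_away\<close> applies.\<close>
   obtain d where d: "d > 0" "\<forall>x\<in>(%s. cr (rc.lim_lam s)) ` {0..1}. d <= dist c x"
    using separate_point_closed[OF cl c] by (elim exE conjE) (rule that)
   have "finite {i : QQ. norm (cr ((norm (cr (tau i)))\<^sup>2) - c) < d / 2}"
   proof (rule finite_subset[OF _ finite_away[of "d / 2"]], rule subsetI)
    fix i assume i: "i : {i : QQ. norm (cr ((norm (cr (tau i)))\<^sup>2) - c) < d / 2}"
    have "d / 2 <= \<bar>(tau i)\<^sup>2 - rc.lim_lam s\<bar>" if s: "s : {0..1}" for s
    proof -
     have 1: "d <= norm (c - of_real (rc.lim_lam s))" using bspec[OF d(2) imageI[OF s]] by (simp add: dist_norm)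
     have 2: "norm (cr ((tau i)\<^sup>2) - c) < d / 2" using i by simp
     have 3: "norm (c - of_real (rc.lim_lam s)) <= norm (cr ((tau i)\<^sup>2) - c) + norm (cr ((tau i)\<^sup>2) - of_real (rc.lim_lam s))"
      using norm_triangle_ineq4[of "cr ((tau i)\<^sup>2) - of_real (rc.lim_lam s)" "cr ((tau i)\<^sup>2) - c"] by simp
     have 4: "norm (cr ((tau i)\<^sup>2) - of_real (rc.lim_lam s)) = \<bar>(tau i)\<^sup>2 - rc.lim_lam s\<bar>"
      by (simp only: of_real_diff[symmetric] norm_of_real)
     show ?thesis using 1 2 3 unfolding 4 by linarith
    qed
    then show "i : {i : QQ. \<forall>s\<in>{0..1}. d / 2 <= \<bar>(tau i)\<^sup>2 - rc.lim_lam s\<bar>}" using i by simp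
   qed (use d in simp)
   then show ?thesis using d(1) by (intro exI[of _ "d / 2"]) simp
  qed
 qed
qed

text \<open>The singular values are the square roots of the eigenvalues, so their largest
  accumulation point is the root of the largest limit value.\<close>

lemma essential_norm_LL:
 assumes s0: "0 <= s0" "s0 <= 1" and max: "!!s. 0 <= s ==> s <= 1 ==> rc.lim_lam s <= rc.lim_lam s0"
 shows "l2_essential_norm mu LL = sqrt (rc.lim_lam s0)"
proof -
 obtain C where "diagonal mu QQ ee vv (%i. cr (tau i)) C" using diagonal_LL by (rule exE)
 then interpret diagonal mu QQ ee vv "%i. cr (tau i)" C .
 have p: "0 <= rc.lim_lam s0" using pp_gt[of s0] by (simp add: rc.lim_lam_def)
 obtain q where q: "inj q" "range q \<subseteq> QQ" "(%k. (tau (q k))\<^sup>2) ---> rc.lim_lam s0"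
  using limit_sequence[OF s0] by (elim exE conjE) (rule that)
 show ?thesis
 proof (rule essential_norm_eq[OF _ _ q(1,2)])
  show "0 <= sqrt (rc.lim_lam s0)" using p by simp
  show "(%k. norm (cr (tau (q k)))) ---> sqrt (rc.lim_lam s0)"
   using tendsto_real_sqrt[OF q(3)] tau_nonneg by simp
  fix e :: real assume e: "0 < e"
  show "finite {i : QQ. sqrt (rc.lim_lam s0) + e < norm (cr (tau i))}"
  proof (rule finite_subset[OF _ finite_away[of "e\<^sup>2"]], rule subsetI)
   fix i assume i: "i : {i : QQ. sqrt (rc.lim_lam s0) + e < norm (cr (tau i))}"
   then have "sqrt (rc.lim_lam s0) + e < tau i" using tau_nonneg[of i] by simp
   then have "(sqrt (rc.lim_lam s0) + e)\<^sup>2 < (tau i)\<^sup>2" using p e by (intro power_strict_mono) auto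
   \<comment> \<open>The cross term of the square is nonnegative, so the eigenvalue exceeds every
     limit value by at least the square of \<open>e\<close>.\<close>
   moreover have "rc.lim_lam s0 + e\<^sup>2 <= (sqrt (rc.lim_lam s0) + e)\<^sup>2" using p e by (simp add: power2_sum)
   ultimately have "e\<^sup>2 <= \<bar>(tau i)\<^sup>2 - rc.lim_lam s\<bar>" if "s : {0..1}" for s using max[of s] that by auto
   then show "i : {i : QQ. \<forall>s\<in>{0..1}. e\<^sup>2 <= \<bar>(tau i)\<^sup>2 - rc.lim_lam s\<bar>}" using i by simp
  qed (use e in simp)
 qed
qed

lemma osc_exponent_range: "osc_exponent D ` frontier D = pp ` {0..1}"
proof (intro equalityI image_subsetI)
 fix zt assume zt: "zt : frontier D"
 show "osc_exponent D zt : pp ` {0..1}"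
 proof (cases "fst zt * snd zt = 0")
  case True
  then have "osc_exponent D zt = pp 0" by (simp add: osc_exponent_def pp_def)
  then show ?thesis by simp
 next
  case False
  then have nz: "fst zt ~= 0" "snd zt ~= 0" by auto
  obtain s where s: "0 < s" "s < 1" "norm (fst zt) = rr s" using frontier_curve[OF zt nz] by (elim exE conjE) (rule that)
  then show ?thesis using osc_exponent_curve[OF s False] by simp
 qed
next
 fix s :: real assume s: "s : {0..1}"
 let ?z = "(cr (rr s), cr (tt s))"
 have z: "?z : frontier D" using s by (intro curve_in_frontier) auto
 have "osc_exponent D ?z = pp s"
 proof (cases "0 < s & s < 1")
  case True
  then show ?thesis using rr_tt_pos[of s] by (intro osc_exponent_curve) auto
 next
  case False
  then have "s = 0 \<or> s = 1" using s by auto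
  then show ?thesis by (auto simp: osc_exponent_def pp_def rr_def tt_def)
 qed
 then show "pp s : osc_exponent D ` frontier D" using z by (rule image_eqI[OF sym])
qed

end

lemma exponent_identities:
 assumes "1 < p"
 shows "sqrt (p * conj_exponent p) / 2 = p / (2 * sqrt (p - 1))"
  "root 4 (p * conj_exponent p / 4) = sqrt (p / (2 * sqrt (p - 1)))"
proof -
 have "p * conj_exponent p = p\<^sup>2 / (p - 1)" by (simp add: conj_exponent_def power2_eq_square)
 then show 1: "sqrt (p * conj_exponent p) / 2 = p / (2 * sqrt (p - 1))"
  using assms by (simp add: real_sqrt_divide)
 have "root 4 (p * conj_exponent p / 4) = sqrt (sqrt (p * conj_exponent p / 4))"
  unfolding sqrt_def real_root_mult_exp[symmetric] by simp
 also have "sqrt (p * conj_exponent p / 4) = p / (2 * sqrt (p - 1))"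
  unfolding real_sqrt_divide by (simp add: 1[symmetric])
 finally show "root 4 (p * conj_exponent p / 4) = sqrt (p / (2 * sqrt (p - 1)))" .
qed

text \<open>\<open>second_derivative\<close> is an iterated Frechet derivative. Near the boundary
  the inner one is the inner product with \<open>G\<close>, so the outer one gives the quadratic
  form of \<open>H\<close>, and strong convexity becomes a statement about \<open>H\<close>.\<close>

lemma C2_reinhardt_exists:
 assumes "open D" "D ~= {}" "bounded D" "reinhardt D" "C2_defining_function D ro" "strongly_convex D ro"
 shows "\<exists>G H U. C2_reinhardt D ro G H U"
proof -
 obtain U where U: "open U" "frontier D \<subseteq> U" "C2_on U ro" "D \<inter> U = {x : U. ro x < 0}"
  using assms(5) unfolding C2_defining_function_def by (elim conjE exE) (rule that)
 obtain G H where GH: "\<forall>x\<in>U. (ro has_derivative (%v. G x \<bullet> v)) (at x)" "\<forall>x\<in>U. (G has_derivative H x) (at x)"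
  "\<forall>v. continuous_on U (%x. H x v)" using U(3) unfolding C2_on_def by (elim exE conjE) (rule that)
 have fd: "frechet_derivative ro (at x) = (%v. G x \<bullet> v)" if "x : U" for x
  using frechet_derivative_at[OF bspec[OF GH(1) that]] by simp
 have "C2_reinhardt D ro G H U"
 proof
  fix zt assume zt: "zt : frontier D"
  then have zU: "zt : U" using U(2) by blast
  obtain v where "frechet_derivative ro (at zt) v ~= 0" using assms(5) zt unfolding C2_defining_function_def by blast
  then show "G zt ~= 0" unfolding fd[OF zU] by (rule contrapos_nn) simp
  fix v :: C2 assume v: "v ~= 0" "G zt \<bullet> v = 0"
  have "((%x. G x \<bullet> v) has_derivative (%u. H zt u \<bullet> v)) (at zt)"
   by (rule bounded_linear.has_derivative[OF bounded_linear_inner_left bspec[OF GH(2) zU]])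
  then have "((%x. frechet_derivative ro (at x) v) has_derivative (%u. H zt u \<bullet> v)) (at zt)"
   by (rule has_derivative_transform_within_open[OF _ U(1) zU]) (simp add: fd)
  from frechet_derivative_at[OF this]
  have "second_derivative ro zt v v = H zt v \<bullet> v" unfolding second_derivative_def by (rule fun_cong[OF sym])
  moreover have "second_derivative ro zt v v > 0"
   by (rule mp[OF spec[OF bspec[OF conjunct2[OF assms(6)[unfolded strongly_convex_def]] zt]]])
    (simp add: fd[OF zU] v)
  ultimately show "0 < H zt v \<bullet> v" by simp
 qed (use assms U GH in \<open>auto simp: strongly_convex_def\<close>)
 then show ?thesis by blast
qed

theorem theorem3:
  fixes D :: "(complex \<times> complex) set"
    and \<rho> h :: "complex \<times> complex \<Rightarrow> real"
    and \<sigma> \<mu> :: "(complex \<times> complex) measure"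
  assumes "open D" and "connected D" and "D \<noteq> {}" and "bounded D"
    and "reinhardt D"
    and "C2_defining_function D \<rho>"
    and "strongly_convex D \<rho>"
    and "surface_measure (frontier D) \<sigma>"
    and "continuous_on (frontier D) h"
    and "\<forall>\<zeta>\<in>frontier D. h \<zeta> > 0"
    and "\<forall>\<zeta>\<in>frontier D. \<forall>a b. h (torus_rot a b \<zeta>) = h \<zeta>"
    and "\<mu> = density \<sigma> (\<lambda>\<zeta>. ennreal (h \<zeta>))"
  shows "\<exists>L Lstar.
    leray_transform D \<rho> \<sigma> \<mu> L \<and> l2_bounded_op \<mu> L \<and> l2_adjoint \<mu> L Lstar \<and>
    (\<exists>E. l2_orthogonal_basis \<mu> E \<and> (\<forall>e\<in>E. l2_eigenfunction \<mu> (\<lambda>f. Lstar (L f)) e)) \<and>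
    l2_essential_spectrum \<mu> (\<lambda>f. Lstar (L f)) =
      {0} \<union> {complex_of_real (sqrt (osc_exponent D \<zeta> * conj_exponent (osc_exponent D \<zeta>)) / 2)
             | \<zeta>. \<zeta> \<in> frontier D} \<and>
    l2_essential_spectrum \<mu> (\<lambda>f. Lstar (L f)) =
      {0} \<union> {complex_of_real (osc_exponent D \<zeta> / (2 * sqrt (osc_exponent D \<zeta> - 1)))
             | \<zeta>. \<zeta> \<in> frontier D} \<and>
    (\<exists>\<zeta>\<in>frontier D. l2_essential_norm \<mu> L =
        root 4 (osc_exponent D \<zeta> * conj_exponent (osc_exponent D \<zeta>) / 4)) \<and>
    (\<forall>\<zeta>\<in>frontier D.
        root 4 (osc_exponent D \<zeta> * conj_exponent (osc_exponent D \<zeta>) / 4)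
          \<le> l2_essential_norm \<mu> L)"
proof -
 obtain G H U where GHU: "C2_reinhardt D \<rho> G H U"
  using C2_reinhardt_exists[OF assms(1,3-7)] by (elim exE) (rule that)
 interpret C2_reinhardt_measure D \<rho> G H U \<sigma> \<mu> h
  by (intro C2_reinhardt_measure.intro C2_reinhardt.pair[OF GHU] C2_reinhardt_measure_axioms.intro)
   (use assms in auto)
 obtain C where "diagonal \<mu> QQ ee vv (%i. cr (tau i)) C" using diagonal_LL by (rule exE)
 then interpret diagonal \<mu> QQ ee vv "%i. cr (tau i)" C .
 interpret sd: self_diagonal \<mu> QQ ee "%i. cr ((norm (cr (tau i)))\<^sup>2)" "C\<^sup>2" "%f. LL' (LL f)"
  by (rule self_diagonal_adjoint)
 have os: "\<exists>s\<in>{0..1}. osc_exponent D zt = pp s" if "zt : frontier D" for zt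
  using imageI[OF that, of "osc_exponent D"] unfolding osc_exponent_range by blast
 have so: "\<exists>zt\<in>frontier D. osc_exponent D zt = pp s" if "s : {0..1}" for s
  using imageI[OF that, of pp] unfolding osc_exponent_range[symmetric] by (auto simp: image_iff)
 have p1: "1 < osc_exponent D zt" if "zt : frontier D" for zt using os[OF that] pp_gt by auto
 have r: "(%s. cr (rc.lim_lam s)) ` {0..1} =
   {cr (osc_exponent D zt / (2 * sqrt (osc_exponent D zt - 1))) | zt. zt : frontier D}"
 proof (intro equalityI subsetI)
  fix c assume "c : (%s. cr (rc.lim_lam s)) ` {0..1}"
  then obtain s where s: "s : {0..1}" "c = cr (rc.lim_lam s)" by blast
  obtain zt where "zt : frontier D" "osc_exponent D zt = pp s" using so[OF s(1)] by blast
  then show "c : {cr (osc_exponent D zt / (2 * sqrt (osc_exponent D zt - 1))) | zt. zt : frontier D}"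
   by (intro CollectI exI[of _ zt]) (simp add: s(2) rc.lim_lam_def)
 next
  fix c assume "c : {cr (osc_exponent D zt / (2 * sqrt (osc_exponent D zt - 1))) | zt. zt : frontier D}"
  then obtain zt where z: "zt : frontier D" "c = cr (osc_exponent D zt / (2 * sqrt (osc_exponent D zt - 1)))" by blast
  obtain s where "s : {0..1}" "osc_exponent D zt = pp s" using os[OF z(1)] by blast
  then show "c : (%s. cr (rc.lim_lam s)) ` {0..1}"
   by (intro image_eqI[of _ _ s]) (simp_all add: z(2) rc.lim_lam_def)
 qed
 have r': "{cr (sqrt (osc_exponent D zt * conj_exponent (osc_exponent D zt)) / 2) | zt. zt : frontier D} =
   {cr (osc_exponent D zt / (2 * sqrt (osc_exponent D zt - 1))) | zt. zt : frontier D}"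
 proof (rule Collect_cong, rule ex_cong1)
  fix u zt
  show "(u = cr (sqrt (osc_exponent D zt * conj_exponent (osc_exponent D zt)) / 2) & zt : frontier D) =
   (u = cr (osc_exponent D zt / (2 * sqrt (osc_exponent D zt - 1))) & zt : frontier D)"
  proof (cases "zt : frontier D")
   case True
   show ?thesis by (simp only: exponent_identities(1)[OF p1[OF True]])
  qed simp
 qed
 obtain s0 where s0: "s0 : {0..1}" "\<forall>s\<in>{0..1}. rc.lim_lam s <= rc.lim_lam s0"
  using continuous_attains_sup[OF _ _ rc.continuous_lim_lam] by auto
 have en: "l2_essential_norm \<mu> LL = sqrt (rc.lim_lam s0)" by (rule essential_norm_LL) (use s0 in auto)
 show ?thesis
 proof (rule exI[of _ LL], rule exI[of _ LL'], intro conjI)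
  show "\<exists>zt\<in>frontier D. l2_essential_norm \<mu> LL = root 4 (osc_exponent D zt * conj_exponent (osc_exponent D zt) / 4)"
  proof -
   obtain zt where z: "zt : frontier D" "osc_exponent D zt = pp s0" using so[OF s0(1)] by blast
   have "l2_essential_norm \<mu> LL = root 4 (osc_exponent D zt * conj_exponent (osc_exponent D zt) / 4)"
    unfolding en exponent_identities(2)[OF p1[OF z(1)]] by (simp only: z(2) rc.lim_lam_def)
   then show ?thesis using z(1) by (rule bexI)
  qed
  show "\<forall>zt\<in>frontier D. root 4 (osc_exponent D zt * conj_exponent (osc_exponent D zt) / 4) <= l2_essential_norm \<mu> LL"
  proof
   fix zt assume z: "zt : frontier D"
   obtain s where s: "s : {0..1}" "osc_exponent D zt = pp s" using os[OF z] by blast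
   have "sqrt (rc.lim_lam s) <= sqrt (rc.lim_lam s0)" using s0(2) s(1) by simp
   then show "root 4 (osc_exponent D zt * conj_exponent (osc_exponent D zt) / 4) <= l2_essential_norm \<mu> LL"
    unfolding en exponent_identities(2)[OF p1[OF z]] by (simp only: s(2) rc.lim_lam_def)
  qed
 qed (rule leray_transform_LL bounded_T adjoint sd.eigenbasis spectrum_LL[unfolded r] spectrum_LL[unfolded r, folded r'])+
qed

end
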